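(* Let $\mathcal{G}$ be a group operad, $\mathcal{H}$ a non-crossed normal sub group operad of $\mathcal{G}$ and $\mathcal{C}$ a topological $\mathcal{G}$-operad. If $\mathcal{C}/\mathcal{H}$ is a path-connected covering $\mathcal{G}/\mathcal{H}$-operad with a good basepoint, then $\pi_1(\mathcal{C}/\mathcal{H})$ is a non-crossed group operad; $\pi_1(\mathcal{C}/\mathcal{G})=\pi_1((\mathcal{C}/\mathcal{H})/(\mathcal{G}/\mathcal{H}))$ is a group operad with a short exact sequence of group operads $$1\to\pi_1(\mathcal{C}/\mathcal{H})\to\pi_1(\mathcal{C}/\mathcal{G})\to\mathcal{G}/\mathcal{H}\to1;$$ and $\pi_l(\mathcal{C}/\mathcal{G})$ is a $\pi_1(\mathcal{C}/\mathcal{G})$-operad for all $l\ge1$ if $\mathcal{G}$ is non-crossed and for all $l>1$ if $\mathcal{G}$ is crossed.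
   Context: All spaces are compactly generated Hausdorff. A (nonsymmetric) topological operad $\mathcal{C}$ consists of spaces $\mathcal{C}(n)$, $n\ge 0$, with $\mathcal{C}(0)=*$, continuous maps $\gamma:\mathcal{C}(k)\times\mathcal{C}(m_1)\times\cdots\times\mathcal{C}(m_k)\to\mathcal{C}(m_1+\cdots+m_k)$ ($k\ge1$, $m_i\ge0$) and a unit $1\in\mathcal{C}(1)$, such that $\gamma(\gamma(a;b_1,\ldots,b_k);c_1,\ldots,c_m)=\gamma(a;\gamma(b_1;c_1,\ldots,c_{m_1}),\ldots,\gamma(b_k;c_{m_1+\cdots+m_{k-1}+1},\ldots,c_m))$, $\gamma(1;a)=a$, $\gamma(a;1,\ldots,1)=a$. Morphisms preserve $\gamma$ and the unit. An operad of sets is a discrete topological operad. In $S_n$ the product is $(\sigma\tau)(i)=\tau(\sigma(i))$. The symmetric groups operad $\mathcal{S}=\{S_n\}_{n\ge0}$ has $\gamma(\sigma;\tau_1,\ldots,\tau_k)$ sending $m_1+\cdots+m_{i-1}+j$ ($1\le j\le m_i$) to $\sum_{l:\sigma(l)<\sigma(i)}m_l+\tau_i(j)$. A group operad is an operad of sets $\mathcal{G}=\{G_n\}_{n\ge0}$ with a morphism of operads $\pi:\mathcal{G}\to\mathcal{S}$ such that each $G_n$ is a group and $\pi:G_n\to S_n$ a homomorphism, the identity of $G_1$ is the operad unit, and $\gamma(aa';b_1b_1',\ldots,b_kb_k')=\gamma(a;b_1,\ldots,b_k)\gamma(a';b'_{a^{-1}(1)},\ldots,b'_{a^{-1}(k)})$,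 where $a(i)=\pi(a)(i)$. It is non-crossed if all $\pi$ are trivial, crossed otherwise. A morphism of group operads is a sequence of homomorphisms commuting with $\gamma$ and $\pi$. A sub group operad $\mathcal{H}\le\mathcal{G}$ is a sequence of subgroups $H_n\le G_n$ closed under $\gamma$ (with restricted $\pi$); it is normal if each $H_n$ is normal in $G_n$. A short exact sequence of group operads is a sequence of morphisms that is short exact in each degree. A topological $\mathcal{G}$-operad is a topological operad $\mathcal{C}$ with left actions of $G_n$ on $\mathcal{C}(n)$ such that $\gamma(\sigma a;\tau_1b_1,\ldots,\tau_kb_k)=\gamma(\sigma;\tau_1,\ldots,\tau_k)\gamma(a;b_{\sigma^{-1}(1)},\ldots,b_{\sigma^{-1}(k)})$ for $\sigma\in G_k$, $\tau_i\in G_{m_i}$. It is covering if each action is a covering action (every point has a neighbourhood $U$ with $gU\cap U=\emptyset$ for $g\ne1$), path-connected if each $\mathcal{C}(k)$ is. If $\mathcal{H}$ is a non-crossed normal sub group operad, $\mathcal{G}/\mathcal{H}=\{G_k/H_k\}$ is a group operad with the induced $\gamma$ and $\pi$; $\mathcal{C}/\mathcal{H}=\{\mathcal{C}(k)/H_k\}$ (orbits of the left action, with induced $\gamma$) is a $\mathcal{G}/\mathcal{H}$-operad via $gH_k\cdot H_ka=H_k(ga)$, and $(\mathcal{C}/\mathcal{H})/(\mathcal{G}/\mathcal{H})=\mathcal{C}/\mathcal{G}=\{\mathcal{C}(k)/G_k\}$. Good basepoint of an operad $\mathcal{D}$: $\mathcal{C}_1$ is the little intervals operad: $\mathcal{C}_1(k)$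 is the space of $k$-tuples of increasing affine embeddings $[0,1]\to[0,1]$ with images having pairwise disjoint interiors, $\mathcal{C}_1(0)=*$, unit the identity, $\gamma(c;d^1,\ldots,d^k)$ the tuple of all composites $c_i\circ d^i_j$ in lexicographic order. Let $c_0=*$, $c_k=([0,\frac1k],\ldots,[\frac{k-1}k,1])$ and let $\mathcal{C}_1(k)_0$ be the path component of $c_k$; $(\mathcal{C}_1)_0=\{\mathcal{C}_1(k)_0\}$ is a nonsymmetric operad. A good basepoint is $\{e_k=\eta(c_k)\}$ for a chosen morphism of nonsymmetric operads $\eta:(\mathcal{C}_1)_0\to\mathcal{D}$. For $u,v\in\mathcal{C}_1(k)_0$ the path $t\mapsto\eta((1-t)u+tv)$ is the linear path from $\eta(u)$ to $\eta(v)$; the linear path from $e_m$ to $\gamma(e_k;e_{n_1},\ldots,e_{n_k})$ uses $u=c_m$, $v=\gamma(c_k;c_{n_1},\ldots,c_{n_k})$. Structures: write $\mathcal{D}=\mathcal{C}/\mathcal{H}$ with good basepoint $\{e_k\}$, $\mathcal{Q}=\mathcal{G}/\mathcal{H}$. Paths are composed left to right, and $\gamma$ of maps is pointwise. (1) $\pi_1\mathcal{D}=\{\pi_1(\mathcal{D}(k),e_k)\}$ has trivial $\pi$ and $\gamma([f];[g_1],\ldots,[g_k])=[\delta_1][\gamma(f;g_1,\ldots,g_k)][\delta_1]^{-1}$, where, for $m=\sum m_i$, $\delta_1$ is the linear path from $e_m$ to $\gamma(e_k;e_{m_1},\ldots,e_{m_k})$. (2) $\pi_1(\mathcal{C}/\mathcal{G})=\{\pi_1(\mathcal{D}(k)/Q_k,Q_ke_k)\}$,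 whose $k$-th group is identified by path lifting with homotopy classes rel endpoints of paths $f$ in $\mathcal{D}(k)$ from $e_k$ to a point $(\partial f)e_k$, $\partial f\in Q_k$, with product $[f]*[g]=[f\cdot(\partial f)g]$. The map to $\mathcal{G}/\mathcal{H}=\mathcal{Q}$ is $\partial$, the map to $\mathcal{S}$ is $\pi\circ\partial$, and $\gamma([f];[g_1],\ldots,[g_k])=[\delta_1\cdot\gamma(f;g_1,\ldots,g_k)\cdot\gamma(\partial f;\partial g_1,\ldots,\partial g_k)\delta_2^{-1}]$, with $\delta_2$ the linear path from $e_m$ to $\gamma(e_k;e_{m_{(\partial f)^{-1}(1)}},\ldots,e_{m_{(\partial f)^{-1}(k)}})$. (3) For $l>1$, $\pi_l(\mathcal{C}/\mathcal{G})=\{\pi_l(\mathcal{D}(k)/Q_k,Q_ke_k)\}$ is identified with $\{\pi_l(\mathcal{D}(k),e_k)\}$, with $\gamma([f];[g_1],\ldots,[g_k])=(\delta_1)_*[\gamma(f;g_1,\ldots,g_k)]$ and action $[a]\star[f]=a_*[(\partial a)f]$, where $u_*:\pi_l(X,y)\to\pi_l(X,x)$ is change of basepoint along a path $u$ from $x$ to $y$. For $l=1$ (non-crossed case) $\pi_1(\mathcal{C}/\mathcal{G})$ acts on itself by conjugation. *)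

theory Defs
  imports "HOL-Analysis.Analysis" "HOL-Algebra.Group_Action" "HOL-Combinatorics.Permutations"
begin

section \<open>Topological operads\<close>

text \<open>
  The map \<open>\<gamma> : C(k) \<times> C(m\<^sub>1) \<times> \<dots> \<times> C(m\<^sub>k) \<rightarrow> C(m\<^sub>1 + \<dots> + m\<^sub>k)\<close> is \<open>\<gamma> ms a bs\<close>, where \<open>ms\<close> is the list
  of the arities \<open>m\<^sub>i\<close> and \<open>bs\<close> the list of the \<open>b\<^sub>i\<close>. The arities are an explicit argument because
  the same element of the underlying type may belong to several of the spaces. Indices start at 0.
\<close>

record 'a operad =
  Space :: "nat \<Rightarrow> 'a topology"
  opcomp :: "nat list \<Rightarrow> 'a \<Rightarrow> 'a list \<Rightarrow> 'a"
  opunit :: 'a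

abbreviation Elems :: "('a, 'm) operad_scheme \<Rightarrow> nat \<Rightarrow> 'a set" where
  "Elems C n \<equiv> topspace (Space C n)"

definition ElemLists :: "('a, 'm) operad_scheme \<Rightarrow> nat list \<Rightarrow> 'a list set" where
  "ElemLists C ms = listset (map (Elems C) ms)"

text \<open>
  Products are taken in compactly generated spaces, hence the \<^const>\<open>kification\<close> in the continuity
  of \<open>\<gamma>\<close>. For \<open>k = 0\<close> the map \<open>\<gamma>\<close> is the only map \<open>C(0) \<rightarrow> C(0)\<close>; it occurs in the inner terms of the
  associativity law when some \<open>m\<^sub>i\<close> is 0. In that law, \<open>nss ! i\<close> is the list of the arities
  of the elements that are plugged into \<open>bs ! i\<close>.
\<close>

definition topological_operad :: "('a, 'm) operad_scheme \<Rightarrow> bool" where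
  "topological_operad C \<longleftrightarrow>
     (\<forall>n. k_space (Space C n) \<and> Hausdorff_space (Space C n)) \<and>
     (\<exists>x. Elems C 0 = {x}) \<and>
     opunit C \<in> Elems C 1 \<and>
     (\<forall>ms. continuous_map
        (kification (prod_topology (Space C (length ms))
           (product_topology (\<lambda>i. Space C (ms ! i)) {..<length ms})))
        (Space C (sum_list ms))
        (\<lambda>(a, b). opcomp C ms a (map b [0..<length ms]))) \<and>
     (\<forall>nss a bs css.
        a \<in> Elems C (length nss) \<longrightarrow>
        bs \<in> ElemLists C (map length nss) \<longrightarrow>
        list_all2 (\<lambda>cs ns. cs \<in> ElemLists C ns) css nss \<longrightarrow>
        opcomp C (concat nss) (opcomp C (map length nss) a bs) (concat css) =
        opcomp C (map sum_list nss) a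
          (map (\<lambda>i. opcomp C (nss ! i) (bs ! i) (css ! i)) [0..<length nss])) \<and>
     (\<forall>n. \<forall>a \<in> Elems C n. opcomp C [n] (opunit C) [a] = a) \<and>
     (\<forall>n. \<forall>a \<in> Elems C n. opcomp C (replicate n 1) a (replicate n (opunit C)) = a)"

definition operad_morphism ::
  "('a, 'm) operad_scheme \<Rightarrow> ('b, 'n) operad_scheme \<Rightarrow> (nat \<Rightarrow> 'a \<Rightarrow> 'b) \<Rightarrow> bool" where
  "operad_morphism A B f \<longleftrightarrow>
     (\<forall>n. continuous_map (Space A n) (Space B n) (f n)) \<and>
     f 1 (opunit A) = opunit B \<and>
     (\<forall>ms. \<forall>a \<in> Elems A (length ms). \<forall>bs \<in> ElemLists A ms.
        f (sum_list ms) (opcomp A ms a bs) = opcomp B ms (f (length ms) a) (map2 f ms bs))"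


section \<open>Group operads\<close>

text \<open>The product of the symmetric groups is \<open>(\<sigma>\<tau>)(i) = \<tau>(\<sigma>(i))\<close>.\<close>

definition sym_grp :: "nat \<Rightarrow> (nat \<Rightarrow> nat) monoid" where
  "sym_grp n = \<lparr>carrier = {\<sigma>. \<sigma> permutes {..<n}}, mult = (\<lambda>\<sigma> \<tau>. \<tau> \<circ> \<sigma>), one = id\<rparr>"

text \<open>The number \<open>x < sum_list ms\<close> is the \<open>j\<close>-th element of the \<open>i\<close>-th block.\<close>

definition sym_comp :: "nat list \<Rightarrow> (nat \<Rightarrow> nat) \<Rightarrow> (nat \<Rightarrow> nat) list \<Rightarrow> nat \<Rightarrow> nat" where
  "sym_comp ms \<sigma> \<tau>s x =
     (if x < sum_list ms then
        let i = (LEAST i. x < sum_list (take (Suc i) ms));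
            j = x - sum_list (take i ms)
        in (\<Sum>l | l < length ms \<and> \<sigma> l < \<sigma> i. ms ! l) + (\<tau>s ! i) j
      else x)"

definition sym_operad :: "(nat \<Rightarrow> nat) operad" where
  "sym_operad =
     \<lparr>Space = (\<lambda>n. discrete_topology (carrier (sym_grp n))), opcomp = sym_comp, opunit = id\<rparr>"

record 'g grp_operad =
  Grp :: "nat \<Rightarrow> 'g monoid"
  gcomp :: "nat list \<Rightarrow> 'g \<Rightarrow> 'g list \<Rightarrow> 'g"
  gperm :: "nat \<Rightarrow> 'g \<Rightarrow> nat \<Rightarrow> nat"

definition discrete_operad :: "'g grp_operad \<Rightarrow> 'g operad" where
  "discrete_operad G =
     \<lparr>Space = (\<lambda>n. discrete_topology (carrier (Grp G n))), opcomp = gcomp G,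
      opunit = \<one>\<^bsub>Grp G 1\<^esub>\<rparr>"

text \<open>
  The \<open>i\<close>-th entry of \<open>invperm \<sigma> xs\<close> is \<open>xs ! (\<sigma>\<^sup>-\<^sup>1 i)\<close>. The list of arities is permuted together with the
  list of elements.
\<close>

definition invperm :: "(nat \<Rightarrow> nat) \<Rightarrow> 'a list \<Rightarrow> 'a list" where
  "invperm \<sigma> xs = permute_list (inv_into UNIV \<sigma>) xs"

definition group_operad :: "'g grp_operad \<Rightarrow> bool" where
  "group_operad G \<longleftrightarrow>
     topological_operad (discrete_operad G) \<and>
     operad_morphism (discrete_operad G) sym_operad (gperm G) \<and>
     (\<forall>n. group (Grp G n) \<and> gperm G n \<in> hom (Grp G n) (sym_grp n)) \<and>
     (\<forall>ms a a' bs bs'.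
        a \<in> carrier (Grp G (length ms)) \<longrightarrow> a' \<in> carrier (Grp G (length ms)) \<longrightarrow>
        bs \<in> ElemLists (discrete_operad G) ms \<longrightarrow> bs' \<in> ElemLists (discrete_operad G) ms \<longrightarrow>
        gcomp G ms (a \<otimes>\<^bsub>Grp G (length ms)\<^esub> a')
          (map (\<lambda>i. bs ! i \<otimes>\<^bsub>Grp G (ms ! i)\<^esub> bs' ! i) [0..<length ms]) =
        gcomp G ms a bs \<otimes>\<^bsub>Grp G (sum_list ms)\<^esub>
        gcomp G (invperm (gperm G (length ms) a) ms) a' (invperm (gperm G (length ms) a) bs'))"

definition non_crossed :: "'g grp_operad \<Rightarrow> bool" where
  "non_crossed G \<longleftrightarrow> (\<forall>n. \<forall>a \<in> carrier (Grp G n). gperm G n a = id)"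

definition grp_operad_morphism ::
  "'g grp_operad \<Rightarrow> 'h grp_operad \<Rightarrow> (nat \<Rightarrow> 'g \<Rightarrow> 'h) \<Rightarrow> bool" where
  "grp_operad_morphism A B f \<longleftrightarrow>
     (\<forall>n. f n \<in> hom (Grp A n) (Grp B n)) \<and>
     (\<forall>ms. \<forall>a \<in> carrier (Grp A (length ms)). \<forall>bs \<in> ElemLists (discrete_operad A) ms.
        f (sum_list ms) (gcomp A ms a bs) = gcomp B ms (f (length ms) a) (map2 f ms bs)) \<and>
     (\<forall>n. \<forall>a \<in> carrier (Grp A n). gperm B n (f n a) = gperm A n a)"

text \<open>
  The library's \<open>short_exact_sequence\<close> and \<open>exact_seq\<close> require all groups to be over the same type,
  so exactness is spelled out.
\<close>

definition grp_operad_ses ::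
  "'a grp_operad \<Rightarrow> 'b grp_operad \<Rightarrow> 'c grp_operad \<Rightarrow> (nat \<Rightarrow> 'a \<Rightarrow> 'b) \<Rightarrow> (nat \<Rightarrow> 'b \<Rightarrow> 'c) \<Rightarrow> bool" where
  "grp_operad_ses A B C f g \<longleftrightarrow>
     group_operad A \<and> group_operad B \<and> group_operad C \<and>
     grp_operad_morphism A B f \<and> grp_operad_morphism B C g \<and>
     (\<forall>n. f n \<in> mon (Grp A n) (Grp B n) \<and> g n \<in> epi (Grp B n) (Grp C n) \<and>
          f n ` carrier (Grp A n) = kernel (Grp B n) (Grp C n) (g n))"

definition sub_grp_operad :: "'g grp_operad \<Rightarrow> (nat \<Rightarrow> 'g set) \<Rightarrow> bool" where
  "sub_grp_operad G H \<longleftrightarrow>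
     (\<forall>n. subgroup (H n) (Grp G n)) \<and>
     (\<forall>ms. \<forall>a \<in> H (length ms). \<forall>bs \<in> listset (map H ms). gcomp G ms a bs \<in> H (sum_list ms))"

definition normal_sub_grp_operad :: "'g grp_operad \<Rightarrow> (nat \<Rightarrow> 'g set) \<Rightarrow> bool" where
  "normal_sub_grp_operad G H \<longleftrightarrow> sub_grp_operad G H \<and> (\<forall>n. H n \<lhd> Grp G n)"

definition restrict_grp_operad :: "'g grp_operad \<Rightarrow> (nat \<Rightarrow> 'g set) \<Rightarrow> 'g grp_operad" where
  "restrict_grp_operad G H = G\<lparr>Grp := (\<lambda>n. (Grp G n)\<lparr>carrier := H n\<rparr>)\<rparr>"


section \<open>Operads with an action of a group operad\<close>

text \<open>
  The library's notion of group action makes each \<open>act n g\<close> extensional, i.e. equal to \<^const>\<open>undefined\<close>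
  outside the space acted on.
\<close>

definition topological_G_operad ::
  "'g grp_operad \<Rightarrow> 'a operad \<Rightarrow> (nat \<Rightarrow> 'g \<Rightarrow> 'a \<Rightarrow> 'a) \<Rightarrow> bool" where
  "topological_G_operad G C act \<longleftrightarrow>
     group_operad G \<and> topological_operad C \<and>
     (\<forall>n. group_action (Grp G n) (Elems C n) (act n) \<and>
          (\<forall>g \<in> carrier (Grp G n). continuous_map (Space C n) (Space C n) (act n g))) \<and>
     (\<forall>ms \<sigma> \<tau>s a bs.
        \<sigma> \<in> carrier (Grp G (length ms)) \<longrightarrow> \<tau>s \<in> ElemLists (discrete_operad G) ms \<longrightarrow>
        a \<in> Elems C (length ms) \<longrightarrow> bs \<in> ElemLists C ms \<longrightarrow>
        opcomp C ms (act (length ms) \<sigma> a)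
          (map (\<lambda>i. act (ms ! i) (\<tau>s ! i) (bs ! i)) [0..<length ms]) =
        act (sum_list ms) (gcomp G ms \<sigma> \<tau>s)
          (opcomp C (invperm (gperm G (length ms) \<sigma>) ms) a
             (invperm (gperm G (length ms) \<sigma>) bs)))"

definition covering_G_operad ::
  "'g grp_operad \<Rightarrow> 'a operad \<Rightarrow> (nat \<Rightarrow> 'g \<Rightarrow> 'a \<Rightarrow> 'a) \<Rightarrow> bool" where
  "covering_G_operad G C act \<longleftrightarrow>
     topological_G_operad G C act \<and>
     (\<forall>n. \<forall>x \<in> Elems C n. \<exists>U. openin (Space C n) U \<and> x \<in> U \<and>
        (\<forall>g \<in> carrier (Grp G n). g \<noteq> \<one>\<^bsub>Grp G n\<^esub> \<longrightarrow> act n g ` U \<inter> U = {}))"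

definition path_connected_operad :: "'a operad \<Rightarrow> bool" where
  "path_connected_operad C \<longleftrightarrow> (\<forall>n. path_connected_space (Space C n))"


section \<open>Quotients\<close>

definition quotient_topology :: "'a topology \<Rightarrow> ('a \<Rightarrow> 'b) \<Rightarrow> 'b topology" where
  "quotient_topology X q =
     topology (\<lambda>U. U \<subseteq> q ` topspace X \<and> openin X {x \<in> topspace X. q x \<in> U})"

definition orbit_space :: "'g monoid \<Rightarrow> 'a topology \<Rightarrow> ('g \<Rightarrow> 'a \<Rightarrow> 'a) \<Rightarrow> 'a set topology" where
  "orbit_space G X \<phi> = quotient_topology X (orbit G \<phi>)"

text \<open>
  Here and below, an operation on classes is the union, over all representatives, of the classes of
  the results. If the operation is independent of the representatives, this is the
  class of the result for any choice of them. Likewise \<^const>\<open>the_elem\<close> of the set of the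
  values on all representatives is their common value.
\<close>

definition quotient_grp_operad :: "'g grp_operad \<Rightarrow> (nat \<Rightarrow> 'g set) \<Rightarrow> 'g set grp_operad" where
  "quotient_grp_operad G H =
     \<lparr>Grp = (\<lambda>n. Grp G n Mod H n),
      gcomp = (\<lambda>ms A Bs. \<Union>a\<in>A. \<Union>bs\<in>listset Bs.
        H (sum_list ms) #>\<^bsub>Grp G (sum_list ms)\<^esub> gcomp G ms a bs),
      gperm = (\<lambda>n A. the_elem (gperm G n ` A))\<rparr>"

definition sub_orbit ::
  "'g grp_operad \<Rightarrow> (nat \<Rightarrow> 'g set) \<Rightarrow> (nat \<Rightarrow> 'g \<Rightarrow> 'a \<Rightarrow> 'a) \<Rightarrow> nat \<Rightarrow> 'a \<Rightarrow> 'a set" where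
  "sub_orbit G H act n x = orbit (Grp (restrict_grp_operad G H) n) (act n) x"

definition quotient_operad ::
  "'g grp_operad \<Rightarrow> (nat \<Rightarrow> 'g set) \<Rightarrow> 'a operad \<Rightarrow> (nat \<Rightarrow> 'g \<Rightarrow> 'a \<Rightarrow> 'a) \<Rightarrow> 'a set operad" where
  "quotient_operad G H C act =
     \<lparr>Space = (\<lambda>n. orbit_space (Grp (restrict_grp_operad G H) n) (Space C n) (act n)),
      opcomp = (\<lambda>ms A Bs. \<Union>a\<in>A. \<Union>bs\<in>listset Bs.
        sub_orbit G H act (sum_list ms) (opcomp C ms a bs)),
      opunit = sub_orbit G H act 1 (opunit C)\<rparr>"

definition quotient_act ::
  "'g grp_operad \<Rightarrow> (nat \<Rightarrow> 'g set) \<Rightarrow> 'a operad \<Rightarrow> (nat \<Rightarrow> 'g \<Rightarrow> 'a \<Rightarrow> 'a) \<Rightarrow>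
    nat \<Rightarrow> 'g set \<Rightarrow> 'a set \<Rightarrow> 'a set" where
  "quotient_act G H C act n A =
     (\<lambda>X \<in> Elems (quotient_operad G H C act) n. \<Union>g\<in>A. \<Union>x\<in>X. sub_orbit G H act n (act n g x))"


section \<open>Little intervals and good basepoints\<close>

text \<open>
  An increasing affine embedding of the unit interval into itself is represented by the pair of
  the endpoints of its image.
\<close>

definition affine_emb :: "real \<times> real \<Rightarrow> real \<Rightarrow> real" where
  "affine_emb c t = fst c + (snd c - fst c) * t"

definition emb_comp :: "real \<times> real \<Rightarrow> real \<times> real \<Rightarrow> real \<times> real" where
  "emb_comp c d = (affine_emb c (fst d), affine_emb c (snd d))"

type_synonym intervals = "nat \<Rightarrow> real \<times> real"

definition little_intervals :: "nat \<Rightarrow> intervals set" where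
  "little_intervals k =
     {c \<in> {..<k} \<rightarrow>\<^sub>E UNIV.
        (\<forall>i<k. 0 \<le> fst (c i) \<and> fst (c i) < snd (c i) \<and> snd (c i) \<le> 1) \<and>
        (\<forall>i<k. \<forall>j<k. i \<noteq> j \<longrightarrow>
           {fst (c i)<..<snd (c i)} \<inter> {fst (c j)<..<snd (c j)} = {})}"

definition little_intervals_space :: "nat \<Rightarrow> intervals topology" where
  "little_intervals_space k =
     subtopology (product_topology (\<lambda>_. euclidean) {..<k}) (little_intervals k)"

definition little_intervals_comp :: "nat list \<Rightarrow> intervals \<Rightarrow> intervals list \<Rightarrow> intervals" where
  "little_intervals_comp ms c ds =
     (\<lambda>x\<in>{..<sum_list ms}.
        concat (map (\<lambda>i. map (\<lambda>j. emb_comp (c i) ((ds ! i) j)) [0..<ms ! i]) [0..<length ms]) ! x)"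

definition standard_intervals :: "nat \<Rightarrow> intervals" where
  "standard_intervals k = (\<lambda>i\<in>{..<k}. (real i / real k, real (Suc i) / real k))"

definition little_intervals_operad0 :: "intervals operad" where
  "little_intervals_operad0 =
     \<lparr>Space = (\<lambda>k. subtopology (little_intervals_space k)
        (path_component_of_set (little_intervals_space k) (standard_intervals k))),
      opcomp = little_intervals_comp,
      opunit = (\<lambda>i\<in>{..<1}. (0, 1))\<rparr>"

definition interval_segment :: "nat \<Rightarrow> intervals \<Rightarrow> intervals \<Rightarrow> real \<Rightarrow> intervals" where
  "interval_segment k u v t = (\<lambda>i\<in>{..<k}. (1 - t) *\<^sub>R u i + t *\<^sub>R v i)"

definition good_basepoint_morphism :: "'a operad \<Rightarrow> (nat \<Rightarrow> intervals \<Rightarrow> 'a) \<Rightarrow> bool" where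
  "good_basepoint_morphism D \<eta> \<longleftrightarrow> operad_morphism little_intervals_operad0 D \<eta>"

definition basept :: "(nat \<Rightarrow> intervals \<Rightarrow> 'a) \<Rightarrow> nat \<Rightarrow> 'a" where
  "basept \<eta> k = \<eta> k (standard_intervals k)"

text \<open>The linear path from \<open>e\<^sub>m\<close> to \<open>\<gamma>(e\<^sub>k; e\<^bsub>m\<^sub>1\<^esub>, \<dots>, e\<^bsub>m\<^sub>k\<^esub>)\<close>, where \<open>m = m\<^sub>1 + \<dots> + m\<^sub>k\<close>.\<close>

definition linear_path :: "(nat \<Rightarrow> intervals \<Rightarrow> 'a) \<Rightarrow> nat list \<Rightarrow> real \<Rightarrow> 'a" where
  "linear_path \<eta> ms t =
     \<eta> (sum_list ms)
       (interval_segment (sum_list ms) (standard_intervals (sum_list ms))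
          (little_intervals_comp ms (standard_intervals (length ms)) (map standard_intervals ms)) t)"


section \<open>Fundamental groups\<close>

text \<open>
  The library's \<open>joinpaths\<close>, \<open>reversepath\<close> and \<open>homotopic_paths\<close> are restricted to spaces given by
  a topological type class.
\<close>

definition path_join :: "(real \<Rightarrow> 'a) \<Rightarrow> (real \<Rightarrow> 'a) \<Rightarrow> real \<Rightarrow> 'a" (infixr \<open>\<bullet>\<bullet>\<close> 75) where
  "f \<bullet>\<bullet> g = (\<lambda>t. if t \<le> 1/2 then f (2 * t) else g (2 * t - 1))"

definition path_rev :: "(real \<Rightarrow> 'a) \<Rightarrow> real \<Rightarrow> 'a" where
  "path_rev f = (\<lambda>t. f (1 - t))"

definition path_class :: "'a topology \<Rightarrow> (real \<Rightarrow> 'a) \<Rightarrow> (real \<Rightarrow> 'a) set" where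
  "path_class X f = {g. homotopic_with (\<lambda>p. p 0 = f 0 \<and> p 1 = f 1) (top_of_set {0..1}) X f g}"

definition fundamental_group :: "'a topology \<Rightarrow> 'a \<Rightarrow> (real \<Rightarrow> 'a) set monoid" where
  "fundamental_group X x =
     \<lparr>carrier = {path_class X f |f. pathin X f \<and> f 0 = x \<and> f 1 = x},
      mult = (\<lambda>A B. \<Union>f\<in>A. \<Union>g\<in>B. path_class X (f \<bullet>\<bullet> g)),
      one = path_class X (\<lambda>_. x)\<rparr>"

definition pointwise_comp ::
  "'a operad \<Rightarrow> nat list \<Rightarrow> ('t \<Rightarrow> 'a) \<Rightarrow> ('t \<Rightarrow> 'a) list \<Rightarrow> 't \<Rightarrow> 'a" where
  "pointwise_comp D ms f gs = (\<lambda>t. opcomp D ms (f t) (map (\<lambda>g. g t) gs))"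

definition pi1_operad ::
  "'a operad \<Rightarrow> (nat \<Rightarrow> intervals \<Rightarrow> 'a) \<Rightarrow> (real \<Rightarrow> 'a) set grp_operad" where
  "pi1_operad D \<eta> =
     \<lparr>Grp = (\<lambda>k. fundamental_group (Space D k) (basept \<eta> k)),
      gcomp = (\<lambda>ms A Bs. \<Union>f\<in>A. \<Union>gs\<in>listset Bs.
        path_class (Space D (sum_list ms))
          ((linear_path \<eta> ms \<bullet>\<bullet> pointwise_comp D ms f gs) \<bullet>\<bullet> path_rev (linear_path \<eta> ms))),
      gperm = (\<lambda>k A. id)\<rparr>"


section \<open>Fundamental groups of the orbit spaces of a covering operad\<close>

text \<open>
  In this section and the next one \<open>D\<close> is a \<open>Q\<close>-operad with action \<open>act\<close> and good basepoint given
  by \<open>\<eta>\<close>.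
\<close>

definition op_orbit_space ::
  "'q grp_operad \<Rightarrow> 'a operad \<Rightarrow> (nat \<Rightarrow> 'q \<Rightarrow> 'a \<Rightarrow> 'a) \<Rightarrow> nat \<Rightarrow> 'a set topology" where
  "op_orbit_space Q D act k = orbit_space (Grp Q k) (Space D k) (act k)"

definition op_orbit :: "'q grp_operad \<Rightarrow> (nat \<Rightarrow> 'q \<Rightarrow> 'a \<Rightarrow> 'a) \<Rightarrow> nat \<Rightarrow> 'a \<Rightarrow> 'a set" where
  "op_orbit Q act k x = orbit (Grp Q k) (act k) x"

text \<open>
  The elements of the \<open>k\<close>-th group are homotopy classes of loops in the orbit space itself.
  They are identified with classes of paths in \<open>D(k)\<close> by passing to the lifts that start at \<open>e\<^sub>k\<close>;
  the product \<open>[f]*[g] = [f\<cdot>(\<partial>f)g]\<close> of the lifts corresponds to the product of loops.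
\<close>

definition path_lifts ::
  "'q grp_operad \<Rightarrow> 'a operad \<Rightarrow> (nat \<Rightarrow> 'q \<Rightarrow> 'a \<Rightarrow> 'a) \<Rightarrow> (nat \<Rightarrow> intervals \<Rightarrow> 'a) \<Rightarrow>
    nat \<Rightarrow> (real \<Rightarrow> 'a set) set \<Rightarrow> (real \<Rightarrow> 'a) set" where
  "path_lifts Q D act \<eta> k A =
     {f. pathin (Space D k) f \<and> f 0 = basept \<eta> k \<and> op_orbit Q act k \<circ> f \<in> A}"

definition path_bd ::
  "'q grp_operad \<Rightarrow> (nat \<Rightarrow> 'q \<Rightarrow> 'a \<Rightarrow> 'a) \<Rightarrow> (nat \<Rightarrow> intervals \<Rightarrow> 'a) \<Rightarrow>
    nat \<Rightarrow> (real \<Rightarrow> 'a) \<Rightarrow> 'q" where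
  "path_bd Q act \<eta> k f = (THE q. q \<in> carrier (Grp Q k) \<and> f 1 = act k q (basept \<eta> k))"

definition pi1_bd ::
  "'q grp_operad \<Rightarrow> 'a operad \<Rightarrow> (nat \<Rightarrow> 'q \<Rightarrow> 'a \<Rightarrow> 'a) \<Rightarrow> (nat \<Rightarrow> intervals \<Rightarrow> 'a) \<Rightarrow>
    nat \<Rightarrow> (real \<Rightarrow> 'a set) set \<Rightarrow> 'q" where
  "pi1_bd Q D act \<eta> k A = the_elem (path_bd Q act \<eta> k ` path_lifts Q D act \<eta> k A)"

definition pi1_orbit_operad ::
  "'q grp_operad \<Rightarrow> 'a operad \<Rightarrow> (nat \<Rightarrow> 'q \<Rightarrow> 'a \<Rightarrow> 'a) \<Rightarrow> (nat \<Rightarrow> intervals \<Rightarrow> 'a) \<Rightarrow>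
    (real \<Rightarrow> 'a set) set grp_operad" where
  "pi1_orbit_operad Q D act \<eta> =
     \<lparr>Grp = (\<lambda>k. fundamental_group (op_orbit_space Q D act k) (op_orbit Q act k (basept \<eta> k))),
      gcomp = (\<lambda>ms A Bs.
        \<Union>f \<in> path_lifts Q D act \<eta> (length ms) A.
        \<Union>gs \<in> listset (map2 (path_lifts Q D act \<eta>) ms Bs).
          let m = sum_list ms;
              df = path_bd Q act \<eta> (length ms) f;
              dgs = map2 (path_bd Q act \<eta>) ms gs;
              \<delta>1 = linear_path \<eta> ms;
              \<delta>2 = linear_path \<eta> (invperm (gperm Q (length ms) df) ms)
          in path_class (op_orbit_space Q D act m)
               (op_orbit Q act m \<circ>
                 (\<delta>1 \<bullet>\<bullet> pointwise_comp D ms f gs \<bullet>\<bullet> (act m (gcomp Q ms df dgs) \<circ> path_rev \<delta>2)))),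
      gperm = (\<lambda>k A. gperm Q k (pi1_bd Q D act \<eta> k A))\<rparr>"

text \<open>The map induced on fundamental groups by the projection to the orbit space.\<close>

definition pi1_proj ::
  "'q grp_operad \<Rightarrow> 'a operad \<Rightarrow> (nat \<Rightarrow> 'q \<Rightarrow> 'a \<Rightarrow> 'a) \<Rightarrow>
    nat \<Rightarrow> (real \<Rightarrow> 'a) set \<Rightarrow> (real \<Rightarrow> 'a set) set" where
  "pi1_proj Q D act k A = (\<Union>f\<in>A. path_class (op_orbit_space Q D act k) (op_orbit Q act k \<circ> f))"

definition conj_act :: "'g grp_operad \<Rightarrow> nat \<Rightarrow> 'g \<Rightarrow> 'g \<Rightarrow> 'g" where
  "conj_act G n a =
     (\<lambda>b \<in> carrier (Grp G n). a \<otimes>\<^bsub>Grp G n\<^esub> b \<otimes>\<^bsub>Grp G n\<^esub> inv\<^bsub>Grp G n\<^esub> a)"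


section \<open>Higher homotopy groups\<close>

type_synonym 'a cube_map = "(nat \<Rightarrow> real) \<Rightarrow> 'a"

definition unit_cube :: "nat \<Rightarrow> (nat \<Rightarrow> real) topology" where
  "unit_cube l = product_topology (\<lambda>_. top_of_set {0..1}) {..<l}"

definition cube_boundary :: "nat \<Rightarrow> (nat \<Rightarrow> real) set" where
  "cube_boundary l = {x \<in> topspace (unit_cube l). \<exists>i<l. x i = 0 \<or> x i = 1}"

definition spheroids :: "nat \<Rightarrow> 'a topology \<Rightarrow> 'a \<Rightarrow> 'a cube_map set" where
  "spheroids l X y = {f. continuous_map (unit_cube l) X f \<and> (\<forall>s \<in> cube_boundary l. f s = y)}"

definition cube_class :: "nat \<Rightarrow> 'a topology \<Rightarrow> 'a \<Rightarrow> 'a cube_map \<Rightarrow> 'a cube_map set" where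
  "cube_class l X y f =
     {g. homotopic_with (\<lambda>p. \<forall>s \<in> cube_boundary l. p s = y) (unit_cube l) X f g}"

text \<open>Only the underlying set of the homotopy group is needed here.\<close>

definition homotopy_group_set :: "nat \<Rightarrow> 'a topology \<Rightarrow> 'a \<Rightarrow> 'a cube_map set set" where
  "homotopy_group_set l X y = cube_class l X y ` spheroids l X y"

text \<open>
  Change of basepoint along a path \<open>u\<close> from \<open>x\<close> to \<open>y\<close>, on a map \<open>f\<close> based at \<open>y\<close>: put \<open>f\<close> on the
  concentric cube of half the size, and \<open>u\<close> on the radial segments from the boundary to that cube.
\<close>

definition change_base :: "nat \<Rightarrow> (real \<Rightarrow> 'a) \<Rightarrow> 'a cube_map \<Rightarrow> 'a cube_map" where
  "change_base l u f x =
     (let r = Max ((\<lambda>i. \<bar>2 * x i - 1\<bar>) ` {..<l})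
      in if r \<le> 1/2 then f (\<lambda>i\<in>{..<l}. 2 * x i - 1/2) else u (2 - 2 * r))"

text \<open>
  As for \<open>l = 1\<close>, the elements are homotopy classes in the orbit space, identified with classes of
  maps to \<open>D(k)\<close> by lifting.
\<close>

definition cube_lifts ::
  "nat \<Rightarrow> 'q grp_operad \<Rightarrow> 'a operad \<Rightarrow> (nat \<Rightarrow> 'q \<Rightarrow> 'a \<Rightarrow> 'a) \<Rightarrow> (nat \<Rightarrow> intervals \<Rightarrow> 'a) \<Rightarrow>
    nat \<Rightarrow> 'a set cube_map set \<Rightarrow> 'a cube_map set" where
  "cube_lifts l Q D act \<eta> k A =
     {f \<in> spheroids l (Space D k) (basept \<eta> k). op_orbit Q act k \<circ> f \<in> A}"

definition proj_cube_class ::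
  "nat \<Rightarrow> 'q grp_operad \<Rightarrow> 'a operad \<Rightarrow> (nat \<Rightarrow> 'q \<Rightarrow> 'a \<Rightarrow> 'a) \<Rightarrow> (nat \<Rightarrow> intervals \<Rightarrow> 'a) \<Rightarrow>
    nat \<Rightarrow> 'a cube_map \<Rightarrow> 'a set cube_map set" where
  "proj_cube_class l Q D act \<eta> k f =
     cube_class l (op_orbit_space Q D act k) (op_orbit Q act k (basept \<eta> k)) (op_orbit Q act k \<circ> f)"

definition pi_orbit_operad ::
  "nat \<Rightarrow> 'q grp_operad \<Rightarrow> 'a operad \<Rightarrow> (nat \<Rightarrow> 'q \<Rightarrow> 'a \<Rightarrow> 'a) \<Rightarrow> (nat \<Rightarrow> intervals \<Rightarrow> 'a) \<Rightarrow>
    'a set cube_map set operad" where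
  "pi_orbit_operad l Q D act \<eta> =
     \<lparr>Space = (\<lambda>k. discrete_topology
        (homotopy_group_set l (op_orbit_space Q D act k) (op_orbit Q act k (basept \<eta> k)))),
      opcomp = (\<lambda>ms A Bs.
        \<Union>f \<in> cube_lifts l Q D act \<eta> (length ms) A.
        \<Union>gs \<in> listset (map2 (cube_lifts l Q D act \<eta>) ms Bs).
          proj_cube_class l Q D act \<eta> (sum_list ms)
            (change_base l (linear_path \<eta> ms) (pointwise_comp D ms f gs))),
      opunit = proj_cube_class l Q D act \<eta> 1 (\<lambda>_. basept \<eta> 1)\<rparr>"

definition pi_orbit_act ::
  "nat \<Rightarrow> 'q grp_operad \<Rightarrow> 'a operad \<Rightarrow> (nat \<Rightarrow> 'q \<Rightarrow> 'a \<Rightarrow> 'a) \<Rightarrow> (nat \<Rightarrow> intervals \<Rightarrow> 'a) \<Rightarrow>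
    nat \<Rightarrow> (real \<Rightarrow> 'a set) set \<Rightarrow> 'a set cube_map set \<Rightarrow> 'a set cube_map set" where
  "pi_orbit_act l Q D act \<eta> k A =
     (\<lambda>B \<in> Elems (pi_orbit_operad l Q D act \<eta>) k.
        \<Union>a \<in> path_lifts Q D act \<eta> k A. \<Union>f \<in> cube_lifts l Q D act \<eta> k B.
          proj_cube_class l Q D act \<eta> k
            (change_base l a (act k (path_bd Q act \<eta> k a) \<circ> f)))"

end

theory Submission
  imports Defs
begin

text \<open>
  Put \<open>D = C/H\<close> and \<open>Q = G/H\<close>. The iterated orbit spaces are those of \<open>C\<close> because a space has the same
  quotient topology in one step as in two (\<open>homeomorphic_iterated_orbit_space\<close>). The rest is about
  the path-connected covering \<open>Q\<close>-operad \<open>D\<close> with basepoints \<open>e\<^sub>k\<close> that come from configurations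
  of little intervals; these data form the locale \<open>based_operad\<close>.

  Since \<open>Q\<^sub>k\<close> acts on \<open>D(k)\<close> by a covering action, homotopies lift uniquely along the projection to the
  orbit space (\<open>homotopy_lifting\<close>, \<open>rel_homotopic_lift\<close>). So an element of the fundamental group of
  \<open>D(k)/Q\<^sub>k\<close> is the homotopy class of a path \<open>f\<close> in \<open>D(k)\<close> from \<open>e\<^sub>k\<close> to a point \<open>(\<partial>f)e\<^sub>k\<close> (\<open>cls_eq_iff\<close>,
  \<open>\<pi>1_cases\<close>), and all identities can be checked for such paths, up to homotopy in \<open>D(k)\<close>.

  Two principles then do the work. First, the pointwise \<open>\<gamma>\<close> of joins of paths is the join of the
  pointwise \<open>\<gamma>\<close>, with equality and not just homotopy (\<open>pointwise_comp_join\<close>), and equivariance moves group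
  elements out of \<open>\<gamma>\<close> (\<open>pointwise_comp_act\<close>). Second, the linear paths, which correct the
  endpoints of the pointwise \<open>\<gamma>\<close>, are images of paths in a convex set of configurations. Hence any two
  ways of composing them with the same endpoints agree up to homotopy (\<open>\<delta>_assoc\<close>), and
  those for composition with the unit are constant. The interchange law (\<open>gamma_star\<close>)
  holds because the linear path at the end of the first factor cancels against the one at the beginning
  of the second. Associativity (\<open>gamma_assoc\<close>) splits into a middle piece, where it is associativity
  in \<open>D\<close>, and two outer pieces, where it is \<open>\<delta>_assoc\<close>.

  The projection \<open>D(k) \<rightarrow> D(k)/Q\<^sub>k\<close> induces injective homomorphisms that are compatible with \<open>\<gamma>\<close>, and the
  axioms for the fundamental groups of \<open>D\<close> are inherited along them (\<open>group_operad_transport\<close>). Their image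
  consists of the classes of paths that end at \<open>e\<^sub>k\<close>, which is the kernel of \<open>\<partial>\<close>; and \<open>\<partial>\<close> is onto because
  \<open>D(k)\<close> is path-connected.

  The higher homotopy groups are treated in the same way, with maps of cubes that lift to \<open>D(k)\<close> in dimension
  at least two (\<open>spheroid_lift\<close>), and with change of basepoint in place of joins of paths. What is
  needed about change of basepoint is that it composes (\<open>change_base_join\<close>) and that it commutes with the
  pointwise \<open>\<gamma>\<close> (\<open>pointwise_comp_change_base\<close>). In the non-crossed case each \<open>\<gamma>\<close> is a group
  homomorphism and therefore commutes with conjugation (\<open>topological_G_operad_conj\<close>).
\<close>

section \<open>Homotopies relative to a subspace\<close>

abbreviation unit_I :: "real topology" where
  "unit_I \<equiv> top_of_set {0..1}"

text \<open>The condition on \<open>B\<close> refers to \<open>f\<close> instead of a fixed point, so that paths with fixed endpoints and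
  maps of cubes with constant boundary are both instances.\<close>

definition rel_homotopic ::
  "'b topology \<Rightarrow> 'a topology \<Rightarrow> 'b set \<Rightarrow> ('b \<Rightarrow> 'a) \<Rightarrow> ('b \<Rightarrow> 'a) \<Rightarrow> bool" where
  "rel_homotopic Y X B f g \<longleftrightarrow> homotopic_with (\<lambda>p. \<forall>b\<in>B. p b = f b) Y X f g"

lemma rel_homotopicI:
  assumes "B \<subseteq> topspace Y" "continuous_map (prod_topology unit_I Y) X h"
    "\<And>y. y \<in> topspace Y \<Longrightarrow> h (0, y) = f y" "\<And>y. y \<in> topspace Y \<Longrightarrow> h (1, y) = g y"
    "\<And>t b. t \<in> {0..1} \<Longrightarrow> b \<in> B \<Longrightarrow> h (t, b) = f b"
  shows "rel_homotopic Y X B f g"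
  unfolding rel_homotopic_def
proof (subst homotopic_with)
  show "\<And>h k. (\<And>x. x \<in> topspace Y \<Longrightarrow> h x = k x) \<Longrightarrow> (\<forall>b\<in>B. h b = f b) \<longleftrightarrow> (\<forall>b\<in>B. k b = f b)"
    using assms(1) by (metis subsetD)
qed (use assms in blast)

lemma rel_homotopicE:
  assumes "rel_homotopic Y X B f g"
  obtains h where "continuous_map (prod_topology unit_I Y) X h"
    "\<And>y. h (0, y) = f y" "\<And>y. h (1, y) = g y" "\<And>t b. t \<in> {0..1} \<Longrightarrow> b \<in> B \<Longrightarrow> h (t, b) = f b"
  using assms unfolding rel_homotopic_def homotopic_with_def by metis

lemma rel_homotopic_continuous:
  assumes "rel_homotopic Y X B f g"
  shows "continuous_map Y X f" "continuous_map Y X g"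
  using assms homotopic_with_imp_continuous_maps unfolding rel_homotopic_def by blast+

lemma rel_homotopic_on: "rel_homotopic Y X B f g \<Longrightarrow> b \<in> B \<Longrightarrow> g b = f b"
  by (erule rel_homotopicE) (metis atLeastAtMost_iff order_refl zero_le_one)

lemma rel_homotopic_refl: "continuous_map Y X f \<Longrightarrow> rel_homotopic Y X B f f"
  by (simp add: rel_homotopic_def)

lemma rel_homotopic_eqI:
  assumes "continuous_map Y X f" "B \<subseteq> topspace Y" "\<And>y. y \<in> topspace Y \<Longrightarrow> f y = g y"
  shows "rel_homotopic Y X B f g"
  unfolding rel_homotopic_def by (rule homotopic_with_equal) (use assms in auto)

lemma rel_homotopic_sym:
  assumes "rel_homotopic Y X B f g"
  shows "rel_homotopic Y X B g f"
proof -
  have "homotopic_with (\<lambda>p. \<forall>b\<in>B. p b = f b) Y X g f"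
    using assms homotopic_with_symD unfolding rel_homotopic_def by blast
  then show ?thesis
    using rel_homotopic_on[OF assms] unfolding rel_homotopic_def by simp
qed

lemma rel_homotopic_trans [trans]:
  assumes "rel_homotopic Y X B f g" "rel_homotopic Y X B g h"
  shows "rel_homotopic Y X B f h"
proof -
  have "homotopic_with (\<lambda>p. \<forall>b\<in>B. p b = f b) Y X g h"
    using assms(2) rel_homotopic_on[OF assms(1)] unfolding rel_homotopic_def by simp
  then show ?thesis
    using assms(1) homotopic_with_trans unfolding rel_homotopic_def by blast
qed

lemma rel_homotopic_postcompose:
  assumes "rel_homotopic Y X B f g" "continuous_map X Z k"
  shows "rel_homotopic Y Z B (k \<circ> f) (k \<circ> g)"
  unfolding rel_homotopic_def
  by (rule homotopic_with_compose_continuous_map_left[OF assms(1)[unfolded rel_homotopic_def] assms(2)]) simp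

lemma rel_homotopic_precompose:
  assumes "rel_homotopic Y X B f g" "continuous_map Z Y k" "\<And>a. a \<in> A \<Longrightarrow> k a \<in> B"
  shows "rel_homotopic Z X A (f \<circ> k) (g \<circ> k)"
  unfolding rel_homotopic_def
  by (rule homotopic_with_compose_continuous_map_right[OF assms(1)[unfolded rel_homotopic_def] assms(2)])
     (simp add: assms(3))

text \<open>Joining in the first variable concatenates homotopies; with a one-point space \<open>Y\<close>, or with the
  variables exchanged, it also joins paths and families of paths.\<close>

lemma continuous_map_join_first:
  assumes H: "continuous_map (prod_topology unit_I Y) X H"
    and K: "continuous_map (prod_topology unit_I Y) X K"
    and HK: "\<And>y. y \<in> topspace Y \<Longrightarrow> H (1, y) = K (0, y)"
  shows "continuous_map (prod_topology unit_I Y) X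
    (\<lambda>z. if fst z \<le> 1/2 then H (2 * fst z, snd z) else K (2 * fst z - 1, snd z))"
proof (rule continuous_map_cases_le)
  let ?Z = "prod_topology unit_I Y"
  show fst: "continuous_map ?Z euclideanreal fst"
    using continuous_map_fst continuous_map_in_subtopology by blast
  show "continuous_map (subtopology ?Z {z \<in> topspace ?Z. fst z \<le> 1/2}) X (\<lambda>z. H (2 * fst z, snd z))"
  proof (rule continuous_map_compose[OF _ H, unfolded o_def])
    show "continuous_map (subtopology ?Z {z \<in> topspace ?Z. fst z \<le> 1/2}) ?Z (\<lambda>z. (2 * fst z, snd z))"
      by (intro continuous_map_pairedI continuous_map_into_subtopology continuous_map_real_mult_left
          continuous_map_from_subtopology[OF fst] continuous_map_from_subtopology[OF continuous_map_snd]) auto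
  qed
  show "continuous_map (subtopology ?Z {z \<in> topspace ?Z. 1/2 \<le> fst z}) X (\<lambda>z. K (2 * fst z - 1, snd z))"
  proof (rule continuous_map_compose[OF _ K, unfolded o_def])
    show "continuous_map (subtopology ?Z {z \<in> topspace ?Z. 1/2 \<le> fst z}) ?Z (\<lambda>z. (2 * fst z - 1, snd z))"
      by (intro continuous_map_pairedI continuous_map_into_subtopology continuous_map_diff
          continuous_map_real_mult_left
          continuous_map_from_subtopology[OF fst] continuous_map_from_subtopology[OF continuous_map_snd]) auto
  qed
next
  show "H (2 * fst z, snd z) = K (2 * fst z - 1, snd z)"
    if "z \<in> topspace (prod_topology unit_I Y)" "fst z = 1/2" for z
    unfolding that(2) using that(1) HK[of "snd z"] by auto
qed auto

section \<open>Paths up to homotopy\<close>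

abbreviation path_homotopic :: "'a topology \<Rightarrow> (real \<Rightarrow> 'a) \<Rightarrow> (real \<Rightarrow> 'a) \<Rightarrow> bool" where
  "path_homotopic X \<equiv> rel_homotopic unit_I X {0, 1}"

lemma join_simps [simp]: "(f \<bullet>\<bullet> g) 0 = f 0" "(f \<bullet>\<bullet> g) 1 = g 1"
  by (simp_all add: path_join_def)

lemma rev_simps [simp]: "path_rev f 0 = f 1" "path_rev f 1 = f 0"
  by (simp_all add: path_rev_def)

lemma compose_join: "k \<circ> (f \<bullet>\<bullet> g) = (k \<circ> f) \<bullet>\<bullet> (k \<circ> g)"
  by (auto simp: path_join_def)

lemma compose_rev: "k \<circ> path_rev f = path_rev (k \<circ> f)"
  by (auto simp: path_rev_def)

lemma pathin_join:
  assumes "pathin X f" "pathin X g" "f 1 = g 0"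
  shows "pathin X (f \<bullet>\<bullet> g)"
proof -
  have "continuous_map unit_I X ((\<lambda>z. if fst z \<le> 1/2 then f (2 * fst z) else g (2 * fst z - 1)) \<circ> (\<lambda>t. (t, ())))"
    by (rule continuous_map_compose[OF _ continuous_map_join_first[where Y="discrete_topology {()}"
            and H="f \<circ> fst" and K = "g \<circ> fst", unfolded o_def fst_conv]])
       (use assms in \<open>auto simp: pathin_def continuous_map_pairwise o_def intro: continuous_map_of_fst[THEN iffD2]
          continuous_map_compose[OF continuous_map_fst, unfolded o_def]\<close>)
  then show ?thesis
    by (simp only: pathin_def path_join_def o_def fst_conv)
qed

lemma pathin_rev: "pathin X f \<Longrightarrow> pathin X (path_rev f)"
proof -
  assume "pathin X f"
  moreover have "continuous_map unit_I unit_I (\<lambda>t. 1 - t)"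
    by (auto intro!: continuous_map_into_subtopology continuous_intros)
  ultimately show ?thesis
    unfolding pathin_def path_rev_def by (metis (full_types) continuous_map_compose[unfolded o_def])
qed

lemma path_homotopic_pathin:
  assumes "path_homotopic X f g"
  shows "pathin X f" "pathin X g" "g 0 = f 0" "g 1 = f 1"
  using rel_homotopic_continuous[OF assms] rel_homotopic_on[OF assms] by (auto simp: pathin_def)

lemma path_homotopic_refl: "pathin X f \<Longrightarrow> path_homotopic X f f"
  by (simp add: pathin_def rel_homotopic_refl)

lemma path_homotopic_eqI:
  assumes "pathin X f" "\<And>t. 0 \<le> t \<Longrightarrow> t \<le> 1 \<Longrightarrow> f t = g t"
  shows "path_homotopic X f g"
  by (rule rel_homotopic_eqI) (use assms in \<open>auto simp: pathin_def\<close>)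

lemma path_homotopic_join:
  assumes "path_homotopic X f f'" "path_homotopic X g g'" "f 1 = g 0"
  shows "path_homotopic X (f \<bullet>\<bullet> g) (f' \<bullet>\<bullet> g')"
proof -
  obtain h where h: "continuous_map (prod_topology unit_I unit_I) X h"
    "\<And>y. h (0, y) = f y" "\<And>y. h (1, y) = f' y" "\<And>t b. t \<in> {0..1} \<Longrightarrow> b \<in> {0,1} \<Longrightarrow> h (t, b) = f b"
    using rel_homotopicE[OF assms(1)] by blast
  obtain k where k: "continuous_map (prod_topology unit_I unit_I) X k"
    "\<And>y. k (0, y) = g y" "\<And>y. k (1, y) = g' y" "\<And>t b. t \<in> {0..1} \<Longrightarrow> b \<in> {0,1} \<Longrightarrow> k (t, b) = g b"
    using rel_homotopicE[OF assms(2)] by blast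
  have sw: "continuous_map (prod_topology unit_I unit_I) (prod_topology unit_I unit_I) (\<lambda>z. (snd z, fst z))"
    by (intro continuous_map_pairedI continuous_map_fst continuous_map_snd)
  have "continuous_map (prod_topology unit_I unit_I) X
    (\<lambda>z. if fst z \<le> 1/2 then (h \<circ> (\<lambda>z. (snd z, fst z))) (2 * fst z, snd z)
         else (k \<circ> (\<lambda>z. (snd z, fst z))) (2 * fst z - 1, snd z))"
    by (rule continuous_map_join_first; (rule continuous_map_compose[OF sw])?)
       (use h k assms(3) in auto)
  from continuous_map_compose[OF sw this]
  have "continuous_map (prod_topology unit_I unit_I) X
    (\<lambda>z. ((\<lambda>t. h (fst z, t)) \<bullet>\<bullet> (\<lambda>t. k (fst z, t))) (snd z))"
    by (simp only: o_def path_join_def fst_conv snd_conv)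
  then show ?thesis
    by (rule rel_homotopicI[rotated]) (use h k in \<open>auto simp: path_join_def\<close>)
qed

lemma path_homotopic_rev:
  assumes "path_homotopic X f g"
  shows "path_homotopic X (path_rev f) (path_rev g)"
proof -
  have "continuous_map unit_I unit_I (\<lambda>t. 1 - t)"
    by (auto intro!: continuous_map_into_subtopology continuous_intros)
  from rel_homotopic_precompose[OF assms this, of "{0,1}"] show ?thesis
    by (auto simp: path_rev_def o_def)
qed

text \<open>The unit interval is convex, so two reparametrizations with the same endpoints are homotopic
  by a straight line.\<close>

lemma path_homotopic_reparam:
  assumes f: "pathin X f"
    and \<phi>: "continuous_on {0..1} \<phi>" "\<phi> ` {0..1} \<subseteq> {0..1}"
    and \<psi>: "continuous_on {0..1} \<psi>" "\<psi> ` {0..1} \<subseteq> {0..1}"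
    and ends: "\<phi> 0 = \<psi> 0" "\<phi> 1 = \<psi> 1"
  shows "path_homotopic X (f \<circ> \<phi>) (f \<circ> \<psi>)"
proof (rule rel_homotopicI)
  let ?l = "\<lambda>z::real \<times> real. (1 - fst z) * \<phi> (snd z) + fst z * \<psi> (snd z)"
  have "?l z \<in> {0..1}" if "z \<in> {0..1} \<times> {0..1}" for z
  proof -
    have "\<phi> (snd z) \<in> {0..1}" "\<psi> (snd z) \<in> {0..1}" "fst z \<in> {0..1}"
      using that \<phi>(2) \<psi>(2) by auto
    then show ?thesis
      using convexD_alt[of "{0..1::real}" "\<phi> (snd z)" "\<psi> (snd z)" "fst z"] by simp
  qed
  moreover have "continuous_on ({0..1} \<times> {0..1}) ?l"
    by (intro continuous_intros continuous_on_compose2[OF \<phi>(1)] continuous_on_compose2[OF \<psi>(1)]) auto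
  ultimately have "continuous_map (prod_topology unit_I unit_I) unit_I ?l"
    by (auto simp: continuous_map_in_subtopology simp flip: subtopology_Times)
  then show "continuous_map (prod_topology unit_I unit_I) X (f \<circ> ?l)"
    using f unfolding pathin_def by (rule continuous_map_compose)
qed (use ends in \<open>auto simp: algebra_simps\<close>)

lemma path_homotopic_assoc:
  assumes "pathin X f" "pathin X g" "pathin X h" "f 1 = g 0" "g 1 = h 0"
  shows "path_homotopic X ((f \<bullet>\<bullet> g) \<bullet>\<bullet> h) (f \<bullet>\<bullet> (g \<bullet>\<bullet> h))"
proof -
  \<comment> \<open>the reparametrization has slopes \<open>2\<close>, \<open>1\<close> and \<open>1/2\<close>; being concave, it is the minimum of its linear pieces\<close>
  let ?k = "f \<bullet>\<bullet> (g \<bullet>\<bullet> h)" and ?\<phi> = "\<lambda>t::real. min (2 * t) (min (t + 1/4) ((t + 1) / 2))"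
  have k: "pathin X ?k"
    using assms by (auto intro!: pathin_join)
  have "path_homotopic X (?k \<circ> ?\<phi>) (?k \<circ> (\<lambda>t. t))"
  proof (rule path_homotopic_reparam[OF k])
    show "?\<phi> ` {0..1} \<subseteq> {0..1}" by (auto simp: min_def)
  qed (auto intro!: continuous_intros)
  moreover have "(f \<bullet>\<bullet> g) \<bullet>\<bullet> h = ?k \<circ> ?\<phi>"
  proof
    fix t :: real
    consider "t \<le> 1/4" | "1/4 < t" "t \<le> 1/2" | "1/2 < t" by linarith
    then show "((f \<bullet>\<bullet> g) \<bullet>\<bullet> h) t = (?k \<circ> ?\<phi>) t"
    proof cases
      case 1
      then have "?\<phi> t = 2 * t" by auto
      with 1 show ?thesis by (simp add: path_join_def)
    next
      case 2
      then have "?\<phi> t = t + 1/4" by auto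
      with 2 show ?thesis by (simp add: path_join_def algebra_simps)
    next
      case 3
      then have *: "?\<phi> t = (t + 1) / 2" by (simp add: min_def field_simps)
      from 3 show ?thesis unfolding o_def * by (simp add: path_join_def algebra_simps add_divide_distrib)
    qed
  qed
  ultimately show ?thesis by (simp add: o_def)
qed

lemma path_homotopic_const_left:
  assumes "pathin X f" "f 0 = x"
  shows "path_homotopic X ((\<lambda>_. x) \<bullet>\<bullet> f) f"
proof -
  have "path_homotopic X (f \<circ> (\<lambda>t. max 0 (2 * t - 1))) (f \<circ> (\<lambda>t. t))"
    by (rule path_homotopic_reparam[OF assms(1)]) (auto intro!: continuous_intros)
  moreover have "(\<lambda>_. x) \<bullet>\<bullet> f = f \<circ> (\<lambda>t. max 0 (2 * t - 1))"
    by (rule ext) (use assms(2) in \<open>auto simp: path_join_def max_def not_le order_less_le_trans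
        dest: order_antisym\<close>)
  ultimately show ?thesis by (simp add: o_def)
qed

lemma path_homotopic_const_right:
  assumes "pathin X f" "f 1 = x"
  shows "path_homotopic X (f \<bullet>\<bullet> (\<lambda>_. x)) f"
proof -
  have "path_homotopic X (f \<circ> (\<lambda>t. min (2 * t) 1)) (f \<circ> (\<lambda>t. t))"
    by (rule path_homotopic_reparam[OF assms(1)]) (auto intro!: continuous_intros)
  moreover have "f \<bullet>\<bullet> (\<lambda>_. x) = f \<circ> (\<lambda>t. min (2 * t) 1)"
    by (rule ext) (use assms(2) in \<open>auto simp: path_join_def min_def\<close>)
  ultimately show ?thesis by (simp add: o_def)
qed

lemma path_homotopic_rev_right:
  assumes "pathin X f" "f 0 = x"
  shows "path_homotopic X (f \<bullet>\<bullet> path_rev f) (\<lambda>_. x)"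
proof -
  have "path_homotopic X (f \<circ> (\<lambda>t. min (2 * t) (2 - 2 * t))) (f \<circ> (\<lambda>t. 0))"
    by (rule path_homotopic_reparam[OF assms(1)]) (auto intro!: continuous_intros)
  moreover have "f \<bullet>\<bullet> path_rev f = f \<circ> (\<lambda>t. min (2 * t) (2 - 2 * t))"
    by (rule ext) (auto simp: path_join_def path_rev_def min_def)
  ultimately show ?thesis unfolding assms(2)[symmetric] by (simp only: o_def)
qed

lemma path_rev_rev [simp]: "path_rev (path_rev f) = f"
  by (simp add: path_rev_def)

lemma path_homotopic_rev_left:
  assumes "pathin X f" "f 1 = x"
  shows "path_homotopic X (path_rev f \<bullet>\<bullet> f) (\<lambda>_. x)"
  using path_homotopic_rev_right[OF pathin_rev[OF assms(1)], of x] assms(2) by simp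

section \<open>The fundamental group\<close>

lemma path_class_eq: "path_class X f = {g. path_homotopic X f g}"
  by (simp add: path_class_def rel_homotopic_def)

lemma path_class_eqI: "path_homotopic X f g \<Longrightarrow> path_class X f = path_class X g"
  unfolding path_class_eq
  by (rule Collect_cong) (metis (full_types) rel_homotopic_sym rel_homotopic_trans)

lemma path_class_self: "pathin X f \<Longrightarrow> f \<in> path_class X f"
  by (simp add: path_class_eq path_homotopic_refl)

lemma path_class_eq_iff:
  assumes "pathin X f" shows "path_class X f = path_class X g \<longleftrightarrow> path_homotopic X f g"
proof
  assume "path_class X f = path_class X g"
  then have "f \<in> path_class X g" using path_class_self[OF assms] by simp
  then show "path_homotopic X f g" by (simp add: path_class_eq rel_homotopic_sym)
qed (rule path_class_eqI)

text \<open>Operations on classes are defined as unions over all representatives; this evaluates them.\<close>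

lemma path_class_UN:
  assumes "pathin X f" "\<And>f'. path_homotopic X f f' \<Longrightarrow> F f' = F f"
  shows "(\<Union>f'\<in>path_class X f. F f') = F f"
proof -
  have "(\<Union>f'\<in>path_class X f. F f') = (\<Union>f'\<in>path_class X f. F f)"
    by (intro SUP_cong refl assms(2)) (simp add: path_class_eq)
  then show ?thesis using path_class_self[OF assms(1)] by auto
qed

lemma UN_const:
  assumes "a0 \<in> A" "b0 \<in> B" "\<And>a b. a \<in> A \<Longrightarrow> b \<in> B \<Longrightarrow> F a b = c"
  shows "(\<Union>a\<in>A. \<Union>b\<in>B. F a b) = c"
proof -
  have "(\<Union>a\<in>A. \<Union>b\<in>B. F a b) = (\<Union>a\<in>A. \<Union>b\<in>B. c)"
    by (intro SUP_cong refl assms(3))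
  then show ?thesis using assms(1,2) by auto
qed

lemma fundamental_group_mult:
  assumes "pathin X f" "pathin X g" "f 1 = g 0"
  shows "path_class X f \<otimes>\<^bsub>fundamental_group X x\<^esub> path_class X g = path_class X (f \<bullet>\<bullet> g)"
proof -
  have "(\<Union>f'\<in>path_class X f. \<Union>g'\<in>path_class X g. path_class X (f' \<bullet>\<bullet> g')) =
        (\<Union>f'\<in>path_class X f. path_class X (f' \<bullet>\<bullet> g))"
  proof (rule SUP_cong)
    fix f' assume "f' \<in> path_class X f"
    then have f': "path_homotopic X f f'" by (simp add: path_class_eq)
    show "(\<Union>g'\<in>path_class X g. path_class X (f' \<bullet>\<bullet> g')) = path_class X (f' \<bullet>\<bullet> g)"
      by (rule path_class_UN[OF assms(2)], rule path_class_eqI[OF rel_homotopic_sym],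
          rule path_homotopic_join)
         (use f' assms path_homotopic_pathin[OF f'] in \<open>auto intro: path_homotopic_refl\<close>)
  qed simp
  also have "\<dots> = path_class X (f \<bullet>\<bullet> g)"
    by (rule path_class_UN[OF assms(1)], rule path_class_eqI[OF rel_homotopic_sym],
        rule path_homotopic_join) (use assms in \<open>auto intro: path_homotopic_refl\<close>)
  finally show ?thesis by (simp add: fundamental_group_def)
qed

lemma fundamental_group_carrierI:
  "pathin X f \<Longrightarrow> f 0 = x \<Longrightarrow> f 1 = x \<Longrightarrow> path_class X f \<in> carrier (fundamental_group X x)"
  by (auto simp: fundamental_group_def)

lemma fundamental_group_carrierE:
  assumes "A \<in> carrier (fundamental_group X x)"
  obtains f where "A = path_class X f" "pathin X f" "f 0 = x" "f 1 = x"
  using assms by (auto simp: fundamental_group_def)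

lemma fundamental_group_one: "\<one>\<^bsub>fundamental_group X x\<^esub> = path_class X (\<lambda>_. x)"
  by (simp add: fundamental_group_def)

lemma group_fundamental_group:
  assumes "x \<in> topspace X"
  shows "group (fundamental_group X x)"
proof (rule groupI, goal_cases)
  case (1 A B)
  obtain f where f: "A = path_class X f" "pathin X f" "f 0 = x" "f 1 = x"
    using 1(1) by (rule fundamental_group_carrierE)
  obtain g where g: "B = path_class X g" "pathin X g" "g 0 = x" "g 1 = x"
    using 1(2) by (rule fundamental_group_carrierE)
  show ?case
    using f g by (simp add: fundamental_group_mult fundamental_group_carrierI pathin_join)
next
  case 2
  show ?case unfolding fundamental_group_one by (rule fundamental_group_carrierI) (use assms in auto)
next
  case (3 A B C)
  obtain f where f: "A = path_class X f" "pathin X f" "f 0 = x" "f 1 = x"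
    using 3(1) by (rule fundamental_group_carrierE)
  obtain g where g: "B = path_class X g" "pathin X g" "g 0 = x" "g 1 = x"
    using 3(2) by (rule fundamental_group_carrierE)
  obtain h where h: "C = path_class X h" "pathin X h" "h 0 = x" "h 1 = x"
    using 3(3) by (rule fundamental_group_carrierE)
  show ?case
    using f g h by (simp add: fundamental_group_mult pathin_join path_class_eqI path_homotopic_assoc)
next
  case (4 A)
  then obtain f where f: "A = path_class X f" "pathin X f" "f 0 = x" "f 1 = x"
    by (rule fundamental_group_carrierE)
  then show ?case
    by (simp add: fundamental_group_mult fundamental_group_one assms path_class_eqI
        path_homotopic_const_left)
next
  case (5 A)
  then obtain f where f: "A = path_class X f" "pathin X f" "f 0 = x" "f 1 = x"
    by (rule fundamental_group_carrierE)
  show ?case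
  proof
    show "path_class X (path_rev f) \<in> carrier (fundamental_group X x)"
      using f by (simp add: fundamental_group_carrierI pathin_rev)
    show "path_class X (path_rev f) \<otimes>\<^bsub>fundamental_group X x\<^esub> A = \<one>\<^bsub>fundamental_group X x\<^esub>"
      using f by (simp add: fundamental_group_mult fundamental_group_one pathin_rev path_class_eqI
          path_homotopic_rev_left)
  qed
qed

section \<open>Orbit spaces\<close>

lemma istopology_quotient:
  "istopology (\<lambda>U. U \<subseteq> q ` topspace X \<and> openin X {x \<in> topspace X. q x \<in> U})"
  unfolding istopology_def
proof (intro conjI allI impI)
  fix S T
  assume S: "S \<subseteq> q ` topspace X \<and> openin X {x \<in> topspace X. q x \<in> S}"
    and T: "T \<subseteq> q ` topspace X \<and> openin X {x \<in> topspace X. q x \<in> T}"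
  have "{x \<in> topspace X. q x \<in> S \<inter> T} = {x \<in> topspace X. q x \<in> S} \<inter> {x \<in> topspace X. q x \<in> T}"
    by auto
  then show "openin X {x \<in> topspace X. q x \<in> S \<inter> T}"
    using S T by (simp add: openin_Int)
  show "S \<inter> T \<subseteq> q ` topspace X" using S by blast
next
  fix K
  assume K: "\<forall>S\<in>K. S \<subseteq> q ` topspace X \<and> openin X {x \<in> topspace X. q x \<in> S}"
  have "{x \<in> topspace X. q x \<in> \<Union>K} = (\<Union>S\<in>K. {x \<in> topspace X. q x \<in> S})"
    by auto
  moreover have "openin X (\<Union>S\<in>K. {x \<in> topspace X. q x \<in> S})"
    using K by (intro openin_Union) auto
  ultimately show "openin X {x \<in> topspace X. q x \<in> \<Union>K}"
    by simp
  show "\<Union>K \<subseteq> q ` topspace X" using K by blast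
qed

lemma openin_quotient:
  "openin (quotient_topology X q) U \<longleftrightarrow> U \<subseteq> q ` topspace X \<and> openin X {x \<in> topspace X. q x \<in> U}"
  unfolding quotient_topology_def topology_inverse'[OF istopology_quotient] ..

lemma topspace_quotient [simp]: "topspace (quotient_topology X q) = q ` topspace X"
proof -
  have "{x \<in> topspace X. q x \<in> q ` topspace X} = topspace X" by auto
  then have "openin (quotient_topology X q) (q ` topspace X)"
    by (simp add: openin_quotient)
  then show ?thesis
    by (metis openin_quotient openin_subset openin_topspace subset_antisym)
qed

lemma quotient_map_quotient: "quotient_map X (quotient_topology X q) q"
  by (auto simp: quotient_map_def openin_quotient)

locale continuous_action =
  fixes X :: "'a topology" and G :: "'g monoid" and \<phi> :: "'g \<Rightarrow> 'a \<Rightarrow> 'a"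
  assumes action: "group_action G (topspace X) \<phi>"
    and continuous: "\<And>g. g \<in> carrier G \<Longrightarrow> continuous_map X X (\<phi> g)"
begin

abbreviation quot :: "'a \<Rightarrow> 'a set" where "quot \<equiv> orbit G \<phi>"

abbreviation base :: "'a set topology" where "base \<equiv> orbit_space G X \<phi>"

lemma group_G: "group G"
  using action unfolding group_action_def group_hom_def by blast

lemma act_closed: "g \<in> carrier G \<Longrightarrow> x \<in> topspace X \<Longrightarrow> \<phi> g x \<in> topspace X"
  using group_action.element_image[OF action] by blast

lemma act_mult:
  "x \<in> topspace X \<Longrightarrow> g \<in> carrier G \<Longrightarrow> h \<in> carrier G \<Longrightarrow> \<phi> (g \<otimes>\<^bsub>G\<^esub> h) x = \<phi> g (\<phi> h x)"
  by (rule group_action.composition_rule[OF action])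

lemma act_one: "x \<in> topspace X \<Longrightarrow> \<phi> \<one>\<^bsub>G\<^esub> x = x"
  using group_action.id_eq_one[OF action] by (metis restrict_apply')

lemma act_inv: "x \<in> topspace X \<Longrightarrow> g \<in> carrier G \<Longrightarrow> \<phi> (inv\<^bsub>G\<^esub> g) (\<phi> g x) = x"
  using group_action.orbit_sym_aux[OF action] by blast

lemma act_inv': "x \<in> topspace X \<Longrightarrow> g \<in> carrier G \<Longrightarrow> \<phi> g (\<phi> (inv\<^bsub>G\<^esub> g) x) = x"
  by (metis act_mult act_one group.inv_closed group.r_inv group_G)

lemma quot_eq_iff:
  assumes "x \<in> topspace X" "y \<in> topspace X"
  shows "quot x = quot y \<longleftrightarrow> (\<exists>g\<in>carrier G. y = \<phi> g x)"
proof
  assume "quot x = quot y"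
  then have "y \<in> quot x" using group_action.orbit_refl[OF action assms(2)] by simp
  then show "\<exists>g\<in>carrier G. y = \<phi> g x" by (auto simp: orbit_def)
next
  assume "\<exists>g\<in>carrier G. y = \<phi> g x"
  then obtain g where g: "g \<in> carrier G" "y = \<phi> g x" by blast
  show "quot x = quot y"
  proof (intro Set.set_eqI iffI)
    fix z assume "z \<in> quot x"
    then obtain h where h: "h \<in> carrier G" "z = \<phi> h x" by (auto simp: orbit_def)
    have "z = \<phi> (h \<otimes>\<^bsub>G\<^esub> inv\<^bsub>G\<^esub> g) y"
      using g h assms act_mult act_inv act_closed group.inv_closed[OF group_G] by simp
    then show "z \<in> quot y"
      using g h group_G by (auto simp: orbit_def intro!: exI[of _ "h \<otimes>\<^bsub>G\<^esub> inv\<^bsub>G\<^esub> g"] monoid.m_closed group.is_monoid)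
  next
    fix z assume "z \<in> quot y"
    then obtain h where h: "h \<in> carrier G" "z = \<phi> h y" by (auto simp: orbit_def)
    then show "z \<in> quot x"
      using g assms act_mult[of x h g] group_G
      by (auto simp: orbit_def intro!: exI[of _ "h \<otimes>\<^bsub>G\<^esub> g"] monoid.m_closed group.is_monoid)
  qed
qed

lemma quotE:
  assumes "quot x = quot y" "x \<in> topspace X" "y \<in> topspace X"
  obtains g where "g \<in> carrier G" "y = \<phi> g x"
  using quot_eq_iff[OF assms(2,3)] assms(1) by auto

lemma quot_act [simp]: "x \<in> topspace X \<Longrightarrow> g \<in> carrier G \<Longrightarrow> quot (\<phi> g x) = quot x"
  using quot_eq_iff[of x "\<phi> g x"] act_closed by auto

lemma topspace_base [simp]: "topspace base = quot ` topspace X"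
  by (simp add: orbit_space_def)

lemma quotient_map_quot: "quotient_map X base quot"
  by (simp add: orbit_space_def quotient_map_quotient)

lemma continuous_quot: "continuous_map X base quot"
  by (rule quotient_imp_continuous_map[OF quotient_map_quot])

lemma openin_act:
  assumes "openin X U" "g \<in> carrier G"
  shows "openin X (\<phi> g ` U)"
proof -
  have U: "U \<subseteq> topspace X" using assms(1) by (rule openin_subset)
  have "\<phi> g ` U = {x \<in> topspace X. \<phi> (inv\<^bsub>G\<^esub> g) x \<in> U}" (is "?L = ?R")
  proof (intro Set.set_eqI iffI)
    fix x assume "x \<in> ?L" then show "x \<in> ?R" using U act_inv act_closed assms(2) by auto
  next
    fix x assume x: "x \<in> ?R"
    then have "x = \<phi> g (\<phi> (inv\<^bsub>G\<^esub> g) x)" using act_inv' assms(2) by simp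
    then show "x \<in> ?L" using x by blast
  qed
  moreover have "continuous_map X X (\<phi> (inv\<^bsub>G\<^esub> g))"
    using continuous assms(2) group.inv_closed[OF group_G] by blast
  ultimately show ?thesis using openin_continuous_map_preimage assms(1) by fastforce
qed

text \<open>The saturation of an open set is the union of its translates, so the projection is an open map.\<close>

lemma openin_quot_image:
  assumes "openin X U"
  shows "openin base (quot ` U)"
proof -
  have U: "U \<subseteq> topspace X" using assms by (rule openin_subset)
  have "{x \<in> topspace X. quot x \<in> quot ` U} = (\<Union>g\<in>carrier G. \<phi> g ` U)"
  proof (intro Set.set_eqI iffI)
    fix x assume "x \<in> {x \<in> topspace X. quot x \<in> quot ` U}"
    then obtain u where "u \<in> U" "x \<in> topspace X" "quot u = quot x" by auto
    moreover from this obtain g where "g \<in> carrier G" "x = \<phi> g u"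
      using quotE U by (metis subsetD)
    ultimately show "x \<in> (\<Union>g\<in>carrier G. \<phi> g ` U)" by auto
  next
    fix x assume "x \<in> (\<Union>g\<in>carrier G. \<phi> g ` U)"
    then obtain g u where "g \<in> carrier G" "u \<in> U" "x = \<phi> g u" by auto
    then show "x \<in> {x \<in> topspace X. quot x \<in> quot ` U}" using U act_closed by auto
  qed
  moreover have "openin X (\<Union>g\<in>carrier G. \<phi> g ` U)"
    using openin_act assms by blast
  moreover have "quot ` U \<subseteq> quot ` topspace X" using U by (rule image_mono)
  ultimately show ?thesis
    unfolding orbit_space_def openin_quotient by simp
qed

end

section \<open>Lifting along the projection of a covering action\<close>

locale covering_action = continuous_action +
  assumes covering: "\<And>x. x \<in> topspace X \<Longrightarrow> \<exists>U. openin X U \<and> x \<in> U \<and>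
    (\<forall>g \<in> carrier G. g \<noteq> \<one>\<^bsub>G\<^esub> \<longrightarrow> \<phi> g ` U \<inter> U = {})"
begin

lemma act_free:
  assumes "x \<in> topspace X" "g \<in> carrier G" "\<phi> g x = x"
  shows "g = \<one>\<^bsub>G\<^esub>"
proof (rule ccontr)
  obtain U where "x \<in> U" "\<forall>g \<in> carrier G. g \<noteq> \<one>\<^bsub>G\<^esub> \<longrightarrow> \<phi> g ` U \<inter> U = {}"
    using covering[OF assms(1)] by (elim exE conjE)
  moreover assume "g \<noteq> \<one>\<^bsub>G\<^esub>"
  ultimately have "\<phi> g ` U \<inter> U = {}" using assms(2) by simp
  then show False using \<open>x \<in> U\<close> imageI[OF \<open>x \<in> U\<close>, of "\<phi> g"] unfolding assms(3) by auto
qed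

lemma act_cancel:
  assumes "x \<in> topspace X" "g \<in> carrier G" "h \<in> carrier G" "\<phi> g x = \<phi> h x"
  shows "g = h"
proof -
  interpret G: group G by (rule group_G)
  have "\<phi> (inv\<^bsub>G\<^esub> g \<otimes>\<^bsub>G\<^esub> h) x = \<phi> (inv\<^bsub>G\<^esub> g) (\<phi> g x)"
    using assms(4) by (simp add: act_mult assms(1-3))
  also have "\<dots> = x" by (rule act_inv[OF assms(1,2)])
  finally have "inv\<^bsub>G\<^esub> g \<otimes>\<^bsub>G\<^esub> h = \<one>\<^bsub>G\<^esub>"
    by (intro act_free[OF assms(1)]) (simp_all add: assms(2,3))
  then show ?thesis
    using assms(2,3) G.inv_equality[of "inv\<^bsub>G\<^esub> g" h] by (metis G.inv_closed G.inv_inv)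
qed

text \<open>Near any given point, two lifts differ by one and the same group element. So the
  set where they agree is both open and closed.\<close>

lemma lifts_agree:
  assumes Y: "connected_space Y"
    and f: "continuous_map Y X f" and g: "continuous_map Y X g"
    and fg: "\<And>y. y \<in> topspace Y \<Longrightarrow> quot (f y) = quot (g y)"
    and y0: "y0 \<in> topspace Y" "f y0 = g y0"
    and y: "y \<in> topspace Y"
  shows "f y = g y"
proof -
  let ?E = "{y \<in> topspace Y. f y = g y}"
  have f_in: "f y \<in> topspace X" and g_in: "g y \<in> topspace X" if "y \<in> topspace Y" for y
    using that f g continuous_map_image_subset_topspace by fastforce+
  have "\<exists>N. openin Y N \<and> z \<in> N \<and> (N \<subseteq> ?E \<or> N \<inter> ?E = {})" if z: "z \<in> topspace Y" for z
  proof -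
    obtain U where U: "openin X U" "f z \<in> U"
      "\<And>k. k \<in> carrier G \<Longrightarrow> k \<noteq> \<one>\<^bsub>G\<^esub> \<Longrightarrow> \<phi> k ` U \<inter> U = {}"
      using covering[OF f_in[OF z]] by (elim exE conjE) simp
    obtain k where k: "k \<in> carrier G" "g z = \<phi> k (f z)"
      using quotE[OF fg[OF z] f_in[OF z] g_in[OF z]] .
    let ?N = "{y \<in> topspace Y. f y \<in> U} \<inter> {y \<in> topspace Y. g y \<in> \<phi> k ` U}"
    have "openin Y ?N"
      using f g U openin_act k by (intro openin_Int openin_continuous_map_preimage) auto
    moreover have "z \<in> ?N" using z U k by auto
    moreover have *: "f y = g y \<longleftrightarrow> k = \<one>\<^bsub>G\<^esub>" if y: "y \<in> ?N" for y
    proof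
      assume "f y = g y"
      then have "f y \<in> \<phi> k ` U \<inter> U" using y by simp
      then show "k = \<one>\<^bsub>G\<^esub>" using U(3)[OF k(1)] by auto
    next
      assume k1: "k = \<one>\<^bsub>G\<^esub>"
      have "g y \<in> U"
        using y k1 act_one openin_subset[OF U(1)] by auto
      have "y \<in> topspace Y" using y by simp
      then obtain h where h: "h \<in> carrier G" "g y = \<phi> h (f y)"
        using quotE[OF fg f_in g_in] by metis
      then have "g y \<in> \<phi> h ` U" using y by simp
      then have "h = \<one>\<^bsub>G\<^esub>" using U(3)[OF h(1)] \<open>g y \<in> U\<close> by auto
      then show "f y = g y" using h act_one f_in y by auto
    qed
    moreover have "?N \<subseteq> ?E \<or> ?N \<inter> ?E = {}"
    proof (cases "k = \<one>\<^bsub>G\<^esub>")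
      case True
      have "?N \<subseteq> ?E"
      proof
        fix y assume y: "y \<in> ?N"
        with *[OF y] True show "y \<in> ?E" by simp
      qed
      then show ?thesis ..
    next
      case False
      have "y \<notin> ?E" if "y \<in> ?N" for y using *[OF that] False by simp
      then show ?thesis by auto
    qed
    ultimately show ?thesis by (intro exI[of _ ?N] conjI)
  qed
  note nbhd = this
  have "openin Y ?E"
  proof (subst openin_subopen, intro ballI)
    fix z assume z: "z \<in> ?E"
    then obtain N where "openin Y N" "z \<in> N" "N \<subseteq> ?E \<or> N \<inter> ?E = {}"
      using nbhd[of z] by auto
    then show "\<exists>T. openin Y T \<and> z \<in> T \<and> T \<subseteq> ?E" using z by blast
  qed
  moreover have "openin Y (topspace Y - ?E)"
  proof (subst openin_subopen, intro ballI)
    fix z assume z: "z \<in> topspace Y - ?E"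
    then obtain N where N: "openin Y N" "z \<in> N" "N \<subseteq> ?E \<or> N \<inter> ?E = {}"
      using nbhd[of z] by auto
    then have "N \<subseteq> topspace Y - ?E" using z openin_subset[OF N(1)] by blast
    then show "\<exists>T. openin Y T \<and> z \<in> T \<and> T \<subseteq> topspace Y - ?E" using N by blast
  qed
  ultimately
  have "closedin Y ?E" "openin Y ?E" by (auto simp: closedin_def)
  then have "?E = {} \<or> ?E = topspace Y" using Y unfolding connected_space_clopen_in by metis
  moreover have "y0 \<in> ?E" using y0 by simp
  ultimately have "y \<in> ?E" using y by (metis empty_iff)
  then show ?thesis by simp
qed

lemma path_lifts_agree:
  assumes "pathin X f" "pathin X g" "\<And>t. t \<in> {0..1} \<Longrightarrow> quot (f t) = quot (g t)" "f 0 = g 0"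
    "t \<in> {0..1}"
  shows "f t = g t"
  by (rule lifts_agree[of unit_I f g 0])
     (use assms in \<open>simp_all add: pathin_def connected_space_subtopology\<close>)

text \<open>The projection is open, and it is injective on a neighbourhood as in the definition of a covering
  action and on the translates of this neighbourhood. The sections are the inverses of these restrictions.\<close>

lemma local_section:
  assumes x: "x \<in> topspace X"
  obtains V where "openin base V" "quot x \<in> V"
    "\<And>y. y \<in> topspace X \<Longrightarrow> quot y \<in> V \<Longrightarrow>
      \<exists>W s. openin X W \<and> y \<in> W \<and> continuous_map (subtopology base V) X s \<and>
        (\<forall>b\<in>V. quot (s b) = b) \<and> (\<forall>w\<in>W. s (quot w) = w)"
proof -
  obtain U where U: "openin X U" "x \<in> U"
    "\<And>k. k \<in> carrier G \<Longrightarrow> k \<noteq> \<one>\<^bsub>G\<^esub> \<Longrightarrow> \<phi> k ` U \<inter> U = {}"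
    using covering[OF x] by (elim exE conjE) simp
  have UX: "U \<subseteq> topspace X" by (rule openin_subset[OF U(1)])
  have inj: "inj_on quot U"
  proof (rule inj_onI)
    fix u v assume uv: "u \<in> U" "v \<in> U" "quot u = quot v"
    obtain k where k: "k \<in> carrier G" "v = \<phi> k u"
      by (rule quotE[OF uv(3)]) (use UX uv in auto)
    then have "v \<in> \<phi> k ` U \<inter> U" using uv by simp
    then have "k = \<one>\<^bsub>G\<^esub>" using U(3)[OF k(1)] by auto
    then show "u = v" using k act_one UX uv by auto
  qed
  show thesis
  proof
    show "openin base (quot ` U)" by (rule openin_quot_image[OF U(1)])
    show "quot x \<in> quot ` U" using U by blast
    fix y assume y: "y \<in> topspace X" "quot y \<in> quot ` U"
    then obtain u where u0: "u \<in> U" "quot u = quot y" by auto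
    obtain k where "k \<in> carrier G" "y = \<phi> k u"
      by (rule quotE[OF u0(2)]) (use UX u0 y in auto)
    note u = u0(1) this
    let ?W = "\<phi> k ` U"
    have W: "openin X ?W" using openin_act U(1) u(2) .
    have "quot (\<phi> k v) = quot v" if "v \<in> U" for v using UX u(2) that by auto
    then have qW: "quot ` ?W = quot ` U" by (simp add: image_image)
    have injW: "inj_on quot ?W"
    proof (rule inj_onI)
      fix v w assume "v \<in> ?W" "w \<in> ?W" "quot v = quot w"
      then obtain v' w' where *: "v' \<in> U" "w' \<in> U" "v = \<phi> k v'" "w = \<phi> k w'" "quot v = quot w"
        by auto
      then have "quot v' = quot w'" using UX u(2) by (metis quot_act subsetD)
      then show "v = w" using inj_onD[OF inj _ *(1,2)] * by simp
    qed
    define s where "s = inv_into ?W quot"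
    have s: "s b \<in> ?W" "quot (s b) = b" if "b \<in> quot ` U" for b
      using that qW by (metis inv_into_into s_def, metis f_inv_into_f s_def)
    have sw: "s (quot w) = w" if "w \<in> ?W" for w
      using injW that by (simp add: s_def)
    have "continuous_map (subtopology base (quot ` U)) X s"
      unfolding continuous_map_def
    proof (intro conjI allI impI)
      show "s \<in> topspace (subtopology base (quot ` U)) \<rightarrow> topspace X"
        using s(1) openin_subset[OF W] by auto
      fix O' assume O': "openin X O'"
      have "{b \<in> topspace (subtopology base (quot ` U)). s b \<in> O'} = quot ` (O' \<inter> ?W)"
      proof (intro Set.set_eqI iffI)
        fix b assume "b \<in> {b \<in> topspace (subtopology base (quot ` U)). s b \<in> O'}"
        then show "b \<in> quot ` (O' \<inter> ?W)" using s[of b] by (metis (no_types, lifting) IntD2 IntI image_eqI mem_Collect_eq topspace_subtopology)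
      next
        fix b assume "b \<in> quot ` (O' \<inter> ?W)"
        then obtain w where w: "w \<in> O'" "w \<in> ?W" "b = quot w" by blast
        then have "b \<in> quot ` U" using qW by blast
        moreover have "s b \<in> O'" using w sw by simp
        ultimately show "b \<in> {b \<in> topspace (subtopology base (quot ` U)). s b \<in> O'}" using UX by auto
      qed
      moreover have "openin base (quot ` (O' \<inter> ?W))"
        using openin_quot_image openin_Int O' W by blast
      moreover have "quot ` (O' \<inter> ?W) \<subseteq> quot ` U" using qW by blast
      ultimately show "openin (subtopology base (quot ` U)) {b \<in> topspace (subtopology base (quot ` U)). s b \<in> O'}"
        unfolding openin_subtopology by (intro exI[of _ "quot ` (O' \<inter> ?W)"]) auto
    qed
    moreover have "y \<in> ?W" using u by simp
    ultimately show "\<exists>W s. openin X W \<and> y \<in> W \<and> continuous_map (subtopology base (quot ` U)) X s \<and>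
        (\<forall>b\<in>quot ` U. quot (s b) = b) \<and> (\<forall>w\<in>W. s (quot w) = w)"
      by (intro exI[of _ ?W] exI[of _ s] conjI ballI W) (simp_all only: s(2) sw)
  qed
qed

text \<open>For a fixed point \<open>y\<close> of the parameter space, a lift near \<open>y\<close> extends in the time
  direction over every interval: this is local by the sections above, and Bolzano's bisection
  argument makes it global.\<close>

lemma lift_near_point:
  assumes F: "continuous_map (prod_topology unit_I Y) base F"
    and y: "y \<in> topspace Y"
    and f0: "continuous_map Y X f0" "\<And>y. y \<in> topspace Y \<Longrightarrow> quot (f0 y) = F (0, y)"
  obtains N h where "openin Y N" "y \<in> N"
    "continuous_map (prod_topology unit_I (subtopology Y N)) X h"
    "\<And>z. z \<in> N \<Longrightarrow> h (0, z) = f0 z"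
    "\<And>t z. t \<in> {0..1} \<Longrightarrow> z \<in> N \<Longrightarrow> quot (h (t, z)) = F (t, z)"
proof -
  let ?E = "prod_topology euclideanreal Y"
  \<comment> \<open>\<open>L\<close>: the lift \<open>h\<close> over the times from \<open>a\<close> to \<open>b\<close> continues \<open>g\<close>, on a possibly smaller neighbourhood \<open>N'\<close>;
    \<open>P\<close>: every lift \<open>g\<close> at time \<open>a\<close> can be continued up to \<open>b\<close>\<close>
  define L where "L a b N g N' h \<longleftrightarrow> openin Y N' \<and> y \<in> N' \<and> N' \<subseteq> N \<and>
        continuous_map (subtopology ?E ({a..b} \<times> N')) X h \<and>
        (\<forall>z\<in>N'. h (a, z) = g z) \<and> (\<forall>t\<in>{a..b}. \<forall>z\<in>N'. quot (h (t, z)) = F (t, z))"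
    for a b :: real and N g N' h
  define P where "P a b \<longleftrightarrow> (0 \<le> a \<and> a \<le> b \<and> b \<le> 1 \<longrightarrow> (\<forall>N g. openin Y N \<and> y \<in> N \<and>
      continuous_map (subtopology Y N) X g \<and> (\<forall>z\<in>N. quot (g z) = F (a, z)) \<longrightarrow>
      (\<exists>N' h. L a b N g N' h)))"
    for a b :: real
  have F': "continuous_map (subtopology ?E ({0..1} \<times> topspace Y)) base F"
    using F by (simp add: subtopology_Times)
  have "P 0 1"
  proof (rule Bolzano)
    show "(0::real) \<le> 1" by simp
  next
    fix a b c :: real
    assume Pab: "P a b" and Pbc: "P b c" and ab: "a \<le> b" and bc: "b \<le> c"
    show "P a c"
      unfolding P_def
    proof (intro impI allI, elim conjE)
      fix N g
      assume a: "0 \<le> a" and c: "c \<le> 1" and N: "openin Y N" "y \<in> N"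
        and g: "continuous_map (subtopology Y N) X g" "\<forall>z\<in>N. quot (g z) = F (a, z)"
      obtain N1 h1 where "L a b N g N1 h1"
        using Pab[unfolded P_def, rule_format, of N g] a ab bc c N g by auto
      then have 1: "openin Y N1" "y \<in> N1" "N1 \<subseteq> N"
        "continuous_map (subtopology ?E ({a..b} \<times> N1)) X h1"
        "\<And>z. z \<in> N1 \<Longrightarrow> h1 (a, z) = g z"
        "\<And>t z. t \<in> {a..b} \<Longrightarrow> z \<in> N1 \<Longrightarrow> quot (h1 (t, z)) = F (t, z)"
        by (auto simp: L_def)
      have "continuous_map (subtopology Y N1) (subtopology ?E ({a..b} \<times> N1)) (\<lambda>z. (b, z))"
        using ab by (auto simp: continuous_map_in_subtopology continuous_map_pairedI)
      from continuous_map_compose[OF this 1(4)]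
      have "continuous_map (subtopology Y N1) X (\<lambda>z. h1 (b, z))" by (simp add: o_def)
      then obtain N2 h2 where "L b c N1 (\<lambda>z. h1 (b, z)) N2 h2"
        using Pbc[unfolded P_def, rule_format, of N1 "\<lambda>z. h1 (b, z)"] a ab bc c 1 by auto
      then have 2: "openin Y N2" "y \<in> N2" "N2 \<subseteq> N1"
        "continuous_map (subtopology ?E ({b..c} \<times> N2)) X h2"
        "\<And>z. z \<in> N2 \<Longrightarrow> h2 (b, z) = h1 (b, z)"
        "\<And>t z. t \<in> {b..c} \<Longrightarrow> z \<in> N2 \<Longrightarrow> quot (h2 (t, z)) = F (t, z)"
        by (auto simp: L_def)
      let ?h = "\<lambda>z. if fst z \<le> b then h1 z else h2 z"
      let ?Z = "subtopology ?E ({a..c} \<times> N2)"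
      have "continuous_map ?Z X ?h"
      proof (rule continuous_map_cases_le)
        show "continuous_map ?Z euclideanreal fst"
          by (rule continuous_map_from_subtopology[OF continuous_map_fst])
        show "continuous_map (subtopology ?Z {z \<in> topspace ?Z. fst z \<le> b}) X h1"
          unfolding subtopology_subtopology
          by (rule continuous_map_from_subtopology_mono[OF 1(4)]) (use 2(3) in auto)
        show "continuous_map (subtopology ?Z {z \<in> topspace ?Z. b \<le> fst z}) X h2"
          unfolding subtopology_subtopology
          by (rule continuous_map_from_subtopology_mono[OF 2(4)]) auto
      qed (use 2(5) in auto)
      then have "L a c N g N2 ?h"
        unfolding L_def using 1 2 ab bc by auto
      then show "\<exists>N' h. L a c N g N' h" by blast
    qed
  next
    fix x :: real
    assume x: "0 \<le> x" "x \<le> 1"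
    have "F (x, y) \<in> topspace base"
      using F x y continuous_map_image_subset_topspace by fastforce
    then obtain x0 where x0: "x0 \<in> topspace X" "F (x, y) = quot x0" by auto
    obtain V where V: "openin base V" "quot x0 \<in> V"
      and sect: "\<And>y. y \<in> topspace X \<Longrightarrow> quot y \<in> V \<Longrightarrow>
        \<exists>W s. openin X W \<and> y \<in> W \<and> continuous_map (subtopology base V) X s \<and>
          (\<forall>b\<in>V. quot (s b) = b) \<and> (\<forall>w\<in>W. s (quot w) = w)"
      using local_section[OF x0(1)] by metis
    have op: "openin (prod_topology unit_I Y) {z \<in> topspace (prod_topology unit_I Y). F z \<in> V}"
      by (rule openin_continuous_map_preimage[OF F V(1)])
    have "(x, y) \<in> {z \<in> topspace (prod_topology unit_I Y). F z \<in> V}"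
      using x y x0 V by auto
    from op[unfolded openin_prod_topology_alt, rule_format, OF this]
    obtain T N0 where T: "openin unit_I T" "openin Y N0" "x \<in> T" "y \<in> N0"
      "T \<times> N0 \<subseteq> {z \<in> topspace (prod_topology unit_I Y). F z \<in> V}"
      by (elim exE conjE)
    obtain T' where T': "open T'" "T = {0..1} \<inter> T'"
      using T(1) unfolding openin_open by (elim exE conjE)
    then obtain d where d: "d > 0" "ball x d \<subseteq> T'"
      using T(3) openE by blast
    have "P a b" if ab: "a \<le> x" "x \<le> b" "b - a < d" for a b
      unfolding P_def
    proof (intro impI allI, elim conjE)
      fix N g
      assume a: "0 \<le> a" "a \<le> b" and b: "b \<le> 1" and N: "openin Y N" "y \<in> N"
        and g: "continuous_map (subtopology Y N) X g" "\<forall>z\<in>N. quot (g z) = F (a, z)"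
      have abT: "{a..b} \<subseteq> T"
        using ab a b d(2) T'(2) by (auto simp: dist_real_def subset_iff)
      have FV: "F (t, z) \<in> V" if "t \<in> {a..b}" "z \<in> N0" for t z
        using that abT T(5) by blast
      have gy: "g y \<in> topspace X"
        using g(1) N y continuous_map_image_subset_topspace by fastforce
      have "quot (g y) \<in> V" using FV[of a y] g(2) N T(4) a by auto
      then obtain W s where W: "openin X W" "g y \<in> W" "continuous_map (subtopology base V) X s"
          "\<forall>b\<in>V. quot (s b) = b" "\<forall>w\<in>W. s (quot w) = w"
        using sect[OF gy] by blast
      define N' where "N' = N0 \<inter> (N \<inter> {z \<in> topspace (subtopology Y N). g z \<in> W})"
      have "openin (subtopology Y N) {z \<in> topspace (subtopology Y N). g z \<in> W}"
        by (rule openin_continuous_map_preimage[OF g(1) W(1)])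
      then have "openin Y (N \<inter> {z \<in> topspace (subtopology Y N). g z \<in> W})"
        using N(1) openin_Int openin_trans_full by blast
      then have "openin Y N'" unfolding N'_def using T(2) by blast
      moreover have "y \<in> N'" unfolding N'_def using T(4) N y W by auto
      moreover have "N' \<subseteq> N" unfolding N'_def by blast
      moreover have "continuous_map (subtopology ?E ({a..b} \<times> N')) X (\<lambda>z. s (F z))"
      proof (rule continuous_map_compose[OF _ W(3), unfolded o_def])
        have "continuous_map (subtopology ?E ({a..b} \<times> N')) base F"
          by (rule continuous_map_from_subtopology_mono[OF F'])
             (use a b openin_subset[OF T(2)] in \<open>auto simp: N'_def\<close>)
        then show "continuous_map (subtopology ?E ({a..b} \<times> N')) (subtopology base V) F"
          unfolding continuous_map_in_subtopology using FV by (auto simp: N'_def)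
      qed
      moreover have "s (F (a, z)) = g z" if "z \<in> N'" for z
        using that g(2) W(5) by (force simp: N'_def)
      moreover have "quot (s (F (t, z))) = F (t, z)" if "t \<in> {a..b}" "z \<in> N'" for t z
        using FV[of t z] W(4) that by (simp add: N'_def)
      ultimately have "L a b N g N' (\<lambda>z. s (F z))"
        unfolding L_def by blast
      then show "\<exists>N' h. L a b N g N' h" by blast
    qed
    then show "\<exists>d>0. \<forall>a b. a \<le> x \<and> x \<le> b \<and> b - a < d \<longrightarrow> P a b"
      using d(1) by blast
  qed
  from this[unfolded P_def, rule_format, of "topspace Y" f0]
  obtain N h where "L 0 1 (topspace Y) f0 N h"
    using y f0 by auto
  then show thesis
    by (intro that[of N h]) (auto simp: L_def subtopology_Times)
qed

text \<open>By uniqueness of lifts of the paths \<open>t \<mapsto> F (t, y)\<close> the local lifts agree on overlaps.\<close>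

lemma homotopy_lifting:
  assumes F: "continuous_map (prod_topology unit_I Y) base F"
    and f0: "continuous_map Y X f0" "\<And>y. y \<in> topspace Y \<Longrightarrow> quot (f0 y) = F (0, y)"
  obtains h where "continuous_map (prod_topology unit_I Y) X h"
    "\<And>y. y \<in> topspace Y \<Longrightarrow> h (0, y) = f0 y"
    "\<And>t y. t \<in> {0..1} \<Longrightarrow> y \<in> topspace Y \<Longrightarrow> quot (h (t, y)) = F (t, y)"
proof -
  define L where "L y N h \<longleftrightarrow> openin Y N \<and> y \<in> N \<and>
      continuous_map (prod_topology unit_I (subtopology Y N)) X h \<and>
      (\<forall>z\<in>N. h (0, z) = f0 z) \<and> (\<forall>t\<in>{0..1}. \<forall>z\<in>N. quot (h (t, z)) = F (t, z))"
    for y N h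
  have "\<exists>N h. L y N h" if y: "y \<in> topspace Y" for y
    by (rule lift_near_point[OF F y f0]) (unfold L_def, blast+)
  then obtain N h where L: "\<And>y. y \<in> topspace Y \<Longrightarrow> L y (N y) (h y)"
    by metis
  have N: "openin Y (N y)" "y \<in> N y" and h: "continuous_map (prod_topology unit_I (subtopology Y (N y))) X (h y)"
    and h0: "\<And>z. z \<in> N y \<Longrightarrow> h y (0, z) = f0 z"
    and hF: "\<And>t z. t \<in> {0..1} \<Longrightarrow> z \<in> N y \<Longrightarrow> quot (h y (t, z)) = F (t, z)"
    if "y \<in> topspace Y" for y
    using L[OF that] unfolding L_def by simp_all
  have path: "continuous_map unit_I X (\<lambda>t. h y (t, z))" if "y \<in> topspace Y" "z \<in> N y" for y z
  proof -
    have "z \<in> topspace (subtopology Y (N y))"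
      using openin_subset[OF N(1)[OF that(1)]] that(2) by auto
    then have "continuous_map unit_I (prod_topology unit_I (subtopology Y (N y))) (\<lambda>t. (t, z))"
      by (intro continuous_map_pairedI) auto
    from continuous_map_compose[OF this h[OF that(1)]] show ?thesis by (simp add: o_def)
  qed
  have agree: "h y (t, z) = h y' (t, z)"
    if "y \<in> topspace Y" "y' \<in> topspace Y" "z \<in> N y" "z \<in> N y'" "t \<in> {0..1}" for y y' z t
  proof -
    have "quot (h y (s, z)) = quot (h y' (s, z))" if "s \<in> {0..1}" for s
      using that hF \<open>y \<in> topspace Y\<close> \<open>y' \<in> topspace Y\<close> \<open>z \<in> N y\<close> \<open>z \<in> N y'\<close> by simp
    moreover have "h y (0, z) = h y' (0, z)" using that h0 by simp
    ultimately show ?thesis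
      using path_lifts_agree[of "\<lambda>t. h y (t, z)" "\<lambda>t. h y' (t, z)" t] path that
      by (simp add: pathin_def)
  qed
  have "continuous_map (prod_topology unit_I Y) X (\<lambda>z. h (snd z) z)"
  proof (rule pasting_lemma[where I = "topspace Y" and T = "\<lambda>y. {0..1} \<times> N y" and f = h])
    fix y assume y: "y \<in> topspace Y"
    have "openin unit_I {0..1}" using openin_topspace[of unit_I] by simp
    then show "openin (prod_topology unit_I Y) ({0..1} \<times> N y)"
      using N(1)[OF y] by (simp add: openin_prod_Times_iff)
    show "continuous_map (subtopology (prod_topology unit_I Y) ({0..1} \<times> N y)) X (h y)"
      using h[OF y] by (simp add: subtopology_Times subtopology_subtopology)
  next
    fix y y' x
    assume *: "y \<in> topspace Y" "y' \<in> topspace Y"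
      "x \<in> topspace (prod_topology unit_I Y) \<inter> {0..1} \<times> N y \<inter> {0..1} \<times> N y'"
    then show "h y x = h y' x" using agree[of y y' "snd x" "fst x"] by auto
  next
    fix x assume x: "x \<in> topspace (prod_topology unit_I Y)"
    then show "\<exists>j. j \<in> topspace Y \<and> x \<in> {0..1} \<times> N j \<and> h (snd x) x = h j x"
      using N(2)[of "snd x"] by (intro exI[of _ "snd x"]) (auto simp: mem_Times_iff)
  qed
  then show thesis
    by (rule that[of "\<lambda>z. h (snd z) z"]) (use h0 hF N in simp_all)
qed

text \<open>The lift of a homotopy is stationary on \<open>B\<close>, because constant paths have constant lifts, and it
  ends at \<open>g\<close> by uniqueness of lifts on the connected space \<open>Y\<close>.\<close>

lemma rel_homotopic_lift:
  assumes f: "continuous_map Y X f" and g: "continuous_map Y X g"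
    and Y: "connected_space Y" and B: "B \<subseteq> topspace Y" "b0 \<in> B" "f b0 = g b0"
    and hom: "rel_homotopic Y base B (quot \<circ> f) (quot \<circ> g)"
  shows "rel_homotopic Y X B f g"
proof -
  obtain F where F: "continuous_map (prod_topology unit_I Y) base F"
    "\<And>y. F (0, y) = quot (f y)" "\<And>y. F (1, y) = quot (g y)"
    "\<And>t b. t \<in> {0..1} \<Longrightarrow> b \<in> B \<Longrightarrow> F (t, b) = quot (f b)"
    using rel_homotopicE[OF hom] unfolding o_def by blast
  obtain h where h: "continuous_map (prod_topology unit_I Y) X h"
    "\<And>y. y \<in> topspace Y \<Longrightarrow> h (0, y) = f y"
    "\<And>t y. t \<in> {0..1} \<Longrightarrow> y \<in> topspace Y \<Longrightarrow> quot (h (t, y)) = F (t, y)"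
    using homotopy_lifting[OF F(1) f] F(2) by metis
  have hB: "h (t, b) = f b" if t: "t \<in> {0..1}" and b: "b \<in> B" for t b
  proof -
    have bY: "b \<in> topspace Y" using b B by blast
    then have "continuous_map unit_I (prod_topology unit_I Y) (\<lambda>t. (t, b))"
      by (intro continuous_map_pairedI) auto
    from continuous_map_compose[OF this h(1)] have "pathin X (\<lambda>t. h (t, b))"
      by (simp add: o_def pathin_def)
    moreover have "pathin X (\<lambda>t. f b)"
      using f bY continuous_map_image_subset_topspace by fastforce
    ultimately show ?thesis
      using path_lifts_agree[of "\<lambda>t. h (t, b)" "\<lambda>t. f b" t] t b F(4) h(2,3) bY by simp
  qed
  have h1: "h (1, y) = g y" if "y \<in> topspace Y" for y
  proof -
    have "continuous_map Y (prod_topology unit_I Y) (\<lambda>y. (1, y))"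
      by (intro continuous_map_pairedI) auto
    from continuous_map_compose[OF this h(1)] have c: "continuous_map Y X (\<lambda>y. h (1, y))"
      by (simp add: o_def)
    have "b0 \<in> topspace Y" using B by blast
    then show ?thesis
      using lifts_agree[OF Y c g _ _ _ that, of b0] h(3) F(3) hB[of 1 b0] B(2,3) by simp
  qed
  show ?thesis
    by (rule rel_homotopicI[OF B(1) h(1)]) (use h(2) h1 hB in auto)
qed

text \<open>A map from a contractible space is lifted by lifting a contraction to a point.\<close>

lemma lift_contractible:
  assumes F: "continuous_map Y base F"
    and c: "continuous_map (prod_topology unit_I Y) Y c"
      "\<And>y. y \<in> topspace Y \<Longrightarrow> c (0, y) = y0" "\<And>y. y \<in> topspace Y \<Longrightarrow> c (1, y) = y"
      "\<And>t. t \<in> {0..1} \<Longrightarrow> c (t, y0) = y0"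
    and y0: "y0 \<in> topspace Y" "x0 \<in> topspace X" "quot x0 = F y0"
  obtains f where "continuous_map Y X f" "f y0 = x0" "\<And>y. y \<in> topspace Y \<Longrightarrow> quot (f y) = F y"
proof -
  have Fc: "continuous_map (prod_topology unit_I Y) base (F \<circ> c)"
    using c(1) F by (rule continuous_map_compose)
  obtain h where h: "continuous_map (prod_topology unit_I Y) X h"
    "\<And>y. y \<in> topspace Y \<Longrightarrow> h (0, y) = x0"
    "\<And>t y. t \<in> {0..1} \<Longrightarrow> y \<in> topspace Y \<Longrightarrow> quot (h (t, y)) = (F \<circ> c) (t, y)"
    by (rule homotopy_lifting[OF Fc, of "\<lambda>_. x0"]) (use y0 c(2) in auto)
  have "h (t, y0) = x0" if t: "t \<in> {0..1}" for t
  proof -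
    have "continuous_map unit_I (prod_topology unit_I Y) (\<lambda>t. (t, y0))"
      using y0 by (intro continuous_map_pairedI) auto
    from continuous_map_compose[OF this h(1)] have "pathin X (\<lambda>t. h (t, y0))"
      by (simp add: o_def pathin_def)
    then show ?thesis
      using path_lifts_agree[of "\<lambda>t. h (t, y0)" "\<lambda>t. x0" t] t y0 h(2,3) c(4) by simp
  qed
  moreover have "continuous_map Y (prod_topology unit_I Y) (\<lambda>y. (1, y))"
    by (intro continuous_map_pairedI) auto
  from continuous_map_compose[OF this h(1)] have "continuous_map Y X (\<lambda>y. h (1, y))"
    by (simp add: o_def)
  ultimately show thesis
    by (intro that[of "\<lambda>y. h (1, y)"]) (use h(3) c(3) in auto)
qed

end

section \<open>Ordered configurations of little intervals\<close>

definition ivs_list :: "nat \<Rightarrow> intervals \<Rightarrow> (real \<times> real) list" where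
  "ivs_list k c = map c [0..<k]"

definition list_ivs :: "(real \<times> real) list \<Rightarrow> intervals" where
  "list_ivs l = (\<lambda>i\<in>{..<length l}. l ! i)"

text \<open>The composition of the little intervals operad on lists of intervals: each interval of \<open>es\<close> is
  replaced by a scaled copy of a list. In this form associativity is an induction on lists.\<close>

definition graft :: "(real \<times> real) list \<Rightarrow> (real \<times> real) list list \<Rightarrow> (real \<times> real) list" where
  "graft es ls = concat (map2 (\<lambda>e. map (emb_comp e)) es ls)"

lemma length_ivs_list [simp]: "length (ivs_list k c) = k"
  by (simp add: ivs_list_def)

lemma ivs_list_of_list: "length l = k \<Longrightarrow> ivs_list k (list_ivs l) = l"
  by (auto simp: ivs_list_def list_ivs_def intro: nth_equalityI)

lemma list_ivs_of_ivs: "c \<in> extensional {..<k} \<Longrightarrow> list_ivs (ivs_list k c) = c"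
  by (auto simp: ivs_list_def list_ivs_def fun_eq_iff extensional_def)

lemma list_ivs_extensional: "length l = k \<Longrightarrow> list_ivs l \<in> extensional {..<k}"
  by (auto simp: list_ivs_def)

lemma graft_alt:
  assumes "length ds = length ms"
  shows "graft (ivs_list (length ms) c) (map2 ivs_list ms ds) =
    concat (map (\<lambda>i. map (\<lambda>j. emb_comp (c i) ((ds ! i) j)) [0..<ms ! i]) [0..<length ms])"
  unfolding graft_def
  by (rule arg_cong[where f = concat], rule nth_equalityI)
     (use assms in \<open>auto simp: ivs_list_def\<close>)

lemma length_graft:
  assumes "length es = length ls"
  shows "length (graft es ls) = sum_list (map length ls)"
  using assms unfolding graft_def by (induction es ls rule: list_induct2) auto

lemma little_intervals_comp_list:
  assumes "length ds = length ms"
  shows "little_intervals_comp ms c ds =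
    list_ivs (graft (ivs_list (length ms) c) (map2 ivs_list ms ds))"
proof -
  have "map length (map2 ivs_list ms ds) = ms"
    using assms by (auto intro: nth_equalityI)
  then have "length (graft (ivs_list (length ms) c) (map2 ivs_list ms ds)) = sum_list ms"
    using assms by (subst length_graft) auto
  then show ?thesis
    unfolding little_intervals_comp_def list_ivs_def graft_alt[OF assms] by simp
qed

lemma emb_comp_assoc: "emb_comp (emb_comp a b) c = emb_comp a (emb_comp b c)"
  by (simp add: emb_comp_def affine_emb_def algebra_simps)

lemma graft_Nil [simp]: "graft [] ls = []" "graft es [] = []"
  by (simp_all add: graft_def)

lemma graft_Cons [simp]: "graft (e # es) (l # ls) = map (emb_comp e) l @ graft es ls"
  by (simp add: graft_def)

lemma graft_append:
  "length xs = length as \<Longrightarrow> graft (xs @ ys) (as @ bs) = graft xs as @ graft ys bs"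
  by (simp add: graft_def)

lemma graft_map_emb:
  "graft (map (emb_comp e) es) ls = map (emb_comp e) (graft es ls)"
proof (induction es arbitrary: ls)
  case (Cons a es)
  then show ?case by (cases ls) (auto simp: emb_comp_assoc)
qed simp

lemma graft_assoc:
  assumes "length es = length ls" "length ls = length lss"
    "list_all2 (\<lambda>l ls. length l = length ls) ls lss"
  shows "graft (graft es ls) (concat lss) = graft es (map2 graft ls lss)"
  using assms
  by (induction es ls lss rule: list_induct3) (auto simp: graft_append graft_map_emb)

definition ordered_list :: "(real \<times> real) list \<Rightarrow> bool" where
  "ordered_list l \<longleftrightarrow> sorted_wrt (\<lambda>a b. snd a \<le> fst b) l \<and>
     (\<forall>a\<in>set l. 0 \<le> fst a \<and> fst a < snd a \<and> snd a \<le> 1)"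

text \<open>The increasing configurations are easier to work with than the path component of the
  standard configuration. They contain the standard configurations, are closed
  under composition and form a convex set, which therefore lies in that component.\<close>

definition ordered_intervals :: "nat \<Rightarrow> intervals set" where
  "ordered_intervals k = {c \<in> extensional {..<k}. ordered_list (ivs_list k c)}"

lemma ordered_intervals_iff:
  "c \<in> ordered_intervals k \<longleftrightarrow> c \<in> extensional {..<k} \<and>
     (\<forall>i<k. 0 \<le> fst (c i) \<and> fst (c i) < snd (c i) \<and> snd (c i) \<le> 1) \<and>
     (\<forall>i j. i < j \<longrightarrow> j < k \<longrightarrow> snd (c i) \<le> fst (c j))"
  unfolding ordered_intervals_def ordered_list_def
  by (auto simp: ivs_list_def sorted_wrt_iff_nth_less)

lemma emb_comp_bounds:
  assumes "fst e < snd e" "0 \<le> fst a" "fst a < snd a" "snd a \<le> 1"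
  shows "fst e \<le> fst (emb_comp e a)" "fst (emb_comp e a) < snd (emb_comp e a)"
    "snd (emb_comp e a) \<le> snd e"
proof -
  have "0 \<le> (snd e - fst e) * fst a" "(snd e - fst e) * fst a < (snd e - fst e) * snd a"
    "(snd e - fst e) * snd a \<le> snd e - fst e"
    using assms by (intro mult_nonneg_nonneg mult_strict_left_mono mult_left_le; simp)+
  then show "fst e \<le> fst (emb_comp e a)" "fst (emb_comp e a) < snd (emb_comp e a)"
    "snd (emb_comp e a) \<le> snd e"
    unfolding emb_comp_def affine_emb_def fst_conv snd_conv by linarith+
qed

lemma ordered_list_graft:
  assumes "length es = length ls" "ordered_list es" "\<forall>l\<in>set ls. ordered_list l"
  shows "ordered_list (graft es ls)"
proof -
  \<comment> \<open>the second part, for the tail of \<open>es\<close>, shows that the first block lies to the left of all others\<close>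
  have "ordered_list (graft es ls) \<and> (\<forall>a\<in>set (graft es ls). \<exists>e\<in>set es. fst e \<le> fst a)"
    using assms
  proof (induction es ls rule: list_induct2)
    case (Cons e es l ls)
    have e: "0 \<le> fst e" "fst e < snd e" "snd e \<le> 1"
      and es: "ordered_list es" "\<And>e'. e' \<in> set es \<Longrightarrow> snd e \<le> fst e'"
      using Cons.prems(1) by (auto simp: ordered_list_def)
    have l: "ordered_list l" using Cons.prems(2) by simp
    have IH: "ordered_list (graft es ls)" "\<And>a. a \<in> set (graft es ls) \<Longrightarrow> \<exists>e\<in>set es. fst e \<le> fst a"
      using Cons.IH es Cons.prems(2) by auto
    have b: "fst e \<le> fst (emb_comp e a)" "fst (emb_comp e a) < snd (emb_comp e a)"
      "snd (emb_comp e a) \<le> snd e" if "a \<in> set l" for a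
      using emb_comp_bounds[OF e(2), of a] l that by (auto simp: ordered_list_def)
    have "sorted_wrt (\<lambda>a b. snd a \<le> fst b) (map (emb_comp e) l)"
      unfolding sorted_wrt_map
    proof (rule sorted_wrt_mono_rel[of l "\<lambda>a b. snd a \<le> fst b"])
      fix a b :: "real \<times> real" assume "snd a \<le> fst b"
      then have "(snd e - fst e) * snd a \<le> (snd e - fst e) * fst b"
        using e by (intro mult_left_mono) auto
      then show "snd (emb_comp e a) \<le> fst (emb_comp e b)"
        by (simp add: emb_comp_def affine_emb_def)
    qed (use l in \<open>auto simp: ordered_list_def\<close>)
    moreover have "snd (emb_comp e a) \<le> fst a'" if a: "a \<in> set l" "a' \<in> set (graft es ls)" for a a'
    proof -
      obtain e' where "e' \<in> set es" "fst e' \<le> fst a'" using IH(2)[OF a(2)] by auto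
      then show ?thesis using b(3)[OF a(1)] es(2)[of e'] by linarith
    qed
    ultimately have "sorted_wrt (\<lambda>a b. snd a \<le> fst b) (graft (e # es) (l # ls))"
      using IH(1) by (simp add: ordered_list_def sorted_wrt_append)
    moreover have "0 \<le> fst a \<and> fst a < snd a \<and> snd a \<le> 1" if a: "a \<in> set (graft (e # es) (l # ls))" for a
    proof (cases "a \<in> set (graft es ls)")
      case False
      then obtain a' where "a' \<in> set l" "a = emb_comp e a'" using a by (auto simp del: split_paired_Ex)
      then show ?thesis using b(1)[of a'] b(2)[of a'] b(3)[of a'] e by auto
    qed (use IH(1) in \<open>simp add: ordered_list_def\<close>)
    ultimately have "ordered_list (graft (e # es) (l # ls))"
      unfolding ordered_list_def by blast
    moreover have "\<forall>a\<in>set (graft (e # es) (l # ls)). \<exists>e'\<in>set (e # es). fst e' \<le> fst a"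
      using IH(2) b(1) by auto
    ultimately show ?case by blast
  qed (simp add: ordered_list_def)
  then show ?thesis by blast
qed

lemma ordered_intervals_comp:
  assumes "c \<in> ordered_intervals (length ms)" "length ds = length ms"
    "\<And>i. i < length ms \<Longrightarrow> ds ! i \<in> ordered_intervals (ms ! i)"
  shows "little_intervals_comp ms c ds \<in> ordered_intervals (sum_list ms)"
proof -
  let ?g = "graft (ivs_list (length ms) c) (map2 ivs_list ms ds)"
  have "map length (map2 ivs_list ms ds) = ms"
    using assms(2) by (auto intro: nth_equalityI)
  then have len: "length ?g = sum_list ms"
    using assms(2) by (subst length_graft) auto
  have "ordered_list ?g"
  proof (rule ordered_list_graft)
    show "\<forall>l\<in>set (map2 ivs_list ms ds). ordered_list l"
      using assms(2,3) by (auto simp: set_zip ordered_intervals_def)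
  qed (use assms in \<open>auto simp: ordered_intervals_def\<close>)
  then show ?thesis
    unfolding ordered_intervals_def little_intervals_comp_list[OF assms(2)]
    using len by (simp add: ivs_list_of_list list_ivs_extensional)
qed

lemma standard_intervals_ordered: "standard_intervals k \<in> ordered_intervals k"
  unfolding ordered_intervals_iff
proof (intro conjI allI impI)
  fix i j assume "i < j" "j < k"
  then show "snd (standard_intervals k i) \<le> fst (standard_intervals k j)"
    by (simp add: standard_intervals_def divide_right_mono)
qed (auto simp: standard_intervals_def divide_strict_right_mono)

lemma ordered_intervals_subset: "ordered_intervals k \<subseteq> little_intervals k"
proof
  fix c assume c: "c \<in> ordered_intervals k"
  have "{fst (c i)<..<snd (c i)} \<inter> {fst (c j)<..<snd (c j)} = {}"
    if "i < k" "j < k" "i \<noteq> j" for i j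
  proof -
    consider "i < j" | "j < i" using \<open>i \<noteq> j\<close> by linarith
    then have "snd (c i) \<le> fst (c j) \<or> snd (c j) \<le> fst (c i)"
      using c that unfolding ordered_intervals_iff by metis
    then show ?thesis by auto
  qed
  then show "c \<in> little_intervals k"
    using c unfolding ordered_intervals_iff little_intervals_def by (auto simp: PiE_def)
qed

lemma ordered_intervals_segment:
  assumes "u \<in> ordered_intervals k" "v \<in> ordered_intervals k" "0 \<le> t" "t \<le> 1"
  shows "interval_segment k u v t \<in> ordered_intervals k"
  unfolding ordered_intervals_iff
proof (intro conjI allI impI)
  have conv: "(1 - t) * a + t * b \<le> (1 - t) * a' + t * b'" if "a \<le> a'" "b \<le> b'" for a b a' b'
    using that assms(3,4) by (intro add_mono mult_left_mono) auto
  have convs: "(1 - t) * a + t * b < (1 - t) * a' + t * b'" if "a < a'" "b < b'" for a b a' b'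
  proof (cases "t = 0")
    case False
    then show ?thesis
      using that assms(3,4) by (intro add_le_less_mono mult_left_mono mult_strict_left_mono) auto
  qed (use that in simp)
  fix i assume i: "i < k"
  have u: "0 \<le> fst (u i)" "fst (u i) < snd (u i)" "snd (u i) \<le> 1"
    and v: "0 \<le> fst (v i)" "fst (v i) < snd (v i)" "snd (v i) \<le> 1"
    using assms(1,2) i unfolding ordered_intervals_iff by auto
  show "0 \<le> fst (interval_segment k u v t i)"
    using i conv[of 0 _ 0] u v by (simp add: interval_segment_def)
  show "fst (interval_segment k u v t i) < snd (interval_segment k u v t i)"
    using i convs u v by (simp add: interval_segment_def)
  show "snd (interval_segment k u v t i) \<le> 1"
    using i conv[of _ 1 _ 1] u v by (simp add: interval_segment_def)
next
  have conv: "(1 - t) * a + t * b \<le> (1 - t) * a' + t * b'" if "a \<le> a'" "b \<le> b'" for a b a' b'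
    using that assms(3,4) by (intro add_mono mult_left_mono) auto
  fix i j assume "i < j" "j < k"
  then show "snd (interval_segment k u v t i) \<le> fst (interval_segment k u v t j)"
    using assms(1,2) conv unfolding ordered_intervals_iff by (simp add: interval_segment_def)
qed (simp add: interval_segment_def)

lemma segment_same: "u \<in> ordered_intervals k \<Longrightarrow> interval_segment k u u t = u"
  by (auto simp: interval_segment_def ordered_intervals_iff extensional_def fun_eq_iff
      simp flip: scaleR_left_distrib)

definition ordered_space :: "nat \<Rightarrow> intervals topology" where
  "ordered_space k = subtopology (product_topology (\<lambda>_. euclidean) {..<k}) (ordered_intervals k)"

lemma topspace_ordered_space [simp]: "topspace (ordered_space k) = ordered_intervals k"
  by (auto simp: ordered_space_def ordered_intervals_iff PiE_def)

lemma continuous_map_ordered_space: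
  "continuous_map Y (ordered_space k) f \<longleftrightarrow>
     (\<forall>y\<in>topspace Y. f y \<in> ordered_intervals k) \<and> (\<forall>i<k. continuous_map Y euclidean (\<lambda>y. f y i))"
proof -
  have "f y \<in> extensional {..<k}" if "f y \<in> ordered_intervals k" for y
    using that by (simp add: ordered_intervals_iff)
  then show ?thesis
    unfolding ordered_space_def continuous_map_in_subtopology continuous_map_componentwise
    by (auto simp: Pi_iff image_subset_iff)
qed

text \<open>Ordered configurations form a convex set, so that a straight line is a homotopy.\<close>

lemma ordered_space_path_homotopic:
  assumes \<phi>: "pathin (ordered_space k) \<phi>" and \<psi>: "pathin (ordered_space k) \<psi>"
    and ends: "\<phi> 0 = \<psi> 0" "\<phi> 1 = \<psi> 1"
  shows "path_homotopic (ordered_space k) \<phi> \<psi>"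
proof (rule rel_homotopicI)
  let ?h = "\<lambda>z. interval_segment k (\<phi> (snd z)) (\<psi> (snd z)) (fst z)"
  have in_O: "\<phi> s \<in> ordered_intervals k" "\<psi> s \<in> ordered_intervals k" if "s \<in> {0..1}" for s
    using \<phi> \<psi> that by (auto simp: pathin_def continuous_map_ordered_space)
  show "continuous_map (prod_topology unit_I unit_I) (ordered_space k) ?h"
    unfolding continuous_map_ordered_space
  proof (intro conjI ballI allI impI)
    show "?h z \<in> ordered_intervals k" if "z \<in> topspace (prod_topology unit_I unit_I)" for z
      using that in_O by (intro ordered_intervals_segment) auto
    fix i assume i: "i < k"
    have "continuous_on {0..1} (\<lambda>s. \<phi> s i)" "continuous_on {0..1} (\<lambda>s. \<psi> s i)"
      using \<phi> \<psi> i by (auto simp: pathin_def continuous_map_ordered_space)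
    then have "continuous_on ({0..1} \<times> {0..1}) (\<lambda>z. (1 - fst z) *\<^sub>R \<phi> (snd z) i + fst z *\<^sub>R \<psi> (snd z) i)"
      by (intro continuous_intros continuous_on_compose2[of "{0..1}" "\<lambda>s. \<phi> s i" _ snd]
          continuous_on_compose2[of "{0..1}" "\<lambda>s. \<psi> s i" _ snd]) auto
    then show "continuous_map (prod_topology unit_I unit_I) euclidean (\<lambda>z. ?h z i)"
      using i by (simp add: interval_segment_def flip: subtopology_Times)
  qed
  show "?h (0, s) = \<phi> s" "?h (1, s) = \<psi> s" if "s \<in> topspace unit_I" for s
    using in_O[of s] that by (auto simp: interval_segment_def ordered_intervals_iff extensional_def fun_eq_iff)
  show "?h (t, b) = \<phi> b" if "t \<in> {0..1}" "b \<in> {0, 1}" for t b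
    using that ends in_O[of b] segment_same[of "\<phi> b" k t] by auto
qed simp

lemma pathin_interval_segment:
  assumes "u \<in> ordered_intervals k" "v \<in> ordered_intervals k"
  shows "pathin (ordered_space k) (interval_segment k u v)"
  unfolding pathin_def continuous_map_ordered_space
proof (intro conjI ballI allI impI)
  fix i assume "i < k"
  then show "continuous_map unit_I euclidean (\<lambda>y. interval_segment k u v y i)"
    by (auto simp: interval_segment_def intro!: continuous_intros)
qed (use assms ordered_intervals_segment in auto)

lemma interval_segment_ends [simp]:
  assumes "u \<in> ordered_intervals k" "v \<in> ordered_intervals k"
  shows "interval_segment k u v 0 = u" "interval_segment k u v 1 = v"
  using assms by (auto simp: interval_segment_def ordered_intervals_iff extensional_def fun_eq_iff)

text \<open>The position \<open>(i, j)\<close> is the same for all configurations; hence each coordinate of the composite is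
  a polynomial in the coordinates of the arguments.\<close>

lemma little_intervals_comp_nth:
  assumes "x < sum_list ms"
  shows "\<exists>i j. i < length ms \<and> j < ms ! i \<and>
    (\<forall>c ds. little_intervals_comp ms c ds x = emb_comp (c i) ((ds ! i) j))"
proof -
  let ?I = "concat (map (\<lambda>i. map (\<lambda>j. (i, j)) [0..<ms ! i]) [0..<length ms])"
  obtain i j where ij: "?I ! x = (i, j)" by fastforce
  have "map ((!) ms) [0..<length ms] = ms" by (rule map_nth)
  then have len: "length ?I = sum_list ms"
    by (simp add: length_concat o_def)
  then have "(i, j) \<in> set ?I" using assms ij nth_mem[of x ?I] by simp
  then have "i < length ms" "j < ms ! i" by auto
  moreover have "little_intervals_comp ms c ds x = emb_comp (c i) ((ds ! i) j)" for c ds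
  proof -
    have "concat (map (\<lambda>i. map (\<lambda>j. emb_comp (c i) ((ds ! i) j)) [0..<ms ! i]) [0..<length ms]) =
      map (\<lambda>(i, j). emb_comp (c i) ((ds ! i) j)) ?I"
      by (simp add: map_concat o_def)
    then show ?thesis using assms ij len by (simp add: little_intervals_comp_def)
  qed
  ultimately show ?thesis by blast
qed

lemma pathin_little_intervals_comp:
  assumes "pathin (ordered_space (length ms)) c" "length ds = length ms"
    "\<And>i. i < length ms \<Longrightarrow> pathin (ordered_space (ms ! i)) (ds ! i)"
  shows "pathin (ordered_space (sum_list ms)) (\<lambda>t. little_intervals_comp ms (c t) (map (\<lambda>d. d t) ds))"
  unfolding pathin_def continuous_map_ordered_space
proof (intro conjI ballI allI impI)
  show "little_intervals_comp ms (c t) (map (\<lambda>d. d t) ds) \<in> ordered_intervals (sum_list ms)"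
    if "t \<in> topspace unit_I" for t
    by (rule ordered_intervals_comp)
       (use assms that in \<open>auto simp: pathin_def continuous_map_ordered_space\<close>)
  fix x assume "x < sum_list ms"
  then obtain i j where ij: "i < length ms" "j < ms ! i"
    "\<And>c ds. little_intervals_comp ms c ds x = emb_comp (c i) ((ds ! i) j)"
    using little_intervals_comp_nth by blast
  have "continuous_on {0..1} (\<lambda>t. c t i)" "continuous_on {0..1} (\<lambda>t. (ds ! i) t j)"
    using assms(1) assms(3)[OF ij(1)] ij(1,2) by (auto simp: pathin_def continuous_map_ordered_space)
  then show "continuous_map unit_I euclidean (\<lambda>t. little_intervals_comp ms (c t) (map (\<lambda>d. d t) ds) x)"
    using ij(1) assms(2) unfolding ij(3)
    by (auto simp: emb_comp_def affine_emb_def intro!: continuous_intros)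
qed

lemma emb_comp_unit [simp]: "emb_comp (0, 1) e = e" "emb_comp e (0, 1) = e"
  by (simp_all add: emb_comp_def affine_emb_def)

lemma graft_units: "graft es (replicate (length es) [(0, 1)]) = es"
  by (induction es) auto

lemma standard_intervals_1: "ivs_list 1 (standard_intervals 1) = [(0, 1)]"
  by (simp add: ivs_list_def standard_intervals_def)

lemma list_ivs_standard: "list_ivs (ivs_list n (standard_intervals n)) = standard_intervals n"
  by (rule list_ivs_of_ivs) (simp add: standard_intervals_def)

lemma little_intervals_comp_units:
  "little_intervals_comp (replicate n 1) (standard_intervals n) (map standard_intervals (replicate n 1))
    = standard_intervals n"
proof -
  have *: "map2 ivs_list (replicate n 1) (map standard_intervals (replicate n 1)) = replicate n [(0, 1)]"
    using standard_intervals_1 by (auto intro!: nth_equalityI)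
  show ?thesis
    using graft_units[of "ivs_list n (standard_intervals n)"]
    by (subst little_intervals_comp_list, simp)
       (simp only: * length_replicate length_ivs_list list_ivs_standard)
qed

lemma little_intervals_comp_unit:
  "little_intervals_comp [n] (standard_intervals 1) [standard_intervals n] = standard_intervals n"
proof -
  have "graft (ivs_list (length [n]) (standard_intervals 1)) (map2 ivs_list [n] [standard_intervals n])
      = ivs_list n (standard_intervals n)"
    using standard_intervals_1 by (simp add: map_idI)
  then show ?thesis
    by (subst little_intervals_comp_list, simp) (simp only: list_ivs_standard)
qed

text \<open>This makes the two paths of linear pieces that \<open>\<delta>_assoc\<close> compares end at the same point.\<close>

lemma little_intervals_comp_assoc:
  "little_intervals_comp (concat nss)
     (little_intervals_comp (map length nss) (standard_intervals (length nss))
        (map standard_intervals (map length nss)))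
     (map standard_intervals (concat nss)) =
   little_intervals_comp (map sum_list nss) (standard_intervals (length nss))
     (map (\<lambda>ns. little_intervals_comp ns (standard_intervals (length ns)) (map standard_intervals ns)) nss)"
proof -
  let ?s = "\<lambda>n. ivs_list n (standard_intervals n)"
  have s: "map2 ivs_list ns (map standard_intervals ns) = map ?s ns" for ns
    by (auto intro: nth_equalityI)
  have *: "little_intervals_comp ns (standard_intervals (length ns)) (map standard_intervals ns) =
      list_ivs (graft (?s (length ns)) (map ?s ns))" for ns
    by (simp add: little_intervals_comp_list s)
  have len: "length (graft (?s (length ns)) (map ?s ns)) = sum_list ns" for ns
    by (subst length_graft) (auto simp: o_def)
  have g: "ivs_list (sum_list ns) (little_intervals_comp ns (standard_intervals (length ns)) (map standard_intervals ns)) =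
      graft (?s (length ns)) (map ?s ns)" for ns
    unfolding * by (rule ivs_list_of_list) (rule len)
  have l: "length (concat nss) = sum_list (map length nss)" by (simp add: length_concat)
  have g2: "map2 ivs_list (map sum_list nss) (map (\<lambda>ns. little_intervals_comp ns (standard_intervals (length ns)) (map standard_intervals ns)) nss)
      = map2 graft (map ?s (map length nss)) (map (map ?s) nss)"
    by (rule nth_equalityI) (auto simp: g)
  have "graft (graft (?s (length nss)) (map ?s (map length nss))) (concat (map (map ?s) nss)) =
      graft (?s (length nss)) (map2 graft (map ?s (map length nss)) (map (map ?s) nss))"
    by (rule graft_assoc) (auto simp: list_all2_conv_all_nth)
  moreover have "ivs_list (length (concat nss)) (little_intervals_comp (map length nss)
      (standard_intervals (length nss)) (map standard_intervals (map length nss))) =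
      graft (?s (length nss)) (map ?s (map length nss))"
    using g[of "map length nss"] unfolding l length_map .
  moreover have "little_intervals_comp (concat nss) c (map standard_intervals (concat nss)) =
      list_ivs (graft (ivs_list (length (concat nss)) c) (concat (map (map ?s) nss)))" for c
    by (subst little_intervals_comp_list, simp) (simp only: s, simp only: map_concat)
  moreover have "little_intervals_comp (map sum_list nss) (standard_intervals (length nss))
      (map (\<lambda>ns. little_intervals_comp ns (standard_intervals (length ns)) (map standard_intervals ns)) nss) =
      list_ivs (graft (?s (length nss)) (map2 graft (map ?s (map length nss)) (map (map ?s) nss)))"
    by (subst little_intervals_comp_list, simp) (simp only: g2 length_map)
  ultimately show ?thesis by (simp only:)
qed

section \<open>Permuting lists and lists of blocks\<close>

abbreviation perm_inv :: "(nat \<Rightarrow> nat) \<Rightarrow> nat \<Rightarrow> nat" where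
  "perm_inv \<sigma> \<equiv> inv_into UNIV \<sigma>"

lemma length_invperm [simp]: "length (invperm \<sigma> xs) = length xs"
  by (simp add: invperm_def permute_list_def)

lemma invperm_nth: "i < length xs \<Longrightarrow> invperm \<sigma> xs ! i = xs ! perm_inv \<sigma> i"
  by (simp add: invperm_def permute_list_def)

lemma invperm_id [simp]: "invperm id xs = xs"
  by (simp add: invperm_def)

lemma invperm_nth_perm:
  assumes "\<sigma> permutes {..<length xs}" "i < length xs"
  shows "invperm \<sigma> xs ! \<sigma> i = xs ! i"
proof -
  have "\<sigma> i < length xs" using assms permutes_in_image by fastforce
  then show ?thesis using assms(1) by (simp add: invperm_nth permutes_inverses)
qed

lemma inv_perm_less: "\<sigma> permutes {..<n} \<Longrightarrow> i < n \<Longrightarrow> perm_inv \<sigma> i < n"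
  using permutes_in_image[OF permutes_inv, of \<sigma> "{..<n}" i] by simp

lemma perm_less: "\<sigma> permutes {..<n} \<Longrightarrow> i < n \<Longrightarrow> \<sigma> i < n"
  using permutes_in_image[of \<sigma> "{..<n}" i] by simp

lemma sum_list_invperm:
  fixes ms :: "nat list"
  assumes "\<sigma> permutes {..<length ms}"
  shows "sum_list (invperm \<sigma> ms) = sum_list ms"
  unfolding invperm_def
  using mset_permute_list[OF permutes_inv[OF assms]] by (metis sum_mset_sum_list)

lemma invperm_invperm:
  assumes "\<sigma> permutes {..<length xs}" "\<tau> permutes {..<length xs}"
  shows "invperm \<tau> (invperm \<sigma> xs) = invperm (\<tau> \<circ> \<sigma>) xs"
proof (rule nth_equalityI)
  fix i assume i: "i < length (invperm \<tau> (invperm \<sigma> xs))"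
  have "perm_inv (\<tau> \<circ> \<sigma>) = perm_inv \<sigma> \<circ> perm_inv \<tau>"
    using assms by (intro o_inv_distrib permutes_bij)
  then show "invperm \<tau> (invperm \<sigma> xs) ! i = invperm (\<tau> \<circ> \<sigma>) xs ! i"
    using i inv_perm_less[OF assms(2), of i] by (simp add: invperm_nth)
qed simp

lemma map_invperm:
  assumes "\<sigma> permutes {..<length xs}"
  shows "map f (invperm \<sigma> xs) = invperm \<sigma> (map f xs)"
  using inv_perm_less[OF assms] by (auto simp: invperm_nth intro: nth_equalityI)

lemma map2_invperm:
  assumes "\<sigma> permutes {..<length xs}" "length ys = length xs"
  shows "map2 f (invperm \<sigma> xs) (invperm \<sigma> ys) = invperm \<sigma> (map2 f xs ys)"
  using inv_perm_less[OF assms(1)] assms(2) by (auto simp: invperm_nth intro: nth_equalityI)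

lemma nth_concat:
  "i < length xss \<Longrightarrow> j < length (xss ! i) \<Longrightarrow>
    concat xss ! (sum_list (map length (take i xss)) + j) = xss ! i ! j"
proof (induction xss arbitrary: i)
  case (Cons xs xss)
  then show ?case
    by (cases i) (auto simp: nth_append add.assoc)
qed simp

lemma block_position:
  fixes ms :: "nat list"
  assumes "x < sum_list ms" "i = (LEAST i. x < sum_list (take (Suc i) ms))"
  shows "i < length ms" "sum_list (take i ms) \<le> x" "x - sum_list (take i ms) < ms ! i"
proof -
  have ms: "ms \<noteq> []" using assms(1) by auto
  then have ex: "x < sum_list (take (Suc (length ms - 1)) ms)" using assms(1) by simp
  have less: "x < sum_list (take (Suc i) ms)"
    unfolding assms(2) by (rule LeastI[of "\<lambda>i. x < sum_list (take (Suc i) ms)", OF ex])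
  have "i \<le> length ms - 1" unfolding assms(2) by (rule Least_le[of "\<lambda>i. x < sum_list (take (Suc i) ms)", OF ex])
  then show i: "i < length ms" using ms by (cases ms) auto
  show le: "sum_list (take i ms) \<le> x"
  proof (cases i)
    case (Suc i')
    then have "\<not> x < sum_list (take (Suc i') ms)"
      using not_less_Least[of i' "\<lambda>i. x < sum_list (take (Suc i) ms)"] assms(2) by simp
    then show ?thesis using Suc by simp
  qed simp
  show "x - sum_list (take i ms) < ms ! i"
    using less le i by (simp add: take_Suc_conv_app_nth)
qed

text \<open>The permutation \<^const>\<open>sym_comp\<close> moves the blocks by the outer permutation and the entries of
  each block by its own permutation. This matches the arities on both sides of the associativity law.\<close>

lemma invperm_concat:
  assumes \<sigma>: "\<sigma> permutes {..<length xss}"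
    and \<tau>: "length \<tau>s = length xss" "\<And>i. i < length xss \<Longrightarrow> \<tau>s ! i permutes {..<length (xss ! i)}"
    and \<pi>: "sym_comp (map length xss) \<sigma> \<tau>s permutes {..<length (concat xss)}"
  shows "invperm (sym_comp (map length xss) \<sigma> \<tau>s) (concat xss) =
    concat (invperm \<sigma> (map2 invperm \<tau>s xss))"
proof -
  let ?ms = "map length xss"
  let ?\<pi> = "sym_comp ?ms \<sigma> \<tau>s"
  let ?zss = "invperm \<sigma> (map2 invperm \<tau>s xss)"
  have len_z: "length (?zss ! q) = length (xss ! perm_inv \<sigma> q)" if "q < length xss" for q
    using that inv_perm_less[OF \<sigma> that] \<tau>(1) by (simp add: invperm_nth)
  have mlz: "map length ?zss = invperm \<sigma> ?ms"
    using \<tau>(1) len_z inv_perm_less[OF \<sigma>] by (auto simp: invperm_nth intro!: nth_equalityI)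
  have len: "length (concat ?zss) = length (concat xss)"
    using sum_list_invperm[of \<sigma> ?ms] \<sigma> mlz by (simp add: length_concat)
  have main: "concat ?zss ! ?\<pi> x = concat xss ! x" if x: "x < length (concat xss)" for x
  proof -
    define i where "i = (LEAST i. x < sum_list (take (Suc i) ?ms))"
    define j where "j = x - sum_list (take i ?ms)"
    have x': "x < sum_list ?ms" using x by (simp add: length_concat)
    note b = block_position[OF x' i_def]
    have i: "i < length xss" and j: "j < length (xss ! i)" and xij: "x = sum_list (map length (take i xss)) + j"
      using b by (auto simp: j_def take_map)
    have "\<sigma> i < length xss" by (rule perm_less[OF \<sigma> i])
    have "(\<Sum>l | l < length ?ms \<and> \<sigma> l < \<sigma> i. ?ms ! l) = (\<Sum>q<\<sigma> i. length (?zss ! q))"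
    proof (rule sum.reindex_bij_witness[of _ "perm_inv \<sigma>" \<sigma>])
      fix q assume q: "q \<in> {..<\<sigma> i}"
      then show "perm_inv \<sigma> q \<in> {l. l < length ?ms \<and> \<sigma> l < \<sigma> i}" "\<sigma> (perm_inv \<sigma> q) = q"
        using \<open>\<sigma> i < length xss\<close> inv_perm_less[OF \<sigma>, of q] permutes_inverses[OF \<sigma>] by auto
    qed (use permutes_inverses[OF \<sigma>] perm_less[OF \<sigma>] len_z in auto)
    also have "\<dots> = sum_list (map length (take (\<sigma> i) ?zss))"
      using \<open>\<sigma> i < length xss\<close> \<tau>(1) by (simp add: sum_list_sum_nth atLeast0LessThan min_def)
    finally have "?\<pi> x = sum_list (map length (take (\<sigma> i) ?zss)) + (\<tau>s ! i) j"
      using x' unfolding sym_comp_def Let_def i_def[symmetric] j_def[symmetric] by simp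
    moreover have z: "?zss ! \<sigma> i = invperm (\<tau>s ! i) (xss ! i)"
      using invperm_nth_perm[of \<sigma> "map2 invperm \<tau>s xss" i] \<sigma> \<tau>(1) i by simp
    moreover have "concat ?zss ! (sum_list (map length (take (\<sigma> i) ?zss)) + (\<tau>s ! i) j) = ?zss ! \<sigma> i ! (\<tau>s ! i) j"
      by (rule nth_concat) (use z perm_less[OF \<tau>(2)[OF i] j] \<open>\<sigma> i < length xss\<close> \<tau>(1) in auto)
    ultimately have "concat ?zss ! ?\<pi> x = xss ! i ! j"
      using invperm_nth_perm[OF \<tau>(2)[OF i] j] by simp
    then show ?thesis using nth_concat[OF i j] xij by simp
  qed
  show ?thesis
  proof (rule nth_equalityI)
    fix y assume "y < length (invperm ?\<pi> (concat xss))"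
    then have y: "y < length (concat xss)" by simp
    show "invperm ?\<pi> (concat xss) ! y = concat ?zss ! y"
      using main[of "perm_inv ?\<pi> y"] inv_perm_less[OF \<pi> y] permutes_inverses[OF \<pi>] y
      by (simp add: invperm_nth)
  qed (use len in simp)
qed

section \<open>Lists of elements\<close>

lemma listset_iff: "xs \<in> listset As \<longleftrightarrow> length xs = length As \<and> (\<forall>i<length As. xs ! i \<in> As ! i)"
proof (induction As arbitrary: xs)
  case (Cons A As)
  show ?case
    by (cases xs) (auto simp: Cons set_Cons_def nth_Cons less_Suc_eq_0_disj split: nat.splits)
qed simp

lemma ElemLists_iff:
  "bs \<in> ElemLists C ms \<longleftrightarrow> length bs = length ms \<and> (\<forall>i<length ms. bs ! i \<in> Elems C (ms ! i))"
  by (auto simp: ElemLists_def listset_iff)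

lemma discrete_operad_simps [simp]:
  "Elems (discrete_operad G) n = carrier (Grp G n)" "opcomp (discrete_operad G) = gcomp G"
  "opunit (discrete_operad G) = \<one>\<^bsub>Grp G 1\<^esub>"
  by (simp_all add: discrete_operad_def)

lemma ElemLists_concat:
  assumes "list_all2 (\<lambda>cs ns. cs \<in> ElemLists C ns) css nss"
  shows "concat css \<in> ElemLists C (concat nss)"
proof -
  have app: "xs @ ys \<in> ElemLists C (ms @ ns)" if "xs \<in> ElemLists C ms" "ys \<in> ElemLists C ns" for xs ys ms ns
    using that unfolding ElemLists_iff
    by (auto simp: nth_append)
  show ?thesis
    using assms by (induction rule: list_all2_induct) (auto simp: app ElemLists_iff[of "[]"])
qed

lemma ElemLists_invperm:
  assumes "\<sigma> permutes {..<length ms}" "bs \<in> ElemLists C ms"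
  shows "invperm \<sigma> bs \<in> ElemLists C (invperm \<sigma> ms)"
  using assms inv_perm_less[OF assms(1)] unfolding ElemLists_iff by (auto simp: invperm_nth)

section \<open>Change of basepoint for maps of cubes\<close>

lemma continuous_map_cube:
  "continuous_map Y (unit_cube l) f \<longleftrightarrow>
     (\<forall>y\<in>topspace Y. f y \<in> extensional {..<l}) \<and>
     (\<forall>i<l. continuous_map Y euclideanreal (\<lambda>y. f y i) \<and> (\<forall>y\<in>topspace Y. f y i \<in> {0..1}))"
  unfolding unit_cube_def continuous_map_componentwise continuous_map_in_subtopology
  by (auto simp: image_subset_iff Pi_iff)

lemma topspace_cube: "topspace (unit_cube l) = {..<l} \<rightarrow>\<^sub>E {0..1}"
  by (simp add: unit_cube_def)

lemma cube_coord:
  assumes "x \<in> topspace (unit_cube l)"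
  shows "x \<in> extensional {..<l}" "i < l \<Longrightarrow> 0 \<le> x i" "i < l \<Longrightarrow> x i \<le> 1"
  using assms by (auto simp: topspace_cube PiE_def Pi_iff)

lemma cube_boundary_subset: "cube_boundary l \<subseteq> topspace (unit_cube l)"
  by (auto simp: cube_boundary_def)

lemma continuous_map_cube_coord:
  "i < l \<Longrightarrow> continuous_map (unit_cube l) euclideanreal (\<lambda>x. x i)"
  using continuous_map_cube[of "unit_cube l" l "\<lambda>x. x"] by simp

lemma continuous_map_Max:
  assumes "finite I" "I \<noteq> {}" "\<And>i. i \<in> I \<Longrightarrow> continuous_map Y euclideanreal (f i)"
  shows "continuous_map Y euclideanreal (\<lambda>y. Max ((\<lambda>i. f i y) ` I))"
  using assms
proof (induction rule: finite_ne_induct)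
  case (insert i I)
  then have "continuous_map Y euclideanreal (\<lambda>y. max (f i y) (Max ((\<lambda>i. f i y) ` I)))"
    by (intro continuous_map_real_max) auto
  then show ?case using insert by (simp add: Max_insert)
qed simp

text \<open>The boundary of the cube has radius \<open>1\<close>, and the inner cube of \<^const>\<open>change_base\<close> consists of the
  points of radius at most \<open>1/2\<close>.\<close>

definition cube_radius :: "nat \<Rightarrow> (nat \<Rightarrow> real) \<Rightarrow> real" where
  "cube_radius l x = Max ((\<lambda>i. \<bar>2 * x i - 1\<bar>) ` {..<l})"

context
  fixes l :: nat
  assumes l: "0 < l"
begin

lemma cube_radius_ge: "i < l \<Longrightarrow> \<bar>2 * x i - 1\<bar> \<le> cube_radius l x"
  unfolding cube_radius_def by (rule Max_ge) auto

lemma cube_radius_attained: "\<exists>i<l. cube_radius l x = \<bar>2 * x i - 1\<bar>"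
proof -
  have "cube_radius l x \<in> (\<lambda>i. \<bar>2 * x i - 1\<bar>) ` {..<l}"
    unfolding cube_radius_def by (rule Max_in) (use l in auto)
  then show ?thesis by auto
qed

lemma cube_radius_bounds:
  assumes "x \<in> topspace (unit_cube l)"
  shows "0 \<le> cube_radius l x" "cube_radius l x \<le> 1"
proof -
  obtain i where i: "i < l" "cube_radius l x = \<bar>2 * x i - 1\<bar>" using cube_radius_attained by blast
  then show "0 \<le> cube_radius l x" "cube_radius l x \<le> 1"
    using cube_coord(2,3)[OF assms i(1)] by auto
qed

lemma cube_boundary_iff:
  "x \<in> cube_boundary l \<longleftrightarrow> x \<in> topspace (unit_cube l) \<and> cube_radius l x = 1"
proof
  assume x: "x \<in> cube_boundary l"
  then have xc: "x \<in> topspace (unit_cube l)" by (simp add: cube_boundary_def)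
  obtain i where "i < l" "x i = 0 \<or> x i = 1" using x by (auto simp: cube_boundary_def)
  then have "1 \<le> cube_radius l x" using cube_radius_ge[of i x] by auto
  then show "x \<in> topspace (unit_cube l) \<and> cube_radius l x = 1"
    using xc cube_radius_bounds(2)[OF xc] by simp
next
  assume x: "x \<in> topspace (unit_cube l) \<and> cube_radius l x = 1"
  obtain i where i: "i < l" "cube_radius l x = \<bar>2 * x i - 1\<bar>" using cube_radius_attained by blast
  then have "x i = 0 \<or> x i = 1" using x by auto
  then show "x \<in> cube_boundary l" using x i by (auto simp: cube_boundary_def)
qed

lemma continuous_cube_radius: "continuous_map (unit_cube l) euclideanreal (cube_radius l)"
  unfolding cube_radius_def
  by (rule continuous_map_Max)
     (use l in \<open>auto intro!: continuous_map_real_abs continuous_map_diff continuous_map_real_mult_left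
        continuous_map_cube_coord\<close>)

lemma change_base_eq:
  "change_base l u f x =
    (if cube_radius l x \<le> 1/2 then f (\<lambda>i\<in>{..<l}. 2 * x i - 1/2) else u (2 - 2 * cube_radius l x))"
  by (simp add: change_base_def cube_radius_def Let_def)

lemma change_base_boundary: "s \<in> cube_boundary l \<Longrightarrow> change_base l u f s = u 0"
  by (simp add: change_base_eq cube_boundary_iff)

lemma inner_cube:
  assumes "x \<in> topspace (unit_cube l)" "cube_radius l x \<le> 1/2"
  shows "(\<lambda>i\<in>{..<l}. 2 * x i - 1/2) \<in> topspace (unit_cube l)"
proof -
  have "0 \<le> 2 * x i - 1/2" "2 * x i - 1/2 \<le> 1" if "i < l" for i
    using cube_radius_ge[OF that, of x] assms(2) by linarith+
  then show ?thesis by (auto simp: topspace_cube PiE_def)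
qed

lemma inner_cube_boundary:
  assumes "x \<in> topspace (unit_cube l)" "cube_radius l x = 1/2"
  shows "(\<lambda>i\<in>{..<l}. 2 * x i - 1/2) \<in> cube_boundary l"
proof -
  obtain i where i: "i < l" "cube_radius l x = \<bar>2 * x i - 1\<bar>" using cube_radius_attained by blast
  then have "2 * x i - 1/2 = 0 \<or> 2 * x i - 1/2 = 1" using assms(2) by linarith
  then show ?thesis
    using i(1) inner_cube[OF assms(1)] assms(2) by (auto simp: cube_boundary_def)
qed

text \<open>The parameter space \<open>T\<close> is a unit interval below, which turns homotopies of paths and of maps of
  cubes into homotopies of the results.\<close>

lemma continuous_map_change_base:
  assumes F: "continuous_map (prod_topology T (unit_cube l)) X F"
    and U: "continuous_map (prod_topology T unit_I) X U"
    and FU: "\<And>t s. t \<in> topspace T \<Longrightarrow> s \<in> cube_boundary l \<Longrightarrow> F (t, s) = U (t, 1)"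
  shows "continuous_map (prod_topology T (unit_cube l)) X
    (\<lambda>z. change_base l (\<lambda>r. U (fst z, r)) (\<lambda>x. F (fst z, x)) (snd z))"
  unfolding change_base_eq
proof (rule continuous_map_cases_le)
  let ?Z = "prod_topology T (unit_cube l)"
  have rad: "continuous_map ?Z euclideanreal (\<lambda>z. cube_radius l (snd z))"
    using continuous_map_compose[OF continuous_map_snd continuous_cube_radius] by (simp add: o_def)
  then show "continuous_map ?Z euclideanreal (\<lambda>z. cube_radius l (snd z))" .
  show "continuous_map ?Z euclideanreal (\<lambda>z. 1/2)" by simp
  let ?A = "subtopology ?Z {z \<in> topspace ?Z. cube_radius l (snd z) \<le> 1/2}"
  have "continuous_map ?A (unit_cube l) (\<lambda>z. \<lambda>i\<in>{..<l}. 2 * snd z i - 1/2)"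
    unfolding continuous_map_cube
  proof (intro conjI allI impI ballI)
    fix i assume i: "i < l"
    have "continuous_map ?A euclideanreal (\<lambda>z. snd z i)"
      using continuous_map_compose[OF continuous_map_snd continuous_map_cube_coord[OF i]]
      by (auto simp: o_def intro: continuous_map_from_subtopology)
    then show "continuous_map ?A euclideanreal (\<lambda>z. (\<lambda>i\<in>{..<l}. 2 * snd z i - 1/2) i)"
      using i by (simp add: continuous_map_diff continuous_map_real_mult_left)
    fix z assume "z \<in> topspace ?A"
    then have "snd z \<in> topspace (unit_cube l)" "cube_radius l (snd z) \<le> 1/2" by auto
    from cube_coord(2,3)[OF inner_cube[OF this] i]
    show "(\<lambda>i\<in>{..<l}. 2 * snd z i - 1/2) i \<in> {0..1}" by simp
  qed auto
  then have "continuous_map ?A ?Z (\<lambda>z. (fst z, \<lambda>i\<in>{..<l}. 2 * snd z i - 1/2))"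
    by (intro continuous_map_pairedI continuous_map_from_subtopology[OF continuous_map_fst])
  from continuous_map_compose[OF this F]
  show "continuous_map ?A X (\<lambda>z. F (fst z, \<lambda>i\<in>{..<l}. 2 * snd z i - 1/2))" by (simp add: o_def)
  let ?B = "subtopology ?Z {z \<in> topspace ?Z. 1/2 \<le> cube_radius l (snd z)}"
  have "continuous_map ?B unit_I (\<lambda>z. 2 - 2 * cube_radius l (snd z))"
  proof (rule continuous_map_into_subtopology)
    show "continuous_map ?B euclideanreal (\<lambda>z. 2 - 2 * cube_radius l (snd z))"
      by (intro continuous_map_diff continuous_map_real_mult_left
          continuous_map_from_subtopology[OF rad]) auto
    show "(\<lambda>z. 2 - 2 * cube_radius l (snd z)) \<in> topspace ?B \<rightarrow> {0..1}"
      using cube_radius_bounds by auto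
  qed
  then have "continuous_map ?B (prod_topology T unit_I) (\<lambda>z. (fst z, 2 - 2 * cube_radius l (snd z)))"
    by (intro continuous_map_pairedI continuous_map_from_subtopology[OF continuous_map_fst])
  from continuous_map_compose[OF this U]
  show "continuous_map ?B X (\<lambda>z. U (fst z, 2 - 2 * cube_radius l (snd z)))" by (simp add: o_def)
  fix z assume z: "z \<in> topspace ?Z" "cube_radius l (snd z) = 1/2"
  then have this_b: "(\<lambda>i\<in>{..<l}. 2 * snd z i - 1/2) \<in> cube_boundary l"
    by (intro inner_cube_boundary) auto
  show "F (fst z, \<lambda>i\<in>{..<l}. 2 * snd z i - 1/2) = U (fst z, 2 - 2 * cube_radius l (snd z))"
    unfolding z(2) using FU[of "fst z", OF _ this_b] z(1) by (simp add: mem_Times_iff)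
qed

abbreviation cube_homotopic :: "'a topology \<Rightarrow> 'a cube_map \<Rightarrow> 'a cube_map \<Rightarrow> bool" where
  "cube_homotopic X \<equiv> rel_homotopic (unit_cube l) X (cube_boundary l)"

lemma change_base_cong:
  assumes f: "cube_homotopic X f f'" and u: "path_homotopic X u u'"
    and fu: "\<And>s. s \<in> cube_boundary l \<Longrightarrow> f s = u 1"
  shows "cube_homotopic X (change_base l u f) (change_base l u' f')"
proof -
  obtain F where F: "continuous_map (prod_topology unit_I (unit_cube l)) X F"
    "\<And>y. F (0, y) = f y" "\<And>y. F (1, y) = f' y"
    "\<And>t b. t \<in> {0..1} \<Longrightarrow> b \<in> cube_boundary l \<Longrightarrow> F (t, b) = f b"
    using rel_homotopicE[OF f] by blast
  obtain U where U: "continuous_map (prod_topology unit_I unit_I) X U"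
    "\<And>y. U (0, y) = u y" "\<And>y. U (1, y) = u' y"
    "\<And>t b. t \<in> {0..1} \<Longrightarrow> b \<in> {0, 1} \<Longrightarrow> U (t, b) = u b"
    using rel_homotopicE[OF u] by blast
  show ?thesis
  proof (rule rel_homotopicI[OF cube_boundary_subset])
    show "continuous_map (prod_topology unit_I (unit_cube l)) X
      (\<lambda>z. change_base l (\<lambda>r. U (fst z, r)) (\<lambda>x. F (fst z, x)) (snd z))"
      by (rule continuous_map_change_base[OF F(1) U(1)]) (use F U fu in auto)
  qed (use F U in \<open>auto simp: change_base_boundary\<close>)
qed

text \<open>The homotopy \<open>H\<close> from \<open>g\<close> to \<open>f\<close> moves the boundary of the cube along \<open>u\<close>. Such an \<open>H\<close> determines
  \<open>g\<close> up to homotopy: \<open>g\<close> and the change of basepoint of \<open>f\<close> are the composites of \<open>H\<close> with the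
  bottom of the cylinder and with the union of its side and its top, and these two
  maps of the cube into the cylinder are joined by a straight line.\<close>

definition tracks :: "'a topology \<Rightarrow> (real \<Rightarrow> 'a) \<Rightarrow> 'a cube_map \<Rightarrow> 'a cube_map \<Rightarrow> bool" where
  "tracks X u f g \<longleftrightarrow> (\<exists>H. continuous_map (prod_topology unit_I (unit_cube l)) X H \<and>
     (\<forall>x\<in>topspace (unit_cube l). H (0, x) = g x \<and> H (1, x) = f x) \<and>
     (\<forall>t\<in>{0..1}. \<forall>s\<in>cube_boundary l. H (t, s) = u t))"

lemma tracks_unique:
  assumes "tracks X u f g"
  shows "cube_homotopic X g (change_base l u f)"
proof -
  obtain H where H: "continuous_map (prod_topology unit_I (unit_cube l)) X H"
    "\<And>x. x \<in> topspace (unit_cube l) \<Longrightarrow> H (0, x) = g x"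
    "\<And>x. x \<in> topspace (unit_cube l) \<Longrightarrow> H (1, x) = f x"
    "\<And>t s. t \<in> {0..1} \<Longrightarrow> s \<in> cube_boundary l \<Longrightarrow> H (t, s) = u t"
    using assms unfolding tracks_def by blast
  \<comment> \<open>\<open>(a x, b x)\<close> lies on the top of the cylinder if \<open>x\<close> is in the inner cube, and on the side
    otherwise; \<open>K\<close> moves the point \<open>x\<close> of the bottom to it on a straight line\<close>
  define m where "m x = max (1/2) (cube_radius l x)" for x
  define a where "a x = min 1 (2 - 2 * cube_radius l x)" for x
  define b where "b x i = 1/2 + (x i - 1/2) / m x" for x i
  have m: "1/2 \<le> m x" for x by (simp add: m_def)
  have a01: "0 \<le> a x" "a x \<le> 1" if "x \<in> topspace (unit_cube l)" for x
    using cube_radius_bounds[OF that] by (auto simp: a_def)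
  have b01: "0 \<le> b x i" "b x i \<le> 1" if "i < l" for x i
  proof -
    have "\<bar>2 * x i - 1\<bar> \<le> m x" using cube_radius_ge[OF that, of x] by (simp add: m_def)
    then have "2 * (x i - 1/2) \<le> m x" "- m x \<le> 2 * (x i - 1/2)" by auto
    then have "(x i - 1/2) / m x \<le> 1/2" "-(1/2) \<le> (x i - 1/2) / m x"
      using m[of x] by (auto simp: field_simps)
    then show "0 \<le> b x i" "b x i \<le> 1" unfolding b_def by linarith+
  qed
  define K where "K z = (fst z * a (snd z),
      \<lambda>i\<in>{..<l}. (1 - fst z) * snd z i + fst z * b (snd z) i)" for z :: "real \<times> (nat \<Rightarrow> real)"
  let ?Z = "prod_topology unit_I (unit_cube l)"
  have fst: "continuous_map ?Z euclideanreal fst"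
    using continuous_map_fst continuous_map_in_subtopology by blast
  have rad: "continuous_map ?Z euclideanreal (\<lambda>z. cube_radius l (snd z))"
    using continuous_map_compose[OF continuous_map_snd continuous_cube_radius] by (simp add: o_def)
  have K1: "continuous_map ?Z unit_I (\<lambda>z. fst z * a (snd z))"
  proof (rule continuous_map_into_subtopology)
    show "continuous_map ?Z euclideanreal (\<lambda>z. fst z * a (snd z))"
      unfolding a_def
      by (intro continuous_map_real_mult fst continuous_map_real_min continuous_map_diff
          continuous_map_real_mult_left rad) auto
    show "(\<lambda>z. fst z * a (snd z)) \<in> topspace ?Z \<rightarrow> {0..1}"
      by (auto intro!: mult_le_one mult_nonneg_nonneg a01)
  qed
  have K2: "continuous_map ?Z (unit_cube l) (\<lambda>z. \<lambda>i\<in>{..<l}. (1 - fst z) * snd z i + fst z * b (snd z) i)"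
    unfolding continuous_map_cube
  proof (intro conjI allI impI ballI)
    fix i assume i: "i < l"
    have coord: "continuous_map ?Z euclideanreal (\<lambda>z. snd z i)"
      using continuous_map_compose[OF continuous_map_snd continuous_map_cube_coord[OF i]]
      by (simp add: o_def)
    have "continuous_map ?Z euclideanreal (\<lambda>z. (1 - fst z) * snd z i + fst z * b (snd z) i)"
      unfolding b_def m_def
      by (intro continuous_map_add continuous_map_real_mult continuous_map_diff fst coord
          continuous_map_real_divide continuous_map_real_max rad) auto
    then show "continuous_map ?Z euclideanreal
        (\<lambda>z. (\<lambda>i\<in>{..<l}. (1 - fst z) * snd z i + fst z * b (snd z) i) i)"
      using i by simp
    fix z assume z: "z \<in> topspace ?Z"
    then have "fst z \<in> {0..1}" "snd z i \<in> {0..1}" "b (snd z) i \<in> {0..1}"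
      using cube_coord(2,3)[of "snd z" l i] b01[OF i, of "snd z"] i by auto
    then have "(1 - fst z) *\<^sub>R snd z i + fst z *\<^sub>R b (snd z) i \<in> {0..1}"
      by (intro convexD_alt[of "{0..1::real}"]) auto
    then show "(\<lambda>i\<in>{..<l}. (1 - fst z) * snd z i + fst z * b (snd z) i) i \<in> {0..1}"
      using i by simp
  qed auto
  have "continuous_map ?Z ?Z K"
    unfolding K_def using K1 K2 by (rule continuous_map_pairedI)
  from continuous_map_compose[OF this H(1)]
  have HK: "continuous_map ?Z X (\<lambda>z. H (K z))" by (simp add: o_def)
  have top: "H (K (1, x)) = change_base l u f x" if x: "x \<in> topspace (unit_cube l)" for x
  proof (cases "cube_radius l x \<le> 1/2")
    case True
    then have ax: "a x = 1" and mx: "m x = 1/2" by (auto simp: a_def m_def)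
    have "K (1, x) = (1, \<lambda>i\<in>{..<l}. 2 * x i - 1/2)"
      unfolding K_def b_def fst_conv snd_conv ax mx by (simp add: mult.commute)
    then show ?thesis
      using True H(3)[OF inner_cube[OF x True]] by (simp add: change_base_eq)
  next
    case False
    let ?b = "\<lambda>i\<in>{..<l}. b x i"
    have am: "a x = 2 - 2 * cube_radius l x" "m x = cube_radius l x" using False by (auto simp: a_def m_def)
    obtain i where i: "i < l" "cube_radius l x = \<bar>2 * x i - 1\<bar>" using cube_radius_attained by blast
    then have "m x = 2 * x i - 1 \<or> m x = 1 - 2 * x i" using am by auto
    then have "b x i = 1 \<or> b x i = 0"
      using m[of x] unfolding b_def by (auto simp: field_simps)
    then have "?b \<in> cube_boundary l"
      using i(1) b01 by (auto simp: cube_boundary_def topspace_cube)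
    moreover have "a x \<in> {0..1}" using a01[OF x] by simp
    moreover have "K (1, x) = (a x, ?b)" by (simp add: K_def)
    ultimately show ?thesis using False H(4) am(1) by (simp add: change_base_eq)
  qed
  have bottom: "K (0, x) = (0, x)" if "x \<in> topspace (unit_cube l)" for x
    using cube_coord(1)[OF that] by (auto simp: K_def extensional_def fun_eq_iff)
  have side: "K (t, s) = (0, s)" if "s \<in> cube_boundary l" for t s
  proof -
    have s: "s \<in> topspace (unit_cube l)" "cube_radius l s = 1" using that cube_boundary_iff by auto
    then have "m s = 1" "a s = 0" by (auto simp: m_def a_def)
    then show ?thesis
      using cube_coord(1)[OF s(1)] by (auto simp: K_def b_def extensional_def fun_eq_iff algebra_simps)
  qed
  show ?thesis
    by (rule rel_homotopicI[OF cube_boundary_subset HK])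
       (use top bottom side H(2) subsetD[OF cube_boundary_subset] in auto)
qed

lemma tracks_join:
  assumes "tracks X u f g" "tracks X v h f"
  shows "tracks X (u \<bullet>\<bullet> v) h g"
proof -
  obtain H where H: "continuous_map (prod_topology unit_I (unit_cube l)) X H"
    "\<And>x. x \<in> topspace (unit_cube l) \<Longrightarrow> H (0, x) = g x \<and> H (1, x) = f x"
    "\<And>t s. t \<in> {0..1} \<Longrightarrow> s \<in> cube_boundary l \<Longrightarrow> H (t, s) = u t"
    using assms(1) unfolding tracks_def by blast
  obtain K where K: "continuous_map (prod_topology unit_I (unit_cube l)) X K"
    "\<And>x. x \<in> topspace (unit_cube l) \<Longrightarrow> K (0, x) = f x \<and> K (1, x) = h x"
    "\<And>t s. t \<in> {0..1} \<Longrightarrow> s \<in> cube_boundary l \<Longrightarrow> K (t, s) = v t"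
    using assms(2) unfolding tracks_def by blast
  have "continuous_map (prod_topology unit_I (unit_cube l)) X
    (\<lambda>z. if fst z \<le> 1/2 then H (2 * fst z, snd z) else K (2 * fst z - 1, snd z))"
    by (rule continuous_map_join_first) (use H K in auto)
  then show ?thesis
    unfolding tracks_def path_join_def
    by (intro exI[of _ "\<lambda>z. if fst z \<le> 1/2 then H (2 * fst z, snd z) else K (2 * fst z - 1, snd z)"])
       (use H K in auto)
qed

lemma tracks_homotopic:
  assumes "cube_homotopic X g f" "\<And>s. s \<in> cube_boundary l \<Longrightarrow> g s = y"
  shows "tracks X (\<lambda>_. y) f g"
proof -
  obtain F where F: "continuous_map (prod_topology unit_I (unit_cube l)) X F"
    "\<And>y. F (0, y) = g y" "\<And>y. F (1, y) = f y"
    "\<And>t b. t \<in> {0..1} \<Longrightarrow> b \<in> cube_boundary l \<Longrightarrow> F (t, b) = g b"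
    using rel_homotopicE[OF assms(1)] by blast
  then show ?thesis unfolding tracks_def using assms(2) by (intro exI[of _ F]) auto
qed

lemma spheroidsD:
  assumes "f \<in> spheroids l X y"
  shows "continuous_map (unit_cube l) X f" "s \<in> cube_boundary l \<Longrightarrow> f s = y"
  using assms by (auto simp: spheroids_def)

lemma change_base_const:
  assumes "f \<in> spheroids l X y"
  shows "cube_homotopic X f (change_base l (\<lambda>_. y) f)"
  by (rule tracks_unique, rule tracks_homotopic)
     (use assms in \<open>auto simp: spheroids_def rel_homotopic_refl\<close>)

lemma change_base_spheroid:
  assumes "f \<in> spheroids l X y" "pathin X u" "u 1 = y"
  shows "change_base l u f \<in> spheroids l X (u 0)"
proof -
  have "cube_homotopic X (change_base l u f) (change_base l u f)"
    by (rule change_base_cong)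
       (use assms in \<open>auto simp: spheroids_def rel_homotopic_refl path_homotopic_refl\<close>)
  then show ?thesis
    using rel_homotopic_continuous(1) by (simp add: spheroids_def change_base_boundary)
qed

text \<open>Replacing \<open>u\<close> at time \<open>t\<close> by its part from \<open>u(t)\<close> to \<open>u(1)\<close> deforms the change of basepoint along \<open>u\<close> into
  one along a constant path. This homotopy moves the boundary along \<open>u\<close>.\<close>

lemma tracks_change_base:
  assumes f: "f \<in> spheroids l X y" and u: "pathin X u" "u 1 = y"
  shows "tracks X (u \<bullet>\<bullet> (\<lambda>_. y)) f (change_base l u f)"
proof (rule tracks_join)
  let ?U = "\<lambda>z. u (fst z + (1 - fst z) * snd z)"
  have "continuous_map (prod_topology unit_I unit_I) unit_I (\<lambda>z. fst z + (1 - fst z) * snd z)"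
  proof -
    have "fst z + (1 - fst z) * snd z \<in> {0..1}" if "z \<in> {0..1} \<times> {0..1}" for z :: "real \<times> real"
      using convexD_alt[of "{0..1::real}" "snd z" 1 "fst z"] that by auto
    moreover have "continuous_on ({0..1} \<times> {0..1}) (\<lambda>z::real \<times> real. fst z + (1 - fst z) * snd z)"
      by (intro continuous_intros)
    ultimately show ?thesis
      by (auto simp: continuous_map_in_subtopology simp flip: subtopology_Times)
  qed
  from continuous_map_compose[OF this u(1)[unfolded pathin_def]]
  have U: "continuous_map (prod_topology unit_I unit_I) X ?U" by (simp add: o_def)
  have F: "continuous_map (prod_topology unit_I (unit_cube l)) X (\<lambda>z. f (snd z))"
    using continuous_map_compose[OF continuous_map_snd spheroidsD(1)[OF f]] by (simp add: o_def)
  have "continuous_map (prod_topology unit_I (unit_cube l)) X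
    (\<lambda>z. change_base l (\<lambda>r. ?U (fst z, r)) (\<lambda>x. (\<lambda>z. f (snd z)) (fst z, x)) (snd z))"
    by (rule continuous_map_change_base[OF F U]) (use spheroidsD(2)[OF f] u(2) in auto)
  then show "tracks X u (change_base l (\<lambda>_. y) f) (change_base l u f)"
    unfolding tracks_def
    by (intro exI[of _ "\<lambda>z. change_base l (\<lambda>r. ?U (fst z, r)) (\<lambda>x. f x) (snd z)"])
       (use u(2) in \<open>auto simp: change_base_boundary\<close>)
  show "tracks X (\<lambda>_. y) f (change_base l (\<lambda>_. y) f)"
    by (rule tracks_homotopic[OF rel_homotopic_sym[OF change_base_const[OF f]]])
       (simp add: change_base_boundary)
qed

text \<open>Both sides track \<open>f\<close> along homotopic paths, because tracking homotopies can be concatenated.\<close>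

lemma change_base_join:
  assumes f: "f \<in> spheroids l X y" and v: "pathin X v" "v 1 = y" and u: "pathin X u" "u 1 = v 0"
  shows "cube_homotopic X (change_base l u (change_base l v f)) (change_base l (u \<bullet>\<bullet> v) f)"
proof -
  let ?c = "\<lambda>_. v 0" and ?d = "\<lambda>_. y"
  have vf: "change_base l v f \<in> spheroids l X (v 0)" by (rule change_base_spheroid[OF f v])
  have in_X: "v 0 \<in> topspace X" "y \<in> topspace X"
    using v path_start_in_topspace path_finish_in_topspace by blast+
  have "tracks X ((u \<bullet>\<bullet> ?c) \<bullet>\<bullet> (v \<bullet>\<bullet> ?d)) f (change_base l u (change_base l v f))"
    by (rule tracks_join[OF tracks_change_base[OF vf u] tracks_change_base[OF f v]])
  then have "cube_homotopic X (change_base l u (change_base l v f))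
      (change_base l ((u \<bullet>\<bullet> ?c) \<bullet>\<bullet> (v \<bullet>\<bullet> ?d)) f)"
    by (rule tracks_unique)
  also have "cube_homotopic X \<dots> (change_base l (u \<bullet>\<bullet> v) f)"
  proof (rule change_base_cong)
    show "path_homotopic X ((u \<bullet>\<bullet> ?c) \<bullet>\<bullet> (v \<bullet>\<bullet> ?d)) (u \<bullet>\<bullet> v)"
      by (rule path_homotopic_join) (use u v in \<open>auto intro: path_homotopic_const_right\<close>)
  qed (use f in \<open>auto simp: spheroids_def rel_homotopic_refl\<close>)
  finally show ?thesis .
qed

lemma compose_change_base: "k \<circ> change_base l u f = change_base l (k \<circ> u) (k \<circ> f)"
  by (auto simp: change_base_eq)

text \<open>At each point of the cube, all the changes of basepoint evaluate the same one of their two arguments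
  at the same parameter.\<close>

lemma pointwise_comp_change_base:
  assumes "length us = length gs"
  shows "pointwise_comp D ms (change_base l u f) (map2 (change_base l) us gs) =
    change_base l (pointwise_comp D ms u us) (pointwise_comp D ms f gs)"
proof
  fix x
  show "pointwise_comp D ms (change_base l u f) (map2 (change_base l) us gs) x =
    change_base l (pointwise_comp D ms u us) (pointwise_comp D ms f gs) x"
    using assms by (auto simp: change_base_eq pointwise_comp_def o_def intro!: arg_cong[where f = "opcomp D ms _"] nth_equalityI)
qed

end

lemma connected_cube: "connected_space (unit_cube l)"
  by (simp add: unit_cube_def connected_space_product_topology connected_space_subtopology)

text \<open>In dimension at least two every boundary point is joined to the corner \<open>0\<close> by at most two segments
  in faces of the cube, along which a lift of a spheroid is constant.\<close>

lemma (in covering_action) spheroid_lift: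
  assumes l: "1 < l" and F: "F \<in> spheroids l base (quot e)" and e: "e \<in> topspace X"
  obtains f where "f \<in> spheroids l X e" "\<And>x. x \<in> topspace (unit_cube l) \<Longrightarrow> quot (f x) = F x"
proof -
  let ?o = "\<lambda>i\<in>{..<l}. 0::real"
  have l0: "0 < l" using l by simp
  have o_b: "?o \<in> cube_boundary l" using l by (auto simp: cube_boundary_def topspace_cube)
  have Fc: "continuous_map (unit_cube l) base F" and Fb: "\<And>s. s \<in> cube_boundary l \<Longrightarrow> F s = quot e"
    using F by (auto simp: spheroids_def)
  have cont: "continuous_map (prod_topology unit_I (unit_cube l)) (unit_cube l)
      (\<lambda>z. \<lambda>i\<in>{..<l}. fst z * snd z i)"
    unfolding continuous_map_cube
  proof (intro conjI allI impI ballI)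
    fix i assume i: "i < l"
    have "continuous_map (prod_topology unit_I (unit_cube l)) euclideanreal fst"
      using continuous_map_fst continuous_map_in_subtopology by blast
    then have "continuous_map (prod_topology unit_I (unit_cube l)) euclideanreal (\<lambda>z. fst z * snd z i)"
      using continuous_map_compose[OF continuous_map_snd continuous_map_cube_coord[OF i]]
      by (intro continuous_map_real_mult) (auto simp: o_def)
    then show "continuous_map (prod_topology unit_I (unit_cube l)) euclideanreal
        (\<lambda>z. (\<lambda>i\<in>{..<l}. fst z * snd z i) i)"
      using i by simp
    fix z assume "z \<in> topspace (prod_topology unit_I (unit_cube l))"
    then show "(\<lambda>i\<in>{..<l}. fst z * snd z i) i \<in> {0..1}"
      using i cube_coord(2,3)[of "snd z" l i] by (auto intro: mult_le_one)
  qed auto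
  obtain f where f: "continuous_map (unit_cube l) X f" "f ?o = e"
    "\<And>x. x \<in> topspace (unit_cube l) \<Longrightarrow> quot (f x) = F x"
  proof (rule lift_contractible[OF Fc cont, of ?o e])
    show "(\<lambda>i\<in>{..<l}. fst (0, y) * snd (0, y) i) = ?o" for y :: "nat \<Rightarrow> real" by auto
    show "(\<lambda>i\<in>{..<l}. fst (1, y) * snd (1, y) i) = y" if "y \<in> topspace (unit_cube l)" for y
      using cube_coord(1)[OF that] by (auto simp: extensional_def fun_eq_iff)
  qed (use o_b Fb e subsetD[OF cube_boundary_subset] in auto)
  have step: "f s = e"
    if s: "s \<in> topspace (unit_cube l)" and s': "s' \<in> topspace (unit_cube l)" "f s' = e"
      and i: "i < l" "s i = s' i" "s i = 0 \<or> s i = 1" for s s' i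
  proof -
    define p where "p t = (\<lambda>i\<in>{..<l}. (1 - t) * s' i + t * s i)" for t
    have p01: "p t i \<in> {0..1}" if "t \<in> {0..1}" "i < l" for t i
      using convexD_alt[of "{0..1::real}" "s' i" "s i" t] that cube_coord(2,3)[OF s] cube_coord(2,3)[OF s'(1)]
      by (auto simp: p_def)
    have "continuous_map unit_I (unit_cube l) p"
      unfolding continuous_map_cube
    proof (intro conjI allI impI ballI)
      show "continuous_map unit_I euclideanreal (\<lambda>y. p y i)" if "i < l" for i
        using that by (auto simp: p_def intro!: continuous_intros)
    qed (use p01 in \<open>auto simp: p_def\<close>)
    then have "pathin X (\<lambda>t. f (p t))"
      using continuous_map_compose[OF _ f(1)] by (simp add: pathin_def o_def)
    moreover have p_b: "p t \<in> cube_boundary l" if "t \<in> {0..1}" for t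
    proof -
      have "p t i = s i" using i by (simp add: p_def algebra_simps)
      then have "\<exists>i<l. p t i = 0 \<or> p t i = 1" using i by auto
      moreover have "p t \<in> topspace (unit_cube l)"
        using p01[OF that] by (auto simp: topspace_cube PiE_def p_def)
      ultimately show ?thesis by (simp add: cube_boundary_def)
    qed
    moreover have "p 0 = s'" "p 1 = s"
      using cube_coord(1)[OF s] cube_coord(1)[OF s'(1)] by (auto simp: p_def extensional_def fun_eq_iff)
    ultimately show "f s = e"
      using path_lifts_agree[of "\<lambda>t. f (p t)" "\<lambda>_. e" 1] f(3) Fb e s'(2) subsetD[OF cube_boundary_subset, of _ l] by auto
  qed
  have "f s = e" if sb: "s \<in> cube_boundary l" for s
  proof -
    have s: "s \<in> topspace (unit_cube l)" using sb cube_boundary_subset by blast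
    have zero: "f s = e" if "s \<in> topspace (unit_cube l)" "i < l" "s i = 0" for s i
      by (rule step[of s ?o i]) (use that o_b f(2) subsetD[OF cube_boundary_subset, of _ l] in auto)
    obtain i where i: "i < l" "s i = 0 \<or> s i = 1" using sb by (auto simp: cube_boundary_def)
    define j where "j = (if i = 0 then 1 else 0 :: nat)"
    have j: "j < l" "j \<noteq> i" using l by (auto simp: j_def)
    have s': "s(j := 0) \<in> topspace (unit_cube l)"
      using s j(1) by (auto simp: topspace_cube PiE_def extensional_def)
    show ?thesis
      by (rule step[OF s s' _ i(1)]) (use zero[OF s' j(1)] i j in auto)
  qed
  then have "f \<in> spheroids l X e" using f(1) by (simp add: spheroids_def)
  then show thesis using that f(3) by blast
qed

section \<open>Pointwise composites\<close>

lemma compact_unit_I: "compact_space unit_I"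
  by (simp add: compact_space_subtopology)

lemma compact_cube: "compact_space (unit_cube l)"
  by (simp add: unit_cube_def compact_space_product_topology compact_unit_I)

lemma topological_operad_opcomp_closed:
  assumes "topological_operad C" "a \<in> Elems C (length ms)" "bs \<in> ElemLists C ms"
  shows "opcomp C ms a bs \<in> Elems C (sum_list ms)"
proof -
  have cont: "continuous_map
        (kification (prod_topology (Space C (length ms))
           (product_topology (\<lambda>i. Space C (ms ! i)) {..<length ms})))
        (Space C (sum_list ms))
        (\<lambda>(a, b). opcomp C ms a (map b [0..<length ms]))"
    using assms(1) unfolding topological_operad_def by (elim conjE) (rule spec)
  have len: "length bs = length ms" using assms(3) by (simp add: ElemLists_iff)
  have "map (\<lambda>i\<in>{..<length ms}. bs ! i) [0..<length ms] = map ((!) bs) [0..<length bs]"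
    using len by (intro map_cong) auto
  then have bs: "map (\<lambda>i\<in>{..<length ms}. bs ! i) [0..<length ms] = bs" by (simp add: map_nth)
  have "(a, \<lambda>i\<in>{..<length ms}. bs ! i) \<in> topspace (kification (prod_topology (Space C (length ms))
           (product_topology (\<lambda>i. Space C (ms ! i)) {..<length ms})))"
    using assms(2,3) by (auto simp: ElemLists_iff)
  then have "(\<lambda>(a, b). opcomp C ms a (map b [0..<length ms])) (a, \<lambda>i\<in>{..<length ms}. bs ! i)
      \<in> Elems C (sum_list ms)"
    using continuous_map_image_subset_topspace[OF cont] by blast
  then show ?thesis using bs by simp
qed

text \<open>A map from a compact space to a product is also continuous for the compactly generated topology of
  the product. Intervals, squares and cubes are compact.\<close>

lemma continuous_pointwise_comp:
  assumes C: "topological_operad C" and Y: "compact_space Y"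
    and f: "continuous_map Y (Space C (length ms)) f"
    and gs: "length gs = length ms" "\<And>i. i < length ms \<Longrightarrow> continuous_map Y (Space C (ms ! i)) (gs ! i)"
  shows "continuous_map Y (Space C (sum_list ms)) (pointwise_comp C ms f gs)"
proof -
  let ?P = "prod_topology (Space C (length ms))
           (product_topology (\<lambda>i. Space C (ms ! i)) {..<length ms})"
  let ?j = "\<lambda>y. (f y, \<lambda>i\<in>{..<length ms}. (gs ! i) y)"
  have cont: "continuous_map (kification ?P) (Space C (sum_list ms))
        (\<lambda>(a, b). opcomp C ms a (map b [0..<length ms]))"
    using C unfolding topological_operad_def by (elim conjE) (rule spec)
  have "continuous_map Y (product_topology (\<lambda>i. Space C (ms ! i)) {..<length ms})
      (\<lambda>y. \<lambda>i\<in>{..<length ms}. (gs ! i) y)"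
    unfolding continuous_map_componentwise using gs(2) by auto
  then have "continuous_map Y ?P ?j" using f by (rule continuous_map_pairedI[rotated])
  then have "continuous_map Y (kification ?P) ?j"
    by (simp add: continuous_map_into_kification compact_imp_k_space Y)
  from continuous_map_compose[OF this cont]
  have c: "continuous_map Y (Space C (sum_list ms))
      (\<lambda>y. opcomp C ms (f y) (map (\<lambda>i\<in>{..<length ms}. (gs ! i) y) [0..<length ms]))"
    by (simp add: o_def)
  have "map (\<lambda>i\<in>{..<length ms}. (gs ! i) y) [0..<length ms] = map (\<lambda>g. g y) gs" for y
    by (rule nth_equalityI) (use gs(1) in auto)
  then show ?thesis using c by (simp add: pointwise_comp_def)
qed

lemma rel_homotopic_pointwise_comp:
  assumes C: "topological_operad C" and Y: "compact_space Y" and B: "B \<subseteq> topspace Y"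
    and f: "rel_homotopic Y (Space C (length ms)) B f f'"
    and gs: "length gs = length ms" "length gs' = length ms"
      "\<And>i. i < length ms \<Longrightarrow> rel_homotopic Y (Space C (ms ! i)) B (gs ! i) (gs' ! i)"
  shows "rel_homotopic Y (Space C (sum_list ms)) B (pointwise_comp C ms f gs) (pointwise_comp C ms f' gs')"
proof -
  obtain F where F: "continuous_map (prod_topology unit_I Y) (Space C (length ms)) F"
    "\<And>y. F (0, y) = f y" "\<And>y. F (1, y) = f' y"
    "\<And>t b. t \<in> {0..1} \<Longrightarrow> b \<in> B \<Longrightarrow> F (t, b) = f b"
    using rel_homotopicE[OF f] by blast
  define R where "R i h \<longleftrightarrow> (i < length ms \<longrightarrow> continuous_map (prod_topology unit_I Y) (Space C (ms ! i)) h \<and>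
    (\<forall>y. h (0, y) = (gs ! i) y \<and> h (1, y) = (gs' ! i) y) \<and>
    (\<forall>t\<in>{0..1}. \<forall>b\<in>B. h (t, b) = (gs ! i) b))" for i h
  have "\<exists>h. R i h" for i
  proof (cases "i < length ms")
    case True
    show ?thesis by (rule rel_homotopicE[OF gs(3)[OF True]]) (auto simp: R_def)
  qed (simp add: R_def)
  then obtain h where "\<And>i. R i (h i)" by metis
  then have h: "continuous_map (prod_topology unit_I Y) (Space C (ms ! i)) (h i)"
    "h i (0, y) = (gs ! i) y" "h i (1, y) = (gs' ! i) y"
    "t \<in> {0..1} \<Longrightarrow> b \<in> B \<Longrightarrow> h i (t, b) = (gs ! i) b" if "i < length ms" for i y t b
    using that by (auto simp: R_def)
  let ?hs = "map h [0..<length ms]"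
  show ?thesis
  proof (rule rel_homotopicI[OF B])
    show "continuous_map (prod_topology unit_I Y) (Space C (sum_list ms)) (pointwise_comp C ms F ?hs)"
      by (rule continuous_pointwise_comp[OF C])
         (use Y F h in \<open>auto simp: compact_space_prod_topology compact_unit_I\<close>)
    have "map (\<lambda>g. g (0, y)) ?hs = map (\<lambda>g. g y) gs" "map (\<lambda>g. g (1, y)) ?hs = map (\<lambda>g. g y) gs'" for y
      using gs h by (auto intro: nth_equalityI)
    then show "pointwise_comp C ms F ?hs (0, y) = pointwise_comp C ms f gs y"
      "pointwise_comp C ms F ?hs (1, y) = pointwise_comp C ms f' gs' y" for y
      by (simp_all add: pointwise_comp_def F)
    fix t b assume tb: "t \<in> {0..1::real}" "b \<in> B"
    have "map (\<lambda>g. g (t, b)) ?hs = map (\<lambda>g. g b) gs"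
      using gs h(4)[OF _ tb] by (auto intro: nth_equalityI)
    then show "pointwise_comp C ms F ?hs (t, b) = pointwise_comp C ms f gs b"
      by (simp add: pointwise_comp_def F(4)[OF tb])
  qed
qed

text \<open>All the joins switch from the first to the second path at the same time.\<close>

lemma pointwise_comp_join:
  assumes "length gs' = length gs"
  shows "pointwise_comp C ms (f \<bullet>\<bullet> f') (map2 (\<bullet>\<bullet>) gs gs') =
    pointwise_comp C ms f gs \<bullet>\<bullet> pointwise_comp C ms f' gs'"
proof
  fix t
  have "map (\<lambda>g. g t) (map2 (\<bullet>\<bullet>) gs gs') =
      (if t \<le> 1/2 then map (\<lambda>g. g (2 * t)) gs else map (\<lambda>g. g (2 * t - 1)) gs')"
    using assms by (auto simp: path_join_def intro: nth_equalityI)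
  then show "pointwise_comp C ms (f \<bullet>\<bullet> f') (map2 (\<bullet>\<bullet>) gs gs') t =
    (pointwise_comp C ms f gs \<bullet>\<bullet> pointwise_comp C ms f' gs') t"
    by (simp add: pointwise_comp_def path_join_def)
qed

lemma pointwise_comp_rev:
  "pointwise_comp C ms (path_rev f) (map path_rev gs) = path_rev (pointwise_comp C ms f gs)"
  by (simp add: pointwise_comp_def path_rev_def o_def)

lemma path_rev_join:
  assumes "f 1 = g 0"
  shows "path_rev (f \<bullet>\<bullet> g) = path_rev g \<bullet>\<bullet> path_rev f"
proof
  fix t :: real
  consider "t < 1/2" | "t = 1/2" | "t > 1/2" by linarith
  then show "path_rev (f \<bullet>\<bullet> g) t = (path_rev g \<bullet>\<bullet> path_rev f) t"
    by cases (use assms in \<open>auto simp: path_rev_def path_join_def algebra_simps\<close>)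
qed

lemma path_homotopic_shuffle:
  assumes "pathin X d" "pathin X a" "pathin X x" "pathin X c" "pathin X b"
    and "d 1 = a 0" "a 1 = x 0" "x 1 = c 0" "c 1 = b 0"
  shows "path_homotopic X (d \<bullet>\<bullet> ((a \<bullet>\<bullet> (x \<bullet>\<bullet> c)) \<bullet>\<bullet> b)) ((d \<bullet>\<bullet> a) \<bullet>\<bullet> (x \<bullet>\<bullet> (c \<bullet>\<bullet> b)))"
proof -
  note p = pathin_join path_homotopic_refl
  have "path_homotopic X ((a \<bullet>\<bullet> (x \<bullet>\<bullet> c)) \<bullet>\<bullet> b) (a \<bullet>\<bullet> ((x \<bullet>\<bullet> c) \<bullet>\<bullet> b))"
    by (rule path_homotopic_assoc) (simp_all add: assms p)
  also have "path_homotopic X \<dots> (a \<bullet>\<bullet> (x \<bullet>\<bullet> (c \<bullet>\<bullet> b)))"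
    by (rule path_homotopic_join[OF _ path_homotopic_assoc]) (simp_all add: assms p)
  finally have "path_homotopic X (d \<bullet>\<bullet> ((a \<bullet>\<bullet> (x \<bullet>\<bullet> c)) \<bullet>\<bullet> b)) (d \<bullet>\<bullet> (a \<bullet>\<bullet> (x \<bullet>\<bullet> (c \<bullet>\<bullet> b))))"
    by (rule path_homotopic_join[rotated]) (simp_all add: assms p)
  also have "path_homotopic X \<dots> ((d \<bullet>\<bullet> a) \<bullet>\<bullet> (x \<bullet>\<bullet> (c \<bullet>\<bullet> b)))"
    by (rule rel_homotopic_sym, rule path_homotopic_assoc) (simp_all add: assms p)
  finally show ?thesis .
qed

text \<open>This is how two linear paths cancel in the product of two composites.\<close>

lemma path_homotopic_cancel:
  assumes "pathin X d" "pathin X x" "pathin X c" "pathin X y" "pathin X z"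
    and "d 1 = x 0" "x 1 = c 1" "c 1 = y 0" "y 1 = z 0"
  shows "path_homotopic X ((d \<bullet>\<bullet> (x \<bullet>\<bullet> path_rev c)) \<bullet>\<bullet> (c \<bullet>\<bullet> (y \<bullet>\<bullet> z))) (d \<bullet>\<bullet> ((x \<bullet>\<bullet> y) \<bullet>\<bullet> z))"
proof -
  note p = pathin_join path_homotopic_refl pathin_rev
  let ?r = "path_rev c"
  have "path_homotopic X (?r \<bullet>\<bullet> (c \<bullet>\<bullet> (y \<bullet>\<bullet> z))) ((?r \<bullet>\<bullet> c) \<bullet>\<bullet> (y \<bullet>\<bullet> z))"
    by (rule rel_homotopic_sym, rule path_homotopic_assoc) (simp_all add: assms p)
  also have "path_homotopic X \<dots> ((\<lambda>_. c 1) \<bullet>\<bullet> (y \<bullet>\<bullet> z))"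
    by (rule path_homotopic_join[OF path_homotopic_rev_left]) (simp_all add: assms p)
  also have "path_homotopic X \<dots> (y \<bullet>\<bullet> z)"
    by (rule path_homotopic_const_left) (simp_all add: assms p)
  finally have 1: "path_homotopic X (?r \<bullet>\<bullet> (c \<bullet>\<bullet> (y \<bullet>\<bullet> z))) (y \<bullet>\<bullet> z)" .
  have "path_homotopic X ((x \<bullet>\<bullet> ?r) \<bullet>\<bullet> (c \<bullet>\<bullet> (y \<bullet>\<bullet> z))) (x \<bullet>\<bullet> (?r \<bullet>\<bullet> (c \<bullet>\<bullet> (y \<bullet>\<bullet> z))))"
    by (rule path_homotopic_assoc) (simp_all add: assms p)
  also have "path_homotopic X \<dots> (x \<bullet>\<bullet> (y \<bullet>\<bullet> z))"
    by (rule path_homotopic_join[OF _ 1]) (simp_all add: assms p)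
  also have "path_homotopic X \<dots> ((x \<bullet>\<bullet> y) \<bullet>\<bullet> z)"
    by (rule rel_homotopic_sym, rule path_homotopic_assoc) (simp_all add: assms p)
  finally have 2: "path_homotopic X ((x \<bullet>\<bullet> ?r) \<bullet>\<bullet> (c \<bullet>\<bullet> (y \<bullet>\<bullet> z))) ((x \<bullet>\<bullet> y) \<bullet>\<bullet> z)" .
  have "path_homotopic X ((d \<bullet>\<bullet> (x \<bullet>\<bullet> ?r)) \<bullet>\<bullet> (c \<bullet>\<bullet> (y \<bullet>\<bullet> z))) (d \<bullet>\<bullet> ((x \<bullet>\<bullet> ?r) \<bullet>\<bullet> (c \<bullet>\<bullet> (y \<bullet>\<bullet> z))))"
    by (rule path_homotopic_assoc) (simp_all add: assms p)
  also have "path_homotopic X \<dots> (d \<bullet>\<bullet> ((x \<bullet>\<bullet> y) \<bullet>\<bullet> z))"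
    by (rule path_homotopic_join[OF _ 2]) (simp_all add: assms p)
  finally show ?thesis .
qed

section \<open>Based operads with a covering action\<close>

locale based_operad =
  fixes Q :: "'q grp_operad" and D :: "'a operad"
    and act :: "nat \<Rightarrow> 'q \<Rightarrow> 'a \<Rightarrow> 'a" and \<eta> :: "nat \<Rightarrow> intervals \<Rightarrow> 'a"
  assumes covering: "covering_G_operad Q D act"
    and path_connected: "path_connected_operad D"
    and good: "good_basepoint_morphism D \<eta>"
begin

lemma G_operad: "topological_G_operad Q D act"
  using covering by (simp add: covering_G_operad_def)

lemma operad_D: "topological_operad D" and group_operad_Q: "group_operad Q"
  using G_operad by (simp_all add: topological_G_operad_def)

sublocale cov: covering_action "Space D k" "Grp Q k" "act k" for k
proof (intro covering_action.intro continuous_action.intro covering_action_axioms.intro)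
  show "group_action (Grp Q k) (Elems D k) (act k)"
    using G_operad unfolding topological_G_operad_def by blast
  show "continuous_map (Space D k) (Space D k) (act k g)" if "g \<in> carrier (Grp Q k)" for g
    using G_operad that unfolding topological_G_operad_def by blast
  show "\<exists>U. openin (Space D k) U \<and> x \<in> U \<and>
      (\<forall>g\<in>carrier (Grp Q k). g \<noteq> \<one>\<^bsub>Grp Q k\<^esub> \<longrightarrow> act k g ` U \<inter> U = {})" if "x \<in> Elems D k" for x
    using covering that unfolding covering_G_operad_def by (elim conjE) (drule spec, drule bspec)
qed

lemma group_Q: "group (Grp Q k)"
  by (rule cov.group_G)

lemma Q_mult_closed: "a \<in> carrier (Grp Q k) \<Longrightarrow> b \<in> carrier (Grp Q k) \<Longrightarrow> a \<otimes>\<^bsub>Grp Q k\<^esub> b \<in> carrier (Grp Q k)"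
  by (rule monoid.m_closed[OF group.is_monoid[OF group_Q]])

lemma Q_one_closed: "\<one>\<^bsub>Grp Q k\<^esub> \<in> carrier (Grp Q k)"
  by (rule monoid.one_closed[OF group.is_monoid[OF group_Q]])

lemma perm_hom: "gperm Q k \<in> hom (Grp Q k) (sym_grp k)"
  using group_operad_Q unfolding group_operad_def by blast

lemma perm_permutes: "q \<in> carrier (Grp Q k) \<Longrightarrow> gperm Q k q permutes {..<k}"
  using perm_hom[of k] by (auto simp: hom_def sym_grp_def)

lemma perm_mult:
  "a \<in> carrier (Grp Q k) \<Longrightarrow> b \<in> carrier (Grp Q k) \<Longrightarrow>
    gperm Q k (a \<otimes>\<^bsub>Grp Q k\<^esub> b) = gperm Q k b \<circ> gperm Q k a"
  using perm_hom[of k] by (auto simp: hom_def sym_grp_def)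

lemma perm_one: "gperm Q k \<one>\<^bsub>Grp Q k\<^esub> = id"
proof -
  let ?p = "gperm Q k \<one>\<^bsub>Grp Q k\<^esub>"
  have "?p \<circ> ?p = ?p"
    using perm_mult[OF Q_one_closed Q_one_closed, of k] group_Q[of k]
    by (simp add: Q_one_closed group.is_monoid monoid.l_one)
  moreover have "inj ?p" using perm_permutes[OF Q_one_closed] permutes_inj by blast
  ultimately show ?thesis by (metis (no_types) comp_apply eq_id_iff injD)
qed

lemma gcomp_closed:
  "a \<in> carrier (Grp Q (length ms)) \<Longrightarrow> bs \<in> ElemLists (discrete_operad Q) ms \<Longrightarrow>
    gcomp Q ms a bs \<in> carrier (Grp Q (sum_list ms))"
  using topological_operad_opcomp_closed[of "discrete_operad Q" a ms bs] group_operad_Q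
  by (simp add: group_operad_def)

lemma gperm_gcomp:
  assumes "a \<in> carrier (Grp Q (length ms))" "bs \<in> ElemLists (discrete_operad Q) ms"
  shows "gperm Q (sum_list ms) (gcomp Q ms a bs) =
    sym_comp ms (gperm Q (length ms) a) (map2 (gperm Q) ms bs)"
proof -
  have "operad_morphism (discrete_operad Q) sym_operad (gperm Q)"
    using group_operad_Q by (simp add: group_operad_def)
  then have "gperm Q (sum_list ms) (opcomp (discrete_operad Q) ms a bs) =
     opcomp sym_operad ms (gperm Q (length ms) a) (map2 (gperm Q) ms bs)"
    using assms unfolding operad_morphism_def by simp
  then show ?thesis by (simp add: sym_operad_def)
qed

lemma gcomp_mult:
  assumes "a \<in> carrier (Grp Q (length ms))" "a' \<in> carrier (Grp Q (length ms))"
    "bs \<in> ElemLists (discrete_operad Q) ms" "bs' \<in> ElemLists (discrete_operad Q) ms"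
  shows "gcomp Q ms (a \<otimes>\<^bsub>Grp Q (length ms)\<^esub> a')
          (map (\<lambda>i. bs ! i \<otimes>\<^bsub>Grp Q (ms ! i)\<^esub> bs' ! i) [0..<length ms]) =
        gcomp Q ms a bs \<otimes>\<^bsub>Grp Q (sum_list ms)\<^esub>
        gcomp Q (invperm (gperm Q (length ms) a) ms) a' (invperm (gperm Q (length ms) a) bs')"
  using group_operad_Q assms unfolding group_operad_def by simp

lemma gcomp_assoc:
  assumes "a \<in> carrier (Grp Q (length nss))" "bs \<in> ElemLists (discrete_operad Q) (map length nss)"
    "list_all2 (\<lambda>cs ns. cs \<in> ElemLists (discrete_operad Q) ns) css nss"
  shows "gcomp Q (concat nss) (gcomp Q (map length nss) a bs) (concat css) =
    gcomp Q (map sum_list nss) a (map (\<lambda>i. gcomp Q (nss ! i) (bs ! i) (css ! i)) [0..<length nss])"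
proof -
  have "topological_operad (discrete_operad Q)" using group_operad_Q by (simp add: group_operad_def)
  then show ?thesis using assms unfolding topological_operad_def by simp
qed

lemma opcomp_assoc:
  assumes "a \<in> Elems D (length nss)" "bs \<in> ElemLists D (map length nss)"
    "list_all2 (\<lambda>cs ns. cs \<in> ElemLists D ns) css nss"
  shows "opcomp D (concat nss) (opcomp D (map length nss) a bs) (concat css) =
    opcomp D (map sum_list nss) a (map (\<lambda>i. opcomp D (nss ! i) (bs ! i) (css ! i)) [0..<length nss])"
  using operad_D assms unfolding topological_operad_def by simp

lemma opcomp_act:
  assumes "\<sigma> \<in> carrier (Grp Q (length ms))" "\<tau>s \<in> ElemLists (discrete_operad Q) ms"
    "a \<in> Elems D (length ms)" "bs \<in> ElemLists D ms"
  shows "opcomp D ms (act (length ms) \<sigma> a) (map (\<lambda>i. act (ms ! i) (\<tau>s ! i) (bs ! i)) [0..<length ms]) =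
        act (sum_list ms) (gcomp Q ms \<sigma> \<tau>s)
          (opcomp D (invperm (gperm Q (length ms) \<sigma>) ms) a (invperm (gperm Q (length ms) \<sigma>) bs))"
  using G_operad assms unfolding topological_G_operad_def by simp

lemma gcomp_ones:
  "gcomp Q ms \<one>\<^bsub>Grp Q (length ms)\<^esub> (map (\<lambda>m. \<one>\<^bsub>Grp Q m\<^esub>) ms) = \<one>\<^bsub>Grp Q (sum_list ms)\<^esub>"
proof -
  let ?os = "map (\<lambda>m. \<one>\<^bsub>Grp Q m\<^esub>) ms" and ?o = "\<one>\<^bsub>Grp Q (length ms)\<^esub>"
  interpret G: group "Grp Q (sum_list ms)" by (rule group_Q)
  have os: "?os \<in> ElemLists (discrete_operad Q) ms" by (auto simp: ElemLists_iff Q_one_closed)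
  have "map (\<lambda>i. ?os ! i \<otimes>\<^bsub>Grp Q (ms ! i)\<^esub> ?os ! i) [0..<length ms] = ?os"
    by (rule nth_equalityI) (auto simp: monoid.l_one group.is_monoid[OF group_Q] Q_one_closed)
  moreover have "?o \<otimes>\<^bsub>Grp Q (length ms)\<^esub> ?o = ?o"
    by (simp add: monoid.l_one group.is_monoid[OF group_Q] Q_one_closed)
  ultimately have "gcomp Q ms ?o ?os = gcomp Q ms ?o ?os \<otimes>\<^bsub>Grp Q (sum_list ms)\<^esub> gcomp Q ms ?o ?os"
    using gcomp_mult[OF Q_one_closed Q_one_closed os os] by (simp add: perm_one)
  moreover have "gcomp Q ms ?o ?os \<in> carrier (Grp Q (sum_list ms))"
    by (rule gcomp_closed[OF Q_one_closed os])
  ultimately show ?thesis by (metis G.l_cancel_one')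
qed

end

lemma sum_list_concat: "sum_list (concat xss) = sum_list (map sum_list xss)"
  for xss :: "nat list list"
  by (induction xss) auto

context based_operad
begin

abbreviation e :: "nat \<Rightarrow> 'a" where "e k \<equiv> basept \<eta> k"

abbreviation \<delta> :: "nat list \<Rightarrow> real \<Rightarrow> 'a" where "\<delta> ms \<equiv> linear_path \<eta> ms"

abbreviation std :: "nat \<Rightarrow> intervals" where "std \<equiv> standard_intervals"

lemma \<eta>_morphism: "operad_morphism little_intervals_operad0 D \<eta>"
  using good by (simp add: good_basepoint_morphism_def)

lemma ordered_in_component:
  assumes "c \<in> ordered_intervals k"
  shows "path_component_of (little_intervals_space k) (std k) c"
  unfolding path_component_of_def
proof (intro exI conjI)
  have "pathin (ordered_space k) (interval_segment k (std k) c)"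
    by (rule pathin_interval_segment[OF standard_intervals_ordered assms])
  then show "pathin (little_intervals_space k) (interval_segment k (std k) c)"
    using ordered_intervals_subset[of k]
    unfolding ordered_space_def little_intervals_space_def pathin_subtopology by blast
qed (simp_all add: standard_intervals_ordered assms)

lemma ordered_in_operad0: "c \<in> ordered_intervals k \<Longrightarrow> c \<in> Elems little_intervals_operad0 k"
proof -
  assume c: "c \<in> ordered_intervals k"
  have "c \<in> topspace (little_intervals_space k)"
    using path_component_of_equiv ordered_in_component[OF c] by metis
  then show ?thesis
    using ordered_in_component[OF c] by (simp add: little_intervals_operad0_def)
qed

lemma continuous_\<eta>: "continuous_map (ordered_space k) (Space D k) (\<eta> k)"
proof -
  let ?P = "product_topology (\<lambda>_. euclidean) {..<k} :: intervals topology"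
  let ?C = "path_component_of_set (little_intervals_space k) (std k)"
  have "continuous_map (Space little_intervals_operad0 k) (Space D k) (\<eta> k)"
    using \<eta>_morphism unfolding operad_morphism_def by blast
  then have "continuous_map (subtopology ?P (little_intervals k \<inter> ?C)) (Space D k) (\<eta> k)"
    by (simp add: little_intervals_operad0_def little_intervals_space_def subtopology_subtopology)
  moreover have "ordered_intervals k \<subseteq> little_intervals k \<inter> ?C"
    using ordered_intervals_subset[of k] ordered_in_component by auto
  ultimately show ?thesis
    unfolding ordered_space_def by (rule continuous_map_from_subtopology_mono)
qed

lemma \<eta>_comp:
  assumes "c \<in> ordered_intervals (length ms)" "length ds = length ms"
    "\<And>i. i < length ms \<Longrightarrow> ds ! i \<in> ordered_intervals (ms ! i)"
  shows "\<eta> (sum_list ms) (little_intervals_comp ms c ds) =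
    opcomp D ms (\<eta> (length ms) c) (map2 \<eta> ms ds)"
proof -
  have "ds \<in> ElemLists little_intervals_operad0 ms"
    using assms ordered_in_operad0 by (simp add: ElemLists_iff)
  moreover have "c \<in> Elems little_intervals_operad0 (length ms)"
    using assms ordered_in_operad0 by blast
  ultimately have "\<eta> (sum_list ms) (opcomp little_intervals_operad0 ms c ds) =
      opcomp D ms (\<eta> (length ms) c) (map2 \<eta> ms ds)"
    using \<eta>_morphism unfolding operad_morphism_def by blast
  then show ?thesis by (simp add: little_intervals_operad0_def)
qed

lemma map2_\<eta>_std: "map2 \<eta> ms (map std ms) = map e ms"
  by (auto simp: basept_def intro: nth_equalityI)

lemma e_in: "e k \<in> Elems D k"
  using continuous_map_image_subset_topspace[OF continuous_\<eta>[of k]] standard_intervals_ordered[of k]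
  unfolding basept_def by fastforce

lemma e_1: "e 1 = opunit D"
proof -
  have "\<eta> 1 (opunit little_intervals_operad0) = opunit D"
    using \<eta>_morphism unfolding operad_morphism_def by blast
  moreover have "opunit little_intervals_operad0 = std 1"
    by (auto simp: little_intervals_operad0_def standard_intervals_def)
  ultimately show ?thesis by (simp add: basept_def)
qed

definition seg :: "nat list \<Rightarrow> real \<Rightarrow> intervals" where
  "seg ms = interval_segment (sum_list ms) (std (sum_list ms))
     (little_intervals_comp ms (std (length ms)) (map std ms))"

lemma \<delta>_seg: "\<delta> ms = \<eta> (sum_list ms) \<circ> seg ms"
  by (auto simp: linear_path_def seg_def)

lemma comp_std_ordered:
  "little_intervals_comp ms (std (length ms)) (map std ms) \<in> ordered_intervals (sum_list ms)"
  by (rule ordered_intervals_comp) (auto simp: standard_intervals_ordered)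

lemma pathin_seg: "pathin (ordered_space (sum_list ms)) (seg ms)"
  unfolding seg_def by (rule pathin_interval_segment[OF standard_intervals_ordered comp_std_ordered])

lemma seg_ends: "seg ms 0 = std (sum_list ms)"
  "seg ms 1 = little_intervals_comp ms (std (length ms)) (map std ms)"
  by (simp_all add: seg_def standard_intervals_ordered comp_std_ordered)

lemma seg_ordered: "t \<in> {0..1} \<Longrightarrow> seg ms t \<in> ordered_intervals (sum_list ms)"
  using pathin_seg[of ms] by (auto simp: pathin_def continuous_map_ordered_space)

lemma pathin_\<delta>: "pathin (Space D (sum_list ms)) (\<delta> ms)"
  unfolding \<delta>_seg by (rule pathin_compose[OF pathin_seg continuous_\<eta>])

lemma \<delta>_0: "\<delta> ms 0 = e (sum_list ms)"
  by (simp add: \<delta>_seg seg_ends basept_def)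

lemma \<delta>_1: "\<delta> ms 1 = opcomp D ms (e (length ms)) (map e ms)"
proof -
  have "\<delta> ms 1 = opcomp D ms (\<eta> (length ms) (std (length ms))) (map2 \<eta> ms (map std ms))"
    unfolding \<delta>_seg o_apply seg_ends by (rule \<eta>_comp) (auto simp: standard_intervals_ordered)
  then show ?thesis by (simp only: map2_\<eta>_std basept_def)
qed

lemma \<delta>_unit: "\<delta> [n] = (\<lambda>_. e n)"
  unfolding linear_path_def basept_def using little_intervals_comp_unit[of n]
  by (simp add: segment_same standard_intervals_ordered)

lemma \<delta>_units: "\<delta> (replicate n 1) = (\<lambda>_. e n)"
  unfolding linear_path_def basept_def using little_intervals_comp_units[of n]
  by (simp add: segment_same standard_intervals_ordered sum_list_replicate)

text \<open>The two ways from \<open>e\<close> to a three-fold composite are homotopic, because both lie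
  in the image of a convex set.\<close>

lemma \<delta>_assoc:
  "path_homotopic (Space D (sum_list (concat nss)))
    (\<delta> (concat nss) \<bullet>\<bullet> pointwise_comp D (concat nss) (\<delta> (map length nss)) (map (\<lambda>n _. e n) (concat nss)))
    (\<delta> (map sum_list nss) \<bullet>\<bullet> pointwise_comp D (map sum_list nss) (\<lambda>_. e (length nss)) (map \<delta> nss))"
proof -
  let ?N = "concat nss" and ?Ns = "map sum_list nss" and ?ms = "map length nss"
  let ?M = "sum_list ?N"
  have M: "sum_list ?Ns = ?M" and lenN: "sum_list ?ms = length ?N"
    by (simp_all add: sum_list_concat length_concat)
  let ?p = "\<lambda>t. little_intervals_comp ?N (seg ?ms t) (map std ?N)"
  let ?q = "\<lambda>t. little_intervals_comp ?Ns (std (length nss)) (map (\<lambda>d. d t) (map seg nss))"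
  have const: "pathin (ordered_space k) (\<lambda>_. std k)" for k
    by (simp add: standard_intervals_ordered)
  have "pathin (ordered_space ?M) (\<lambda>t. little_intervals_comp ?N (seg ?ms t) (map (\<lambda>d. d t) (map (\<lambda>n _. std n) ?N)))"
    by (rule pathin_little_intervals_comp) (use pathin_seg[of ?ms] lenN const in auto)
  then have p: "pathin (ordered_space ?M) ?p" by (simp add: o_def)
  have "pathin (ordered_space (sum_list ?Ns)) ?q"
    by (rule pathin_little_intervals_comp) (use pathin_seg const[of "length nss"] in auto)
  then have q: "pathin (ordered_space ?M) ?q" by (simp only: M)
  have p0: "seg ?N 1 = ?p 0" unfolding seg_ends lenN ..
  have m0: "map (\<lambda>d. d 0) (map seg nss) = map std ?Ns" by (simp add: seg_ends)
  have q0: "seg ?Ns 1 = ?q 0" unfolding seg_ends m0 length_map ..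
  have m1: "map (\<lambda>d. d 1) (map seg nss) =
      map (\<lambda>ns. little_intervals_comp ns (std (length ns)) (map std ns)) nss" by (simp add: seg_ends)
  have pq1: "?p 1 = ?q 1"
    unfolding m1 seg_ends length_map by (rule little_intervals_comp_assoc)
  have segNs: "pathin (ordered_space ?M) (seg ?Ns)" using pathin_seg[of ?Ns] by (simp only: M)
  have "path_homotopic (ordered_space ?M) (seg ?N \<bullet>\<bullet> ?p) (seg ?Ns \<bullet>\<bullet> ?q)"
    by (rule ordered_space_path_homotopic)
       (use pathin_join[OF pathin_seg p p0] pathin_join[OF segNs q q0] pq1 in \<open>simp_all add: seg_ends M\<close>)
  from rel_homotopic_postcompose[OF this continuous_\<eta>]
  have *: "path_homotopic (Space D ?M) ((\<eta> ?M \<circ> seg ?N) \<bullet>\<bullet> (\<eta> ?M \<circ> ?p)) ((\<eta> ?M \<circ> seg ?Ns) \<bullet>\<bullet> (\<eta> ?M \<circ> ?q))"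
    by (simp only: compose_join)
  have p': "path_homotopic (Space D ?M) (\<eta> ?M \<circ> ?p) (pointwise_comp D ?N (\<delta> ?ms) (map (\<lambda>n _. e n) ?N))"
  proof (rule path_homotopic_eqI[OF pathin_compose[OF p continuous_\<eta>]])
    fix t :: real assume t: "0 \<le> t" "t \<le> 1"
    have "\<eta> ?M (?p t) = opcomp D ?N (\<eta> (length ?N) (seg ?ms t)) (map2 \<eta> ?N (map std ?N))"
      by (rule \<eta>_comp) (use seg_ordered[of t ?ms] t lenN in \<open>auto simp: standard_intervals_ordered\<close>)
    also have "\<dots> = opcomp D ?N (\<delta> ?ms t) (map (\<lambda>g. g t) (map (\<lambda>n _. e n) ?N))"
      unfolding map2_\<eta>_std \<delta>_seg o_apply lenN by (simp add: o_def)
    finally show "(\<eta> ?M \<circ> ?p) t = pointwise_comp D ?N (\<delta> ?ms) (map (\<lambda>n _. e n) ?N) t"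
      by (simp add: pointwise_comp_def)
  qed
  have q': "path_homotopic (Space D ?M) (\<eta> ?M \<circ> ?q) (pointwise_comp D ?Ns (\<lambda>_. e (length nss)) (map \<delta> nss))"
  proof (rule path_homotopic_eqI[OF pathin_compose[OF q continuous_\<eta>]])
    fix t :: real assume t: "0 \<le> t" "t \<le> 1"
    have "\<eta> (sum_list ?Ns) (?q t) =
        opcomp D ?Ns (\<eta> (length ?Ns) (std (length nss))) (map2 \<eta> ?Ns (map (\<lambda>d. d t) (map seg nss)))"
      by (rule \<eta>_comp) (use t in \<open>auto simp: standard_intervals_ordered seg_ordered\<close>)
    also have "map2 \<eta> ?Ns (map (\<lambda>d. d t) (map seg nss)) = map (\<lambda>g. g t) (map \<delta> nss)"
      by (rule nth_equalityI) (auto simp: \<delta>_seg)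
    finally show "(\<eta> ?M \<circ> ?q) t = pointwise_comp D ?Ns (\<lambda>_. e (length nss)) (map \<delta> nss) t"
      by (simp add: pointwise_comp_def basept_def M)
  qed
  note d = p0[THEN arg_cong[where f = "\<eta> ?M"]] q0[THEN arg_cong[where f = "\<eta> ?M"]]
  have "path_homotopic (Space D ?M) (\<delta> ?N \<bullet>\<bullet> pointwise_comp D ?N (\<delta> ?ms) (map (\<lambda>n _. e n) ?N))
      ((\<eta> ?M \<circ> seg ?N) \<bullet>\<bullet> (\<eta> ?M \<circ> ?p))"
    unfolding \<delta>_seg[of ?N]
    by (rule path_homotopic_join[OF path_homotopic_refl rel_homotopic_sym[OF p']])
       (use path_homotopic_pathin(3)[OF p'] pathin_compose[OF pathin_seg[of ?N] continuous_\<eta>] d(1) in simp_all)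
  also note *
  also have "path_homotopic (Space D ?M) ((\<eta> ?M \<circ> seg ?Ns) \<bullet>\<bullet> (\<eta> ?M \<circ> ?q))
      (\<delta> ?Ns \<bullet>\<bullet> pointwise_comp D ?Ns (\<lambda>_. e (length nss)) (map \<delta> nss))"
    unfolding \<delta>_seg[of ?Ns] M
    by (rule path_homotopic_join[OF path_homotopic_refl q'])
       (use pathin_compose[OF segNs continuous_\<eta>] d(2) in simp_all)
  finally show ?thesis .
qed

section \<open>Loops in the orbit spaces and their lifts\<close>

abbreviation quo :: "nat \<Rightarrow> 'a \<Rightarrow> 'a set" where "quo \<equiv> op_orbit Q act"

abbreviation orb :: "nat \<Rightarrow> 'a set topology" where "orb \<equiv> op_orbit_space Q D act"

abbreviation bd :: "nat \<Rightarrow> (real \<Rightarrow> 'a) \<Rightarrow> 'q" where "bd \<equiv> path_bd Q act \<eta>"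

text \<open>Paths that start at the basepoint and whose projections are loops.\<close>

definition loop_lifts :: "nat \<Rightarrow> (real \<Rightarrow> 'a) set" where
  "loop_lifts k = {f. pathin (Space D k) f \<and> f 0 = e k \<and> (\<exists>q\<in>carrier (Grp Q k). f 1 = act k q (e k))}"

definition cls :: "nat \<Rightarrow> (real \<Rightarrow> 'a) \<Rightarrow> (real \<Rightarrow> 'a set) set" where
  "cls k f = path_class (orb k) (quo k \<circ> f)"

lemma quo_conv: "quo k = cov.quot k"
  by (auto simp: op_orbit_def)

lemma orb_conv: "orb k = cov.base k"
  by (simp add: op_orbit_space_def)

lemma continuous_quo: "continuous_map (Space D k) (orb k) (quo k)"
  unfolding quo_conv orb_conv by (rule cov.continuous_quot)

lemma quo_act [simp]: "x \<in> Elems D k \<Longrightarrow> q \<in> carrier (Grp Q k) \<Longrightarrow> quo k (act k q x) = quo k x"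
  unfolding quo_conv by (rule cov.quot_act)

lemma continuous_act: "q \<in> carrier (Grp Q k) \<Longrightarrow> continuous_map (Space D k) (Space D k) (act k q)"
  by (rule cov.continuous)

lemma pathin_in: "pathin X f \<Longrightarrow> t \<in> {0..1} \<Longrightarrow> f t \<in> topspace X"
  unfolding pathin_def using continuous_map_image_subset_topspace by fastforce

lemma bd_eq:
  assumes "q \<in> carrier (Grp Q k)" "f 1 = act k q (e k)"
  shows "bd k f = q"
  unfolding path_bd_def
proof (rule the_equality)
  show "q' = q" if "q' \<in> carrier (Grp Q k) \<and> f 1 = act k q' (e k)" for q'
    using cov.act_cancel[OF e_in, of q' k q] that assms by simp
qed (use assms in simp)

lemma loop_liftsD:
  assumes "f \<in> loop_lifts k"
  shows "pathin (Space D k) f" "f 0 = e k" "bd k f \<in> carrier (Grp Q k)" "f 1 = act k (bd k f) (e k)"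
proof -
  obtain q where "q \<in> carrier (Grp Q k)" "f 1 = act k q (e k)" "pathin (Space D k) f" "f 0 = e k"
    using assms unfolding loop_lifts_def by blast
  then show "pathin (Space D k) f" "f 0 = e k" "bd k f \<in> carrier (Grp Q k)" "f 1 = act k (bd k f) (e k)"
    using bd_eq[of q k f] by simp_all
qed

lemma loop_liftsI:
  "pathin (Space D k) f \<Longrightarrow> f 0 = e k \<Longrightarrow> q \<in> carrier (Grp Q k) \<Longrightarrow> f 1 = act k q (e k) \<Longrightarrow> f \<in> loop_lifts k"
  unfolding loop_lifts_def by blast

lemma loop_lifts_homotopic:
  assumes "f \<in> loop_lifts k" "path_homotopic (Space D k) f g"
  shows "g \<in> loop_lifts k" "bd k g = bd k f"
proof -
  note g = path_homotopic_pathin[OF assms(2)] and f = loop_liftsD[OF assms(1)]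
  show "g \<in> loop_lifts k" by (rule loop_liftsI[OF g(2) _ f(3)]) (use g f in simp_all)
  show "bd k g = bd k f" by (rule bd_eq[OF f(3)]) (use g f in simp)
qed

lemma pathin_quo: "pathin (Space D k) f \<Longrightarrow> pathin (orb k) (quo k \<circ> f)"
  by (rule pathin_compose[OF _ continuous_quo])

lemma cls_eqI: "path_homotopic (Space D k) f g \<Longrightarrow> cls k f = cls k g"
  unfolding cls_def by (rule path_class_eqI) (rule rel_homotopic_postcompose[OF _ continuous_quo])

lemma homotopic_lift:
  assumes "pathin (Space D k) f" "pathin (Space D k) g" "f 0 = g 0"
    "path_homotopic (orb k) (quo k \<circ> f) (quo k \<circ> g)"
  shows "path_homotopic (Space D k) f g"
  by (rule cov.rel_homotopic_lift[where ?b0.0 = 0])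
     (use assms in \<open>simp_all add: pathin_def quo_conv orb_conv connected_space_subtopology\<close>)

text \<open>Since homotopies lift, classes of loops in the orbit space and classes of their lifts are
  the same.\<close>

lemma cls_eq_iff:
  assumes "f \<in> loop_lifts k" "g \<in> loop_lifts k"
  shows "cls k f = cls k g \<longleftrightarrow> path_homotopic (Space D k) f g"
proof
  assume "cls k f = cls k g"
  then have "path_homotopic (orb k) (quo k \<circ> f) (quo k \<circ> g)"
    unfolding cls_def using path_class_eq_iff[OF pathin_quo] loop_liftsD(1)[OF assms(1)] by blast
  then show "path_homotopic (Space D k) f g"
    using homotopic_lift loop_liftsD[OF assms(1)] loop_liftsD[OF assms(2)] by simp
qed (rule cls_eqI)

lemma path_lifts_cls:
  assumes f: "f \<in> loop_lifts k"
  shows "path_lifts Q D act \<eta> k (cls k f) = {g. path_homotopic (Space D k) f g}"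
proof (intro Set.set_eqI iffI)
  fix g assume "g \<in> path_lifts Q D act \<eta> k (cls k f)"
  then have "pathin (Space D k) g" "g 0 = e k" "path_homotopic (orb k) (quo k \<circ> f) (quo k \<circ> g)"
    by (simp_all add: path_lifts_def cls_def path_class_eq)
  then show "g \<in> {g. path_homotopic (Space D k) f g}"
    using homotopic_lift loop_liftsD[OF f] by simp
next
  fix g assume "g \<in> {g. path_homotopic (Space D k) f g}"
  then have h: "path_homotopic (Space D k) f g" by simp
  note path_homotopic_pathin[OF h] rel_homotopic_postcompose[OF h continuous_quo]
  then show "g \<in> path_lifts Q D act \<eta> k (cls k f)"
    using loop_liftsD[OF f] by (simp add: path_lifts_def cls_def path_class_eq)
qed

abbreviation \<pi>1 :: "nat \<Rightarrow> (real \<Rightarrow> 'a set) set monoid" where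
  "\<pi>1 k \<equiv> fundamental_group (orb k) (quo k (e k))"

lemma cls_in: "f \<in> loop_lifts k \<Longrightarrow> cls k f \<in> carrier (\<pi>1 k)"
  unfolding cls_def
  by (rule fundamental_group_carrierI) (auto simp: pathin_quo loop_liftsD e_in)

lemma \<pi>1_cases:
  assumes "A \<in> carrier (\<pi>1 k)"
  obtains f where "f \<in> loop_lifts k" "A = cls k f"
proof -
  obtain F where F: "A = path_class (orb k) F" "pathin (orb k) F" "F 0 = quo k (e k)" "F 1 = quo k (e k)"
    using assms by (rule fundamental_group_carrierE)
  have c: "continuous_map (prod_topology unit_I unit_I) unit_I (\<lambda>z. fst z * snd z)"
  proof -
    have "continuous_on ({0..1} \<times> {0..1}) (\<lambda>z::real \<times> real. fst z * snd z)"
      by (intro continuous_intros)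
    then show ?thesis
      by (auto simp: continuous_map_in_subtopology mult_le_one simp flip: subtopology_Times)
  qed
  obtain f where f: "continuous_map unit_I (Space D k) f" "f 0 = e k"
    "\<And>t. t \<in> topspace unit_I \<Longrightarrow> cov.quot k (f t) = F t"
    by (rule cov.lift_contractible[OF F(2)[unfolded pathin_def orb_conv] c, of 0 "e k"])
       (use F(3) e_in in \<open>auto simp: quo_conv\<close>)
  have f1: "f 1 \<in> Elems D k" using f(1) pathin_in[of _ f 1] by (simp add: pathin_def)
  have "cov.quot k (e k) = cov.quot k (f 1)" using f(3)[of 1] F(4) by (simp add: quo_conv)
  then obtain q where "q \<in> carrier (Grp Q k)" "f 1 = act k q (e k)"
    using cov.quotE[OF _ e_in f1] by blast
  then have fl: "f \<in> loop_lifts k" using f by (auto intro: loop_liftsI simp: pathin_def)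
  moreover have "A = cls k f"
    unfolding F(1) cls_def
    by (rule path_class_eqI, rule path_homotopic_eqI[OF F(2)]) (use f(3) in \<open>simp add: quo_conv\<close>)
  ultimately show thesis by (rule that)
qed

lemma const_loop: "(\<lambda>_. e k) \<in> loop_lifts k" "bd k (\<lambda>_. e k) = \<one>\<^bsub>Grp Q k\<^esub>"
  using e_in Q_one_closed cov.act_one[OF e_in]
  by (auto intro!: loop_liftsI[of k _ "\<one>\<^bsub>Grp Q k\<^esub>"] bd_eq)

lemma \<pi>1_one: "\<one>\<^bsub>\<pi>1 k\<^esub> = cls k (\<lambda>_. e k)"
  by (simp add: fundamental_group_one cls_def o_def)

lemma pathin_act: "q \<in> carrier (Grp Q k) \<Longrightarrow> pathin (Space D k) f \<Longrightarrow> pathin (Space D k) (act k q \<circ> f)"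
  by (rule pathin_compose[OF _ continuous_act])

lemma cls_act:
  assumes "pathin (Space D k) f" "q \<in> carrier (Grp Q k)"
  shows "path_homotopic (orb k) (quo k \<circ> (act k q \<circ> f)) (quo k \<circ> f)"
  by (rule path_homotopic_eqI)
     (use assms pathin_in[OF assms(1)] in \<open>auto intro: pathin_quo pathin_act\<close>)

text \<open>The product of loops in terms of their lifts: the second lift is translated to the end of the first.\<close>

definition star :: "nat \<Rightarrow> (real \<Rightarrow> 'a) \<Rightarrow> (real \<Rightarrow> 'a) \<Rightarrow> real \<Rightarrow> 'a" where
  "star k f g = f \<bullet>\<bullet> (act k (bd k f) \<circ> g)"

lemma star_loop:
  assumes "f \<in> loop_lifts k" "g \<in> loop_lifts k"
  shows "star k f g \<in> loop_lifts k" "bd k (star k f g) = bd k f \<otimes>\<^bsub>Grp Q k\<^esub> bd k g"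
proof -
  note f = loop_liftsD[OF assms(1)] and g = loop_liftsD[OF assms(2)]
  have 1: "star k f g 1 = act k (bd k f \<otimes>\<^bsub>Grp Q k\<^esub> bd k g) (e k)"
    using f g by (simp add: star_def cov.act_mult[OF e_in])
  have m: "bd k f \<otimes>\<^bsub>Grp Q k\<^esub> bd k g \<in> carrier (Grp Q k)" using f g Q_mult_closed by blast
  have "pathin (Space D k) (star k f g)"
    unfolding star_def by (rule pathin_join) (use f g in \<open>auto intro: pathin_act\<close>)
  moreover have "star k f g 0 = e k" by (simp add: star_def f)
  ultimately show "star k f g \<in> loop_lifts k"
    using m 1 by (rule loop_liftsI)
  show "bd k (star k f g) = bd k f \<otimes>\<^bsub>Grp Q k\<^esub> bd k g"
    using m 1 by (rule bd_eq)
qed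

lemma \<pi>1_mult:
  assumes "f \<in> loop_lifts k" "g \<in> loop_lifts k"
  shows "cls k f \<otimes>\<^bsub>\<pi>1 k\<^esub> cls k g = cls k (star k f g)"
proof -
  note f = loop_liftsD[OF assms(1)] and g = loop_liftsD[OF assms(2)]
  have "cls k f \<otimes>\<^bsub>\<pi>1 k\<^esub> cls k g = path_class (orb k) ((quo k \<circ> f) \<bullet>\<bullet> (quo k \<circ> g))"
    unfolding cls_def
    by (rule fundamental_group_mult) (use f g e_in in \<open>auto simp: pathin_quo\<close>)
  also have "\<dots> = path_class (orb k) ((quo k \<circ> f) \<bullet>\<bullet> (quo k \<circ> (act k (bd k f) \<circ> g)))"
    by (rule path_class_eqI, rule path_homotopic_join)
       (use f g e_in in \<open>auto intro: path_homotopic_refl pathin_quo rel_homotopic_sym[OF cls_act]\<close>)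
  finally show ?thesis by (simp only: cls_def star_def compose_join)
qed

lemma group_\<pi>1: "group (\<pi>1 k)"
proof (rule group_fundamental_group)
  show "quo k (e k) \<in> topspace (orb k)"
    unfolding quo_conv orb_conv cov.topspace_base using e_in by blast
qed

lemma pi1_bd_cls:
  assumes "f \<in> loop_lifts k"
  shows "pi1_bd Q D act \<eta> k (cls k f) = bd k f"
proof -
  let ?S = "{g. path_homotopic (Space D k) f g}"
  have "bd k ` ?S = (\<lambda>_. bd k f) ` ?S"
    by (rule image_cong[OF refl]) (simp add: loop_lifts_homotopic(2)[OF assms])
  moreover have "f \<in> ?S" using path_homotopic_refl[OF loop_liftsD(1)[OF assms]] by simp
  ultimately have "bd k ` ?S = {bd k f}" by (simp only: image_constant)
  then show ?thesis unfolding pi1_bd_def path_lifts_cls[OF assms] by simp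
qed

end

lemma map2_concat:
  assumes "list_all2 (\<lambda>ys xs. length ys = length xs) yss xss"
  shows "map2 f (concat xss) (concat yss) = concat (map2 (map2 f) xss yss)"
  using assms by (induction rule: list_all2_induct) auto

lemma path_homotopic_const_both:
  assumes "pathin X f"
  shows "path_homotopic X f ((\<lambda>_. f 0) \<bullet>\<bullet> (f \<bullet>\<bullet> (\<lambda>_. f 1)))"
proof -
  have f1: "f 1 \<in> topspace X" by (rule path_finish_in_topspace[OF assms])
  have r: "path_homotopic X (f \<bullet>\<bullet> (\<lambda>_. f 1)) f"
    by (rule path_homotopic_const_right[OF assms refl])
  have p: "pathin X (f \<bullet>\<bullet> (\<lambda>_. f 1))"
    by (rule pathin_join[OF assms]) (simp_all add: f1)
  have "path_homotopic X ((\<lambda>_. f 0) \<bullet>\<bullet> (f \<bullet>\<bullet> (\<lambda>_. f 1))) (f \<bullet>\<bullet> (\<lambda>_. f 1))"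
    by (rule path_homotopic_const_left[OF p]) simp
  then have "path_homotopic X ((\<lambda>_. f 0) \<bullet>\<bullet> (f \<bullet>\<bullet> (\<lambda>_. f 1))) f"
    using r by (rule rel_homotopic_trans)
  then show ?thesis by (rule rel_homotopic_sym)
qed

lemma pointwise_comp_eq:
  assumes "f a = f' b" "length gs = length gs'" "\<And>i. i < length gs \<Longrightarrow> (gs ! i) a = (gs' ! i) b"
  shows "pointwise_comp C ms f gs a = pointwise_comp C ms f' gs' b"
proof -
  have "map (\<lambda>g. g a) gs = map (\<lambda>g. g b) gs'"
    by (rule nth_equalityI) (use assms in auto)
  then show ?thesis using assms(1) by (simp add: pointwise_comp_def)
qed

context based_operad
begin

lemma pathin_pointwise:
  assumes "pathin (Space D (length ms)) f" "length gs = length ms"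
    "\<And>i. i < length ms \<Longrightarrow> pathin (Space D (ms ! i)) (gs ! i)"
  shows "pathin (Space D (sum_list ms)) (pointwise_comp D ms f gs)"
  using assms unfolding pathin_def
  by (intro continuous_pointwise_comp[OF operad_D compact_unit_I])

lemma path_homotopic_pointwise:
  assumes "path_homotopic (Space D (length ms)) f f'" "length gs = length ms" "length gs' = length ms"
    "\<And>i. i < length ms \<Longrightarrow> path_homotopic (Space D (ms ! i)) (gs ! i) (gs' ! i)"
  shows "path_homotopic (Space D (sum_list ms)) (pointwise_comp D ms f gs) (pointwise_comp D ms f' gs')"
  by (rule rel_homotopic_pointwise_comp[OF operad_D compact_unit_I]) (use assms in auto)

text \<open>Applied to the joins of a linear path, a pointwise composite and another linear path that occur
  when one composite is plugged into another one.\<close>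

lemma pointwise_comp_three:
  assumes axc: "pathin (Space D (length ms)) a" "pathin (Space D (length ms)) x"
      "pathin (Space D (length ms)) c" "a 1 = x 0" "x 1 = c 0"
    and F: "path_homotopic (Space D (length ms)) F (a \<bullet>\<bullet> (x \<bullet>\<bullet> c))"
    and len: "length as = length ms" "length xs = length ms" "length cs = length ms" "length Gs = length ms"
    and axcs: "\<And>i. i < length ms \<Longrightarrow> pathin (Space D (ms ! i)) (as ! i)"
      "\<And>i. i < length ms \<Longrightarrow> pathin (Space D (ms ! i)) (xs ! i)"
      "\<And>i. i < length ms \<Longrightarrow> pathin (Space D (ms ! i)) (cs ! i)"
      "\<And>i. i < length ms \<Longrightarrow> (as ! i) 1 = (xs ! i) 0" "\<And>i. i < length ms \<Longrightarrow> (xs ! i) 1 = (cs ! i) 0"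
    and Gs: "\<And>i. i < length ms \<Longrightarrow>
      path_homotopic (Space D (ms ! i)) (Gs ! i) ((as ! i) \<bullet>\<bullet> ((xs ! i) \<bullet>\<bullet> (cs ! i)))"
  shows "path_homotopic (Space D (sum_list ms)) (pointwise_comp D ms F Gs)
      (pointwise_comp D ms a as \<bullet>\<bullet> (pointwise_comp D ms x xs \<bullet>\<bullet> pointwise_comp D ms c cs)) \<and>
    pathin (Space D (sum_list ms)) (pointwise_comp D ms a as) \<and>
    pathin (Space D (sum_list ms)) (pointwise_comp D ms x xs) \<and>
    pathin (Space D (sum_list ms)) (pointwise_comp D ms c cs) \<and>
    pointwise_comp D ms a as 1 = pointwise_comp D ms x xs 0 \<and>
    pointwise_comp D ms x xs 1 = pointwise_comp D ms c cs 0"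
proof (intro conjI)
  have "path_homotopic (Space D (sum_list ms)) (pointwise_comp D ms F Gs)
      (pointwise_comp D ms (a \<bullet>\<bullet> (x \<bullet>\<bullet> c)) (map2 (\<bullet>\<bullet>) as (map2 (\<bullet>\<bullet>) xs cs)))"
    by (rule path_homotopic_pointwise) (use F Gs len in auto)
  then show "path_homotopic (Space D (sum_list ms)) (pointwise_comp D ms F Gs)
      (pointwise_comp D ms a as \<bullet>\<bullet> (pointwise_comp D ms x xs \<bullet>\<bullet> pointwise_comp D ms c cs))"
    using len by (simp add: pointwise_comp_join)
  show "pathin (Space D (sum_list ms)) (pointwise_comp D ms a as)"
    "pathin (Space D (sum_list ms)) (pointwise_comp D ms x xs)"
    "pathin (Space D (sum_list ms)) (pointwise_comp D ms c cs)"
    by (rule pathin_pointwise; use axc axcs len in auto)+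
  show "pointwise_comp D ms a as 1 = pointwise_comp D ms x xs 0"
    "pointwise_comp D ms x xs 1 = pointwise_comp D ms c cs 0"
    by (rule pointwise_comp_eq; use axc axcs len in auto)+
qed

text \<open>The assumptions hold at a single parameter \<open>t\<close> only, so that constant paths at an endpoint of a
  path and maps of cubes are covered as well.\<close>

lemma pointwise_comp_act:
  assumes "\<sigma> \<in> carrier (Grp Q (length ms))" "\<tau>s \<in> ElemLists (discrete_operad Q) ms"
    "a t \<in> Elems D (length ms)" "length bs = length ms"
    "\<And>i. i < length ms \<Longrightarrow> (bs ! i) t \<in> Elems D (ms ! i)"
    "length bs' = length ms" "\<And>i. i < length ms \<Longrightarrow> (bs' ! i) t = act (ms ! i) (\<tau>s ! i) ((bs ! i) t)"
    "a' t = act (length ms) \<sigma> (a t)"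
  shows "pointwise_comp D ms a' bs' t =
    act (sum_list ms) (gcomp Q ms \<sigma> \<tau>s)
      (pointwise_comp D (invperm (gperm Q (length ms) \<sigma>) ms) a (invperm (gperm Q (length ms) \<sigma>) bs) t)"
proof -
  let ?p = "gperm Q (length ms) \<sigma>"
  let ?bt = "map (\<lambda>b. b t) bs"
  have "?bt \<in> ElemLists D ms" using assms by (simp add: ElemLists_iff)
  from opcomp_act[OF assms(1-3) this]
  have "opcomp D ms (act (length ms) \<sigma> (a t)) (map (\<lambda>i. act (ms ! i) (\<tau>s ! i) (?bt ! i)) [0..<length ms]) =
    act (sum_list ms) (gcomp Q ms \<sigma> \<tau>s) (opcomp D (invperm ?p ms) (a t) (invperm ?p ?bt))" .
  moreover have "map (\<lambda>i. act (ms ! i) (\<tau>s ! i) (?bt ! i)) [0..<length ms] = map (\<lambda>b. b t) bs'"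
    by (rule nth_equalityI) (use assms in auto)
  moreover have "invperm ?p ?bt = map (\<lambda>b. b t) (invperm ?p bs)"
    using perm_permutes[OF assms(1)] assms(4) by (simp add: map_invperm)
  ultimately show ?thesis using assms(8) by (simp add: pointwise_comp_def)
qed

section \<open>The operad structure on lifted loops\<close>

definition loop_lists :: "nat list \<Rightarrow> (real \<Rightarrow> 'a) list set" where
  "loop_lists ms = {gs. length gs = length ms \<and> (\<forall>i<length ms. gs ! i \<in> loop_lifts (ms ! i))}"

abbreviation sig :: "nat \<Rightarrow> (real \<Rightarrow> 'a) \<Rightarrow> nat \<Rightarrow> nat" where
  "sig k f \<equiv> gperm Q k (bd k f)"

abbreviation gbd :: "nat list \<Rightarrow> (real \<Rightarrow> 'a) \<Rightarrow> (real \<Rightarrow> 'a) list \<Rightarrow> 'q" where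
  "gbd ms f gs \<equiv> gcomp Q ms (bd (length ms) f) (map2 bd ms gs)"

text \<open>The lift that represents \<open>\<gamma>\<close> of the classes of \<open>f\<close> and \<open>gs\<close>.\<close>

definition gamma :: "nat list \<Rightarrow> (real \<Rightarrow> 'a) \<Rightarrow> (real \<Rightarrow> 'a) list \<Rightarrow> real \<Rightarrow> 'a" where
  "gamma ms f gs = \<delta> ms \<bullet>\<bullet> (pointwise_comp D ms f gs \<bullet>\<bullet>
     (act (sum_list ms) (gbd ms f gs) \<circ> path_rev (\<delta> (invperm (sig (length ms) f) ms))))"

lemma loop_listsD:
  assumes "gs \<in> loop_lists ms"
  shows "length gs = length ms" "i < length ms \<Longrightarrow> gs ! i \<in> loop_lifts (ms ! i)"
  using assms by (auto simp: loop_lists_def)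

lemma bds_in: "gs \<in> loop_lists ms \<Longrightarrow> map2 bd ms gs \<in> ElemLists (discrete_operad Q) ms"
  by (auto simp: ElemLists_iff loop_lists_def loop_liftsD)

lemma sig_permutes: "f \<in> loop_lifts k \<Longrightarrow> sig k f permutes {..<k}"
  by (rule perm_permutes[OF loop_liftsD(3)])

lemma gbd_in: "f \<in> loop_lifts (length ms) \<Longrightarrow> gs \<in> loop_lists ms \<Longrightarrow> gbd ms f gs \<in> carrier (Grp Q (sum_list ms))"
  by (rule gcomp_closed[OF loop_liftsD(3) bds_in])

lemma sum_sig: fixes ms :: "nat list" shows "f \<in> loop_lifts (length ms) \<Longrightarrow> sum_list (invperm (sig (length ms) f) ms) = sum_list ms"
  by (rule sum_list_invperm[OF sig_permutes])

text \<open>By equivariance the pointwise composite ends at a translate of \<open>\<gamma>(e\<^sub>k; \<dots>)\<close> for the permuted arities, which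
  is where the translate of the second linear path begins.\<close>

lemma gamma_parts:
  assumes f: "f \<in> loop_lifts (length ms)" and gs: "gs \<in> loop_lists ms"
  shows "pathin (Space D (sum_list ms)) (pointwise_comp D ms f gs)"
    "pathin (Space D (sum_list ms)) (act (sum_list ms) (gbd ms f gs) \<circ> path_rev (\<delta> (invperm (sig (length ms) f) ms)))"
    "\<delta> ms 1 = pointwise_comp D ms f gs 0"
    "pointwise_comp D ms f gs 1 = act (sum_list ms) (gbd ms f gs) (\<delta> (invperm (sig (length ms) f) ms) 1)"
proof -
  note F = loop_liftsD[OF f] and G = loop_listsD[OF gs]
  note G' = loop_liftsD[OF G(2)]
  show "pathin (Space D (sum_list ms)) (pointwise_comp D ms f gs)"
    by (rule pathin_pointwise) (use F G G' in auto)
  have "pathin (Space D (sum_list ms)) (\<delta> (invperm (sig (length ms) f) ms))"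
    using pathin_\<delta>[of "invperm (sig (length ms) f) ms"] by (simp only: sum_sig[OF f])
  then show "pathin (Space D (sum_list ms)) (act (sum_list ms) (gbd ms f gs) \<circ> path_rev (\<delta> (invperm (sig (length ms) f) ms)))"
    by (rule pathin_act[OF gbd_in[OF f gs] pathin_rev])
  have "map (\<lambda>g. g 0) gs = map e ms"
    by (rule nth_equalityI) (use G G' in auto)
  then show "\<delta> ms 1 = pointwise_comp D ms f gs 0"
    by (simp add: pointwise_comp_def F \<delta>_1)
  have "pointwise_comp D ms f gs 1 = act (sum_list ms) (gbd ms f gs)
      (pointwise_comp D (invperm (sig (length ms) f) ms) (\<lambda>_. e (length ms))
        (invperm (sig (length ms) f) (map (\<lambda>m _. e m) ms)) (1::real))"
    by (rule pointwise_comp_act[OF F(3) bds_in[OF gs]]) (use F G G' e_in in auto)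
  moreover have "invperm (sig (length ms) f) (map (\<lambda>m (_::real). e m) ms) =
      map (\<lambda>m _. e m) (invperm (sig (length ms) f) ms)"
    by (rule map_invperm[symmetric, OF sig_permutes[OF f]])
  ultimately show "pointwise_comp D ms f gs 1 =
      act (sum_list ms) (gbd ms f gs) (\<delta> (invperm (sig (length ms) f) ms) 1)"
    by (simp add: pointwise_comp_def \<delta>_1 o_def)
qed

lemma gamma_loop:
  assumes f: "f \<in> loop_lifts (length ms)" and gs: "gs \<in> loop_lists ms"
  shows "gamma ms f gs \<in> loop_lifts (sum_list ms)" "bd (sum_list ms) (gamma ms f gs) = gbd ms f gs"
proof -
  note P = gamma_parts[OF f gs]
  have "pathin (Space D (sum_list ms)) (gamma ms f gs)"
    unfolding gamma_def
    by (intro pathin_join pathin_\<delta> P(1,2)) (use P(3,4) in simp_all)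
  moreover have "gamma ms f gs 0 = e (sum_list ms)" by (simp add: gamma_def \<delta>_0)
  moreover have 1: "gamma ms f gs 1 = act (sum_list ms) (gbd ms f gs) (e (sum_list ms))"
    by (simp add: gamma_def \<delta>_0 sum_sig[OF f])
  ultimately show "gamma ms f gs \<in> loop_lifts (sum_list ms)"
    using loop_liftsI gbd_in[OF f gs] by blast
  show "bd (sum_list ms) (gamma ms f gs) = gbd ms f gs"
    using gbd_in[OF f gs] 1 by (rule bd_eq)
qed

lemma gamma_cong:
  assumes f: "f \<in> loop_lifts (length ms)" and gs: "gs \<in> loop_lists ms"
    and ff': "path_homotopic (Space D (length ms)) f f'"
    and gg': "length gs' = length ms" "\<And>i. i < length ms \<Longrightarrow> path_homotopic (Space D (ms ! i)) (gs ! i) (gs' ! i)"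
  shows "path_homotopic (Space D (sum_list ms)) (gamma ms f gs) (gamma ms f' gs')"
proof -
  note P = gamma_parts[OF f gs] and G = loop_listsD[OF gs]
  have bf: "bd (length ms) f' = bd (length ms) f" by (rule loop_lifts_homotopic(2)[OF f ff'])
  have "map2 bd ms gs' = map2 bd ms gs"
    by (rule nth_equalityI) (use G gg' in \<open>auto simp: loop_lifts_homotopic(2)[OF G(2)]\<close>)
  then have "gamma ms f' gs' = \<delta> ms \<bullet>\<bullet> (pointwise_comp D ms f' gs' \<bullet>\<bullet>
     (act (sum_list ms) (gbd ms f gs) \<circ> path_rev (\<delta> (invperm (sig (length ms) f) ms))))"
    by (simp add: gamma_def bf)
  moreover have "path_homotopic (Space D (sum_list ms)) (pointwise_comp D ms f gs) (pointwise_comp D ms f' gs')"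
    by (rule path_homotopic_pointwise) (use ff' gg' G in auto)
  ultimately show ?thesis
    unfolding gamma_def[of ms f gs] using P
    by (simp add: path_homotopic_join path_homotopic_refl pathin_\<delta>)
qed

abbreviation PO :: "(real \<Rightarrow> 'a set) set grp_operad" where
  "PO \<equiv> pi1_orbit_operad Q D act \<eta>"

lemma Grp_PO [simp]: "Grp PO k = \<pi>1 k"
  by (simp add: pi1_orbit_operad_def)

lemma gcomp_PO:
  assumes f: "f \<in> loop_lifts (length ms)" and gs: "gs \<in> loop_lists ms"
  shows "gcomp PO ms (cls (length ms) f) (map2 cls ms gs) = cls (sum_list ms) (gamma ms f gs)"
proof -
  note G = loop_listsD[OF gs]
  have "gcomp PO ms A Bs = (\<Union>f \<in> path_lifts Q D act \<eta> (length ms) A.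
        \<Union>gs \<in> listset (map2 (path_lifts Q D act \<eta>) ms Bs). cls (sum_list ms) (gamma ms f gs))" for A Bs
    by (simp add: pi1_orbit_operad_def cls_def gamma_def Let_def)
  moreover have "(\<Union>f' \<in> path_lifts Q D act \<eta> (length ms) (cls (length ms) f).
        \<Union>gs' \<in> listset (map2 (path_lifts Q D act \<eta>) ms (map2 cls ms gs)). cls (sum_list ms) (gamma ms f' gs'))
      = cls (sum_list ms) (gamma ms f gs)"
  proof (rule UN_const)
    show "f \<in> path_lifts Q D act \<eta> (length ms) (cls (length ms) f)"
      using f by (simp add: path_lifts_cls path_homotopic_refl loop_liftsD)
    show "gs \<in> listset (map2 (path_lifts Q D act \<eta>) ms (map2 cls ms gs))"
      using G by (auto simp: listset_iff path_lifts_cls path_homotopic_refl loop_liftsD)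
    fix f' gs' assume "f' \<in> path_lifts Q D act \<eta> (length ms) (cls (length ms) f)"
      and "gs' \<in> listset (map2 (path_lifts Q D act \<eta>) ms (map2 cls ms gs))"
    then have "path_homotopic (Space D (length ms)) f f'" "length gs' = length ms"
      "\<And>i. i < length ms \<Longrightarrow> path_homotopic (Space D (ms ! i)) (gs ! i) (gs' ! i)"
      using G f by (auto simp: listset_iff path_lifts_cls)
    from gamma_cong[OF f gs this] show "cls (sum_list ms) (gamma ms f' gs') = cls (sum_list ms) (gamma ms f gs)"
      by (rule cls_eqI[symmetric])
  qed
  ultimately show ?thesis by simp
qed

lemma PO_lists_cases:
  assumes "Bs \<in> ElemLists (discrete_operad PO) ms"
  obtains gs where "gs \<in> loop_lists ms" "Bs = map2 cls ms gs"
proof -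
  have B: "length Bs = length ms" "\<And>i. i < length ms \<Longrightarrow> Bs ! i \<in> carrier (\<pi>1 (ms ! i))"
    using assms by (auto simp: ElemLists_iff)
  define R where "R i g \<longleftrightarrow> (i < length ms \<longrightarrow> g \<in> loop_lifts (ms ! i) \<and> Bs ! i = cls (ms ! i) g)" for i g
  have "\<exists>g. R i g" for i
  proof (cases "i < length ms")
    case True
    show ?thesis by (rule \<pi>1_cases[OF B(2)[OF True]]) (auto simp: R_def)
  qed (simp add: R_def)
  then obtain g where "\<And>i. R i (g i)" by metis
  then have g: "g i \<in> loop_lifts (ms ! i)" "Bs ! i = cls (ms ! i) (g i)" if "i < length ms" for i
    using that by (auto simp: R_def)
  show thesis
  proof (rule that[of "map g [0..<length ms]"])
    show "map g [0..<length ms] \<in> loop_lists ms" using g by (simp add: loop_lists_def)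
    show "Bs = map2 cls ms (map g [0..<length ms])"
      by (rule nth_equalityI) (use B g in auto)
  qed
qed

lemma path_homotopic_act:
  "q \<in> carrier (Grp Q k) \<Longrightarrow> path_homotopic (Space D k) f g \<Longrightarrow> path_homotopic (Space D k) (act k q \<circ> f) (act k q \<circ> g)"
  by (rule rel_homotopic_postcompose[OF _ continuous_act])

lemma loop_lists_invperm:
  assumes "\<sigma> permutes {..<length ms}" "gs \<in> loop_lists ms"
  shows "invperm \<sigma> gs \<in> loop_lists (invperm \<sigma> ms)"
  using assms(2) inv_perm_less[OF assms(1)] by (auto simp: loop_lists_def invperm_nth)

subsection \<open>The interchange law\<close>

text \<open>Splitting the products on the left-hand side into their two factors gives \<open>\<delta>\<^sub>1\<close>, the pointwise composite of
  the first factors, the translated pointwise composite of the second factors, and a translate of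
  the reverse of the last linear path. The right-hand side has in addition, in the
  middle, a translated linear path and its reverse.\<close>

lemma gamma_star:
  assumes f: "f \<in> loop_lifts (length ms)" and f': "f' \<in> loop_lifts (length ms)"
    and gs: "gs \<in> loop_lists ms" and gs': "gs' \<in> loop_lists ms"
  shows "path_homotopic (Space D (sum_list ms))
    (gamma ms (star (length ms) f f') (map (\<lambda>i. star (ms ! i) (gs ! i) (gs' ! i)) [0..<length ms]))
    (star (sum_list ms) (gamma ms f gs) (gamma (invperm (sig (length ms) f) ms) f' (invperm (sig (length ms) f) gs')))"
proof -
  let ?k = "length ms" and ?m = "sum_list ms" and ?s = "sig (length ms) f"
  let ?ms = "invperm ?s ms" and ?gs' = "invperm ?s gs'"
  let ?X = "Space D ?m"
  note F = loop_liftsD[OF f] and F' = loop_liftsD[OF f'] and G = loop_listsD[OF gs] and G' = loop_listsD[OF gs']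
  note GL = loop_liftsD[OF G(2)] and GL' = loop_liftsD[OF G'(2)]
  have s: "?s permutes {..<?k}" by (rule sig_permutes[OF f])
  have f'l: "f' \<in> loop_lifts (length ?ms)" using f' by simp
  have gs'l: "?gs' \<in> loop_lists ?ms" by (rule loop_lists_invperm[OF s gs'])
  have m: "sum_list ?ms = ?m" by (rule sum_sig[OF f])
  define \<kappa> where "\<kappa> = gbd ms f gs"
  define \<kappa>' where "\<kappa>' = gbd ?ms f' ?gs'"
  have \<kappa>: "\<kappa> \<in> carrier (Grp Q ?m)" unfolding \<kappa>_def by (rule gbd_in[OF f gs])
  have \<kappa>': "\<kappa>' \<in> carrier (Grp Q ?m)" unfolding \<kappa>'_def using gbd_in[OF f'l gs'l] by (simp only: m)
  define S where "S = map (\<lambda>i. star (ms ! i) (gs ! i) (gs' ! i)) [0..<?k]"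
  have bS: "map2 bd ms S = map (\<lambda>i. map2 bd ms gs ! i \<otimes>\<^bsub>Grp Q (ms ! i)\<^esub> map2 bd ms gs' ! i) [0..<?k]"
    by (rule nth_equalityI) (use G G' in \<open>auto simp: S_def star_loop\<close>)
  have "gbd ms (star ?k f f') S = gcomp Q ms (bd ?k f \<otimes>\<^bsub>Grp Q ?k\<^esub> bd ?k f') (map2 bd ms S)"
    by (simp add: star_loop[OF f f'])
  also have "\<dots> = \<kappa> \<otimes>\<^bsub>Grp Q ?m\<^esub> gcomp Q ?ms (bd ?k f') (invperm ?s (map2 bd ms gs'))"
    unfolding bS \<kappa>_def by (rule gcomp_mult[OF F(3) F'(3) bds_in[OF gs] bds_in[OF gs']])
  also have "invperm ?s (map2 bd ms gs') = map2 bd ?ms ?gs'"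
    by (rule map2_invperm[symmetric]) (use s G' in auto)
  finally have \<kappa>2: "gbd ms (star ?k f f') S = \<kappa> \<otimes>\<^bsub>Grp Q ?m\<^esub> \<kappa>'"
    by (simp add: \<kappa>'_def)
  have sig2: "invperm (sig ?k (star ?k f f')) ms = invperm (sig (length ?ms) f') ?ms"
    using s sig_permutes[OF f'] by (simp add: star_loop[OF f f'] perm_mult F F' invperm_invperm)
  define z where "z = path_rev (\<delta> (invperm (sig (length ?ms) f') ?ms))"
  have "sum_list (invperm (sig (length ?ms) f') ?ms) = ?m" using sum_sig[OF f'l] m by simp
  then have z: "pathin ?X z"
    unfolding z_def using pathin_rev[OF pathin_\<delta>[of "invperm (sig (length ?ms) f') ?ms"]] by (simp only:)
  have left: "gamma ms (star ?k f f') S =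
      \<delta> ms \<bullet>\<bullet> (pointwise_comp D ms (star ?k f f') S \<bullet>\<bullet> (act ?m (\<kappa> \<otimes>\<^bsub>Grp Q ?m\<^esub> \<kappa>') \<circ> z))"
    unfolding gamma_def \<kappa>2 sig2 z_def ..
  have zz: "path_homotopic ?X (act ?m (\<kappa> \<otimes>\<^bsub>Grp Q ?m\<^esub> \<kappa>') \<circ> z) (act ?m \<kappa> \<circ> (act ?m \<kappa>' \<circ> z))"
    by (rule path_homotopic_eqI[OF pathin_act[OF Q_mult_closed[OF \<kappa> \<kappa>'] z]])
       (simp add: cov.act_mult[OF _ \<kappa> \<kappa>'] pathin_in[OF z])
  define T where "T = map (\<lambda>i. act (ms ! i) (bd (ms ! i) (gs ! i)) \<circ> gs' ! i) [0..<?k]"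
  have ST: "S = map2 (\<bullet>\<bullet>) gs T"
    by (rule nth_equalityI) (use G in \<open>auto simp: S_def T_def star_def\<close>)
  have PCS: "pointwise_comp D ms (star ?k f f') S =
      pointwise_comp D ms f gs \<bullet>\<bullet> pointwise_comp D ms (act ?k (bd ?k f) \<circ> f') T"
    unfolding ST star_def by (rule pointwise_comp_join) (use G in \<open>simp add: T_def\<close>)
  have pT: "pathin ?X (pointwise_comp D ms (act ?k (bd ?k f) \<circ> f') T)"
    by (rule pathin_pointwise)
       (use F F' GL GL' in \<open>auto simp: T_def intro!: pathin_act\<close>)
  have yy: "path_homotopic ?X (pointwise_comp D ms (act ?k (bd ?k f) \<circ> f') T)
      (act ?m \<kappa> \<circ> pointwise_comp D ?ms f' ?gs')"
  proof (rule path_homotopic_eqI[OF pT])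
    fix t :: real assume t: "0 \<le> t" "t \<le> 1"
    show "pointwise_comp D ms (act ?k (bd ?k f) \<circ> f') T t = (act ?m \<kappa> \<circ> pointwise_comp D ?ms f' ?gs') t"
      unfolding \<kappa>_def o_apply
      by (rule pointwise_comp_act[OF F(3) bds_in[OF gs]])
         (use t G G' pathin_in[OF F'(1)] pathin_in[OF GL'(1)] in \<open>auto simp: T_def\<close>)
  qed
  note P = gamma_parts[OF f gs, folded \<kappa>_def]
    and P' = gamma_parts[OF f'l gs'l, unfolded m, folded \<kappa>'_def]
  have "path_homotopic ?X (gamma ms (star ?k f f') S)
      (\<delta> ms \<bullet>\<bullet> ((pointwise_comp D ms f gs \<bullet>\<bullet> (act ?m \<kappa> \<circ> pointwise_comp D ?ms f' ?gs')) \<bullet>\<bullet> (act ?m \<kappa> \<circ> (act ?m \<kappa>' \<circ> z))))"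
  proof -
    have *: "pointwise_comp D ms f gs 1 = pointwise_comp D ms (act ?k (bd ?k f) \<circ> f') T 0"
      using P(4) P'(3) path_homotopic_pathin(3)[OF yy] by simp
    have "pathin ?X (pointwise_comp D ms f gs)" by (rule P(1))
    then have 1: "path_homotopic ?X (pointwise_comp D ms (star ?k f f') S)
      (pointwise_comp D ms f gs \<bullet>\<bullet> (act ?m \<kappa> \<circ> pointwise_comp D ?ms f' ?gs'))"
      unfolding PCS by (intro path_homotopic_join path_homotopic_refl yy *)
    have "pointwise_comp D ms (star ?k f f') S 1 = (act ?m (\<kappa> \<otimes>\<^bsub>Grp Q ?m\<^esub> \<kappa>') \<circ> z) 0"
      using path_homotopic_pathin(4)[OF yy] P'(4) path_homotopic_pathin(3)[OF zz]
      by (simp add: PCS z_def)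
    then have 2: "path_homotopic ?X (pointwise_comp D ms (star ?k f f') S \<bullet>\<bullet> (act ?m (\<kappa> \<otimes>\<^bsub>Grp Q ?m\<^esub> \<kappa>') \<circ> z))
      ((pointwise_comp D ms f gs \<bullet>\<bullet> (act ?m \<kappa> \<circ> pointwise_comp D ?ms f' ?gs')) \<bullet>\<bullet> (act ?m \<kappa> \<circ> (act ?m \<kappa>' \<circ> z)))"
      by (intro path_homotopic_join 1 zz)
    show ?thesis
      unfolding left
      by (intro path_homotopic_join 2 path_homotopic_refl pathin_\<delta>) (simp add: PCS P(3))
  qed
  also have "path_homotopic ?X \<dots> ((\<delta> ms \<bullet>\<bullet> (pointwise_comp D ms f gs \<bullet>\<bullet> path_rev (act ?m \<kappa> \<circ> \<delta> ?ms))) \<bullet>\<bullet>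
      ((act ?m \<kappa> \<circ> \<delta> ?ms) \<bullet>\<bullet> ((act ?m \<kappa> \<circ> pointwise_comp D ?ms f' ?gs') \<bullet>\<bullet> (act ?m \<kappa> \<circ> (act ?m \<kappa>' \<circ> z)))))"
  proof (rule rel_homotopic_sym, rule path_homotopic_cancel)
    show "pathin ?X (act ?m \<kappa> \<circ> \<delta> ?ms)"
      using pathin_act[OF \<kappa>, of "\<delta> ?ms"] pathin_\<delta>[of ?ms] by (simp only: m)
  qed (use P P' \<kappa> \<kappa>' z in \<open>auto simp: z_def pathin_\<delta> intro!: pathin_act\<close>)
  also have "\<dots> = star ?m (gamma ms f gs) (gamma ?ms f' ?gs')"
  proof -
    have gL: "gamma ms f gs =
        \<delta> ms \<bullet>\<bullet> (pointwise_comp D ms f gs \<bullet>\<bullet> path_rev (act ?m \<kappa> \<circ> \<delta> ?ms))"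
      by (simp only: gamma_def \<kappa>_def compose_rev)
    have gR: "act ?m \<kappa> \<circ> gamma ?ms f' ?gs' = (act ?m \<kappa> \<circ> \<delta> ?ms) \<bullet>\<bullet>
        ((act ?m \<kappa> \<circ> pointwise_comp D ?ms f' ?gs') \<bullet>\<bullet> (act ?m \<kappa> \<circ> (act ?m \<kappa>' \<circ> z)))"
      by (simp only: gamma_def m \<kappa>'_def compose_join z_def)
    show ?thesis
      unfolding star_def gamma_loop(2)[OF f gs] \<kappa>_def[symmetric] by (simp only: gL gR)
  qed
  finally show ?thesis unfolding S_def .
qed

end

section \<open>Discrete operads\<close>

lemma finite_product_discrete:
  assumes "finite I"
  shows "product_topology (\<lambda>i. discrete_topology (E i)) I = discrete_topology (PiE I E)"
proof -
  have "openin (product_topology (\<lambda>i. discrete_topology (E i)) I) {x}" if x: "x \<in> PiE I E" for x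
  proof -
    have "openin (product_topology (\<lambda>i. discrete_topology (E i)) I) (PiE I (\<lambda>i. {x i}))"
      using x by (auto simp: openin_PiE assms)
    moreover have "PiE I (\<lambda>i. {x i}) = {x}" using x by (intro PiE_singleton) (simp add: PiE_def)
    ultimately show ?thesis by simp
  qed
  then have "discrete_topology (PiE I E) = product_topology (\<lambda>i. discrete_topology (E i)) I"
    unfolding discrete_topology_unique by simp
  then show ?thesis by simp
qed

text \<open>Finite products of discrete spaces are discrete, so continuity of \<open>\<gamma>\<close> is automatic.\<close>

lemma topological_operad_discreteI:
  fixes C :: "('x, 'm) operad_scheme"
  assumes E: "\<And>n. Space C n = discrete_topology (E n)"
    and C0: "\<exists>x. E 0 = {x}" and unit: "opunit C \<in> E 1"
    and closed: "\<And>ms a bs. a \<in> E (length ms) \<Longrightarrow> bs \<in> ElemLists C ms \<Longrightarrow> opcomp C ms a bs \<in> E (sum_list ms)"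
    and assoc: "\<And>nss a bs css. a \<in> E (length nss) \<Longrightarrow> bs \<in> ElemLists C (map length nss) \<Longrightarrow>
        list_all2 (\<lambda>cs ns. cs \<in> ElemLists C ns) css nss \<Longrightarrow>
        opcomp C (concat nss) (opcomp C (map length nss) a bs) (concat css) =
        opcomp C (map sum_list nss) a (map (\<lambda>i. opcomp C (nss ! i) (bs ! i) (css ! i)) [0..<length nss])"
    and unit_left: "\<And>n a. a \<in> E n \<Longrightarrow> opcomp C [n] (opunit C) [a] = a"
    and unit_right: "\<And>n a. a \<in> E n \<Longrightarrow> opcomp C (replicate n 1) a (replicate n (opunit C)) = a"
  shows "topological_operad C"
  unfolding topological_operad_def
proof (intro conjI allI impI ballI)
  show "k_space (Space C n)" for n by (simp add: E k_space_discrete_topology)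
  show "Hausdorff_space (Space C n)" for n by (simp add: E)
  fix ms :: "nat list"
  let ?P = "prod_topology (Space C (length ms)) (product_topology (\<lambda>i. Space C (ms ! i)) {..<length ms})"
  have P: "?P = discrete_topology (E (length ms) \<times> (\<Pi>\<^sub>E i\<in>{..<length ms}. E (ms ! i)))"
    by (simp add: E finite_product_discrete prod_topology_discrete_topology)
  then have "kification ?P = ?P" by (simp add: kification_eq_self k_space_discrete_topology)
  moreover have "continuous_map ?P (Space C (sum_list ms)) (\<lambda>(a, b). opcomp C ms a (map b [0..<length ms]))"
  proof -
    have "opcomp C ms a (map b [0..<length ms]) \<in> E (sum_list ms)"
      if "a \<in> E (length ms)" "b \<in> (\<Pi>\<^sub>E i\<in>{..<length ms}. E (ms ! i))" for a b
      by (rule closed[OF that(1)]) (use that(2) in \<open>auto simp: ElemLists_iff E\<close>)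
    then show ?thesis unfolding P unfolding E by auto
  qed
  ultimately show "continuous_map (kification ?P) (Space C (sum_list ms))
      (\<lambda>(a, b). opcomp C ms a (map b [0..<length ms]))" by simp
qed (use E C0 unit assoc unit_left unit_right in auto)

section \<open>Associativity for lifted loops\<close>

context based_operad
begin

lemma concat_loop_lists:
  assumes "list_all2 (\<lambda>hs ns. hs \<in> loop_lists ns) hss nss"
  shows "concat hss \<in> loop_lists (concat nss)"
proof -
  have app: "xs @ ys \<in> loop_lists (ms @ ns)" if "xs \<in> loop_lists ms" "ys \<in> loop_lists ns" for xs ys ms ns
    using that unfolding loop_lists_def by (auto simp: nth_append)
  show ?thesis
    using assms by (induction rule: list_all2_induct) (auto simp: app, simp add: loop_lists_def)
qed

text \<open>If the pointwise composite itself is a join whose last part is a translate of a reversed path \<open>R\<close>, then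
  the first and the last part can be attached to the two linear paths.\<close>

lemma gamma_expand:
  assumes f: "f \<in> loop_lifts (length ms)" and gs: "gs \<in> loop_lists ms"
    and P: "path_homotopic (Space D (sum_list ms)) (pointwise_comp D ms f gs) (A \<bullet>\<bullet> (X \<bullet>\<bullet> C))"
    and A: "pathin (Space D (sum_list ms)) A" and X: "pathin (Space D (sum_list ms)) X"
    and C: "pathin (Space D (sum_list ms)) C" and ends: "A 1 = X 0" "X 1 = C 0"
    and CR: "path_homotopic (Space D (sum_list ms)) C (act (sum_list ms) (gbd ms f gs) \<circ> path_rev R)"
    and R: "pathin (Space D (sum_list ms)) R" "R 0 = \<delta> (invperm (sig (length ms) f) ms) 1"
  shows "path_homotopic (Space D (sum_list ms)) (gamma ms f gs)
    ((\<delta> ms \<bullet>\<bullet> A) \<bullet>\<bullet> (X \<bullet>\<bullet> (act (sum_list ms) (gbd ms f gs) \<circ>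
      path_rev (\<delta> (invperm (sig (length ms) f) ms) \<bullet>\<bullet> R))))"
proof -
  let ?X = "Space D (sum_list ms)"
  define \<kappa> where "\<kappa> = gbd ms f gs"
  define d where "d = \<delta> (invperm (sig (length ms) f) ms)"
  note G = gamma_parts[OF f gs, folded \<kappa>_def d_def]
  have \<kappa>: "\<kappa> \<in> carrier (Grp Q (sum_list ms))" unfolding \<kappa>_def by (rule gbd_in[OF f gs])
  define C' where "C' = act (sum_list ms) \<kappa> \<circ> path_rev R"
  define z where "z = act (sum_list ms) \<kappa> \<circ> path_rev d"
  have C': "path_homotopic ?X C C'" using CR by (simp only: \<kappa>_def C'_def)
  have C'p: "pathin ?X C'" by (rule path_homotopic_pathin(2)[OF C'])
  have C'0: "C' 0 = X 1" using path_homotopic_pathin(3)[OF C'] ends by simp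
  have Rd: "R 0 = d 1" using R(2) by (simp only: d_def)
  have C'1: "C' 1 = z 0" by (simp add: C'_def z_def Rd)
  have z: "pathin ?X z" unfolding z_def by (rule G(2))
  have A0: "\<delta> ms 1 = A 0" using path_homotopic_pathin(3)[OF P] G(3) by simp
  have "path_homotopic ?X (A \<bullet>\<bullet> (X \<bullet>\<bullet> C)) (A \<bullet>\<bullet> (X \<bullet>\<bullet> C'))"
    by (intro path_homotopic_join path_homotopic_refl A X C') (simp_all add: ends)
  with P have P': "path_homotopic ?X (pointwise_comp D ms f gs) (A \<bullet>\<bullet> (X \<bullet>\<bullet> C'))"
    by (rule rel_homotopic_trans)
  have P1: "pointwise_comp D ms f gs 1 = z 0"
    using G(4) by (simp add: z_def)
  have gm: "gamma ms f gs = \<delta> ms \<bullet>\<bullet> (pointwise_comp D ms f gs \<bullet>\<bullet> z)"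
    by (simp only: gamma_def z_def \<kappa>_def d_def)
  have cz: "C' \<bullet>\<bullet> z = act (sum_list ms) \<kappa> \<circ> path_rev (d \<bullet>\<bullet> R)"
    unfolding C'_def z_def compose_join[symmetric] path_rev_join[of d R, OF Rd[symmetric]] ..
  have "path_homotopic ?X (\<delta> ms \<bullet>\<bullet> (pointwise_comp D ms f gs \<bullet>\<bullet> z)) (\<delta> ms \<bullet>\<bullet> ((A \<bullet>\<bullet> (X \<bullet>\<bullet> C')) \<bullet>\<bullet> z))"
    by (intro path_homotopic_join path_homotopic_refl pathin_\<delta> P' z P1) (simp add: G(3))
  also have "path_homotopic ?X \<dots> ((\<delta> ms \<bullet>\<bullet> A) \<bullet>\<bullet> (X \<bullet>\<bullet> (C' \<bullet>\<bullet> z)))"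
    by (intro path_homotopic_shuffle pathin_\<delta> A X C'p z A0 ends C'0[symmetric] C'1)
  finally show ?thesis unfolding gm cz by (simp only: \<kappa>_def d_def)
qed

lemma pathin_\<delta>': "sum_list ms = m \<Longrightarrow> pathin (Space D m) (\<delta> ms)"
  using pathin_\<delta> by blast

text \<open>Expanding the inner composites on each side and padding the remaining paths with constant ones,
  both sides become joins of three parts as in \<open>gamma_expand\<close>. The middle parts are
  equal by associativity in \<open>D\<close>. The first parts are the two paths in \<open>\<delta>_assoc\<close> for the
  arities \<open>nss\<close>, and the last parts are translates of the reversed paths in \<open>\<delta>_assoc\<close> for the arities \<open>nss'\<close> that
  result from permuting \<open>nss\<close>.\<close>

lemma gamma_assoc:
  assumes f: "f \<in> loop_lifts (length nss)" and gs: "gs \<in> loop_lists (map length nss)"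
    and hss: "list_all2 (\<lambda>hs ns. hs \<in> loop_lists ns) hss nss"
  shows "path_homotopic (Space D (sum_list (concat nss)))
    (gamma (concat nss) (gamma (map length nss) f gs) (concat hss))
    (gamma (map sum_list nss) f (map (\<lambda>i. gamma (nss ! i) (gs ! i) (hss ! i)) [0..<length nss]))"
proof -
  let ?N = "concat nss" and ?ms = "map length nss" and ?Ns = "map sum_list nss" and ?k = "length nss"
  let ?M = "sum_list ?N" and ?X = "Space D (sum_list (concat nss))"
  define H where "H = concat hss"
  have lenN: "sum_list ?ms = length ?N" by (simp add: length_concat)
  have MN: "sum_list ?Ns = ?M" by (simp add: sum_list_concat)
  have lh: "length hss = ?k" and hi: "\<And>i. i < ?k \<Longrightarrow> hss ! i \<in> loop_lists (nss ! i)"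
    using hss by (auto simp: list_all2_conv_all_nth)
  note F = loop_liftsD[OF f] and G = loop_listsD[OF gs]
  have lg: "length gs = ?k" and gi: "\<And>i. i < ?k \<Longrightarrow> gs ! i \<in> loop_lifts (length (nss ! i))"
    using G by auto
  have fm: "f \<in> loop_lifts (length ?ms)" "f \<in> loop_lifts (length ?Ns)" using f by simp_all
  have H: "H \<in> loop_lists ?N" unfolding H_def by (rule concat_loop_lists[OF hss])
  note Hd = loop_listsD[OF H]
  define g1 where "g1 = gamma ?ms f gs"
  define \<pi> where "\<pi> = gbd ?ms f gs"
  have g1: "g1 \<in> loop_lifts (length ?N)" "bd (length ?N) g1 = \<pi>"
    using gamma_loop[OF fm(1) gs] unfolding g1_def \<pi>_def lenN by blast+
  have \<pi>: "\<pi> \<in> carrier (Grp Q (length ?N))" using loop_liftsD(3)[OF g1(1)] g1(2) by simp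
  define K where "K = map (\<lambda>i. gamma (nss ! i) (gs ! i) (hss ! i)) [0..<?k]"
  have K: "K \<in> loop_lists ?Ns"
    using gamma_loop(1)[OF gi hi] by (auto simp: K_def loop_lists_def)
  define \<kappa> where "\<kappa> = gbd ?N g1 H"
  have \<kappa>: "\<kappa> \<in> carrier (Grp Q ?M)" unfolding \<kappa>_def by (rule gbd_in[OF g1(1) H])
  have bK: "map2 bd ?Ns K = map (\<lambda>i. gcomp Q (nss ! i) (map2 bd ?ms gs ! i) (map2 (map2 bd) nss hss ! i)) [0..<?k]"
    by (rule nth_equalityI) (use lg lh in \<open>auto simp: K_def gamma_loop(2)[OF gi hi]\<close>)
  have \<kappa>2: "gbd ?Ns f K = \<kappa>"
  proof -
    have "list_all2 (\<lambda>cs ns. cs \<in> ElemLists (discrete_operad Q) ns) (map2 (map2 bd) nss hss) nss"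
      using bds_in[OF hi] lh by (auto simp: list_all2_conv_all_nth)
    from gcomp_assoc[OF F(3) bds_in[OF gs] this]
    have "gcomp Q ?N (gcomp Q ?ms (bd ?k f) (map2 bd ?ms gs)) (concat (map2 (map2 bd) nss hss)) = gbd ?Ns f K"
      unfolding bK by simp
    moreover have "concat (map2 (map2 bd) nss hss) = map2 bd ?N H"
      unfolding H_def by (rule map2_concat[symmetric])
        (use hi lh in \<open>auto simp: list_all2_conv_all_nth loop_lists_def\<close>)
    ultimately show ?thesis by (simp add: \<kappa>_def g1(2) \<pi>_def)
  qed
  \<comment> \<open>the arities after permuting the blocks of \<open>nss\<close> and the entries of each block\<close>
  define \<sigma> where "\<sigma> = sig ?k f"
  define \<tau>s where "\<tau>s = map2 (gperm Q) ?ms (map2 bd ?ms gs)"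
  define L where "L = map2 invperm \<tau>s nss"
  define nss' where "nss' = invperm \<sigma> L"
  have l\<tau>: "length \<tau>s = ?k" using lg by (simp add: \<tau>s_def)
  have \<tau>i: "\<tau>s ! i = sig (length (nss ! i)) (gs ! i)" if "i < ?k" for i
    using that lg by (simp add: \<tau>s_def)
  have \<sigma>: "\<sigma> permutes {..<?k}" unfolding \<sigma>_def by (rule sig_permutes[OF f])
  have \<tau>p: "\<tau>s ! i permutes {..<length (nss ! i)}" if "i < ?k" for i
    unfolding \<tau>i[OF that] by (rule sig_permutes[OF gi[OF that]])
  have sg1: "sig (length ?N) g1 = sym_comp ?ms \<sigma> \<tau>s"
    using gperm_gcomp[of "bd ?k f" ?ms "map2 bd ?ms gs"] F(3) bds_in[OF gs]
    unfolding g1(2) \<pi>_def \<sigma>_def \<tau>s_def lenN by simp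
  have N': "concat nss' = invperm (sig (length ?N) g1) ?N"
    unfolding sg1 nss'_def L_def
    by (rule invperm_concat[symmetric, OF \<sigma> l\<tau> \<tau>p]) (use sig_permutes[OF g1(1)] sg1 in auto)
  have lL: "length L = ?k" using l\<tau> by (simp add: L_def)
  have "map length L = ?ms" by (rule nth_equalityI) (use l\<tau> in \<open>auto simp: L_def\<close>)
  then have ms': "map length nss' = invperm \<sigma> ?ms"
    using map_invperm[of \<sigma> L length] \<sigma> lL by (simp add: nss'_def)
  have "map sum_list L = ?Ns"
    by (rule nth_equalityI) (use l\<tau> \<tau>p in \<open>auto simp: L_def sum_list_invperm\<close>)
  then have Ns': "map sum_list nss' = invperm \<sigma> ?Ns"
    using map_invperm[of \<sigma> L sum_list] \<sigma> lL by (simp add: nss'_def)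
  have ln': "length nss' = ?k" using lL by (simp add: nss'_def)
  have M': "sum_list (concat nss') = ?M" unfolding N' by (rule sum_sig[OF g1(1)])
  have MN': "sum_list (map sum_list nss') = ?M" using M' by (simp add: sum_list_concat)
  have lN': "sum_list (map length nss') = length ?N" "length (concat nss') = length ?N"
    using N' by (simp_all flip: length_concat)
  \<comment> \<open>here \<open>\<gamma>(f; gs)\<close> has three parts, and each entry \<open>h\<close> of \<open>H\<close> is padded by constant paths\<close>
  define as where "as = map (\<lambda>n (_::real). e n) ?N"
  define cs where "cs = map (\<lambda>h (_::real). h 1) H"
  define z1 where "z1 = act (length ?N) \<pi> \<circ> path_rev (\<delta> (invperm \<sigma> ?ms))"
  define A where "A = pointwise_comp D ?N (\<delta> ?ms) as"
  define X where "X = pointwise_comp D ?N (pointwise_comp D ?ms f gs) H"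
  define C where "C = pointwise_comp D ?N z1 cs"
  note P1 = gamma_parts[OF fm(1) gs, unfolded lenN, folded \<pi>_def]
  have g1_eq: "g1 = \<delta> ?ms \<bullet>\<bullet> (pointwise_comp D ?ms f gs \<bullet>\<bullet> z1)"
    by (simp add: g1_def gamma_def z1_def \<pi>_def \<sigma>_def lenN)
  note HL = loop_liftsD[OF Hd(2)]
  have left': "path_homotopic ?X (pointwise_comp D ?N g1 H) (A \<bullet>\<bullet> (X \<bullet>\<bullet> C)) \<and>
    pathin ?X A \<and> pathin ?X X \<and> pathin ?X C \<and> A 1 = X 0 \<and> X 1 = C 0"
    unfolding A_def X_def C_def
  proof (rule pointwise_comp_three[where Gs = H and F = g1])
    show "pathin (Space D (length ?N)) (\<delta> ?ms)" by (rule pathin_\<delta>'[OF lenN])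
    show "pathin (Space D (length ?N)) (pointwise_comp D ?ms f gs)" by (rule P1(1))
    show "pathin (Space D (length ?N)) z1" using P1(2) by (simp add: z1_def \<sigma>_def)
    show "path_homotopic (Space D (length ?N)) g1 (\<delta> ?ms \<bullet>\<bullet> (pointwise_comp D ?ms f gs \<bullet>\<bullet> z1))"
      using path_homotopic_refl[OF loop_liftsD(1)[OF g1(1)]] by (simp only: g1_eq[symmetric])
    show "\<delta> ?ms 1 = pointwise_comp D ?ms f gs 0" by (rule P1(3))
    show "pointwise_comp D ?ms f gs 1 = z1 0" using P1(4) by (simp add: z1_def \<sigma>_def)
    show "path_homotopic (Space D (?N ! i)) (H ! i) ((as ! i) \<bullet>\<bullet> ((H ! i) \<bullet>\<bullet> (cs ! i)))" if "i < length ?N" for i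
      using path_homotopic_const_both[OF HL(1)[OF that]] HL(2)[OF that] that Hd(1) by (simp add: as_def cs_def)
    show "pathin (Space D (?N ! i)) (cs ! i)" if "i < length ?N" for i
      using path_finish_in_topspace[OF HL(1)[OF that]] that Hd(1) by (simp add: cs_def)
  qed (use Hd HL in \<open>auto simp: as_def cs_def e_in\<close>)
  have left: "path_homotopic ?X (pointwise_comp D ?N g1 H) (A \<bullet>\<bullet> (X \<bullet>\<bullet> C))" "pathin ?X A" "pathin ?X X" "pathin ?X C"
    "A 1 = X 0" "X 1 = C 0"
    using left' by - (elim conjE, assumption)+
  \<comment> \<open>\<open>R\<close> and later \<open>R2\<close>: the second halves of the two paths in \<open>\<delta>_assoc\<close> for \<open>nss'\<close>\<close>
  define R where "R = pointwise_comp D (concat nss') (\<delta> (map length nss')) (map (\<lambda>n (_::real). e n) (concat nss'))"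
  have Rp: "pathin ?X R"
  proof -
    have "pathin (Space D (sum_list (concat nss'))) R"
      unfolding R_def by (rule pathin_pointwise) (use pathin_\<delta>'[OF lN'(1)] lN' in \<open>auto simp: e_in\<close>)
    then show ?thesis by (simp only: M')
  qed
  have R0: "R 0 = \<delta> (concat nss') 1"
    using lN' by (simp add: R_def pointwise_comp_def \<delta>_0 \<delta>_1 o_def)
  have CR: "path_homotopic ?X C (act ?M \<kappa> \<circ> path_rev R)"
  proof (rule path_homotopic_eqI[OF left(4)])
    fix t :: real assume t: "0 \<le> t" "t \<le> 1"
    have d: "pathin (Space D (length ?N)) (path_rev (\<delta> (invperm \<sigma> ?ms)))"
      using lN'(1) ms' by (intro pathin_rev pathin_\<delta>') simp
    have "C t = act ?M (gcomp Q ?N \<pi> (map2 bd ?N H)) (pointwise_comp D (invperm (gperm Q (length ?N) \<pi>) ?N)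
        (path_rev (\<delta> (invperm \<sigma> ?ms))) (invperm (gperm Q (length ?N) \<pi>) as) t)"
      unfolding C_def
      by (rule pointwise_comp_act[OF \<pi> bds_in[OF H]])
         (use t Hd HL pathin_in[OF d] in \<open>auto simp: z1_def as_def cs_def e_in\<close>)
    also have "invperm (gperm Q (length ?N) \<pi>) ?N = concat nss'" by (simp add: N' g1(2))
    also have "invperm (gperm Q (length ?N) \<pi>) as = map (\<lambda>n (_::real). e n) (concat nss')"
      using map_invperm[OF perm_permutes[OF \<pi>], of "\<lambda>n (_::real). e n"] by (simp add: as_def N' g1(2))
    also have "pointwise_comp D (concat nss') (path_rev (\<delta> (invperm \<sigma> ?ms))) (map (\<lambda>n (_::real). e n) (concat nss'))
        = path_rev R"
      unfolding R_def pointwise_comp_rev[symmetric] ms' by (simp add: path_rev_def o_def)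
    finally show "C t = (act ?M \<kappa> \<circ> path_rev R) t" by (simp add: \<kappa>_def g1(2))
  qed
  have L1: "path_homotopic ?X (gamma ?N g1 H)
     ((\<delta> ?N \<bullet>\<bullet> A) \<bullet>\<bullet> (X \<bullet>\<bullet> (act ?M \<kappa> \<circ> path_rev (\<delta> (concat nss') \<bullet>\<bullet> R))))"
    unfolding N' \<kappa>_def
    by (rule gamma_expand[OF g1(1) H left CR[unfolded \<kappa>_def] Rp]) (simp only: R0 N')
  \<comment> \<open>here each \<open>\<gamma>(g\<^sub>i; hs\<^sub>i)\<close> has three parts, and \<open>f\<close> is padded by constant paths\<close>
  define bs where "bs = map (\<lambda>i. pointwise_comp D (nss ! i) (gs ! i) (hss ! i)) [0..<?k]"
  define ks where "ks = map (\<lambda>i. act (sum_list (nss ! i)) (gbd (nss ! i) (gs ! i) (hss ! i)) \<circ>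
      path_rev (\<delta> (invperm (sig (length (nss ! i)) (gs ! i)) (nss ! i)))) [0..<?k]"
  define B where "B = pointwise_comp D ?Ns (\<lambda>_. e ?k) (map \<delta> nss)"
  define Y where "Y = pointwise_comp D ?Ns f bs"
  define E where "E = pointwise_comp D ?Ns (\<lambda>_. f 1) ks"
  note PI = gamma_parts[OF gi hi]
  have Ki: "K ! i = \<delta> (nss ! i) \<bullet>\<bullet> (bs ! i \<bullet>\<bullet> ks ! i)" if "i < ?k" for i
    using that by (simp add: K_def bs_def ks_def gamma_def)
  have right': "path_homotopic ?X (pointwise_comp D ?Ns f K) (B \<bullet>\<bullet> (Y \<bullet>\<bullet> E)) \<and>
    pathin ?X B \<and> pathin ?X Y \<and> pathin ?X E \<and> B 1 = Y 0 \<and> Y 1 = E 0"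
    unfolding B_def Y_def E_def MN[symmetric]
  proof (rule pointwise_comp_three[where Gs = K and F = f])
    show "path_homotopic (Space D (length ?Ns)) f ((\<lambda>_. e ?k) \<bullet>\<bullet> (f \<bullet>\<bullet> (\<lambda>_. f 1)))"
      using path_homotopic_const_both[OF F(1)] F(2) by simp
    show "path_homotopic (Space D (?Ns ! i)) (K ! i) ((map \<delta> nss ! i) \<bullet>\<bullet> ((bs ! i) \<bullet>\<bullet> (ks ! i)))"
      if "i < length ?Ns" for i
      using path_homotopic_refl[OF loop_liftsD(1)[OF loop_listsD(2)[OF K that]]] Ki[of i] that by simp
  qed (use F PI path_finish_in_topspace[OF F(1)] K in \<open>auto simp: bs_def ks_def K_def e_in pathin_\<delta>\<close>)
  have right: "path_homotopic ?X (pointwise_comp D ?Ns f K) (B \<bullet>\<bullet> (Y \<bullet>\<bullet> E))" "pathin ?X B" "pathin ?X Y" "pathin ?X E"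
    "B 1 = Y 0" "Y 1 = E 0"
    using right' by - (elim conjE, assumption)+
  define R2 where "R2 = pointwise_comp D (map sum_list nss') (\<lambda>_. e (length nss')) (map \<delta> nss')"
  have R2p: "pathin ?X R2"
  proof -
    have "pathin (Space D (sum_list (map sum_list nss'))) R2"
      unfolding R2_def by (rule pathin_pointwise) (auto simp: e_in pathin_\<delta>)
    then show ?thesis by (simp only: MN')
  qed
  have R20: "R2 0 = \<delta> (map sum_list nss') 1"
    by (simp add: R2_def pointwise_comp_def \<delta>_0 \<delta>_1 o_def)
  have ER: "path_homotopic ?X E (act ?M \<kappa> \<circ> path_rev R2)"
  proof (rule path_homotopic_eqI[OF right(4)])
    fix t :: real assume t: "0 \<le> t" "t \<le> 1"
    define ds where "ds = map (\<lambda>ns. path_rev (\<delta> ns)) L"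
    have di: "ds ! i = path_rev (\<delta> (invperm (sig (length (nss ! i)) (gs ! i)) (nss ! i)))" if "i < ?k" for i
      using that lL l\<tau> by (simp add: ds_def L_def \<tau>i)
    have dp: "pathin (Space D (?Ns ! i)) (ds ! i)" if "i < ?k" for i
      using that by (simp add: di pathin_rev pathin_\<delta>' sum_sig[OF gi])
    have "E t = act (sum_list ?Ns) (gcomp Q ?Ns (bd ?k f) (map2 bd ?Ns K)) (pointwise_comp D (invperm (gperm Q (length ?Ns) (bd ?k f)) ?Ns)
        (\<lambda>_. e ?k) (invperm (gperm Q (length ?Ns) (bd ?k f)) ds) t)"
      unfolding E_def
    proof (rule pointwise_comp_act)
      show "bd ?k f \<in> carrier (Grp Q (length ?Ns))" using F(3) by simp
      show "map2 bd ?Ns K \<in> ElemLists (discrete_operad Q) ?Ns" by (rule bds_in[OF K])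
      show "(ks ! i) t = act (?Ns ! i) (map2 bd ?Ns K ! i) ((ds ! i) t)" if "i < length ?Ns" for i
        using that di loop_listsD(1)[OF K] by (simp add: ks_def K_def gamma_loop(2)[OF gi hi])
    qed (use t F e_in dp pathin_in[OF dp] lL in \<open>auto simp: ks_def ds_def\<close>)
    also have "invperm (gperm Q (length ?Ns) (bd ?k f)) ?Ns = map sum_list nss'" by (simp add: Ns' \<sigma>_def)
    also have "invperm (gperm Q (length ?Ns) (bd ?k f)) ds = map path_rev (map \<delta> nss')"
      using map_invperm[of \<sigma> L "\<lambda>ns. path_rev (\<delta> ns)"] \<sigma> lL by (simp add: ds_def \<sigma>_def nss'_def o_def)
    also have "pointwise_comp D (map sum_list nss') (\<lambda>_. e ?k) (map path_rev (map \<delta> nss')) = path_rev R2"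
      unfolding R2_def pointwise_comp_rev[symmetric] ln' by (simp add: path_rev_def)
    finally show "E t = (act ?M \<kappa> \<circ> path_rev R2) t" using \<kappa>2 by (simp add: MN)
  qed
  have R1: "path_homotopic ?X (gamma ?Ns f K)
     ((\<delta> ?Ns \<bullet>\<bullet> B) \<bullet>\<bullet> (Y \<bullet>\<bullet> (act ?M \<kappa> \<circ> path_rev (\<delta> (map sum_list nss') \<bullet>\<bullet> R2))))"
    using gamma_expand[OF fm(2) K, unfolded MN \<kappa>2, OF right ER R2p] R20 by (simp add: Ns' \<sigma>_def)
  have XY: "path_homotopic ?X X Y"
  proof (rule path_homotopic_eqI[OF left(3)])
    fix t :: real assume t: "0 \<le> t" "t \<le> 1"
    have "opcomp D ?N (opcomp D ?ms (f t) (map (\<lambda>g. g t) gs)) (concat (map (map (\<lambda>h. h t)) hss)) =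
        opcomp D ?Ns (f t) (map (\<lambda>i. opcomp D (nss ! i) (map (\<lambda>g. g t) gs ! i) (map (map (\<lambda>h. h t)) hss ! i)) [0..<?k])"
    proof (rule opcomp_assoc)
      show "f t \<in> Elems D ?k" using pathin_in[OF F(1)] t by simp
      show "map (\<lambda>g. g t) gs \<in> ElemLists D ?ms"
        using pathin_in[OF loop_liftsD(1)[OF gi]] t lg by (simp add: ElemLists_iff)
      have "(hss ! i ! j) t \<in> Elems D (nss ! i ! j)" if "i < ?k" "j < length (nss ! i)" for i j
        using pathin_in[OF loop_liftsD(1)[OF loop_listsD(2)[OF hi]]] that t by simp
      then show "list_all2 (\<lambda>cs ns. cs \<in> ElemLists D ns) (map (map (\<lambda>h. h t)) hss) nss"
        using loop_listsD(1)[OF hi] lh by (auto simp: list_all2_conv_all_nth ElemLists_iff)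
    qed
    moreover have "map (\<lambda>i. opcomp D (nss ! i) (map (\<lambda>g. g t) gs ! i) (map (map (\<lambda>h. h t)) hss ! i)) [0..<?k] =
        map (\<lambda>g. g t) bs"
      by (rule nth_equalityI) (use lg lh in \<open>auto simp: bs_def pointwise_comp_def\<close>)
    ultimately show "X t = Y t"
      by (simp add: X_def Y_def pointwise_comp_def H_def map_concat)
  qed
  have d1: "path_homotopic ?X (\<delta> ?N \<bullet>\<bullet> A) (\<delta> ?Ns \<bullet>\<bullet> B)"
    unfolding A_def B_def as_def by (rule \<delta>_assoc)
  have d2: "path_homotopic ?X (\<delta> (concat nss') \<bullet>\<bullet> R) (\<delta> (map sum_list nss') \<bullet>\<bullet> R2)"
    using \<delta>_assoc[of nss'] unfolding R_def R2_def M' .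
  have X1: "X 1 = (act ?M \<kappa> \<circ> path_rev (\<delta> (concat nss') \<bullet>\<bullet> R)) 0"
    using left(6) path_homotopic_pathin(3)[OF CR] by simp
  have "path_homotopic ?X (gamma ?N g1 H)
      ((\<delta> ?Ns \<bullet>\<bullet> B) \<bullet>\<bullet> (Y \<bullet>\<bullet> (act ?M \<kappa> \<circ> path_rev (\<delta> (map sum_list nss') \<bullet>\<bullet> R2))))"
    by (rule rel_homotopic_trans[OF L1])
       (intro path_homotopic_join d1 XY path_homotopic_act[OF \<kappa>] path_homotopic_rev d2 X1, simp add: left(5))
  then show ?thesis
    using R1 unfolding g1_def[symmetric] H_def[symmetric] K_def[symmetric]
    by (blast intro: rel_homotopic_trans rel_homotopic_sym)
qed

section \<open>The group operad of the orbit spaces\<close>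

text \<open>For one argument, and below for units as arguments, the linear paths are constant.\<close>

lemma gamma_unit_left:
  assumes f: "f \<in> loop_lifts n"
  shows "path_homotopic (Space D n) (gamma [n] (\<lambda>_. e 1) [f]) f"
proof -
  have c: "(\<lambda>_. e 1) \<in> loop_lifts (length [n])" using const_loop(1)[of 1] by simp
  have fl: "[f] \<in> loop_lists [n]" using f by (simp add: loop_lists_def)
  have sn: "sum_list [n] = n" by simp
  let ?p = "pointwise_comp D [n] (\<lambda>_. e 1) [f]"
  note P = gamma_parts[OF c fl, unfolded sn]
  note F = loop_liftsD[OF f]
  have "bd (length [n]) (\<lambda>_. e 1) = \<one>\<^bsub>Grp Q (length [n])\<^esub>" using const_loop(2)[of 1] by simp
  then have sig: "invperm (sig (length [n]) (\<lambda>_. e 1)) [n] = [n]" by (simp only: perm_one invperm_id)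
  define q where "q = gbd [n] (\<lambda>_. e 1) [f]"
  have g: "gamma [n] (\<lambda>_. e 1) [f] = (\<lambda>_. e n) \<bullet>\<bullet> (?p \<bullet>\<bullet> (\<lambda>_. act n q (e n)))"
    unfolding gamma_def sig \<delta>_unit sn q_def by (simp add: path_rev_def o_def)
  have p1: "?p 1 = act n q (e n)" using P(4) unfolding sig \<delta>_unit q_def .
  have p0: "?p 0 = e n" using P(3)[symmetric] unfolding \<delta>_unit .
  have r: "path_homotopic (Space D n) (?p \<bullet>\<bullet> (\<lambda>_. act n q (e n))) ?p"
    by (rule path_homotopic_const_right[OF P(1) p1])
  have "path_homotopic (Space D n) ((\<lambda>_. e n) \<bullet>\<bullet> (?p \<bullet>\<bullet> (\<lambda>_. act n q (e n)))) (?p \<bullet>\<bullet> (\<lambda>_. act n q (e n)))"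
    by (rule path_homotopic_const_left[OF path_homotopic_pathin(1)[OF r]]) (simp only: join_simps p0)
  also note r
  also have "path_homotopic (Space D n) ?p f"
  proof (rule path_homotopic_eqI[OF P(1)])
    fix t :: real assume "0 \<le> t" "t \<le> 1"
    then have "f t \<in> Elems D n" using pathin_in[OF F(1)] by simp
    then show "?p t = f t"
      using operad_D unfolding topological_operad_def pointwise_comp_def e_1 by simp
  qed
  finally show ?thesis unfolding g .
qed

lemma gamma_unit_right:
  assumes f: "f \<in> loop_lifts n"
  shows "path_homotopic (Space D n) (gamma (replicate n 1) f (replicate n (\<lambda>_. e 1))) f"
proof -
  let ?u = "replicate n (1::nat)" and ?c = "replicate n (\<lambda>_::real. e 1)"
  have fl: "f \<in> loop_lifts (length ?u)" using f by simp
  have c: "?c \<in> loop_lists ?u" using const_loop(1)[of 1] by (simp add: loop_lists_def)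
  have sn: "sum_list ?u = n" by (simp add: sum_list_replicate)
  let ?p = "pointwise_comp D ?u f ?c"
  note P = gamma_parts[OF fl c, unfolded sn]
  note F = loop_liftsD[OF f]
  have sig: "invperm (sig (length ?u) f) ?u = ?u"
    by (rule nth_equalityI) (use inv_perm_less[OF sig_permutes[OF f]] in \<open>auto simp: invperm_nth\<close>)
  define q where "q = gbd ?u f ?c"
  have g: "gamma ?u f ?c = (\<lambda>_. e n) \<bullet>\<bullet> (?p \<bullet>\<bullet> (\<lambda>_. act n q (e n)))"
    unfolding gamma_def sig \<delta>_units sn q_def by (simp add: path_rev_def o_def)
  have p1: "?p 1 = act n q (e n)" using P(4) unfolding sig \<delta>_units q_def .
  have p0: "?p 0 = e n" using P(3)[symmetric] unfolding \<delta>_units .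
  have r: "path_homotopic (Space D n) (?p \<bullet>\<bullet> (\<lambda>_. act n q (e n))) ?p"
    by (rule path_homotopic_const_right[OF P(1) p1])
  have "path_homotopic (Space D n) ((\<lambda>_. e n) \<bullet>\<bullet> (?p \<bullet>\<bullet> (\<lambda>_. act n q (e n)))) (?p \<bullet>\<bullet> (\<lambda>_. act n q (e n)))"
    by (rule path_homotopic_const_left[OF path_homotopic_pathin(1)[OF r]]) (simp only: join_simps p0)
  also note r
  also have "path_homotopic (Space D n) ?p f"
  proof (rule path_homotopic_eqI[OF P(1)])
    fix t :: real assume "0 \<le> t" "t \<le> 1"
    then have "f t \<in> Elems D n" using pathin_in[OF F(1)] by simp
    then have "opcomp D ?u (f t) (replicate n (opunit D)) = f t"
      using operad_D unfolding topological_operad_def by (elim conjE) simp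
    then show "?p t = f t" by (simp add: pointwise_comp_def e_1 del: One_nat_def)
  qed
  finally show ?thesis unfolding g .
qed

lemma Elems_0: "Elems D 0 = {e 0}"
  using operad_D e_in[of 0] unfolding topological_operad_def by (metis singletonD)

lemma \<pi>1_0: "carrier (\<pi>1 0) = {cls 0 (\<lambda>_. e 0)}"
proof (intro equalityI subsetI)
  fix A assume "A \<in> carrier (\<pi>1 0)"
  then obtain f where f: "f \<in> loop_lifts 0" "A = cls 0 f" by (rule \<pi>1_cases)
  have "path_homotopic (Space D 0) f (\<lambda>_. e 0)"
    by (rule path_homotopic_eqI[OF loop_liftsD(1)[OF f(1)]])
       (use pathin_in[OF loop_liftsD(1)[OF f(1)]] Elems_0 in auto)
  then show "A \<in> {cls 0 (\<lambda>_. e 0)}" unfolding f(2) by (simp add: cls_eqI)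
next
  fix A assume "A \<in> {cls 0 (\<lambda>_. e 0)}"
  then show "A \<in> carrier (\<pi>1 0)" by (simp add: cls_in[OF const_loop(1)])
qed

lemma gperm_PO: "f \<in> loop_lifts k \<Longrightarrow> gperm PO k (cls k f) = sig k f"
  by (simp add: pi1_orbit_operad_def pi1_bd_cls)

text \<open>Each law holds for the representing lifts up to homotopy.\<close>

lemma topological_operad_PO: "topological_operad (discrete_operad PO)"
proof (rule topological_operad_discreteI[where E = "\<lambda>n. carrier (\<pi>1 n)"])
  show "Space (discrete_operad PO) n = discrete_topology (carrier (\<pi>1 n))" for n
    by (simp add: discrete_operad_def)
  show "\<exists>x. carrier (\<pi>1 0) = {x}" by (rule exI, rule \<pi>1_0)
  have one: "opunit (discrete_operad PO) = cls 1 (\<lambda>_. e 1)" by (simp add: \<pi>1_one del: One_nat_def)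
  show "opunit (discrete_operad PO) \<in> carrier (\<pi>1 1)" unfolding one by (rule cls_in[OF const_loop(1)])
  show "opcomp (discrete_operad PO) ms A Bs \<in> carrier (\<pi>1 (sum_list ms))"
    if A: "A \<in> carrier (\<pi>1 (length ms))" and Bs: "Bs \<in> ElemLists (discrete_operad PO) ms" for ms A Bs
  proof -
    obtain f where f: "f \<in> loop_lifts (length ms)" "A = cls (length ms) f" using A by (rule \<pi>1_cases)
    obtain gs where gs: "gs \<in> loop_lists ms" "Bs = map2 cls ms gs" using Bs by (rule PO_lists_cases)
    show ?thesis
      using f gs by (simp add: gcomp_PO cls_in gamma_loop)
  qed
  show "opcomp (discrete_operad PO) [n] (opunit (discrete_operad PO)) [A] = A"
    if A: "A \<in> carrier (\<pi>1 n)" for n A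
  proof -
    obtain f where f: "f \<in> loop_lifts n" "A = cls n f" using A by (rule \<pi>1_cases)
    have "gcomp PO [n] (cls (length [n]) (\<lambda>_. e 1)) (map2 cls [n] [f]) = cls (sum_list [n]) (gamma [n] (\<lambda>_. e 1) [f])"
      by (rule gcomp_PO) (use f const_loop(1)[of 1] in \<open>simp_all add: loop_lists_def\<close>)
    then show ?thesis
      unfolding one f(2) using cls_eqI[OF gamma_unit_left[OF f(1)]] by simp
  qed
  show "opcomp (discrete_operad PO) (replicate n 1) A (replicate n (opunit (discrete_operad PO))) = A"
    if A: "A \<in> carrier (\<pi>1 n)" for n A
  proof -
    obtain f where f: "f \<in> loop_lifts n" "A = cls n f" using A by (rule \<pi>1_cases)
    have "gcomp PO (replicate n 1) (cls (length (replicate n (1::nat))) f) (map2 cls (replicate n 1) (replicate n (\<lambda>_. e 1)))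
        = cls (sum_list (replicate n 1)) (gamma (replicate n 1) f (replicate n (\<lambda>_. e 1)))"
      by (rule gcomp_PO) (use f const_loop(1)[of 1] in \<open>simp_all add: loop_lists_def\<close>)
    moreover have "map2 cls (replicate n 1) (replicate n (\<lambda>_. e 1)) = replicate n (cls 1 (\<lambda>_. e 1))"
      by (auto intro: nth_equalityI)
    ultimately show ?thesis
      unfolding one f(2) using cls_eqI[OF gamma_unit_right[OF f(1)]]
      by (simp add: sum_list_replicate del: One_nat_def)
  qed
  show "opcomp (discrete_operad PO) (concat nss) (opcomp (discrete_operad PO) (map length nss) A Bs) (concat Css) =
        opcomp (discrete_operad PO) (map sum_list nss) A
          (map (\<lambda>i. opcomp (discrete_operad PO) (nss ! i) (Bs ! i) (Css ! i)) [0..<length nss])"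
    if A: "A \<in> carrier (\<pi>1 (length nss))" and Bs: "Bs \<in> ElemLists (discrete_operad PO) (map length nss)"
      and Css: "list_all2 (\<lambda>cs ns. cs \<in> ElemLists (discrete_operad PO) ns) Css nss" for nss A Bs Css
  proof -
    obtain f where f: "f \<in> loop_lifts (length nss)" "A = cls (length nss) f" using A by (rule \<pi>1_cases)
    obtain gs where gs: "gs \<in> loop_lists (map length nss)" "Bs = map2 cls (map length nss) gs"
      using Bs by (rule PO_lists_cases)
    have "\<exists>hs. i < length nss \<longrightarrow> hs \<in> loop_lists (nss ! i) \<and> Css ! i = map2 cls (nss ! i) hs" for i
    proof (cases "i < length nss")
      case True
      then have "Css ! i \<in> ElemLists (discrete_operad PO) (nss ! i)"
        using Css by (simp add: list_all2_conv_all_nth)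
      then show ?thesis by (rule PO_lists_cases) blast
    qed simp
    then obtain hf where hf: "\<And>i. i < length nss \<Longrightarrow> hf i \<in> loop_lists (nss ! i) \<and> Css ! i = map2 cls (nss ! i) (hf i)"
      by metis
    define hss where "hss = map hf [0..<length nss]"
    have lC: "length Css = length nss" using Css by (rule list_all2_lengthD)
    have hss: "list_all2 (\<lambda>hs ns. hs \<in> loop_lists ns) hss nss"
      using hf by (simp add: hss_def list_all2_conv_all_nth)
    have "Css = map2 (map2 cls) nss hss"
      by (rule nth_equalityI) (use lC hf in \<open>auto simp: hss_def\<close>)
    moreover have "concat (map2 (map2 cls) nss hss) = map2 cls (concat nss) (concat hss)"
      by (rule map2_concat[symmetric]) (use hf in \<open>auto simp: hss_def list_all2_conv_all_nth loop_lists_def\<close>)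
    ultimately have cC: "concat Css = map2 cls (concat nss) (concat hss)" by simp
    note H = concat_loop_lists[OF hss]
    have fm: "f \<in> loop_lifts (length (map length nss))" "f \<in> loop_lifts (length (map sum_list nss))"
      using f by simp_all
    have lenN: "sum_list (map length nss) = length (concat nss)" by (simp add: length_concat)
    have g1: "gamma (map length nss) f gs \<in> loop_lifts (length (concat nss))"
      using gamma_loop(1)[OF fm(1) gs(1)] by (simp only: lenN)
    have left: "gcomp PO (concat nss) (gcomp PO (map length nss) A Bs) (concat Css) =
        cls (sum_list (concat nss)) (gamma (concat nss) (gamma (map length nss) f gs) (concat hss))"
      using gcomp_PO[OF fm(1) gs(1)] gcomp_PO[OF g1 H] unfolding f(2) gs(2) cC lenN length_map by simp
    define K where "K = map (\<lambda>i. gamma (nss ! i) (gs ! i) (hss ! i)) [0..<length nss]"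
    have lg: "length gs = length nss" using loop_listsD(1)[OF gs(1)] by simp
    have gi: "gs ! i \<in> loop_lifts (length (nss ! i))" "hss ! i \<in> loop_lists (nss ! i)" if "i < length nss" for i
      using loop_listsD(2)[OF gs(1), of i] that hf by (simp_all add: hss_def)
    have K: "K \<in> loop_lists (map sum_list nss)"
      using gamma_loop(1)[OF gi] by (auto simp: K_def loop_lists_def)
    have "map (\<lambda>i. gcomp PO (nss ! i) (Bs ! i) (Css ! i)) [0..<length nss] = map2 cls (map sum_list nss) K"
    proof (rule nth_equalityI)
      fix i assume "i < length (map (\<lambda>i. gcomp PO (nss ! i) (Bs ! i) (Css ! i)) [0..<length nss])"
      then have i: "i < length nss" by simp
      then show "map (\<lambda>i. gcomp PO (nss ! i) (Bs ! i) (Css ! i)) [0..<length nss] ! i = map2 cls (map sum_list nss) K ! i"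
        using gcomp_PO[OF gi[OF i]] hf[OF i] lg by (simp add: gs(2) K_def hss_def)
    qed (simp add: K_def)
    then have right: "gcomp PO (map sum_list nss) A (map (\<lambda>i. gcomp PO (nss ! i) (Bs ! i) (Css ! i)) [0..<length nss])
        = cls (sum_list (map sum_list nss)) (gamma (map sum_list nss) f K)"
      using gcomp_PO[OF fm(2) K] unfolding f(2) by simp
    have "cls (sum_list (concat nss)) (gamma (concat nss) (gamma (map length nss) f gs) (concat hss)) =
        cls (sum_list (concat nss)) (gamma (map sum_list nss) f K)"
      unfolding K_def by (rule cls_eqI[OF gamma_assoc[OF f(1) gs(1) hss]])
    then show ?thesis using left right by (simp add: sum_list_concat)
  qed
qed

lemma gcomp_PO_mult:
  assumes A: "A \<in> carrier (\<pi>1 (length ms))" and A': "A' \<in> carrier (\<pi>1 (length ms))"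
    and Bs: "Bs \<in> ElemLists (discrete_operad PO) ms" and Bs': "Bs' \<in> ElemLists (discrete_operad PO) ms"
  shows "gcomp PO ms (A \<otimes>\<^bsub>\<pi>1 (length ms)\<^esub> A')
      (map (\<lambda>i. Bs ! i \<otimes>\<^bsub>\<pi>1 (ms ! i)\<^esub> Bs' ! i) [0..<length ms]) =
    gcomp PO ms A Bs \<otimes>\<^bsub>\<pi>1 (sum_list ms)\<^esub>
    gcomp PO (invperm (gperm PO (length ms) A) ms) A' (invperm (gperm PO (length ms) A) Bs')"
proof -
  obtain f where f: "f \<in> loop_lifts (length ms)" "A = cls (length ms) f" using A by (rule \<pi>1_cases)
  obtain f' where f': "f' \<in> loop_lifts (length ms)" "A' = cls (length ms) f'" using A' by (rule \<pi>1_cases)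
  obtain gs where gs: "gs \<in> loop_lists ms" "Bs = map2 cls ms gs" using Bs by (rule PO_lists_cases)
  obtain gs' where gs': "gs' \<in> loop_lists ms" "Bs' = map2 cls ms gs'" using Bs' by (rule PO_lists_cases)
  note G = loop_listsD[OF gs(1)] and G' = loop_listsD[OF gs'(1)]
  let ?s = "sig (length ms) f"
  have s: "?s permutes {..<length ms}" by (rule sig_permutes[OF f(1)])
  define S where "S = map (\<lambda>i. star (ms ! i) (gs ! i) (gs' ! i)) [0..<length ms]"
  have S: "S \<in> loop_lists ms" using star_loop(1)[OF G(2) G'(2)] by (simp add: S_def loop_lists_def)
  have "map (\<lambda>i. Bs ! i \<otimes>\<^bsub>\<pi>1 (ms ! i)\<^esub> Bs' ! i) [0..<length ms] = map2 cls ms S"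
    by (rule nth_equalityI) (use G G' in \<open>simp_all add: gs(2) gs'(2) S_def \<pi>1_mult\<close>)
  then have "gcomp PO ms (A \<otimes>\<^bsub>\<pi>1 (length ms)\<^esub> A')
      (map (\<lambda>i. Bs ! i \<otimes>\<^bsub>\<pi>1 (ms ! i)\<^esub> Bs' ! i) [0..<length ms]) =
      cls (sum_list ms) (gamma ms (star (length ms) f f') S)"
    using gcomp_PO[OF star_loop(1)[OF f(1) f'(1)] S] by (simp add: f(2) f'(2) \<pi>1_mult[OF f(1) f'(1)])
  also have "\<dots> = cls (sum_list ms) (star (sum_list ms) (gamma ms f gs) (gamma (invperm ?s ms) f' (invperm ?s gs')))"
    unfolding S_def by (rule cls_eqI[OF gamma_star[OF f(1) f'(1) gs(1) gs'(1)]])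
  also have "\<dots> = gcomp PO ms A Bs \<otimes>\<^bsub>\<pi>1 (sum_list ms)\<^esub> gcomp PO (invperm ?s ms) A' (invperm ?s Bs')"
  proof -
    have f'l: "f' \<in> loop_lifts (length (invperm ?s ms))" using f'(1) by simp
    have l: "invperm ?s gs' \<in> loop_lists (invperm ?s ms)" by (rule loop_lists_invperm[OF s gs'(1)])
    have b: "invperm ?s Bs' = map2 cls (invperm ?s ms) (invperm ?s gs')"
      unfolding gs'(2) by (rule map2_invperm[symmetric]) (use s G' in simp_all)
    have g: "gamma (invperm ?s ms) f' (invperm ?s gs') \<in> loop_lifts (sum_list ms)"
      using gamma_loop(1)[OF f'l l] by (simp only: sum_sig[OF f(1)])
    have "gcomp PO (invperm ?s ms) A' (invperm ?s Bs') = cls (sum_list ms) (gamma (invperm ?s ms) f' (invperm ?s gs'))"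
      using gcomp_PO[OF f'l l] by (simp add: b f'(2) sum_sig[OF f(1)])
    moreover have "gcomp PO ms A Bs = cls (sum_list ms) (gamma ms f gs)"
      unfolding f(2) gs(2) by (rule gcomp_PO[OF f(1) gs(1)])
    ultimately show ?thesis by (simp add: \<pi>1_mult[OF gamma_loop(1)[OF f(1) gs(1)] g])
  qed
  finally show ?thesis by (simp add: f(2) gperm_PO[OF f(1)])
qed

lemma group_operad_PO: "group_operad PO"
  unfolding group_operad_def
proof (intro conjI allI impI)
  show "topological_operad (discrete_operad PO)" by (rule topological_operad_PO)
  show "group (Grp PO n)" for n by (simp add: group_\<pi>1)
  show hom: "gperm PO n \<in> hom (Grp PO n) (sym_grp n)" for n
  proof (rule homI)
    fix A assume "A \<in> carrier (Grp PO n)"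
    then obtain f where f: "f \<in> loop_lifts n" "A = cls n f" unfolding Grp_PO by (rule \<pi>1_cases)
    then show "gperm PO n A \<in> carrier (sym_grp n)"
      by (simp add: gperm_PO sym_grp_def sig_permutes)
    fix B assume "B \<in> carrier (Grp PO n)"
    then obtain g where g: "g \<in> loop_lifts n" "B = cls n g" unfolding Grp_PO by (rule \<pi>1_cases)
    show "gperm PO n (A \<otimes>\<^bsub>Grp PO n\<^esub> B) = gperm PO n A \<otimes>\<^bsub>sym_grp n\<^esub> gperm PO n B"
      using f g by (simp add: \<pi>1_mult gperm_PO star_loop perm_mult loop_liftsD sym_grp_def)
  qed
  show "operad_morphism (discrete_operad PO) sym_operad (gperm PO)"
    unfolding operad_morphism_def
  proof (intro conjI allI ballI)
    show "continuous_map (Space (discrete_operad PO) n) (Space sym_operad n) (gperm PO n)" for n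
      using hom[of n] by (auto simp: discrete_operad_def sym_operad_def hom_def)
    show "gperm PO 1 (opunit (discrete_operad PO)) = opunit sym_operad"
      using gperm_PO[OF const_loop(1)[of 1]] const_loop(2)[of 1]
      by (simp add: \<pi>1_one sym_operad_def perm_one del: One_nat_def)
    fix ms A Bs assume A: "A \<in> Elems (discrete_operad PO) (length ms)" and Bs: "Bs \<in> ElemLists (discrete_operad PO) ms"
    obtain f where f: "f \<in> loop_lifts (length ms)" "A = cls (length ms) f"
      using A unfolding discrete_operad_simps Grp_PO by (rule \<pi>1_cases)
    obtain gs where gs: "gs \<in> loop_lists ms" "Bs = map2 cls ms gs" using Bs by (rule PO_lists_cases)
    have "map2 (gperm PO) ms Bs = map2 (gperm Q) ms (map2 bd ms gs)"
      by (rule nth_equalityI) (use loop_listsD[OF gs(1)] in \<open>auto simp: gs(2) gperm_PO\<close>)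
    then show "gperm PO (sum_list ms) (opcomp (discrete_operad PO) ms A Bs) =
        opcomp sym_operad ms (gperm PO (length ms) A) (map2 (gperm PO) ms Bs)"
      using gperm_gcomp[OF loop_liftsD(3)[OF f(1)] bds_in[OF gs(1)]]
      by (simp add: f(2) gs(2) gcomp_PO[OF f(1) gs(1)] gperm_PO gamma_loop[OF f(1) gs(1)] f(1) sym_operad_def)
  qed
qed (use gcomp_PO_mult in simp)

end

section \<open>The short exact sequence\<close>

text \<open>The axioms of a group operad can be checked after applying injective homomorphisms that are
  compatible with the structure.\<close>

lemma group_operad_transport:
  assumes B: "group_operad B"
    and grp: "\<And>n. group (Grp A n)"
    and f: "\<And>n. f n \<in> mon (Grp A n) (Grp B n)"
    and closed: "\<And>ms a bs. a \<in> carrier (Grp A (length ms)) \<Longrightarrow> bs \<in> ElemLists (discrete_operad A) ms \<Longrightarrow>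
      gcomp A ms a bs \<in> carrier (Grp A (sum_list ms))"
    and comp: "\<And>ms a bs. a \<in> carrier (Grp A (length ms)) \<Longrightarrow> bs \<in> ElemLists (discrete_operad A) ms \<Longrightarrow>
      f (sum_list ms) (gcomp A ms a bs) = gcomp B ms (f (length ms) a) (map2 f ms bs)"
    and perm: "\<And>n a. a \<in> carrier (Grp A n) \<Longrightarrow> gperm A n a = gperm B n (f n a)"
  shows "group_operad A"
proof -
  have hom: "f n \<in> hom (Grp A n) (Grp B n)" and inj: "inj_on (f n) (carrier (Grp A n))" for n
    using f[of n] by (auto simp: mon_def)
  have grpB: "group (Grp B n)" for n using B by (simp add: group_operad_def)
  have fcl: "f n a \<in> carrier (Grp B n)" if "a \<in> carrier (Grp A n)" for n a
    using hom[of n] that by (rule hom_in_carrier)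
  have flist: "map2 f ms bs \<in> ElemLists (discrete_operad B) ms" if "bs \<in> ElemLists (discrete_operad A) ms" for ms bs
    using that fcl by (auto simp: ElemLists_iff)
  have one: "f n \<one>\<^bsub>Grp A n\<^esub> = \<one>\<^bsub>Grp B n\<^esub>" for n by (rule hom_one[OF hom grp grpB])
  have onecl: "\<one>\<^bsub>Grp A n\<^esub> \<in> carrier (Grp A n)" for n
    by (rule monoid.one_closed[OF group.is_monoid[OF grp]])
  have topB: "topological_operad (discrete_operad B)" using B by (simp add: group_operad_def)
  note assocB = topB[unfolded topological_operad_def, THEN conjunct2, THEN conjunct2, THEN conjunct2, THEN conjunct2, THEN conjunct1, rule_format]
  have permutes: "gperm A n a permutes {..<n}" if "a \<in> carrier (Grp A n)" for n a
  proof -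
    have "gperm B n \<in> hom (Grp B n) (sym_grp n)" using B by (simp add: group_operad_def)
    from hom_in_carrier[OF this fcl[OF that]] show ?thesis by (simp add: perm[OF that] sym_grp_def)
  qed
  have top: "topological_operad (discrete_operad A)"
  proof (rule topological_operad_discreteI[where E = "\<lambda>n. carrier (Grp A n)"])
    show "Space (discrete_operad A) n = discrete_topology (carrier (Grp A n))" for n
      by (simp add: discrete_operad_def)
    obtain x where x: "carrier (Grp B 0) = {x}"
      using topB unfolding topological_operad_def by auto
    have "a = \<one>\<^bsub>Grp A 0\<^esub>" if "a \<in> carrier (Grp A 0)" for a
      by (rule inj_onD[OF inj[of 0] _ that onecl]) (use fcl[OF that] fcl[OF onecl[of 0]] x in simp)
    then have "carrier (Grp A 0) \<subseteq> {\<one>\<^bsub>Grp A 0\<^esub>}" by blast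
    then show "\<exists>x. carrier (Grp A 0) = {x}" using onecl[of 0] by (intro exI[of _ "\<one>\<^bsub>Grp A 0\<^esub>"] equalityI) auto
    show "opunit (discrete_operad A) \<in> carrier (Grp A 1)" by (simp add: onecl del: One_nat_def)
    show "opcomp (discrete_operad A) ms a bs \<in> carrier (Grp A (sum_list ms))"
      if "a \<in> carrier (Grp A (length ms))" "bs \<in> ElemLists (discrete_operad A) ms" for ms a bs
      using closed[OF that] by simp
    show "opcomp (discrete_operad A) [n] (opunit (discrete_operad A)) [a] = a"
      if a: "a \<in> carrier (Grp A n)" for n a
    proof -
      have u: "\<one>\<^bsub>Grp A 1\<^esub> \<in> carrier (Grp A (length [n]))" using onecl[of 1] by simp
      have l: "[a] \<in> ElemLists (discrete_operad A) [n]" using a by (simp add: ElemLists_iff)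
      have "f (sum_list [n]) (gcomp A [n] \<one>\<^bsub>Grp A 1\<^esub> [a]) = gcomp B [n] (f (length [n]) \<one>\<^bsub>Grp A 1\<^esub>) (map2 f [n] [a])"
        by (rule comp[OF u l])
      moreover have "gcomp B [n] \<one>\<^bsub>Grp B 1\<^esub> [f n a] = f n a"
        using topB fcl[OF a] unfolding topological_operad_def by simp
      ultimately have "f n (gcomp A [n] \<one>\<^bsub>Grp A 1\<^esub> [a]) = f n a" using one[of 1] by simp
      moreover have "gcomp A [n] \<one>\<^bsub>Grp A 1\<^esub> [a] \<in> carrier (Grp A n)" using closed[OF u l] by simp
      ultimately have "gcomp A [n] \<one>\<^bsub>Grp A 1\<^esub> [a] = a" using inj[of n] a by (simp add: inj_on_eq_iff)
      then show ?thesis by (simp del: One_nat_def)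
    qed
    show "opcomp (discrete_operad A) (replicate n 1) a (replicate n (opunit (discrete_operad A))) = a"
      if a: "a \<in> carrier (Grp A n)" for n a
    proof -
      let ?u = "replicate n (1::nat)" and ?o = "replicate n \<one>\<^bsub>Grp A 1\<^esub>"
      have u: "a \<in> carrier (Grp A (length ?u))" using a by simp
      have l: "?o \<in> ElemLists (discrete_operad A) ?u" using onecl[of 1] by (simp add: ElemLists_iff)
      have s: "sum_list ?u = n" by (simp add: sum_list_replicate)
      have "map2 f ?u ?o = replicate n \<one>\<^bsub>Grp B 1\<^esub>" using one[of 1] by (auto intro: nth_equalityI)
      then have "f n (gcomp A ?u a ?o) = gcomp B ?u (f n a) (replicate n \<one>\<^bsub>Grp B 1\<^esub>)"
        using comp[OF u l] by (simp only: s length_replicate)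
      also have "\<dots> = f n a"
        using topB fcl[OF a] unfolding topological_operad_def by (elim conjE) simp
      finally have "f n (gcomp A ?u a ?o) = f n a" .
      moreover have "gcomp A ?u a ?o \<in> carrier (Grp A n)" using closed[OF u l] by (simp only: s)
      ultimately have "gcomp A ?u a ?o = a" using inj[of n] a by (simp add: inj_on_eq_iff)
      then show ?thesis by (simp del: One_nat_def)
    qed
    show "opcomp (discrete_operad A) (concat nss) (opcomp (discrete_operad A) (map length nss) a bs) (concat css) =
        opcomp (discrete_operad A) (map sum_list nss) a
          (map (\<lambda>i. opcomp (discrete_operad A) (nss ! i) (bs ! i) (css ! i)) [0..<length nss])"
      if a: "a \<in> carrier (Grp A (length nss))" and bs: "bs \<in> ElemLists (discrete_operad A) (map length nss)"
        and css: "list_all2 (\<lambda>cs ns. cs \<in> ElemLists (discrete_operad A) ns) css nss" for nss a bs css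
    proof -
      let ?N = "concat nss" and ?ms = "map length nss" and ?Ns = "map sum_list nss"
      have ams: "a \<in> carrier (Grp A (length ?ms))" "a \<in> carrier (Grp A (length ?Ns))" using a by simp_all
      have lN: "sum_list ?ms = length ?N" by (simp add: length_concat)
      have MN: "sum_list ?Ns = sum_list ?N" by (simp add: sum_list_concat)
      have lb: "length bs = length nss" and lc: "length css = length nss"
        using bs list_all2_lengthD[OF css] by (simp_all add: ElemLists_iff)
      have ci: "css ! i \<in> ElemLists (discrete_operad A) (nss ! i)" "bs ! i \<in> carrier (Grp A (length (nss ! i)))"
        if "i < length nss" for i
        using css bs that by (simp_all add: list_all2_conv_all_nth ElemLists_iff)
      have cc: "concat css \<in> ElemLists (discrete_operad A) ?N" by (rule ElemLists_concat[OF css])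
      have x: "gcomp A ?ms a bs \<in> carrier (Grp A (length ?N))" using closed[OF ams(1) bs] by (simp only: lN)
      define K where "K = map (\<lambda>i. gcomp A (nss ! i) (bs ! i) (css ! i)) [0..<length nss]"
      have K: "K \<in> ElemLists (discrete_operad A) ?Ns"
        using closed[OF ci(2,1)] by (simp add: K_def ElemLists_iff)
      have "f (sum_list ?N) (gcomp A ?N (gcomp A ?ms a bs) (concat css)) =
          gcomp B ?N (gcomp B ?ms (f (length nss) a) (map2 f ?ms bs)) (concat (map2 (map2 f) nss css))"
      proof -
        have "map2 f ?N (concat css) = concat (map2 (map2 f) nss css)"
          by (rule map2_concat) (use css in \<open>auto simp: list_all2_conv_all_nth ElemLists_iff\<close>)
        then show ?thesis using comp[OF x cc] comp[OF ams(1) bs] by (simp add: lN)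
      qed
      also have "\<dots> = gcomp B ?Ns (f (length nss) a)
          (map (\<lambda>i. gcomp B (nss ! i) (map2 f ?ms bs ! i) (map2 (map2 f) nss css ! i)) [0..<length nss])"
      proof -
        have "f (length nss) a \<in> carrier (Grp B (length nss))" by (rule fcl[OF a])
        moreover have "map2 f ?ms bs \<in> ElemLists (discrete_operad B) ?ms" by (rule flist[OF bs])
        moreover have "list_all2 (\<lambda>cs ns. cs \<in> ElemLists (discrete_operad B) ns) (map2 (map2 f) nss css) nss"
          using flist[OF ci(1)] lc by (auto simp: list_all2_conv_all_nth)
        ultimately show ?thesis
          using topB unfolding topological_operad_def by simp
      qed
      also have "map (\<lambda>i. gcomp B (nss ! i) (map2 f ?ms bs ! i) (map2 (map2 f) nss css ! i)) [0..<length nss] = map2 f ?Ns K"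
        by (rule nth_equalityI) (use lb lc comp[OF ci(2,1)] in \<open>auto simp: K_def\<close>)
      also have "gcomp B ?Ns (f (length nss) a) (map2 f ?Ns K) = f (sum_list ?N) (gcomp A ?Ns a K)"
        using comp[OF ams(2) K] by (simp add: MN)
      finally have "f (sum_list ?N) (gcomp A ?N (gcomp A ?ms a bs) (concat css)) = f (sum_list ?N) (gcomp A ?Ns a K)" .
      moreover have "gcomp A ?N (gcomp A ?ms a bs) (concat css) \<in> carrier (Grp A (sum_list ?N))"
        by (rule closed[OF x cc])
      moreover have "gcomp A ?Ns a K \<in> carrier (Grp A (sum_list ?N))"
        using closed[OF ams(2) K] by (simp only: MN)
      ultimately have "gcomp A ?N (gcomp A ?ms a bs) (concat css) = gcomp A ?Ns a K"
        by (rule inj_onD[OF inj])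
      then show ?thesis by (simp add: K_def)
    qed
  qed
  have perm_hom: "gperm A n \<in> hom (Grp A n) (sym_grp n)" for n
  proof (rule homI)
    have hB: "gperm B n \<in> hom (Grp B n) (sym_grp n)" using B by (simp add: group_operad_def)
    fix a assume a: "a \<in> carrier (Grp A n)"
    then show "gperm A n a \<in> carrier (sym_grp n)" using permutes by (simp add: sym_grp_def)
    fix b assume b: "b \<in> carrier (Grp A n)"
    have ab: "a \<otimes>\<^bsub>Grp A n\<^esub> b \<in> carrier (Grp A n)"
      by (rule monoid.m_closed[OF group.is_monoid[OF grp] a b])
    show "gperm A n (a \<otimes>\<^bsub>Grp A n\<^esub> b) = gperm A n a \<otimes>\<^bsub>sym_grp n\<^esub> gperm A n b"
      unfolding perm[OF ab] perm[OF a] perm[OF b] hom_mult[OF hom a b]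
      by (rule hom_mult[OF hB fcl[OF a] fcl[OF b]])
  qed
  show ?thesis
    unfolding group_operad_def
  proof (intro conjI allI impI top grp perm_hom)
    have mB: "operad_morphism (discrete_operad B) sym_operad (gperm B)" using B by (simp add: group_operad_def)
    show "operad_morphism (discrete_operad A) sym_operad (gperm A)"
      unfolding operad_morphism_def
    proof (intro conjI allI ballI)
      show "continuous_map (Space (discrete_operad A) n) (Space sym_operad n) (gperm A n)" for n
        using perm_hom[of n] by (auto simp: discrete_operad_def sym_operad_def hom_def)
      show "gperm A 1 (opunit (discrete_operad A)) = opunit sym_operad"
      proof -
        have "gperm A 1 \<one>\<^bsub>Grp A 1\<^esub> = gperm B 1 \<one>\<^bsub>Grp B 1\<^esub>" unfolding perm[OF onecl] one ..
        also have "\<dots> = opunit sym_operad" using mB unfolding operad_morphism_def by (simp del: One_nat_def)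
        finally show ?thesis by (simp del: One_nat_def)
      qed
      fix ms a bs assume "a \<in> Elems (discrete_operad A) (length ms)" and bs: "bs \<in> ElemLists (discrete_operad A) ms"
      then have a: "a \<in> carrier (Grp A (length ms))" by simp
      have "gperm A (sum_list ms) (gcomp A ms a bs) = gperm B (sum_list ms) (gcomp B ms (f (length ms) a) (map2 f ms bs))"
        unfolding perm[OF closed[OF a bs]] comp[OF a bs] ..
      also have "\<dots> = opcomp sym_operad ms (gperm B (length ms) (f (length ms) a)) (map2 (gperm B) ms (map2 f ms bs))"
        using mB fcl[OF a] flist[OF bs] unfolding operad_morphism_def by simp
      also have "map2 (gperm B) ms (map2 f ms bs) = map2 (gperm A) ms bs"
        by (rule nth_equalityI) (use bs perm in \<open>auto simp: ElemLists_iff\<close>)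
      finally show "gperm A (sum_list ms) (opcomp (discrete_operad A) ms a bs) =
        opcomp sym_operad ms (gperm A (length ms) a) (map2 (gperm A) ms bs)"
        by (simp add: perm[OF a])
    qed
    fix ms a a' bs bs'
    assume a: "a \<in> carrier (Grp A (length ms))" and a': "a' \<in> carrier (Grp A (length ms))"
      and bs: "bs \<in> ElemLists (discrete_operad A) ms" and bs': "bs' \<in> ElemLists (discrete_operad A) ms"
    let ?p = "gperm A (length ms) a" and ?m = "sum_list ms"
    have p: "?p permutes {..<length ms}" by (rule permutes[OF a])
    have sp: "sum_list (invperm ?p ms) = ?m" by (rule sum_list_invperm[OF p])
    define S where "S = map (\<lambda>i. bs ! i \<otimes>\<^bsub>Grp A (ms ! i)\<^esub> bs' ! i) [0..<length ms]"
    have S: "S \<in> ElemLists (discrete_operad A) ms"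
      using bs bs' by (simp add: S_def ElemLists_iff monoid.m_closed[OF group.is_monoid[OF grp]])
    have aa: "a \<otimes>\<^bsub>Grp A (length ms)\<^esub> a' \<in> carrier (Grp A (length ms))"
      by (rule monoid.m_closed[OF group.is_monoid[OF grp] a a'])
    have a'p: "a' \<in> carrier (Grp A (length (invperm ?p ms)))" using a' by simp
    have bp: "invperm ?p bs' \<in> ElemLists (discrete_operad A) (invperm ?p ms)" by (rule ElemLists_invperm[OF p bs'])
    have x: "gcomp A ms a bs \<in> carrier (Grp A ?m)" by (rule closed[OF a bs])
    have y: "gcomp A (invperm ?p ms) a' (invperm ?p bs') \<in> carrier (Grp A ?m)"
      using closed[OF a'p bp] by (simp only: sp)
    have mS: "map2 f ms S = map (\<lambda>i. map2 f ms bs ! i \<otimes>\<^bsub>Grp B (ms ! i)\<^esub> map2 f ms bs' ! i) [0..<length ms]"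
      by (rule nth_equalityI) (use bs bs' hom_mult[OF hom] in \<open>auto simp: S_def ElemLists_iff\<close>)
    have "f ?m (gcomp A ms (a \<otimes>\<^bsub>Grp A (length ms)\<^esub> a') S) =
        gcomp B ms (f (length ms) a \<otimes>\<^bsub>Grp B (length ms)\<^esub> f (length ms) a') (map2 f ms S)"
      unfolding comp[OF aa S] hom_mult[OF hom a a'] ..
    also have "\<dots> = gcomp B ms (f (length ms) a) (map2 f ms bs) \<otimes>\<^bsub>Grp B ?m\<^esub>
        gcomp B (invperm (gperm B (length ms) (f (length ms) a)) ms) (f (length ms) a')
          (invperm (gperm B (length ms) (f (length ms) a)) (map2 f ms bs'))"
      unfolding mS using B fcl[OF a] fcl[OF a'] flist[OF bs] flist[OF bs'] unfolding group_operad_def by simp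
    also have "invperm (gperm B (length ms) (f (length ms) a)) (map2 f ms bs') = map2 f (invperm ?p ms) (invperm ?p bs')"
      unfolding perm[OF a, symmetric] by (rule map2_invperm[symmetric, OF p]) (use bs' in \<open>simp add: ElemLists_iff\<close>)
    also have "gcomp B (invperm (gperm B (length ms) (f (length ms) a)) ms) (f (length ms) a')
          (map2 f (invperm ?p ms) (invperm ?p bs')) = f ?m (gcomp A (invperm ?p ms) a' (invperm ?p bs'))"
      unfolding perm[OF a, symmetric] using comp[OF a'p bp] by (simp only: sp length_invperm)
    also have "gcomp B ms (f (length ms) a) (map2 f ms bs) = f ?m (gcomp A ms a bs)" by (rule comp[OF a bs, symmetric])
    also have "f ?m (gcomp A ms a bs) \<otimes>\<^bsub>Grp B ?m\<^esub> f ?m (gcomp A (invperm ?p ms) a' (invperm ?p bs')) =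
        f ?m (gcomp A ms a bs \<otimes>\<^bsub>Grp A ?m\<^esub> gcomp A (invperm ?p ms) a' (invperm ?p bs'))"
      by (rule hom_mult[OF hom x y, symmetric])
    finally show "gcomp A ms (a \<otimes>\<^bsub>Grp A (length ms)\<^esub> a') (map (\<lambda>i. bs ! i \<otimes>\<^bsub>Grp A (ms ! i)\<^esub> bs' ! i) [0..<length ms]) =
      gcomp A ms a bs \<otimes>\<^bsub>Grp A ?m\<^esub> gcomp A (invperm ?p ms) a' (invperm ?p bs')"
      unfolding S_def[symmetric]
      by (rule inj_onD[OF inj _ closed[OF aa S] monoid.m_closed[OF group.is_monoid[OF grp] x y]])
  qed
qed

context based_operad
begin

abbreviation DO :: "(real \<Rightarrow> 'a) set grp_operad" where "DO \<equiv> pi1_operad D \<eta>"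

abbreviation proj :: "nat \<Rightarrow> (real \<Rightarrow> 'a) set \<Rightarrow> (real \<Rightarrow> 'a set) set" where "proj \<equiv> pi1_proj Q D act"

lemma Grp_DO [simp]: "Grp DO k = fundamental_group (Space D k) (e k)"
  by (simp add: pi1_operad_def)

lemma loop_lift:
  assumes "pathin (Space D k) f" "f 0 = e k" "f 1 = e k"
  shows "f \<in> loop_lifts k" "bd k f = \<one>\<^bsub>Grp Q k\<^esub>"
proof -
  have 1: "f 1 = act k \<one>\<^bsub>Grp Q k\<^esub> (e k)" using assms(3) by (simp add: cov.act_one[OF e_in])
  show "f \<in> loop_lifts k" using assms(1,2) Q_one_closed 1 by (rule loop_liftsI)
  show "bd k f = \<one>\<^bsub>Grp Q k\<^esub>" using Q_one_closed 1 by (rule bd_eq)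
qed

definition loops :: "nat \<Rightarrow> (real \<Rightarrow> 'a) set" where
  "loops k = {f. pathin (Space D k) f \<and> f 0 = e k \<and> f 1 = e k}"

lemma loopsD:
  assumes "f \<in> loops k"
  shows "pathin (Space D k) f" "f 0 = e k" "f 1 = e k" "f \<in> loop_lifts k" "bd k f = \<one>\<^bsub>Grp Q k\<^esub>"
  using assms loop_lift by (simp_all add: loops_def)

lemma DO_cases:
  assumes "A \<in> carrier (fundamental_group (Space D k) (e k))"
  obtains f where "f \<in> loops k" "A = path_class (Space D k) f"
  using assms by (rule fundamental_group_carrierE) (auto simp: loops_def intro: that)

lemma DO_in: "f \<in> loops k \<Longrightarrow> path_class (Space D k) f \<in> carrier (fundamental_group (Space D k) (e k))"
  by (rule fundamental_group_carrierI) (simp_all add: loopsD)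

abbreviation pcls :: "nat \<Rightarrow> (real \<Rightarrow> 'a) \<Rightarrow> (real \<Rightarrow> 'a) set" where "pcls k \<equiv> path_class (Space D k)"

lemma DO_lists_cases:
  assumes "Bs \<in> ElemLists (discrete_operad DO) ms"
  obtains gs where "length gs = length ms" "\<And>i. i < length ms \<Longrightarrow> gs ! i \<in> loops (ms ! i)" "Bs = map2 pcls ms gs"
proof -
  have B: "length Bs = length ms" "\<And>i. i < length ms \<Longrightarrow> Bs ! i \<in> carrier (fundamental_group (Space D (ms ! i)) (e (ms ! i)))"
    using assms by (auto simp: ElemLists_iff)
  have "\<exists>g. i < length ms \<longrightarrow> g \<in> loops (ms ! i) \<and> Bs ! i = pcls (ms ! i) g" for i
  proof (cases "i < length ms")
    case True
    show ?thesis by (rule DO_cases[OF B(2)[OF True]]) auto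
  qed simp
  then obtain g where g: "\<And>i. i < length ms \<Longrightarrow> g i \<in> loops (ms ! i) \<and> Bs ! i = pcls (ms ! i) (g i)" by metis
  show thesis
  proof (rule that[of "map g [0..<length ms]"])
    show "Bs = map2 pcls ms (map g [0..<length ms])"
      by (rule nth_equalityI) (use B g in auto)
  qed (use g in simp_all)
qed

lemma proj_pcls: "pathin (Space D k) f \<Longrightarrow> proj k (pcls k f) = cls k f"
  unfolding pi1_proj_def cls_def
  by (rule path_class_UN, assumption)
     (rule path_class_eqI, rule rel_homotopic_postcompose[OF rel_homotopic_sym continuous_quo])

definition loop_comp :: "nat list \<Rightarrow> (real \<Rightarrow> 'a) \<Rightarrow> (real \<Rightarrow> 'a) list \<Rightarrow> real \<Rightarrow> 'a" where
  "loop_comp ms f gs = (\<delta> ms \<bullet>\<bullet> pointwise_comp D ms f gs) \<bullet>\<bullet> path_rev (\<delta> ms)"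

text \<open>For loops \<open>\<partial>\<close> is trivial, so the two linear paths in \<^const>\<open>gamma\<close> are the same.\<close>

lemma loop_comp:
  assumes f: "f \<in> loops (length ms)" and gs: "length gs = length ms" "\<And>i. i < length ms \<Longrightarrow> gs ! i \<in> loops (ms ! i)"
  shows "loop_comp ms f gs \<in> loops (sum_list ms)"
    "path_homotopic (Space D (sum_list ms)) (loop_comp ms f gs) (gamma ms f gs)"
    "gs \<in> loop_lists ms"
proof -
  note F = loopsD[OF f] and G = loopsD[OF gs(2)]
  show gl: "gs \<in> loop_lists ms" using gs G by (simp add: loop_lists_def)
  note P = gamma_parts[OF F(4) gl]
  have "map2 bd ms gs = map (\<lambda>m. \<one>\<^bsub>Grp Q m\<^esub>) ms"
    by (rule nth_equalityI) (use gs G in auto)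
  then have one: "gbd ms f gs = \<one>\<^bsub>Grp Q (sum_list ms)\<^esub>" by (simp only: F(5) gcomp_ones)
  have sig: "invperm (sig (length ms) f) ms = ms" by (simp only: F(5) perm_one invperm_id)
  let ?p = "pointwise_comp D ms f gs" and ?X = "Space D (sum_list ms)"
  have d1: "\<delta> ms 1 \<in> Elems D (sum_list ms)" by (rule path_finish_in_topspace[OF pathin_\<delta>])
  have p1: "?p 1 = \<delta> ms 1" using P(4) unfolding one sig by (simp add: cov.act_one d1)
  have r: "pathin ?X (path_rev (\<delta> ms))" by (rule pathin_rev[OF pathin_\<delta>])
  have "pathin ?X (loop_comp ms f gs)"
    unfolding loop_comp_def by (intro pathin_join pathin_\<delta> P(1) r) (simp_all add: P(3) p1)
  then show "loop_comp ms f gs \<in> loops (sum_list ms)"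
    by (simp add: loops_def loop_comp_def \<delta>_0)
  have "path_homotopic ?X (loop_comp ms f gs) (\<delta> ms \<bullet>\<bullet> (?p \<bullet>\<bullet> path_rev (\<delta> ms)))"
    unfolding loop_comp_def by (rule path_homotopic_assoc[OF pathin_\<delta> P(1) r P(3)]) (simp add: p1)
  also have "path_homotopic ?X \<dots> (\<delta> ms \<bullet>\<bullet> (?p \<bullet>\<bullet> (act (sum_list ms) \<one>\<^bsub>Grp Q (sum_list ms)\<^esub> \<circ> path_rev (\<delta> ms))))"
  proof (intro path_homotopic_join path_homotopic_refl pathin_\<delta> P(1))
    show "path_homotopic ?X (path_rev (\<delta> ms)) (act (sum_list ms) \<one>\<^bsub>Grp Q (sum_list ms)\<^esub> \<circ> path_rev (\<delta> ms))"
      by (rule path_homotopic_eqI[OF r]) (simp add: cov.act_one pathin_in[OF r])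
  qed (simp_all add: P(3) p1)
  finally show "path_homotopic ?X (loop_comp ms f gs) (gamma ms f gs)"
    unfolding gamma_def one sig .
qed

lemma gcomp_DO:
  assumes f: "f \<in> loops (length ms)" and gs: "length gs = length ms" "\<And>i. i < length ms \<Longrightarrow> gs ! i \<in> loops (ms ! i)"
  shows "gcomp DO ms (pcls (length ms) f) (map2 pcls ms gs) = pcls (sum_list ms) (loop_comp ms f gs)"
proof -
  note F = loopsD[OF f] and G = loopsD[OF gs(2)]
  note P = gamma_parts[OF F(4) loop_comp(3)[OF f gs]]
  have "gcomp DO ms A Bs = (\<Union>f\<in>A. \<Union>gs\<in>listset Bs. pcls (sum_list ms) (loop_comp ms f gs))" for A Bs
    by (simp add: pi1_operad_def loop_comp_def)
  moreover have "(\<Union>f'\<in>pcls (length ms) f. \<Union>gs'\<in>listset (map2 pcls ms gs). pcls (sum_list ms) (loop_comp ms f' gs')) =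
      pcls (sum_list ms) (loop_comp ms f gs)"
  proof (rule UN_const)
    show "f \<in> pcls (length ms) f" by (rule path_class_self[OF F(1)])
    show "gs \<in> listset (map2 pcls ms gs)" using gs G by (simp add: listset_iff path_class_self)
    fix f' gs' assume "f' \<in> pcls (length ms) f" and gs': "gs' \<in> listset (map2 pcls ms gs)"
    then have ff: "path_homotopic (Space D (length ms)) f f'" by (simp add: path_class_eq)
    have gg: "length gs' = length ms" "\<And>i. i < length ms \<Longrightarrow> path_homotopic (Space D (ms ! i)) (gs ! i) (gs' ! i)"
      using gs' gs by (simp_all add: listset_iff path_class_eq)
    have "path_homotopic (Space D (length ms)) f f' \<Longrightarrow> f' \<in> loops (length ms)"
      using path_homotopic_pathin[OF ff] F by (simp add: loops_def)
    then have f': "f' \<in> loops (length ms)" using ff .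
    have gs'l: "gs' ! i \<in> loops (ms ! i)" if "i < length ms" for i
      using path_homotopic_pathin[OF gg(2)[OF that]] G[OF that] by (simp add: loops_def)
    have "path_homotopic (Space D (sum_list ms)) (loop_comp ms f' gs') (loop_comp ms f gs)"
      using loop_comp(2)[OF f' gg(1) gs'l] gamma_cong[OF F(4) loop_comp(3)[OF f gs] ff gg] loop_comp(2)[OF f gs]
      by (meson rel_homotopic_sym rel_homotopic_trans)
    then show "pcls (sum_list ms) (loop_comp ms f' gs') = pcls (sum_list ms) (loop_comp ms f gs)"
      by (rule path_class_eqI)
  qed
  ultimately show ?thesis by simp
qed

text \<open>Homotopies lift, so the projection is injective on fundamental groups.\<close>

lemma proj_hom: "proj k \<in> mon (Grp DO k) (Grp PO k)"
proof -
  have "proj k \<in> hom (Grp DO k) (Grp PO k)"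
  proof (rule homI)
    fix A assume "A \<in> carrier (Grp DO k)"
    then obtain f where f: "f \<in> loops k" "A = pcls k f" unfolding Grp_DO by (rule DO_cases)
    then show "proj k A \<in> carrier (Grp PO k)" by (simp add: proj_pcls loopsD cls_in)
    fix B assume "B \<in> carrier (Grp DO k)"
    then obtain g where g: "g \<in> loops k" "B = pcls k g" unfolding Grp_DO by (rule DO_cases)
    note F = loopsD[OF f(1)] and G = loopsD[OF g(1)]
    have j: "pathin (Space D k) (f \<bullet>\<bullet> g)" by (rule pathin_join) (simp_all add: F G)
    have "proj k (A \<otimes>\<^bsub>Grp DO k\<^esub> B) = cls k (f \<bullet>\<bullet> g)"
      unfolding f(2) g(2) by (simp add: fundamental_group_mult F G proj_pcls j)
    also have "\<dots> = cls k (star k f g)"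
      unfolding star_def F(5)
      by (intro cls_eqI path_homotopic_join path_homotopic_refl F path_homotopic_eqI[OF G(1)])
         (simp_all add: F G cov.act_one pathin_in[OF G(1)])
    also have "\<dots> = proj k A \<otimes>\<^bsub>Grp PO k\<^esub> proj k B"
      unfolding f(2) g(2) by (simp add: proj_pcls F G \<pi>1_mult)
    finally show "proj k (A \<otimes>\<^bsub>Grp DO k\<^esub> B) = proj k A \<otimes>\<^bsub>Grp PO k\<^esub> proj k B" .
  qed
  moreover have "inj_on (proj k) (carrier (Grp DO k))"
  proof (rule inj_onI)
    fix A B assume "A \<in> carrier (Grp DO k)" "B \<in> carrier (Grp DO k)" and AB: "proj k A = proj k B"
    then obtain f g where f: "f \<in> loops k" "A = pcls k f" and g: "g \<in> loops k" "B = pcls k g"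
      unfolding Grp_DO by (elim DO_cases)
    have "path_homotopic (Space D k) f g"
      using AB cls_eq_iff[OF loopsD(4)[OF f(1)] loopsD(4)[OF g(1)]] by (simp add: f(2) g(2) proj_pcls loopsD(1) f(1) g(1))
    then show "A = B" unfolding f(2) g(2) by (rule path_class_eqI)
  qed
  ultimately show ?thesis by (simp add: mon_def)
qed

lemma DO_comp:
  assumes A: "A \<in> carrier (Grp DO (length ms))" and Bs: "Bs \<in> ElemLists (discrete_operad DO) ms"
  shows "gcomp DO ms A Bs \<in> carrier (Grp DO (sum_list ms))"
    "proj (sum_list ms) (gcomp DO ms A Bs) = gcomp PO ms (proj (length ms) A) (map2 proj ms Bs)"
proof -
  obtain f where f: "f \<in> loops (length ms)" "A = pcls (length ms) f" using A unfolding Grp_DO by (rule DO_cases)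
  obtain gs where gs: "length gs = length ms" "\<And>i. i < length ms \<Longrightarrow> gs ! i \<in> loops (ms ! i)" "Bs = map2 pcls ms gs"
    using DO_lists_cases[OF Bs] by blast
  note L = loop_comp[OF f(1) gs(1,2)] and F = loopsD[OF f(1)]
  have c: "gcomp DO ms A Bs = pcls (sum_list ms) (loop_comp ms f gs)"
    unfolding f(2) gs(3) by (rule gcomp_DO[OF f(1) gs(1,2)])
  show "gcomp DO ms A Bs \<in> carrier (Grp DO (sum_list ms))"
    unfolding c Grp_DO by (rule DO_in[OF L(1)])
  have "map2 proj ms Bs = map2 cls ms gs"
    by (rule nth_equalityI) (use gs loopsD(1)[OF gs(2)] in \<open>auto simp: proj_pcls\<close>)
  moreover have "proj (length ms) A = cls (length ms) f" unfolding f(2) by (rule proj_pcls[OF F(1)])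
  ultimately have "gcomp PO ms (proj (length ms) A) (map2 proj ms Bs) = cls (sum_list ms) (gamma ms f gs)"
    using gcomp_PO[OF F(4) L(3)] by simp
  also have "\<dots> = cls (sum_list ms) (loop_comp ms f gs)" by (rule cls_eqI[OF rel_homotopic_sym[OF L(2)]])
  also have "\<dots> = proj (sum_list ms) (gcomp DO ms A Bs)"
    unfolding c by (rule proj_pcls[symmetric, OF loopsD(1)[OF L(1)]])
  finally show "proj (sum_list ms) (gcomp DO ms A Bs) = gcomp PO ms (proj (length ms) A) (map2 proj ms Bs)" ..
qed

lemma gperm_proj:
  assumes "A \<in> carrier (Grp DO n)"
  shows "gperm PO n (proj n A) = gperm DO n A"
proof -
  obtain f where f: "f \<in> loops n" "A = pcls n f" using assms unfolding Grp_DO by (rule DO_cases)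
  note F = loopsD[OF f(1)]
  show ?thesis
    unfolding f(2) proj_pcls[OF F(1)] gperm_PO[OF F(4)] F(5) perm_one by (simp add: pi1_operad_def)
qed

lemma group_operad_DO: "group_operad DO"
proof (rule group_operad_transport[OF group_operad_PO])
  show "group (Grp DO n)" for n unfolding Grp_DO by (rule group_fundamental_group[OF e_in])
  show "proj n \<in> mon (Grp DO n) (Grp PO n)" for n by (rule proj_hom)
qed (use DO_comp gperm_proj in simp_all)

lemma non_crossed_DO: "non_crossed DO"
  by (simp add: non_crossed_def pi1_operad_def)

abbreviation pbd :: "nat \<Rightarrow> (real \<Rightarrow> 'a set) set \<Rightarrow> 'q" where "pbd \<equiv> pi1_bd Q D act \<eta>"

text \<open>Any path from the basepoint to its translate by \<open>q\<close> represents an element over \<open>q\<close>.\<close>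

lemma pbd_epi: "pbd k \<in> epi (Grp PO k) (Grp Q k)"
proof -
  have "pbd k \<in> hom (Grp PO k) (Grp Q k)"
  proof (rule homI)
    fix A assume "A \<in> carrier (Grp PO k)"
    then obtain f where f: "f \<in> loop_lifts k" "A = cls k f" unfolding Grp_PO by (rule \<pi>1_cases)
    then show "pbd k A \<in> carrier (Grp Q k)" by (simp add: pi1_bd_cls loop_liftsD)
    fix B assume "B \<in> carrier (Grp PO k)"
    then obtain g where g: "g \<in> loop_lifts k" "B = cls k g" unfolding Grp_PO by (rule \<pi>1_cases)
    show "pbd k (A \<otimes>\<^bsub>Grp PO k\<^esub> B) = pbd k A \<otimes>\<^bsub>Grp Q k\<^esub> pbd k B"
      using f g by (simp add: \<pi>1_mult pi1_bd_cls star_loop)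
  qed
  moreover have "carrier (Grp Q k) \<subseteq> pbd k ` carrier (Grp PO k)"
  proof
    fix q assume q: "q \<in> carrier (Grp Q k)"
    have "act k q (e k) \<in> Elems D k" by (rule cov.act_closed[OF q e_in])
    then obtain f where f: "pathin (Space D k) f" "f 0 = e k" "f 1 = act k q (e k)"
      using path_connected e_in[of k] unfolding path_connected_operad_def path_connected_space_def by metis
    have fl: "f \<in> loop_lifts k" using f(1,2) q f(3) by (rule loop_liftsI)
    have "q = pbd k (cls k f)" using pi1_bd_cls[OF fl] bd_eq[OF q, of f] f(3) by simp
    then show "q \<in> pbd k ` carrier (Grp PO k)" using cls_in[OF fl] by simp
  qed
  ultimately show ?thesis by (auto simp: epi_def hom_def)
qed

text \<open>A path with trivial \<open>\<partial>\<close> is a loop.\<close>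

lemma ses: "grp_operad_ses DO PO Q proj pbd"
  unfolding grp_operad_ses_def
proof (intro conjI allI group_operad_DO group_operad_PO group_operad_Q proj_hom pbd_epi)
  show "grp_operad_morphism DO PO proj"
    unfolding grp_operad_morphism_def
    using proj_hom DO_comp(2) gperm_proj by (simp add: mon_def)
  show "grp_operad_morphism PO Q pbd"
    unfolding grp_operad_morphism_def
  proof (intro conjI allI ballI)
    show "pbd n \<in> hom (Grp PO n) (Grp Q n)" for n using pbd_epi by (simp add: epi_def)
    show "gperm Q n (pbd n A) = gperm PO n A" if "A \<in> carrier (Grp PO n)" for n A
      by (simp add: pi1_orbit_operad_def)
    fix ms A Bs assume A: "A \<in> carrier (Grp PO (length ms))" and Bs: "Bs \<in> ElemLists (discrete_operad PO) ms"
    obtain f where f: "f \<in> loop_lifts (length ms)" "A = cls (length ms) f" using A unfolding Grp_PO by (rule \<pi>1_cases)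
    obtain gs where gs: "gs \<in> loop_lists ms" "Bs = map2 cls ms gs" using Bs by (rule PO_lists_cases)
    have "map2 pbd ms Bs = map2 bd ms gs"
      by (rule nth_equalityI) (use loop_listsD[OF gs(1)] in \<open>auto simp: gs(2) pi1_bd_cls\<close>)
    then show "pbd (sum_list ms) (gcomp PO ms A Bs) = gcomp Q ms (pbd (length ms) A) (map2 pbd ms Bs)"
      by (simp add: f(2) gs(2) gcomp_PO[OF f(1) gs(1)] pi1_bd_cls[OF f(1)] pi1_bd_cls[OF gamma_loop(1)[OF f(1) gs(1)]]
          gamma_loop(2)[OF f(1) gs(1)])
  qed
  fix n
  show "proj n ` carrier (Grp DO n) = kernel (Grp PO n) (Grp Q n) (pbd n)"
  proof (intro equalityI subsetI)
    fix A assume "A \<in> proj n ` carrier (Grp DO n)"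
    then obtain B where B: "B \<in> carrier (Grp DO n)" "A = proj n B" by auto
    obtain f where f: "f \<in> loops n" "B = pcls n f" using B(1) unfolding Grp_DO by (rule DO_cases)
    note F = loopsD[OF f(1)]
    have "A = cls n f" unfolding B(2) f(2) by (rule proj_pcls[OF F(1)])
    then show "A \<in> kernel (Grp PO n) (Grp Q n) (pbd n)"
      by (simp add: kernel_def cls_in F pi1_bd_cls)
  next
    fix A assume "A \<in> kernel (Grp PO n) (Grp Q n) (pbd n)"
    then have A: "A \<in> carrier (\<pi>1 n)" "pbd n A = \<one>\<^bsub>Grp Q n\<^esub>" by (simp_all add: kernel_def)
    obtain f where f: "f \<in> loop_lifts n" "A = cls n f" using A(1) by (rule \<pi>1_cases)
    note F = loop_liftsD[OF f(1)]
    have "bd n f = \<one>\<^bsub>Grp Q n\<^esub>" using A(2) by (simp add: f(2) pi1_bd_cls[OF f(1)])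
    then have fl: "f \<in> loops n" using F by (simp add: loops_def cov.act_one[OF e_in])
    have "A = proj n (pcls n f)" unfolding f(2) by (rule proj_pcls[symmetric, OF F(1)])
    then show "A \<in> proj n ` carrier (Grp DO n)" using DO_in[OF fl] by simp
  qed
qed

end

section \<open>Higher homotopy groups of the orbit spaces\<close>

text \<open>Inverses act as inverse bijections.\<close>

lemma group_actionI:
  assumes G: "group G"
    and ext: "\<And>g. g \<in> carrier G \<Longrightarrow> \<phi> g \<in> extensional E"
    and closed: "\<And>g x. g \<in> carrier G \<Longrightarrow> x \<in> E \<Longrightarrow> \<phi> g x \<in> E"
    and mult: "\<And>g h x. g \<in> carrier G \<Longrightarrow> h \<in> carrier G \<Longrightarrow> x \<in> E \<Longrightarrow> \<phi> (g \<otimes>\<^bsub>G\<^esub> h) x = \<phi> g (\<phi> h x)"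
    and one: "\<And>x. x \<in> E \<Longrightarrow> \<phi> \<one>\<^bsub>G\<^esub> x = x"
  shows "group_action G E \<phi>"
proof -
  interpret G: group G by (rule G)
  have bij: "\<phi> g \<in> Bij E" if g: "g \<in> carrier G" for g
  proof -
    have "bij_betw (\<phi> g) E E"
      by (rule bij_betw_byWitness[where f' = "\<phi> (inv\<^bsub>G\<^esub> g)"])
         (use g closed mult[symmetric] one in auto)
    then show ?thesis using ext[OF g] by (simp add: Bij_def)
  qed
  have "\<phi> \<in> hom G (BijGroup E)"
  proof (rule homI)
    fix g h assume g: "g \<in> carrier G" and h: "h \<in> carrier G"
    show "\<phi> g \<in> carrier (BijGroup E)" using bij[OF g] by (simp add: BijGroup_def)
    have "\<phi> (g \<otimes>\<^bsub>G\<^esub> h) = compose E (\<phi> g) (\<phi> h)"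
    proof (rule extensionalityI)
      show "\<phi> (g \<otimes>\<^bsub>G\<^esub> h) \<in> extensional E" using ext g h by simp
    qed (simp_all add: compose_def mult g h)
    then show "\<phi> (g \<otimes>\<^bsub>G\<^esub> h) = \<phi> g \<otimes>\<^bsub>BijGroup E\<^esub> \<phi> h"
      using bij[OF g] bij[OF h] by (simp add: BijGroup_def)
  qed
  then show ?thesis
    unfolding group_action_def group_hom_def group_hom_axioms_def
    using G group_BijGroup by blast
qed

lemma cube_class_spheroid:
  assumes "f \<in> spheroids l X y"
  shows "cube_class l X y f = {g. rel_homotopic (unit_cube l) X (cube_boundary l) f g}"
proof -
  have "(\<lambda>p. \<forall>s\<in>cube_boundary l. p s = y) = (\<lambda>p. \<forall>s\<in>cube_boundary l. p s = f s)"
    using assms by (auto simp: spheroids_def fun_eq_iff)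
  then show ?thesis by (simp add: cube_class_def rel_homotopic_def)
qed

context based_operad
begin

context
  fixes l :: nat
  assumes l: "1 < l"
begin

lemma l0: "0 < l" using l by simp

abbreviation chom :: "nat \<Rightarrow> 'a cube_map \<Rightarrow> 'a cube_map \<Rightarrow> bool" where
  "chom k \<equiv> rel_homotopic (unit_cube l) (Space D k) (cube_boundary l)"

abbreviation sph :: "nat \<Rightarrow> 'a cube_map set" where
  "sph k \<equiv> spheroids l (Space D k) (e k)"

abbreviation ccls :: "nat \<Rightarrow> 'a cube_map \<Rightarrow> 'a set cube_map set" where
  "ccls \<equiv> proj_cube_class l Q D act \<eta>"

abbreviation LO :: "'a set cube_map set operad" where
  "LO \<equiv> pi_orbit_operad l Q D act \<eta>"

abbreviation hgs :: "nat \<Rightarrow> 'a set cube_map set set" where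
  "hgs k \<equiv> homotopy_group_set l (orb k) (quo k (e k))"

lemma sph_compose_quo: "f \<in> sph k \<Longrightarrow> quo k \<circ> f \<in> spheroids l (orb k) (quo k (e k))"
  using continuous_map_compose[OF _ continuous_quo] by (auto simp: spheroids_def)

lemma ccls_conv:
  "f \<in> sph k \<Longrightarrow> ccls k f = {g. rel_homotopic (unit_cube l) (orb k) (cube_boundary l) (quo k \<circ> f) g}"
  unfolding proj_cube_class_def by (rule cube_class_spheroid[OF sph_compose_quo])

lemma chom_sph: "f \<in> sph k \<Longrightarrow> chom k f g \<Longrightarrow> g \<in> sph k"
  using rel_homotopic_continuous(2) rel_homotopic_on by (fastforce simp: spheroids_def)

lemma boundary_point: "(\<lambda>i\<in>{..<l}. 0) \<in> cube_boundary l"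
  using l by (auto simp: cube_boundary_def topspace_cube)

text \<open>The boundary of the cube provides a point where the two lifts agree.\<close>

lemma chom_lift:
  assumes "f \<in> sph k" "g \<in> sph k" "rel_homotopic (unit_cube l) (orb k) (cube_boundary l) (quo k \<circ> f) (quo k \<circ> g)"
  shows "chom k f g"
proof (rule cov.rel_homotopic_lift[OF _ _ connected_cube cube_boundary_subset boundary_point])
  show "f (\<lambda>i\<in>{..<l}. 0) = g (\<lambda>i\<in>{..<l}. 0)"
    using assms(1,2) boundary_point by (simp add: spheroids_def)
qed (use assms in \<open>simp_all add: spheroids_def quo_conv orb_conv\<close>)

lemma ccls_eqI:
  assumes f: "f \<in> sph k" and h: "chom k f g"
  shows "ccls k f = ccls k g"
proof -
  have h': "rel_homotopic (unit_cube l) (orb k) (cube_boundary l) (quo k \<circ> f) (quo k \<circ> g)"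
    by (rule rel_homotopic_postcompose[OF h continuous_quo])
  show ?thesis
    unfolding ccls_conv[OF f] ccls_conv[OF chom_sph[OF f h]]
    by (rule Collect_cong) (metis (full_types) h' rel_homotopic_sym rel_homotopic_trans)
qed

lemma cube_lifts_ccls:
  assumes f: "f \<in> sph k"
  shows "cube_lifts l Q D act \<eta> k (ccls k f) = {g. chom k f g}"
proof (intro Set.set_eqI iffI)
  fix g assume "g \<in> cube_lifts l Q D act \<eta> k (ccls k f)"
  then show "g \<in> {g. chom k f g}"
    using chom_lift[OF f] by (simp add: cube_lifts_def ccls_conv[OF f])
next
  fix g assume "g \<in> {g. chom k f g}"
  then have h: "chom k f g" by simp
  then show "g \<in> cube_lifts l Q D act \<eta> k (ccls k f)"
    using chom_sph[OF f h] rel_homotopic_postcompose[OF h continuous_quo]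
    by (simp add: cube_lifts_def ccls_conv[OF f])
qed

lemma chom_refl: "f \<in> sph k \<Longrightarrow> chom k f f"
  by (rule rel_homotopic_refl) (simp add: spheroids_def)

lemma ccls_in: "f \<in> sph k \<Longrightarrow> ccls k f \<in> hgs k"
  unfolding homotopy_group_set_def proj_cube_class_def using sph_compose_quo by blast

lemma hgs_cases:
  assumes "A \<in> hgs k"
  obtains f where "f \<in> sph k" "A = ccls k f"
proof -
  obtain F where F: "F \<in> spheroids l (orb k) (quo k (e k))" "A = cube_class l (orb k) (quo k (e k)) F"
    using assms unfolding homotopy_group_set_def by blast
  obtain f where f: "f \<in> sph k" "\<And>x. x \<in> topspace (unit_cube l) \<Longrightarrow> cov.quot k (f x) = F x"
    using cov.spheroid_lift[OF l F(1)[unfolded quo_conv orb_conv] e_in] by blast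
  have "rel_homotopic (unit_cube l) (orb k) (cube_boundary l) F (quo k \<circ> f)"
    by (rule rel_homotopic_eqI) (use F(1) f(2) cube_boundary_subset in \<open>auto simp: spheroids_def quo_conv\<close>)
  then have "A = ccls k f"
    unfolding F(2) cube_class_spheroid[OF F(1)] ccls_conv[OF f(1)]
    by (intro Collect_cong) (metis (full_types) rel_homotopic_sym rel_homotopic_trans)
  then show thesis using f(1) that by blast
qed

lemma Elems_LO [simp]: "Elems LO k = hgs k"
  by (simp add: pi_orbit_operad_def)

definition slists :: "nat list \<Rightarrow> 'a cube_map list set" where
  "slists ms = {gs. length gs = length ms \<and> (\<forall>i<length ms. gs ! i \<in> sph (ms ! i))}"

lemma slistsD:
  assumes "gs \<in> slists ms"
  shows "length gs = length ms" "i < length ms \<Longrightarrow> gs ! i \<in> sph (ms ! i)"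
  using assms by (auto simp: slists_def)

lemma LO_lists_cases:
  assumes "Bs \<in> ElemLists LO ms"
  obtains gs where "gs \<in> slists ms" "Bs = map2 ccls ms gs"
proof -
  have B: "length Bs = length ms" "\<And>i. i < length ms \<Longrightarrow> Bs ! i \<in> hgs (ms ! i)"
    using assms by (auto simp: ElemLists_iff)
  have "\<exists>g. i < length ms \<longrightarrow> g \<in> sph (ms ! i) \<and> Bs ! i = ccls (ms ! i) g" for i
  proof (cases "i < length ms")
    case True
    show ?thesis by (rule hgs_cases[OF B(2)[OF True]]) auto
  qed simp
  then obtain g where g: "\<And>i. i < length ms \<Longrightarrow> g i \<in> sph (ms ! i) \<and> Bs ! i = ccls (ms ! i) (g i)" by metis
  show thesis
  proof (rule that[of "map g [0..<length ms]"])
    show "map g [0..<length ms] \<in> slists ms" using g by (simp add: slists_def)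
    show "Bs = map2 ccls ms (map g [0..<length ms])"
      by (rule nth_equalityI) (use B g in auto)
  qed
qed

definition cgamma :: "nat list \<Rightarrow> 'a cube_map \<Rightarrow> 'a cube_map list \<Rightarrow> 'a cube_map" where
  "cgamma ms f gs = change_base l (\<delta> ms) (pointwise_comp D ms f gs)"

lemma pointwise_spheroid:
  assumes f: "f \<in> spheroids l (Space D (length ms)) x" and gs: "length gs = length ms"
    "\<And>i. i < length ms \<Longrightarrow> gs ! i \<in> spheroids l (Space D (ms ! i)) (xs ! i)" and xs: "length xs = length ms"
  shows "pointwise_comp D ms f gs \<in> spheroids l (Space D (sum_list ms)) (opcomp D ms x xs)"
  unfolding spheroids_def
proof (intro CollectI conjI ballI)
  show "continuous_map (unit_cube l) (Space D (sum_list ms)) (pointwise_comp D ms f gs)"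
    by (rule continuous_pointwise_comp[OF operad_D compact_cube]) (use f gs in \<open>auto simp: spheroids_def\<close>)
  fix s assume s: "s \<in> cube_boundary l"
  have "map (\<lambda>g. g s) gs = xs"
    by (rule nth_equalityI) (use gs xs s in \<open>auto simp: spheroids_def\<close>)
  then show "pointwise_comp D ms f gs s = opcomp D ms x xs"
    using f s by (simp add: pointwise_comp_def spheroids_def)
qed

lemma pointwise_sph:
  assumes "f \<in> sph (length ms)" "gs \<in> slists ms"
  shows "pointwise_comp D ms f gs \<in> spheroids l (Space D (sum_list ms)) (\<delta> ms 1)"
  unfolding \<delta>_1 by (rule pointwise_spheroid[OF assms(1)]) (use slistsD[OF assms(2)] in auto)

lemma cgamma_sph:
  assumes "f \<in> sph (length ms)" "gs \<in> slists ms"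
  shows "cgamma ms f gs \<in> sph (sum_list ms)"
  using change_base_spheroid[OF l0 pointwise_sph[OF assms] pathin_\<delta> refl] by (simp add: cgamma_def \<delta>_0)

lemma cgamma_cong:
  assumes f: "f \<in> sph (length ms)" and gs: "gs \<in> slists ms"
    and ff: "chom (length ms) f f'" and gg: "length gs' = length ms" "\<And>i. i < length ms \<Longrightarrow> chom (ms ! i) (gs ! i) (gs' ! i)"
  shows "chom (sum_list ms) (cgamma ms f gs) (cgamma ms f' gs')"
  unfolding cgamma_def
proof (rule change_base_cong[OF l0 _ path_homotopic_refl[OF pathin_\<delta>]])
  show "chom (sum_list ms) (pointwise_comp D ms f gs) (pointwise_comp D ms f' gs')"
    by (rule rel_homotopic_pointwise_comp[OF operad_D compact_cube cube_boundary_subset])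
       (use ff gg slistsD[OF gs] in auto)
  show "pointwise_comp D ms f gs s = \<delta> ms 1" if "s \<in> cube_boundary l" for s
    using pointwise_sph[OF f gs] that by (simp add: spheroids_def)
qed

lemma opcomp_LO:
  assumes f: "f \<in> sph (length ms)" and gs: "gs \<in> slists ms"
  shows "opcomp LO ms (ccls (length ms) f) (map2 ccls ms gs) = ccls (sum_list ms) (cgamma ms f gs)"
proof -
  note G = slistsD[OF gs]
  have "opcomp LO ms A Bs = (\<Union>f \<in> cube_lifts l Q D act \<eta> (length ms) A.
        \<Union>gs \<in> listset (map2 (cube_lifts l Q D act \<eta>) ms Bs). ccls (sum_list ms) (cgamma ms f gs))" for A Bs
    by (simp add: pi_orbit_operad_def cgamma_def)
  moreover have "(\<Union>f' \<in> cube_lifts l Q D act \<eta> (length ms) (ccls (length ms) f).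
        \<Union>gs' \<in> listset (map2 (cube_lifts l Q D act \<eta>) ms (map2 ccls ms gs)). ccls (sum_list ms) (cgamma ms f' gs'))
      = ccls (sum_list ms) (cgamma ms f gs)"
  proof (rule UN_const)
    show "f \<in> cube_lifts l Q D act \<eta> (length ms) (ccls (length ms) f)"
      using f by (simp add: cube_lifts_ccls chom_refl)
    show "gs \<in> listset (map2 (cube_lifts l Q D act \<eta>) ms (map2 ccls ms gs))"
      using G by (auto simp: listset_iff cube_lifts_ccls chom_refl)
    fix f' gs' assume "f' \<in> cube_lifts l Q D act \<eta> (length ms) (ccls (length ms) f)"
      and "gs' \<in> listset (map2 (cube_lifts l Q D act \<eta>) ms (map2 ccls ms gs))"
    then have "chom (length ms) f f'" "length gs' = length ms"
      "\<And>i. i < length ms \<Longrightarrow> chom (ms ! i) (gs ! i) (gs' ! i)"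
      using G f by (auto simp: listset_iff cube_lifts_ccls)
    from cgamma_cong[OF f gs this] show "ccls (sum_list ms) (cgamma ms f' gs') = ccls (sum_list ms) (cgamma ms f gs)"
      by (rule ccls_eqI[symmetric, OF cgamma_sph[OF f gs]])
  qed
  ultimately show ?thesis by simp
qed

text \<open>If the pointwise composite is itself a change of basepoint, its path can be attached to the linear path.\<close>

lemma cgamma_expand:
  assumes f: "f \<in> sph (length ms)" and gs: "gs \<in> slists ms"
    and P: "chom (sum_list ms) (pointwise_comp D ms f gs) (change_base l A X)"
    and A: "pathin (Space D (sum_list ms)) A" "A 0 = \<delta> ms 1"
    and X: "X \<in> spheroids l (Space D (sum_list ms)) (A 1)"
  shows "chom (sum_list ms) (cgamma ms f gs) (change_base l (\<delta> ms \<bullet>\<bullet> A) X)"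
proof -
  have "chom (sum_list ms) (cgamma ms f gs) (change_base l (\<delta> ms) (change_base l A X))"
    unfolding cgamma_def
    by (rule change_base_cong[OF l0 P path_homotopic_refl[OF pathin_\<delta>]])
       (use pointwise_sph[OF f gs] in \<open>simp add: spheroids_def\<close>)
  also have "chom (sum_list ms) \<dots> (change_base l (\<delta> ms \<bullet>\<bullet> A) X)"
    by (rule change_base_join[OF l0 X A(1) refl pathin_\<delta>]) (simp add: A(2))
  finally show ?thesis .
qed

lemma change_base_const': "f \<in> spheroids l X y \<Longrightarrow> rel_homotopic (unit_cube l) X (cube_boundary l) f (change_base l (\<lambda>_. y) f)"
  by (rule change_base_const[OF l0])

lemma concat_slists:
  assumes "list_all2 (\<lambda>hs ns. hs \<in> slists ns) hss nss"
  shows "concat hss \<in> slists (concat nss)"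
proof -
  have app: "xs @ ys \<in> slists (ms @ ns)" if "xs \<in> slists ms" "ys \<in> slists ns" for xs ys ms ns
    using that unfolding slists_def by (auto simp: nth_append)
  show ?thesis
    using assms by (induction rule: list_all2_induct) (auto simp: app, simp add: slists_def)
qed

lemma sph_in: "f \<in> spheroids l X y \<Longrightarrow> x \<in> topspace (unit_cube l) \<Longrightarrow> f x \<in> topspace X"
  unfolding spheroids_def using continuous_map_image_subset_topspace by fastforce

text \<open>The argument is the one for paths. Both sides are changes of basepoint of pointwise three-fold
  composites, which are equal by associativity in \<open>D\<close>, along the two homotopic paths in \<open>\<delta>_assoc\<close>.\<close>

lemma cgamma_assoc:
  assumes f: "f \<in> sph (length nss)" and gs: "gs \<in> slists (map length nss)"
    and hss: "list_all2 (\<lambda>hs ns. hs \<in> slists ns) hss nss"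
  shows "chom (sum_list (concat nss))
    (cgamma (concat nss) (cgamma (map length nss) f gs) (concat hss))
    (cgamma (map sum_list nss) f (map (\<lambda>i. cgamma (nss ! i) (gs ! i) (hss ! i)) [0..<length nss]))"
proof -
  let ?N = "concat nss" and ?ms = "map length nss" and ?Ns = "map sum_list nss" and ?k = "length nss"
  let ?M = "sum_list ?N" and ?X = "Space D (sum_list (concat nss))"
  define H where "H = concat hss"
  have lenN: "sum_list ?ms = length ?N" by (simp add: length_concat)
  have MN: "sum_list ?Ns = ?M" by (simp add: sum_list_concat)
  have lh: "length hss = ?k" and hi: "\<And>i. i < ?k \<Longrightarrow> hss ! i \<in> slists (nss ! i)"
    using hss by (auto simp: list_all2_conv_all_nth)
  note G = slistsD[OF gs]
  have lg: "length gs = ?k" and gi: "\<And>i. i < ?k \<Longrightarrow> gs ! i \<in> sph (length (nss ! i))" using G by auto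
  have fm: "f \<in> sph (length ?ms)" "f \<in> sph (length ?Ns)" using f by simp_all
  have H: "H \<in> slists ?N" unfolding H_def by (rule concat_slists[OF hss])
  note Hd = slistsD[OF H]
  have g1: "cgamma ?ms f gs \<in> sph (length ?N)" using cgamma_sph[OF fm(1) gs] by (simp only: lenN)
  define K where "K = map (\<lambda>i. cgamma (nss ! i) (gs ! i) (hss ! i)) [0..<?k]"
  have K: "K \<in> slists ?Ns" using cgamma_sph[OF gi hi] by (simp add: K_def slists_def)
  \<comment> \<open>the entries of \<open>H\<close> are replaced by their change of basepoint along constant paths\<close>
  define as where "as = map (\<lambda>n (_::real). e n) ?N"
  define A where "A = pointwise_comp D ?N (\<delta> ?ms) as"
  define X where "X = pointwise_comp D ?N (pointwise_comp D ?ms f gs) H"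
  have A: "pathin ?X A" unfolding A_def
    by (rule pathin_pointwise) (use pathin_\<delta>'[OF lenN] in \<open>auto simp: as_def e_in\<close>)
  have A0: "A 0 = \<delta> ?N 1" by (simp add: A_def pointwise_comp_def \<delta>_0 \<delta>_1 as_def o_def lenN)
  have A1: "A 1 = opcomp D ?N (\<delta> ?ms 1) (map e ?N)" by (simp add: A_def pointwise_comp_def as_def o_def)
  have X: "X \<in> spheroids l ?X (A 1)"
    unfolding X_def A1 by (rule pointwise_spheroid) (use pointwise_sph[OF fm(1) gs, unfolded lenN] Hd in auto)
  have L: "chom ?M (pointwise_comp D ?N (cgamma ?ms f gs) H) (change_base l A X)"
  proof -
    have "chom ?M (pointwise_comp D ?N (cgamma ?ms f gs) H)
        (pointwise_comp D ?N (cgamma ?ms f gs) (map2 (change_base l) as H))"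
    proof (rule rel_homotopic_pointwise_comp[OF operad_D compact_cube cube_boundary_subset])
      show "chom (length ?N) (cgamma ?ms f gs) (cgamma ?ms f gs)" by (rule chom_refl[OF g1])
      show "chom (?N ! i) (H ! i) (map2 (change_base l) as H ! i)" if "i < length ?N" for i
        using change_base_const'[OF Hd(2)[OF that]] that Hd(1) by (simp add: as_def)
    qed (use Hd(1) in \<open>simp_all add: as_def\<close>)
    also have "pointwise_comp D ?N (cgamma ?ms f gs) (map2 (change_base l) as H) = change_base l A X"
      unfolding cgamma_def A_def X_def
      by (rule pointwise_comp_change_base[OF l0]) (use Hd(1) in \<open>simp add: as_def\<close>)
    finally show ?thesis .
  qed
  have L': "chom ?M (cgamma ?N (cgamma ?ms f gs) H) (change_base l (\<delta> ?N \<bullet>\<bullet> A) X)"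
    by (rule cgamma_expand[OF g1 H L A A0 X])
  \<comment> \<open>here the same is done to \<open>f\<close>\<close>
  define bs where "bs = map (\<lambda>i. pointwise_comp D (nss ! i) (gs ! i) (hss ! i)) [0..<?k]"
  define B where "B = pointwise_comp D ?Ns (\<lambda>_. e ?k) (map \<delta> nss)"
  define Y where "Y = pointwise_comp D ?Ns f bs"
  have B: "pathin (Space D (sum_list ?Ns)) B" unfolding B_def
    by (rule pathin_pointwise) (auto simp: e_in pathin_\<delta>)
  have B0: "B 0 = \<delta> ?Ns 1" by (simp add: B_def pointwise_comp_def \<delta>_0 \<delta>_1 o_def)
  have B1: "B 1 = opcomp D ?Ns (e ?k) (map (\<lambda>ns. \<delta> ns 1) nss)" by (simp add: B_def pointwise_comp_def o_def)
  have Y: "Y \<in> spheroids l (Space D (sum_list ?Ns)) (B 1)"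
    unfolding Y_def B1
    by (rule pointwise_spheroid) (use f pointwise_sph[OF gi hi] in \<open>auto simp: bs_def\<close>)
  have "chom (sum_list ?Ns) (pointwise_comp D ?Ns f K) (change_base l B Y)"
  proof -
    have "K = map2 (change_base l) (map \<delta> nss) bs"
      by (rule nth_equalityI) (auto simp: K_def bs_def cgamma_def)
    then have "pointwise_comp D ?Ns (change_base l (\<lambda>_. e ?k) f) K = change_base l B Y"
      unfolding B_def Y_def
      by (simp add: pointwise_comp_change_base[OF l0] bs_def)
    moreover have "chom (sum_list ?Ns) (pointwise_comp D ?Ns f K) (pointwise_comp D ?Ns (change_base l (\<lambda>_. e ?k) f) K)"
      by (rule rel_homotopic_pointwise_comp[OF operad_D compact_cube cube_boundary_subset])
         (use change_base_const'[OF f] slistsD[OF K] chom_refl in auto)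
    ultimately show ?thesis by simp
  qed
  from cgamma_expand[OF fm(2) K this B B0 Y]
  have R': "chom ?M (cgamma ?Ns f K) (change_base l (\<delta> ?Ns \<bullet>\<bullet> B) Y)" by (simp only: MN)
  have XY: "chom ?M X Y"
  proof (rule rel_homotopic_eqI[OF _ cube_boundary_subset])
    show "continuous_map (unit_cube l) ?X X" using X by (simp add: spheroids_def)
    fix t :: "nat \<Rightarrow> real" assume t: "t \<in> topspace (unit_cube l)"
    have "opcomp D ?N (opcomp D ?ms (f t) (map (\<lambda>g. g t) gs)) (concat (map (map (\<lambda>h. h t)) hss)) =
        opcomp D ?Ns (f t) (map (\<lambda>i. opcomp D (nss ! i) (map (\<lambda>g. g t) gs ! i) (map (map (\<lambda>h. h t)) hss ! i)) [0..<?k])"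
    proof (rule opcomp_assoc)
      show "f t \<in> Elems D ?k" by (rule sph_in[OF f t])
      show "map (\<lambda>g. g t) gs \<in> ElemLists D ?ms"
        using sph_in[OF gi t] lg by (simp add: ElemLists_iff)
      have "(hss ! i ! j) t \<in> Elems D (nss ! i ! j)" if "i < ?k" "j < length (nss ! i)" for i j
        by (rule sph_in[OF slistsD(2)[OF hi[OF that(1)] that(2)] t])
      then show "list_all2 (\<lambda>cs ns. cs \<in> ElemLists D ns) (map (map (\<lambda>h. h t)) hss) nss"
        using slistsD(1)[OF hi] lh by (auto simp: list_all2_conv_all_nth ElemLists_iff)
    qed
    moreover have "map (\<lambda>i. opcomp D (nss ! i) (map (\<lambda>g. g t) gs ! i) (map (map (\<lambda>h. h t)) hss ! i)) [0..<?k] =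
        map (\<lambda>g. g t) bs"
      by (rule nth_equalityI) (use lg lh in \<open>auto simp: bs_def pointwise_comp_def\<close>)
    ultimately show "X t = Y t"
      by (simp add: X_def Y_def pointwise_comp_def H_def map_concat)
  qed
  have d: "path_homotopic ?X (\<delta> ?N \<bullet>\<bullet> A) (\<delta> ?Ns \<bullet>\<bullet> B)"
    unfolding A_def B_def as_def by (rule \<delta>_assoc)
  have "chom ?M (change_base l (\<delta> ?N \<bullet>\<bullet> A) X) (change_base l (\<delta> ?Ns \<bullet>\<bullet> B) Y)"
    by (rule change_base_cong[OF l0 XY d]) (use X in \<open>simp add: spheroids_def\<close>)
  then have "chom ?M (cgamma ?N (cgamma ?ms f gs) H) (cgamma ?Ns f K)"
    using L' R' by (meson rel_homotopic_sym rel_homotopic_trans)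
  then show ?thesis unfolding H_def K_def .
qed

lemma const_sph: "(\<lambda>_. e k) \<in> sph k"
  using e_in by (simp add: spheroids_def)

lemma cgamma_unit_left:
  assumes f: "f \<in> sph n"
  shows "chom n (cgamma [n] (\<lambda>_. e 1) [f]) f"
proof -
  let ?p = "pointwise_comp D [n] (\<lambda>_. e 1) [f]"
  have "chom n f ?p"
  proof (rule rel_homotopic_eqI[OF _ cube_boundary_subset])
    show "continuous_map (unit_cube l) (Space D n) f" using f by (simp add: spheroids_def)
    fix t assume "t \<in> topspace (unit_cube l)"
    then have "f t \<in> Elems D n" by (rule sph_in[OF f])
    then show "f t = ?p t"
      using operad_D unfolding topological_operad_def pointwise_comp_def e_1 by simp
  qed
  then have "chom n (change_base l (\<lambda>_. e n) f) (change_base l (\<lambda>_. e n) ?p)"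
    by (rule change_base_cong[OF l0]) (use f e_in in \<open>simp_all add: path_homotopic_refl spheroids_def\<close>)
  then have "chom n f (change_base l (\<lambda>_. e n) ?p)"
    using change_base_const'[OF f] rel_homotopic_trans by blast
  then show ?thesis unfolding cgamma_def \<delta>_unit by (rule rel_homotopic_sym)
qed

lemma cgamma_unit_right:
  assumes f: "f \<in> sph n"
  shows "chom n (cgamma (replicate n 1) f (replicate n (\<lambda>_. e 1))) f"
proof -
  let ?p = "pointwise_comp D (replicate n 1) f (replicate n (\<lambda>_. e 1))"
  have "chom n f ?p"
  proof (rule rel_homotopic_eqI[OF _ cube_boundary_subset])
    show "continuous_map (unit_cube l) (Space D n) f" using f by (simp add: spheroids_def)
    fix t assume "t \<in> topspace (unit_cube l)"
    then have "f t \<in> Elems D n" by (rule sph_in[OF f])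
    then have "opcomp D (replicate n 1) (f t) (replicate n (opunit D)) = f t"
      using operad_D unfolding topological_operad_def by (elim conjE) simp
    then show "f t = ?p t" by (simp add: pointwise_comp_def e_1 del: One_nat_def)
  qed
  then have "chom n (change_base l (\<lambda>_. e n) f) (change_base l (\<lambda>_. e n) ?p)"
    by (rule change_base_cong[OF l0]) (use f e_in in \<open>simp_all add: path_homotopic_refl spheroids_def\<close>)
  then have "chom n f (change_base l (\<lambda>_. e n) ?p)"
    using change_base_const'[OF f] rel_homotopic_trans by blast
  then show ?thesis unfolding cgamma_def \<delta>_units by (rule rel_homotopic_sym)
qed

lemma hgs_0: "hgs 0 = {ccls 0 (\<lambda>_. e 0)}"
proof (intro equalityI subsetI)
  fix A assume "A \<in> hgs 0"
  then obtain f where f: "f \<in> sph 0" "A = ccls 0 f" by (rule hgs_cases)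
  have "chom 0 f (\<lambda>_. e 0)"
    by (rule rel_homotopic_eqI[OF _ cube_boundary_subset]) (use f sph_in[OF f(1)] Elems_0 in \<open>auto simp: spheroids_def\<close>)
  then show "A \<in> {ccls 0 (\<lambda>_. e 0)}" unfolding f(2) by (simp add: ccls_eqI[OF f(1)])
next
  fix A assume "A \<in> {ccls 0 (\<lambda>_. e 0)}"
  then show "A \<in> hgs 0" by (simp add: ccls_in[OF const_sph])
qed

lemma topological_operad_LO: "topological_operad LO"
proof (rule topological_operad_discreteI[where E = hgs])
  show "Space LO n = discrete_topology (hgs n)" for n by (simp add: pi_orbit_operad_def)
  show "\<exists>x. hgs 0 = {x}" by (rule exI, rule hgs_0)
  have one: "opunit LO = ccls 1 (\<lambda>_. e 1)" by (simp add: pi_orbit_operad_def)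
  show "opunit LO \<in> hgs 1" unfolding one by (rule ccls_in[OF const_sph])
  show "opcomp LO ms A Bs \<in> hgs (sum_list ms)" if A: "A \<in> hgs (length ms)" and Bs: "Bs \<in> ElemLists LO ms" for ms A Bs
  proof -
    obtain f where f: "f \<in> sph (length ms)" "A = ccls (length ms) f" using A by (rule hgs_cases)
    obtain gs where gs: "gs \<in> slists ms" "Bs = map2 ccls ms gs" using Bs by (rule LO_lists_cases)
    show ?thesis unfolding f(2) gs(2) opcomp_LO[OF f(1) gs(1)] by (rule ccls_in[OF cgamma_sph[OF f(1) gs(1)]])
  qed
  show "opcomp LO [n] (opunit LO) [A] = A" if A: "A \<in> hgs n" for n A
  proof -
    obtain f where f: "f \<in> sph n" "A = ccls n f" using A by (rule hgs_cases)
    have c: "(\<lambda>_. e 1) \<in> sph (length [n])" using const_sph[of 1] by simp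
    have g: "[f] \<in> slists [n]" using f by (simp add: slists_def)
    have "opcomp LO [n] (ccls (length [n]) (\<lambda>_. e 1)) (map2 ccls [n] [f]) = ccls (sum_list [n]) (cgamma [n] (\<lambda>_. e 1) [f])"
      by (rule opcomp_LO[OF c g])
    moreover have "ccls n (cgamma [n] (\<lambda>_. e 1) [f]) = ccls n f"
      by (rule ccls_eqI[symmetric, OF f(1) rel_homotopic_sym[OF cgamma_unit_left[OF f(1)]]])
    ultimately show ?thesis unfolding one f(2) by simp
  qed
  show "opcomp LO (replicate n 1) A (replicate n (opunit LO)) = A" if A: "A \<in> hgs n" for n A
  proof -
    let ?u = "replicate n (1::nat)"
    obtain f where f: "f \<in> sph n" "A = ccls n f" using A by (rule hgs_cases)
    have fu: "f \<in> sph (length ?u)" using f by simp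
    have g: "replicate n (\<lambda>_. e 1) \<in> slists ?u" using const_sph[of 1] by (simp add: slists_def)
    have s: "sum_list ?u = n" by (simp add: sum_list_replicate)
    have "map2 ccls ?u (replicate n (\<lambda>_. e 1)) = replicate n (ccls 1 (\<lambda>_. e 1))" by (auto intro: nth_equalityI)
    then have "opcomp LO ?u (ccls n f) (replicate n (ccls 1 (\<lambda>_. e 1))) = ccls n (cgamma ?u f (replicate n (\<lambda>_. e 1)))"
      using opcomp_LO[OF fu g] by (simp only: s length_replicate)
    moreover have "ccls n (cgamma ?u f (replicate n (\<lambda>_. e 1))) = ccls n f"
      by (rule ccls_eqI[symmetric, OF f(1) rel_homotopic_sym[OF cgamma_unit_right[OF f(1)]]])
    ultimately show ?thesis unfolding one f(2) by (simp only:)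
  qed
  show "opcomp LO (concat nss) (opcomp LO (map length nss) A Bs) (concat Css) =
        opcomp LO (map sum_list nss) A (map (\<lambda>i. opcomp LO (nss ! i) (Bs ! i) (Css ! i)) [0..<length nss])"
    if A: "A \<in> hgs (length nss)" and Bs: "Bs \<in> ElemLists LO (map length nss)"
      and Css: "list_all2 (\<lambda>cs ns. cs \<in> ElemLists LO ns) Css nss" for nss A Bs Css
  proof -
    obtain f where f: "f \<in> sph (length nss)" "A = ccls (length nss) f" using A by (rule hgs_cases)
    obtain gs where gs: "gs \<in> slists (map length nss)" "Bs = map2 ccls (map length nss) gs"
      using Bs by (rule LO_lists_cases)
    have "\<exists>hs. i < length nss \<longrightarrow> hs \<in> slists (nss ! i) \<and> Css ! i = map2 ccls (nss ! i) hs" for i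
    proof (cases "i < length nss")
      case True
      then have "Css ! i \<in> ElemLists LO (nss ! i)"
        using Css by (simp add: list_all2_conv_all_nth)
      then show ?thesis by (rule LO_lists_cases) blast
    qed simp
    then obtain hf where hf: "\<And>i. i < length nss \<Longrightarrow> hf i \<in> slists (nss ! i) \<and> Css ! i = map2 ccls (nss ! i) (hf i)"
      by metis
    define hss where "hss = map hf [0..<length nss]"
    have lC: "length Css = length nss" using Css by (rule list_all2_lengthD)
    have hss: "list_all2 (\<lambda>hs ns. hs \<in> slists ns) hss nss"
      using hf by (simp add: hss_def list_all2_conv_all_nth)
    have "Css = map2 (map2 ccls) nss hss"
      by (rule nth_equalityI) (use lC hf in \<open>auto simp: hss_def\<close>)
    moreover have "concat (map2 (map2 ccls) nss hss) = map2 ccls (concat nss) (concat hss)"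
      by (rule map2_concat[symmetric]) (use hf in \<open>auto simp: hss_def list_all2_conv_all_nth slists_def\<close>)
    ultimately have cC: "concat Css = map2 ccls (concat nss) (concat hss)" by simp
    note H = concat_slists[OF hss]
    have fm: "f \<in> sph (length (map length nss))" "f \<in> sph (length (map sum_list nss))"
      using f by simp_all
    have lenN: "sum_list (map length nss) = length (concat nss)" by (simp add: length_concat)
    have g1: "cgamma (map length nss) f gs \<in> sph (length (concat nss))"
      using cgamma_sph[OF fm(1) gs(1)] by (simp only: lenN)
    have left: "opcomp LO (concat nss) (opcomp LO (map length nss) A Bs) (concat Css) =
        ccls (sum_list (concat nss)) (cgamma (concat nss) (cgamma (map length nss) f gs) (concat hss))"
      using opcomp_LO[OF fm(1) gs(1)] opcomp_LO[OF g1 H] unfolding f(2) gs(2) cC lenN length_map by simp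
    define K where "K = map (\<lambda>i. cgamma (nss ! i) (gs ! i) (hss ! i)) [0..<length nss]"
    have lg: "length gs = length nss" using slistsD(1)[OF gs(1)] by simp
    have gi: "gs ! i \<in> sph (length (nss ! i))" "hss ! i \<in> slists (nss ! i)" if "i < length nss" for i
      using slistsD(2)[OF gs(1), of i] that hf by (simp_all add: hss_def)
    have K: "K \<in> slists (map sum_list nss)"
      using cgamma_sph[OF gi] by (auto simp: K_def slists_def)
    have "map (\<lambda>i. opcomp LO (nss ! i) (Bs ! i) (Css ! i)) [0..<length nss] = map2 ccls (map sum_list nss) K"
    proof (rule nth_equalityI)
      fix i assume "i < length (map (\<lambda>i. opcomp LO (nss ! i) (Bs ! i) (Css ! i)) [0..<length nss])"
      then have i: "i < length nss" by simp
      then show "map (\<lambda>i. opcomp LO (nss ! i) (Bs ! i) (Css ! i)) [0..<length nss] ! i = map2 ccls (map sum_list nss) K ! i"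
        using opcomp_LO[OF gi[OF i]] hf[OF i] lg by (simp add: gs(2) K_def hss_def)
    qed (simp add: K_def)
    then have right: "opcomp LO (map sum_list nss) A (map (\<lambda>i. opcomp LO (nss ! i) (Bs ! i) (Css ! i)) [0..<length nss])
        = ccls (sum_list (map sum_list nss)) (cgamma (map sum_list nss) f K)"
      using opcomp_LO[OF fm(2) K] unfolding f(2) by simp
    have "ccls (sum_list (concat nss)) (cgamma (concat nss) (cgamma (map length nss) f gs) (concat hss)) =
        ccls (sum_list (concat nss)) (cgamma (map sum_list nss) f K)"
      unfolding K_def by (rule ccls_eqI[OF cgamma_sph[OF g1 H] cgamma_assoc[OF f(1) gs(1) hss]])
    then show ?thesis using left right by (simp add: sum_list_concat)
  qed
qed

subsection \<open>The action of the fundamental groups\<close>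

definition cact :: "nat \<Rightarrow> (real \<Rightarrow> 'a) \<Rightarrow> 'a cube_map \<Rightarrow> 'a cube_map" where
  "cact k a f = change_base l a (act k (bd k a) \<circ> f)"

abbreviation LA :: "nat \<Rightarrow> (real \<Rightarrow> 'a set) set \<Rightarrow> 'a set cube_map set \<Rightarrow> 'a set cube_map set" where
  "LA \<equiv> pi_orbit_act l Q D act \<eta>"

lemma act_sph:
  assumes "q \<in> carrier (Grp Q k)" "f \<in> spheroids l (Space D k) x"
  shows "act k q \<circ> f \<in> spheroids l (Space D k) (act k q x)"
  using assms continuous_map_compose[OF _ continuous_act[OF assms(1)]] by (auto simp: spheroids_def)

lemma act_loop_sph:
  assumes a: "a \<in> loop_lifts k" and f: "f \<in> sph k"
  shows "act k (bd k a) \<circ> f \<in> spheroids l (Space D k) (a 1)"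
  using act_sph[OF loop_liftsD(3)[OF a] f] loop_liftsD(4)[OF a] by simp

lemma cact_sph:
  assumes a: "a \<in> loop_lifts k" and f: "f \<in> sph k"
  shows "cact k a f \<in> sph k"
  using change_base_spheroid[OF l0 act_loop_sph[OF a f] loop_liftsD(1)[OF a] refl] loop_liftsD(2)[OF a]
  by (simp add: cact_def)

lemma cact_cong:
  assumes a: "a \<in> loop_lifts k" and f: "f \<in> sph k" and aa: "path_homotopic (Space D k) a a'" and ff: "chom k f f'"
  shows "chom k (cact k a f) (cact k a' f')"
  unfolding cact_def loop_lifts_homotopic(2)[OF a aa]
  by (rule change_base_cong[OF l0 rel_homotopic_postcompose[OF ff continuous_act[OF loop_liftsD(3)[OF a]]] aa])
     (use act_loop_sph[OF a f] in \<open>simp add: spheroids_def\<close>)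

lemma LA_ccls:
  assumes a: "a \<in> loop_lifts k" and f: "f \<in> sph k"
  shows "LA k (cls k a) (ccls k f) = ccls k (cact k a f)"
proof -
  have "LA k (cls k a) (ccls k f) = (\<Union>a \<in> path_lifts Q D act \<eta> k (cls k a).
      \<Union>f \<in> cube_lifts l Q D act \<eta> k (ccls k f). ccls k (cact k a f))"
    using ccls_in[OF f] by (simp add: pi_orbit_act_def cact_def)
  also have "\<dots> = ccls k (cact k a f)"
  proof (rule UN_const)
    show "a \<in> path_lifts Q D act \<eta> k (cls k a)"
      using a by (simp add: path_lifts_cls path_homotopic_refl loop_liftsD)
    show "f \<in> cube_lifts l Q D act \<eta> k (ccls k f)" using f by (simp add: cube_lifts_ccls chom_refl)
    fix a' f' assume "a' \<in> path_lifts Q D act \<eta> k (cls k a)" "f' \<in> cube_lifts l Q D act \<eta> k (ccls k f)"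
    then have "path_homotopic (Space D k) a a'" "chom k f f'"
      by (simp_all add: path_lifts_cls[OF a] cube_lifts_ccls[OF f])
    then show "ccls k (cact k a' f') = ccls k (cact k a f)"
      by (intro ccls_eqI[symmetric, OF cact_sph[OF a f]] cact_cong[OF a f])
  qed
  finally show ?thesis .
qed

text \<open>Translation commutes with change of basepoint, so two successive actions are one change of basepoint
  along the product of the lifts.\<close>

lemma cact_star:
  assumes a: "a \<in> loop_lifts k" and b: "b \<in> loop_lifts k" and f: "f \<in> sph k"
  shows "chom k (cact k a (cact k b f)) (cact k (star k a b) f)"
proof -
  note A = loop_liftsD[OF a] and B = loop_liftsD[OF b]
  let ?qa = "bd k a" and ?qb = "bd k b"
  have bf: "act k ?qb \<circ> f \<in> spheroids l (Space D k) (b 1)" by (rule act_loop_sph[OF b f])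
  have abf: "act k ?qa \<circ> (act k ?qb \<circ> f) \<in> spheroids l (Space D k) (act k ?qa (b 1))" by (rule act_sph[OF A(3) bf])
  have pb: "pathin (Space D k) (act k ?qa \<circ> b)" by (rule pathin_act[OF A(3) B(1)])
  have "cact k a (cact k b f) = change_base l a (change_base l (act k ?qa \<circ> b) (act k ?qa \<circ> (act k ?qb \<circ> f)))"
    unfolding cact_def compose_change_base[OF l0] ..
  moreover have "chom k (change_base l a (change_base l (act k ?qa \<circ> b) (act k ?qa \<circ> (act k ?qb \<circ> f))))
      (change_base l (a \<bullet>\<bullet> (act k ?qa \<circ> b)) (act k ?qa \<circ> (act k ?qb \<circ> f)))"
    by (rule change_base_join[OF l0 abf pb _ A(1)]) (simp_all add: A B)
  moreover have "chom k (change_base l (a \<bullet>\<bullet> (act k ?qa \<circ> b)) (act k ?qa \<circ> (act k ?qb \<circ> f))) (cact k (star k a b) f)"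
    unfolding cact_def star_loop(2)[OF a b] unfolding star_def
  proof (rule change_base_cong[OF l0])
    show "chom k (act k ?qa \<circ> (act k ?qb \<circ> f)) (act k (?qa \<otimes>\<^bsub>Grp Q k\<^esub> ?qb) \<circ> f)"
    proof (rule rel_homotopic_eqI[OF _ cube_boundary_subset])
      show "continuous_map (unit_cube l) (Space D k) (act k ?qa \<circ> (act k ?qb \<circ> f))" using abf by (simp add: spheroids_def)
    qed (simp add: cov.act_mult A B sph_in[OF f])
    show "path_homotopic (Space D k) (a \<bullet>\<bullet> (act k ?qa \<circ> b)) (a \<bullet>\<bullet> (act k ?qa \<circ> b))"
      by (rule path_homotopic_refl, rule pathin_join[OF A(1) pb]) (simp add: A B)
  qed (use abf in \<open>simp add: spheroids_def\<close>)
  ultimately show ?thesis using rel_homotopic_trans by metis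
qed

lemma group_action_LA: "group_action (Grp PO k) (hgs k) (LA k)"
proof (rule group_actionI)
  show "group (Grp PO k)" by (simp add: group_\<pi>1)
  show "LA k A \<in> extensional (hgs k)" for A by (simp add: pi_orbit_act_def)
  show "LA k A B \<in> hgs k" if A: "A \<in> carrier (Grp PO k)" and B: "B \<in> hgs k" for A B
  proof -
    obtain a where a: "a \<in> loop_lifts k" "A = cls k a" using A unfolding Grp_PO by (rule \<pi>1_cases)
    obtain f where f: "f \<in> sph k" "B = ccls k f" using B by (rule hgs_cases)
    show ?thesis unfolding a(2) f(2) LA_ccls[OF a(1) f(1)] by (rule ccls_in[OF cact_sph[OF a(1) f(1)]])
  qed
  show "LA k (A \<otimes>\<^bsub>Grp PO k\<^esub> A') B = LA k A (LA k A' B)"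
    if A: "A \<in> carrier (Grp PO k)" and A': "A' \<in> carrier (Grp PO k)" and B: "B \<in> hgs k" for A A' B
  proof -
    obtain a where a: "a \<in> loop_lifts k" "A = cls k a" using A unfolding Grp_PO by (rule \<pi>1_cases)
    obtain b where b: "b \<in> loop_lifts k" "A' = cls k b" using A' unfolding Grp_PO by (rule \<pi>1_cases)
    obtain f where f: "f \<in> sph k" "B = ccls k f" using B by (rule hgs_cases)
    have bf: "cact k b f \<in> sph k" by (rule cact_sph[OF b(1) f(1)])
    have "LA k (A \<otimes>\<^bsub>Grp PO k\<^esub> A') B = ccls k (cact k (star k a b) f)"
      unfolding a(2) b(2) f(2) Grp_PO \<pi>1_mult[OF a(1) b(1)] by (rule LA_ccls[OF star_loop(1)[OF a(1) b(1)] f(1)])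
    also have "\<dots> = ccls k (cact k a (cact k b f))"
      by (rule ccls_eqI[symmetric, OF cact_sph[OF a(1) bf] cact_star[OF a(1) b(1) f(1)]])
    also have "\<dots> = LA k A (LA k A' B)"
      unfolding a(2) b(2) f(2) LA_ccls[OF b(1) f(1)] LA_ccls[OF a(1) bf] ..
    finally show ?thesis .
  qed
  show "LA k \<one>\<^bsub>Grp PO k\<^esub> B = B" if B: "B \<in> hgs k" for B
  proof -
    obtain f where f: "f \<in> sph k" "B = ccls k f" using B by (rule hgs_cases)
    have "chom k f (act k \<one>\<^bsub>Grp Q k\<^esub> \<circ> f)"
      by (rule rel_homotopic_eqI[OF _ cube_boundary_subset])
         (use f sph_in[OF f(1)] in \<open>auto simp: spheroids_def cov.act_one\<close>)
    then have "chom k (change_base l (\<lambda>_. e k) f) (cact k (\<lambda>_. e k) f)"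
      unfolding cact_def const_loop(2)
      by (rule change_base_cong[OF l0]) (use f e_in in \<open>simp_all add: path_homotopic_refl spheroids_def\<close>)
    then have "chom k f (cact k (\<lambda>_. e k) f)"
      using change_base_const'[OF f(1)] rel_homotopic_trans by blast
    then show ?thesis
      unfolding Grp_PO \<pi>1_one f(2) LA_ccls[OF const_loop(1) f(1)] by (rule ccls_eqI[symmetric, OF f(1)])
  qed
qed

lemma slists_invperm:
  assumes "\<sigma> permutes {..<length ms}" "gs \<in> slists ms"
  shows "invperm \<sigma> gs \<in> slists (invperm \<sigma> ms)"
  using assms(2) inv_perm_less[OF assms(1)] by (auto simp: slists_def invperm_nth)

text \<open>Both sides are changes of basepoint of pointwise composites that agree by equivariance. On the left-hand
  side the path is \<open>\<delta>\<^sub>1\<close> followed by the pointwise composite of the acting paths. On the right-hand side it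
  is followed in addition by the translated second linear path, back and forth.\<close>

lemma cgamma_cact:
  assumes s: "s \<in> loop_lifts (length ms)" and ts: "ts \<in> loop_lists ms"
    and f: "f \<in> sph (length ms)" and gs: "gs \<in> slists ms"
  shows "chom (sum_list ms) (cgamma ms (cact (length ms) s f) (map (\<lambda>i. cact (ms ! i) (ts ! i) (gs ! i)) [0..<length ms]))
    (cact (sum_list ms) (gamma ms s ts)
      (cgamma (invperm (sig (length ms) s) ms) f (invperm (sig (length ms) s) gs)))"
proof -
  let ?k = "length ms" and ?m = "sum_list ms" and ?p = "sig (length ms) s"
  let ?ms = "invperm ?p ms" and ?gs = "invperm ?p gs" and ?X = "Space D (sum_list ms)"
  note S = loop_liftsD[OF s] and T = loop_listsD[OF ts] and G = slistsD[OF gs]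
  note TL = loop_liftsD[OF T(2)]
  note P = gamma_parts[OF s ts]
  have p: "?p permutes {..<?k}" by (rule sig_permutes[OF s])
  have m: "sum_list ?ms = ?m" by (rule sum_sig[OF s])
  have fl: "f \<in> sph (length ?ms)" using f by simp
  have gl: "?gs \<in> slists ?ms" by (rule slists_invperm[OF p gs])
  define \<kappa> where "\<kappa> = gbd ms s ts"
  have \<kappa>: "\<kappa> \<in> carrier (Grp Q ?m)" unfolding \<kappa>_def by (rule gbd_in[OF s ts])
  define W where "W = map (\<lambda>i. cact (ms ! i) (ts ! i) (gs ! i)) [0..<?k]"
  have W: "W \<in> slists ms" using cact_sph[OF T(2) G(2)] by (simp add: W_def slists_def)
  define ys where "ys = map (\<lambda>i. act (ms ! i) (bd (ms ! i) (ts ! i)) \<circ> gs ! i) [0..<?k]"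
  define A where "A = pointwise_comp D ms s ts"
  define Z where "Z = pointwise_comp D ?ms f ?gs"
  define Y where "Y = pointwise_comp D ms (act ?k (bd ?k s) \<circ> f) ys"
  have A: "pathin ?X A" "A 0 = \<delta> ms 1" using P by (simp_all add: A_def)
  have Zs: "Z \<in> spheroids l ?X (\<delta> ?ms 1)"
    using pointwise_sph[OF fl gl] unfolding Z_def m .
  have A1: "A 1 = act ?m \<kappa> (\<delta> ?ms 1)" unfolding A_def \<kappa>_def by (rule P(4))
  have kZ: "act ?m \<kappa> \<circ> Z \<in> spheroids l ?X (A 1)" unfolding A1 by (rule act_sph[OF \<kappa> Zs])
  have A1': "A 1 = opcomp D ms (s 1) (map (\<lambda>t. t 1) ts)" by (simp add: A_def pointwise_comp_def)
  have Ys: "Y \<in> spheroids l ?X (A 1)"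
    unfolding Y_def A1'
    by (rule pointwise_spheroid[OF act_loop_sph[OF s f]]) (use T act_loop_sph[OF T(2) G(2)] in \<open>auto simp: ys_def\<close>)
  have W2: "W = map2 (change_base l) ts ys"
    by (rule nth_equalityI) (use T in \<open>auto simp: W_def ys_def cact_def\<close>)
  have "pointwise_comp D ms (cact ?k s f) W = change_base l A Y"
    unfolding W2 cact_def A_def Y_def
    by (rule pointwise_comp_change_base[OF l0]) (use T in \<open>simp add: ys_def\<close>)
  moreover have "chom ?m (change_base l A Y) (change_base l A Y)"
    by (rule rel_homotopic_refl)
       (use change_base_spheroid[OF l0 Ys A(1) refl] in \<open>simp add: spheroids_def\<close>)
  ultimately have "chom ?m (pointwise_comp D ms (cact ?k s f) W) (change_base l A Y)" by simp
  from cgamma_expand[OF cact_sph[OF s f] W this A Ys]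
  have L: "chom ?m (cgamma ms (cact ?k s f) W) (change_base l (\<delta> ms \<bullet>\<bullet> A) Y)" .
  have YZ: "chom ?m Y (act ?m \<kappa> \<circ> Z)"
  proof (rule rel_homotopic_eqI[OF _ cube_boundary_subset])
    show "continuous_map (unit_cube l) ?X Y" using Ys by (simp add: spheroids_def)
    fix t assume t: "t \<in> topspace (unit_cube l)"
    show "Y t = (act ?m \<kappa> \<circ> Z) t"
      unfolding Y_def Z_def \<kappa>_def o_apply
      by (rule pointwise_comp_act[OF S(3) bds_in[OF ts]])
         (use G T sph_in[OF f t] sph_in[OF G(2) t] in \<open>auto simp: ys_def\<close>)
  qed
  have kd: "pathin ?X (act ?m \<kappa> \<circ> \<delta> ?ms)" by (rule pathin_act[OF \<kappa> pathin_\<delta>'[OF m]])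
  have kZ': "act ?m \<kappa> \<circ> Z \<in> spheroids l ?X ((act ?m \<kappa> \<circ> \<delta> ?ms) 1)" using kZ by (simp add: A1)
  note gam = loop_liftsD[OF gamma_loop(1)[OF s ts], unfolded gamma_loop(2)[OF s ts], folded \<kappa>_def]
  have "cact ?m (gamma ms s ts) (cgamma ?ms f ?gs) =
      change_base l (gamma ms s ts) (change_base l (act ?m \<kappa> \<circ> \<delta> ?ms) (act ?m \<kappa> \<circ> Z))"
    unfolding cact_def gamma_loop(2)[OF s ts] cgamma_def compose_change_base[OF l0] Z_def \<kappa>_def ..
  moreover have "chom ?m (change_base l (gamma ms s ts) (change_base l (act ?m \<kappa> \<circ> \<delta> ?ms) (act ?m \<kappa> \<circ> Z)))
      (change_base l (gamma ms s ts \<bullet>\<bullet> (act ?m \<kappa> \<circ> \<delta> ?ms)) (act ?m \<kappa> \<circ> Z))"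
    by (rule change_base_join[OF l0 kZ' kd refl gam(1)]) (simp add: gam(4) \<delta>_0 m)
  ultimately have R: "chom ?m (cact ?m (gamma ms s ts) (cgamma ?ms f ?gs))
      (change_base l (gamma ms s ts \<bullet>\<bullet> (act ?m \<kappa> \<circ> \<delta> ?ms)) (act ?m \<kappa> \<circ> Z))" by simp
  have d: "path_homotopic ?X (gamma ms s ts \<bullet>\<bullet> (act ?m \<kappa> \<circ> \<delta> ?ms)) (\<delta> ms \<bullet>\<bullet> A)"
  proof -
    let ?c = "act ?m \<kappa> \<circ> \<delta> ?ms"
    have g: "gamma ms s ts = \<delta> ms \<bullet>\<bullet> (A \<bullet>\<bullet> path_rev ?c)"
      by (simp only: gamma_def A_def \<kappa>_def compose_rev)
    have Ac: "A 1 = ?c 1" by (simp add: A1)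
    note pr = pathin_rev[OF kd]
    have Ar: "pathin ?X (A \<bullet>\<bullet> path_rev ?c)" by (rule pathin_join[OF A(1) pr]) (simp only: Ac rev_simps)
    have "path_homotopic ?X ((\<delta> ms \<bullet>\<bullet> (A \<bullet>\<bullet> path_rev ?c)) \<bullet>\<bullet> ?c) (\<delta> ms \<bullet>\<bullet> ((A \<bullet>\<bullet> path_rev ?c) \<bullet>\<bullet> ?c))"
      by (rule path_homotopic_assoc[OF pathin_\<delta> Ar kd]) (simp_all only: A(2) join_simps rev_simps)
    also have "path_homotopic ?X \<dots> (\<delta> ms \<bullet>\<bullet> A)"
    proof (intro path_homotopic_join path_homotopic_refl pathin_\<delta>)
      have "path_homotopic ?X ((A \<bullet>\<bullet> path_rev ?c) \<bullet>\<bullet> ?c) (A \<bullet>\<bullet> (path_rev ?c \<bullet>\<bullet> ?c))"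
        by (rule path_homotopic_assoc[OF A(1) pr kd]) (simp_all only: Ac rev_simps)
      also have "path_homotopic ?X \<dots> (A \<bullet>\<bullet> (\<lambda>_. A 1))"
        by (rule path_homotopic_join[OF path_homotopic_refl[OF A(1)] path_homotopic_rev_left[OF kd]])
           (simp_all only: Ac join_simps rev_simps)
      also have "path_homotopic ?X \<dots> A" by (rule path_homotopic_const_right[OF A(1) refl])
      finally show "path_homotopic ?X ((A \<bullet>\<bullet> path_rev ?c) \<bullet>\<bullet> ?c) A" .
    qed (simp only: A(2) join_simps)
    finally show ?thesis unfolding g .
  qed
  have "chom ?m (change_base l (gamma ms s ts \<bullet>\<bullet> (act ?m \<kappa> \<circ> \<delta> ?ms)) (act ?m \<kappa> \<circ> Z)) (change_base l (\<delta> ms \<bullet>\<bullet> A) Y)"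
    by (rule change_base_cong[OF l0 rel_homotopic_sym[OF YZ] d]) (use kZ' in \<open>simp add: spheroids_def\<close>)
  then have "chom ?m (cgamma ms (cact ?k s f) W) (cact ?m (gamma ms s ts) (cgamma ?ms f ?gs))"
    using L R by (meson rel_homotopic_sym rel_homotopic_trans)
  then show ?thesis unfolding W_def .
qed

lemma topological_G_operad_LO: "topological_G_operad PO LO LA"
  unfolding topological_G_operad_def
proof (intro conjI allI impI ballI group_operad_PO topological_operad_LO)
  show act: "group_action (Grp PO n) (Elems LO n) (LA n)" for n
    unfolding Elems_LO by (rule group_action_LA)
  show "continuous_map (Space LO n) (Space LO n) (LA n A)" if "A \<in> carrier (Grp PO n)" for n A
    using group_action.element_image[OF group_action_LA that] by (auto simp: pi_orbit_operad_def)
  fix ms \<Sigma> Ts A Bs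
  assume \<Sigma>: "\<Sigma> \<in> carrier (Grp PO (length ms))" and Ts: "Ts \<in> ElemLists (discrete_operad PO) ms"
    and A: "A \<in> Elems LO (length ms)" and Bs: "Bs \<in> ElemLists LO ms"
  obtain s where s: "s \<in> loop_lifts (length ms)" "\<Sigma> = cls (length ms) s" using \<Sigma> unfolding Grp_PO by (rule \<pi>1_cases)
  obtain ts where ts: "ts \<in> loop_lists ms" "Ts = map2 cls ms ts" using Ts by (rule PO_lists_cases)
  obtain f where f: "f \<in> sph (length ms)" "A = ccls (length ms) f" using A unfolding Elems_LO by (rule hgs_cases)
  obtain gs where gs: "gs \<in> slists ms" "Bs = map2 ccls ms gs" using Bs by (rule LO_lists_cases)
  let ?p = "sig (length ms) s"
  have p: "?p permutes {..<length ms}" by (rule sig_permutes[OF s(1)])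
  note T = loop_listsD[OF ts(1)] and G = slistsD[OF gs(1)]
  define W where "W = map (\<lambda>i. cact (ms ! i) (ts ! i) (gs ! i)) [0..<length ms]"
  have W: "W \<in> slists ms" using cact_sph[OF T(2) G(2)] by (simp add: W_def slists_def)
  have "map (\<lambda>i. LA (ms ! i) (Ts ! i) (Bs ! i)) [0..<length ms] = map2 ccls ms W"
    by (rule nth_equalityI) (use T G in \<open>simp_all add: ts(2) gs(2) W_def LA_ccls\<close>)
  then have left: "opcomp LO ms (LA (length ms) \<Sigma> A) (map (\<lambda>i. LA (ms ! i) (Ts ! i) (Bs ! i)) [0..<length ms]) =
      ccls (sum_list ms) (cgamma ms (cact (length ms) s f) W)"
    using opcomp_LO[OF cact_sph[OF s(1) f(1)] W] by (simp add: s(2) f(2) LA_ccls[OF s(1) f(1)])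
  have fl: "f \<in> sph (length (invperm ?p ms))" using f by simp
  have gl: "invperm ?p gs \<in> slists (invperm ?p ms)" by (rule slists_invperm[OF p gs(1)])
  have sp: "sum_list (invperm ?p ms) = sum_list ms" by (rule sum_sig[OF s(1)])
  have c: "cgamma (invperm ?p ms) f (invperm ?p gs) \<in> sph (sum_list ms)"
    using cgamma_sph[OF fl gl] by (simp only: sp)
  have ib: "invperm ?p Bs = map2 ccls (invperm ?p ms) (invperm ?p gs)"
    unfolding gs(2) by (rule map2_invperm[symmetric]) (use p G in simp_all)
  have "opcomp LO (invperm ?p ms) A (invperm ?p Bs) = ccls (sum_list ms) (cgamma (invperm ?p ms) f (invperm ?p gs))"
    using opcomp_LO[OF fl gl] by (simp add: ib f(2) sp)
  then have right: "LA (sum_list ms) (gcomp PO ms \<Sigma> Ts) (opcomp LO (invperm ?p ms) A (invperm ?p Bs)) =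
      ccls (sum_list ms) (cact (sum_list ms) (gamma ms s ts) (cgamma (invperm ?p ms) f (invperm ?p gs)))"
    using LA_ccls[OF gamma_loop(1)[OF s(1) ts(1)] c] by (simp add: s(2) ts(2) gcomp_PO[OF s(1) ts(1)])
  have eq: "ccls (sum_list ms) (cgamma ms (cact (length ms) s f) W) =
      ccls (sum_list ms) (cact (sum_list ms) (gamma ms s ts) (cgamma (invperm ?p ms) f (invperm ?p gs)))"
    unfolding W_def
    by (rule ccls_eqI[OF cgamma_sph[OF cact_sph[OF s(1) f(1)] W[unfolded W_def]] cgamma_cact[OF s(1) ts(1) f(1) gs(1)]])
  have gp: "gperm PO (length ms) \<Sigma> = ?p"
    unfolding s(2) by (rule gperm_PO[OF s(1)])
  show "opcomp LO ms (LA (length ms) \<Sigma> A) (map (\<lambda>i. LA (ms ! i) (Ts ! i) (Bs ! i)) [0..<length ms]) =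
      LA (sum_list ms) (gcomp PO ms \<Sigma> Ts)
        (opcomp LO (invperm (gperm PO (length ms) \<Sigma>) ms) A (invperm (gperm PO (length ms) \<Sigma>) Bs))"
    unfolding gp left right by (rule eq)
qed

end

end

section \<open>Conjugation\<close>

lemma (in group) conj_mult:
  assumes "a \<in> carrier G" "b \<in> carrier G" "x \<in> carrier G"
  shows "a \<otimes> b \<otimes> x \<otimes> inv (a \<otimes> b) = a \<otimes> (b \<otimes> x \<otimes> inv b) \<otimes> inv a"
  using assms by (simp add: inv_mult_group m_assoc)

text \<open>In a non-crossed group operad the interchange law says that each \<open>\<gamma>\<close> is a group homomorphism;
  hence it commutes with conjugation.\<close>

lemma topological_G_operad_conj:
  assumes G: "group_operad G" and nc: "non_crossed G"
  shows "topological_G_operad G (discrete_operad G) (conj_act G)"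
  unfolding topological_G_operad_def
proof (intro conjI allI impI ballI)
  have top: "topological_operad (discrete_operad G)" and grp: "\<And>n. group (Grp G n)"
    and interchange: "\<And>ms a a' bs bs'. \<lbrakk>a \<in> carrier (Grp G (length ms)); a' \<in> carrier (Grp G (length ms));
        bs \<in> ElemLists (discrete_operad G) ms; bs' \<in> ElemLists (discrete_operad G) ms\<rbrakk> \<Longrightarrow>
        gcomp G ms (a \<otimes>\<^bsub>Grp G (length ms)\<^esub> a')
          (map (\<lambda>i. bs ! i \<otimes>\<^bsub>Grp G (ms ! i)\<^esub> bs' ! i) [0..<length ms]) =
        gcomp G ms a bs \<otimes>\<^bsub>Grp G (sum_list ms)\<^esub>
        gcomp G (invperm (gperm G (length ms) a) ms) a' (invperm (gperm G (length ms) a) bs')"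
    using G unfolding group_operad_def by auto
  have gcomp_hom: "gcomp G ms (a \<otimes>\<^bsub>Grp G (length ms)\<^esub> a')
          (map (\<lambda>i. bs ! i \<otimes>\<^bsub>Grp G (ms ! i)\<^esub> bs' ! i) [0..<length ms]) =
        gcomp G ms a bs \<otimes>\<^bsub>Grp G (sum_list ms)\<^esub> gcomp G ms a' bs'"
    if "a \<in> carrier (Grp G (length ms))" "a' \<in> carrier (Grp G (length ms))"
      "bs \<in> ElemLists (discrete_operad G) ms" "bs' \<in> ElemLists (discrete_operad G) ms" for ms a a' bs bs'
    using interchange[OF that] nc that(1) by (simp add: non_crossed_def)
  have closed: "gcomp G ms a bs \<in> carrier (Grp G (sum_list ms))"
    if "a \<in> carrier (Grp G (length ms))" "bs \<in> ElemLists (discrete_operad G) ms" for ms a bs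
    using topological_operad_opcomp_closed[OF top, of a ms bs] that by simp
  show "group_operad G" "topological_operad (discrete_operad G)" by (rule G, rule top)
  show "group_action (Grp G n) (Elems (discrete_operad G) n) (conj_act G n)" for n
  proof (rule group_actionI)
    interpret group "Grp G n" by (rule grp)
    show "group (Grp G n)" by (rule grp)
    show "conj_act G n g \<in> extensional (Elems (discrete_operad G) n)" for g by (simp add: conj_act_def)
  qed (simp_all add: conj_act_def group.conj_mult[OF grp] grp group.is_monoid monoid.m_closed group.inv_closed
      monoid.l_one monoid.r_one monoid.inv_one)
  then show "continuous_map (Space (discrete_operad G) n) (Space (discrete_operad G) n) (conj_act G n g)"
    if "g \<in> carrier (Grp G n)" for n g
    using that group_action.element_image[of "Grp G n" "Elems (discrete_operad G) n" "conj_act G n" g]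
    by (auto simp: discrete_operad_def)
  fix ms \<sigma> \<tau>s a bs
  assume \<sigma>: "\<sigma> \<in> carrier (Grp G (length ms))" and \<tau>: "\<tau>s \<in> ElemLists (discrete_operad G) ms"
    and "a \<in> Elems (discrete_operad G) (length ms)" and b: "bs \<in> ElemLists (discrete_operad G) ms"
  then have a: "a \<in> carrier (Grp G (length ms))" by simp
  let ?k = "length ms" and ?m = "sum_list ms"
  let ?is = "map (\<lambda>i. inv\<^bsub>Grp G (ms ! i)\<^esub> (\<tau>s ! i)) [0..<?k]"
  interpret k: group "Grp G ?k" by (rule grp)
  interpret m: group "Grp G ?m" by (rule grp)
  have ins: "?is \<in> ElemLists (discrete_operad G) ms"
    using \<tau> by (auto simp: ElemLists_iff group.inv_closed grp)
  let ?os = "map (\<lambda>i. \<one>\<^bsub>Grp G (ms ! i)\<^esub>) [0..<?k]"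
  have os: "?os \<in> ElemLists (discrete_operad G) ms"
    by (auto simp: ElemLists_iff grp group.is_monoid monoid.one_closed)
  have one: "gcomp G ms \<one>\<^bsub>Grp G ?k\<^esub> ?os = \<one>\<^bsub>Grp G ?m\<^esub>"
  proof -
    have "map (\<lambda>i. ?os ! i \<otimes>\<^bsub>Grp G (ms ! i)\<^esub> ?os ! i) [0..<?k] = ?os"
      by (rule nth_equalityI) (simp_all add: grp group.is_monoid monoid.l_one monoid.one_closed)
    then have "gcomp G ms \<one>\<^bsub>Grp G ?k\<^esub> ?os \<otimes>\<^bsub>Grp G ?m\<^esub> gcomp G ms \<one>\<^bsub>Grp G ?k\<^esub> ?os = gcomp G ms \<one>\<^bsub>Grp G ?k\<^esub> ?os"
      using gcomp_hom[OF k.one_closed k.one_closed os os] by (simp only: k.l_one[OF k.one_closed])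
    then show ?thesis using closed[OF k.one_closed os] m.l_cancel_one' by metis
  qed
  have inverse: "gcomp G ms (inv\<^bsub>Grp G ?k\<^esub> \<sigma>) ?is = inv\<^bsub>Grp G ?m\<^esub> (gcomp G ms \<sigma> \<tau>s)"
  proof (rule m.inv_equality[symmetric])
    have "map (\<lambda>i. ?is ! i \<otimes>\<^bsub>Grp G (ms ! i)\<^esub> \<tau>s ! i) [0..<?k] = ?os"
      using \<tau> by (intro nth_equalityI) (simp_all add: ElemLists_iff grp group.l_inv)
    then show "gcomp G ms (inv\<^bsub>Grp G ?k\<^esub> \<sigma>) ?is \<otimes>\<^bsub>Grp G ?m\<^esub> gcomp G ms \<sigma> \<tau>s = \<one>\<^bsub>Grp G ?m\<^esub>"
      using gcomp_hom[OF k.inv_closed[OF \<sigma>] \<sigma> ins \<tau>] by (simp only: k.l_inv[OF \<sigma>] one)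
  qed (use closed \<sigma> \<tau> ins in simp_all)
  let ?tb = "map (\<lambda>i. \<tau>s ! i \<otimes>\<^bsub>Grp G (ms ! i)\<^esub> bs ! i) [0..<?k]"
  have tb: "?tb \<in> ElemLists (discrete_operad G) ms"
    using \<tau> b by (auto simp: ElemLists_iff monoid.m_closed group.is_monoid grp)
  have conj: "map (\<lambda>i. conj_act G (ms ! i) (\<tau>s ! i) (bs ! i)) [0..<?k] =
      map (\<lambda>i. ?tb ! i \<otimes>\<^bsub>Grp G (ms ! i)\<^esub> ?is ! i) [0..<?k]"
    using b by (intro nth_equalityI) (simp_all add: ElemLists_iff conj_act_def)
  have "gcomp G ms (conj_act G ?k \<sigma> a) (map (\<lambda>i. conj_act G (ms ! i) (\<tau>s ! i) (bs ! i)) [0..<?k]) =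
      gcomp G ms (\<sigma> \<otimes>\<^bsub>Grp G ?k\<^esub> a) ?tb \<otimes>\<^bsub>Grp G ?m\<^esub> gcomp G ms (inv\<^bsub>Grp G ?k\<^esub> \<sigma>) ?is"
    unfolding conj using gcomp_hom[OF k.m_closed[OF \<sigma> a] k.inv_closed[OF \<sigma>] tb ins] a by (simp add: conj_act_def)
  also have "\<dots> = conj_act G ?m (gcomp G ms \<sigma> \<tau>s) (gcomp G ms a bs)"
    unfolding inverse gcomp_hom[OF \<sigma> a \<tau> b] using closed[OF a b] by (simp add: conj_act_def)
  finally show "opcomp (discrete_operad G) ms (conj_act G ?k \<sigma> a)
      (map (\<lambda>i. conj_act G (ms ! i) (\<tau>s ! i) (bs ! i)) [0..<?k]) =
    conj_act G ?m (gcomp G ms \<sigma> \<tau>s) (opcomp (discrete_operad G) (invperm (gperm G ?k \<sigma>) ms) a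
      (invperm (gperm G ?k \<sigma>) bs))"
    using nc \<sigma> by (simp add: non_crossed_def)
qed

context based_operad
begin

lemma non_crossed_PO:
  assumes "non_crossed Q"
  shows "non_crossed (pi1_orbit_operad Q D act \<eta>)"
  unfolding non_crossed_def
proof (intro allI ballI)
  fix k A assume "A \<in> carrier (Grp (pi1_orbit_operad Q D act \<eta>) k)"
  then obtain s where s: "s \<in> loop_lifts k" "A = cls k s" unfolding Grp_PO by (rule \<pi>1_cases)
  show "gperm (pi1_orbit_operad Q D act \<eta>) k A = id"
    unfolding s(2) gperm_PO[OF s(1)] using assms loop_liftsD(3)[OF s(1)] by (simp add: non_crossed_def)
qed

end

section \<open>Iterated orbit spaces\<close>

lemma non_crossed_quotient:
  assumes "\<And>n. subgroup (H n) (Grp G n)" "\<And>n. group (Grp G n)" "non_crossed G"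
  shows "non_crossed (quotient_grp_operad G H)"
  unfolding non_crossed_def
proof (intro allI ballI)
  fix n A assume "A \<in> carrier (Grp (quotient_grp_operad G H) n)"
  then obtain a where a: "a \<in> carrier (Grp G n)" "A = H n #>\<^bsub>Grp G n\<^esub> a"
    by (auto simp: quotient_grp_operad_def FactGroup_def RCOSETS_def)
  interpret group "Grp G n" by (rule assms(2))
  have sub: "A \<subseteq> carrier (Grp G n)"
    unfolding a(2) by (rule r_coset_subset_G[OF subgroup.subset[OF assms(1)] a(1)])
  have "a \<in> A" unfolding a(2) by (rule rcos_self[OF a(1) assms(1)])
  moreover have "gperm G n ` A = (\<lambda>_. id) ` A"
    by (rule image_cong[OF refl]) (use assms(3) sub in \<open>simp add: non_crossed_def subset_iff\<close>)
  ultimately have "gperm G n ` A = {id}" using image_constant[of a A id] by simp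
  then show "gperm (quotient_grp_operad G H) n A = id" by (simp add: quotient_grp_operad_def)
qed

text \<open>The orbit of an \<open>H\<close>-orbit under \<open>G/H\<close> consists of the \<open>H\<close>-orbits in one \<open>G\<close>-orbit, and \<^term>\<open>X\<close>
  has both orbit spaces as quotient spaces.\<close>

lemma (in continuous_action) homeomorphic_iterated_orbit_space:
  assumes H: "H \<lhd> G"
    and \<psi>: "\<And>g x. g \<in> carrier G \<Longrightarrow> x \<in> topspace X \<Longrightarrow>
      \<psi> (H #>\<^bsub>G\<^esub> g) (orbit (G\<lparr>carrier := H\<rparr>) \<phi> x) = orbit (G\<lparr>carrier := H\<rparr>) \<phi> (\<phi> g x)"
  shows "homeomorphic_map (orbit_space (G Mod H) (orbit_space (G\<lparr>carrier := H\<rparr>) X \<phi>) \<psi>) base Union"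
proof -
  let ?p = "orbit (G\<lparr>carrier := H\<rparr>) \<phi>" and ?r = "orbit (G Mod H) \<psi>"
  let ?Y = "orbit_space (G\<lparr>carrier := H\<rparr>) X \<phi>"
  let ?Z = "orbit_space (G Mod H) ?Y \<psi>"
  interpret G: group G by (rule group_G)
  interpret H: normal H G by (rule H)
  have p: "quotient_map X ?Y ?p" and r: "quotient_map ?Y ?Z ?r"
    by (simp_all add: orbit_space_def quotient_map_quotient)
  have rp: "quotient_map X ?Z (?r \<circ> ?p)" by (rule quotient_map_compose[OF p r])
  have rp_eq: "?r (?p x) = ?p ` quot x" if x: "x \<in> topspace X" for x
  proof -
    have "?r (?p x) = {\<psi> A (?p x) |A. A \<in> carrier (G Mod H)}" by (simp add: orbit_def)
    also have "\<dots> = {\<psi> (H #>\<^bsub>G\<^esub> g) (?p x) |g. g \<in> carrier G}" by (auto simp: FactGroup_def RCOSETS_def)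
    also have "\<dots> = {?p (\<phi> g x) |g. g \<in> carrier G}" using \<psi>[OF _ x] by (intro Collect_cong) metis
    also have "\<dots> = ?p ` quot x" by (auto simp: orbit_def)
    finally show ?thesis .
  qed
  have union: "\<Union>(?r (?p x)) = quot x" if x: "x \<in> topspace X" for x
  proof (intro Set.set_eqI iffI)
    fix y assume "y \<in> \<Union>(?r (?p x))"
    then obtain g h where gh: "g \<in> carrier G" "h \<in> H" "y = \<phi> h (\<phi> g x)"
      unfolding rp_eq[OF x] by (auto simp: orbit_def)
    then have "y = \<phi> (h \<otimes>\<^bsub>G\<^esub> g) x" using x H.subset by (simp add: act_mult subset_iff)
    then show "y \<in> quot x" using gh H.subset by (auto simp: orbit_def)
  next
    fix y assume "y \<in> quot x"
    then obtain g where g: "g \<in> carrier G" "y = \<phi> g x" by (auto simp: orbit_def)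
    have "y = \<phi> \<one>\<^bsub>G\<^esub> y" using act_one[OF act_closed[OF g(1) x]] g(2) by simp
    then have "y \<in> ?p y" using H.one_closed by (auto simp: orbit_def)
    then show "y \<in> \<Union>(?r (?p x))" unfolding rp_eq[OF x] using \<open>y \<in> quot x\<close> by blast
  qed
  have q: "quotient_map X base (Union \<circ> (?r \<circ> ?p))"
    by (rule quotient_map_eq[OF quotient_map_quot]) (simp add: union)
  have "continuous_map ?Z base Union"
    by (rule continuous_compose_quotient_map[OF rp quotient_imp_continuous_map[OF q]])
  then have "quotient_map ?Z base Union"
    by (rule quotient_map_from_composition[OF quotient_imp_continuous_map[OF rp] _ q])
  moreover have "inj_on Union (topspace ?Z)"
  proof (rule inj_onI)
    fix u v assume u: "u \<in> topspace ?Z" and v: "v \<in> topspace ?Z" and eq: "\<Union>u = \<Union>v"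
    have "topspace ?Z = (?r \<circ> ?p) ` topspace X" using rp unfolding quotient_map_def by simp
    then obtain x y where x: "x \<in> topspace X" "u = ?r (?p x)" and y: "y \<in> topspace X" "v = ?r (?p y)"
      using u v by auto
    then show "u = v" using eq by (simp add: union) (simp add: rp_eq)
  qed
  ultimately show ?thesis by (simp add: homeomorphic_map_def)
qed

lemma homeomorphic_quotient_operad:
  assumes C: "topological_G_operad G C act" and H: "\<And>n. H n \<lhd> Grp G n"
  shows "homeomorphic_map
    (op_orbit_space (quotient_grp_operad G H) (quotient_operad G H C act) (quotient_act G H C act) k)
    (op_orbit_space G C act k) Union"
proof -
  interpret continuous_action "Space C k" "Grp G k" "act k"
    using C unfolding topological_G_operad_def continuous_action_def by simp
  interpret G: group "Grp G k" by (rule group_G)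
  interpret H: normal "H k" "Grp G k" by (rule H)
  let ?GH = "(Grp G k)\<lparr>carrier := H k\<rparr>"
  have H_action: "group_action ?GH (Elems C k) (act k)"
  proof (rule group_actionI)
    show "group ?GH" by (rule H.subgroup_is_group[OF group_G])
    show "act k g \<in> extensional (Elems C k)" if "g \<in> carrier ?GH" for g
      using group_hom.hom_closed[OF action[unfolded group_action_def], of g] that H.subset
      by (auto simp: BijGroup_def Bij_def)
    show "act k g x \<in> Elems C k" if "g \<in> carrier ?GH" "x \<in> Elems C k" for g x
      using that act_closed H.subset by auto
    show "act k (g \<otimes>\<^bsub>?GH\<^esub> h) x = act k g (act k h x)"
      if "g \<in> carrier ?GH" "h \<in> carrier ?GH" "x \<in> Elems C k" for g h x
      using that act_mult[of x g h] H.subset by auto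
    show "act k \<one>\<^bsub>?GH\<^esub> x = x" if "x \<in> Elems C k" for x
      using that act_one by simp
  qed
  interpret H: continuous_action "Space C k" ?GH "act k"
    using H_action continuous H.subset by (auto intro: continuous_action.intro)
  have sub: "sub_orbit G H act k = orbit ?GH (act k)"
    by (simp add: sub_orbit_def restrict_grp_operad_def fun_eq_iff)
  have spc: "Space (quotient_operad G H C act) k = orbit_space ?GH (Space C k) (act k)"
    by (simp add: quotient_operad_def restrict_grp_operad_def)
  have "quotient_act G H C act k (H k #>\<^bsub>Grp G k\<^esub> g) (orbit ?GH (act k) x) = orbit ?GH (act k) (act k g x)"
    if g: "g \<in> carrier (Grp G k)" and x: "x \<in> Elems C k" for g x
  proof -
    have one: "orbit ?GH (act k) (act k g' x') = orbit ?GH (act k) (act k g x)"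
      if g': "g' \<in> H k #>\<^bsub>Grp G k\<^esub> g" and x': "x' \<in> orbit ?GH (act k) x" for g' x'
    proof -
      obtain h where h: "h \<in> H k" "g' = h \<otimes>\<^bsub>Grp G k\<^esub> g" using g' by (auto simp: r_coset_def)
      obtain h' where h': "h' \<in> H k" "x' = act k h' x" using x' by (auto simp: orbit_def)
      note c = h(1)[THEN H.mem_carrier] h'(1)[THEN H.mem_carrier]
      let ?n = "h \<otimes>\<^bsub>Grp G k\<^esub> (g \<otimes>\<^bsub>Grp G k\<^esub> h' \<otimes>\<^bsub>Grp G k\<^esub> inv\<^bsub>Grp G k\<^esub> g)"
      have n: "?n \<in> H k" using H.inv_op_closed2[OF g h'(1)] h(1) by simp
      have "act k g' x' = act k (?n \<otimes>\<^bsub>Grp G k\<^esub> g) x"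
        unfolding h(2) h'(2) using g c x by (simp add: act_mult[symmetric] G.m_assoc)
      also have "\<dots> = act k ?n (act k g x)" using act_mult[OF x _ g] n H.mem_carrier by simp
      finally show ?thesis using H.quot_act[OF act_closed[OF g x], of ?n] n by simp
    qed
    have "g \<in> H k #>\<^bsub>Grp G k\<^esub> g" "x \<in> orbit ?GH (act k) x"
      using G.rcos_self[OF g H.subgroup_axioms] group_action.orbit_refl[OF H.action x] by auto
    then have "(\<Union>g'\<in>H k #>\<^bsub>Grp G k\<^esub> g. \<Union>x'\<in>orbit ?GH (act k) x. orbit ?GH (act k) (act k g' x')) =
        orbit ?GH (act k) (act k g x)"
      by (rule UN_const) (rule one)
    then show ?thesis using x by (simp add: quotient_act_def spc sub)
  qed
  from homeomorphic_iterated_orbit_space[OF H, of "quotient_act G H C act k", OF this]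
  show ?thesis unfolding op_orbit_space_def spc by (simp add: quotient_grp_operad_def)
qed

theorem theorem3p8:
  fixes G :: "'g grp_operad" and H :: "nat \<Rightarrow> 'g set"
    and C :: "'c operad" and act :: "nat \<Rightarrow> 'g \<Rightarrow> 'c \<Rightarrow> 'c"
    and Q :: "'g set grp_operad" and D :: "'c set operad"
    and actD :: "nat \<Rightarrow> 'g set \<Rightarrow> 'c set \<Rightarrow> 'c set"
    and \<eta> :: "nat \<Rightarrow> intervals \<Rightarrow> 'c set"
  assumes "group_operad G"
    and "normal_sub_grp_operad G H"
    and "non_crossed (restrict_grp_operad G H)"
    and "topological_G_operad G C act"
    and "Q = quotient_grp_operad G H"
    and "D = quotient_operad G H C act"
    and "actD = quotient_act G H C act"
    and "covering_G_operad Q D actD"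
    and "path_connected_operad D"
    and "good_basepoint_morphism D \<eta>"
  shows "(group_operad (pi1_operad D \<eta>) \<and> non_crossed (pi1_operad D \<eta>)) \<and>
    (\<forall>k. homeomorphic_map (op_orbit_space Q D actD k) (op_orbit_space G C act k) Union) \<and>
    group_operad (pi1_orbit_operad Q D actD \<eta>) \<and>
    grp_operad_ses (pi1_operad D \<eta>) (pi1_orbit_operad Q D actD \<eta>) Q
      (pi1_proj Q D actD) (pi1_bd Q D actD \<eta>) \<and>
    (non_crossed G \<longrightarrow>
      topological_G_operad (pi1_orbit_operad Q D actD \<eta>)
        (discrete_operad (pi1_orbit_operad Q D actD \<eta>))
        (conj_act (pi1_orbit_operad Q D actD \<eta>)) \<and>
      (\<forall>l>1. topological_G_operad (pi1_orbit_operad Q D actD \<eta>)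
        (pi_orbit_operad l Q D actD \<eta>) (pi_orbit_act l Q D actD \<eta>))) \<and>
    (\<not> non_crossed G \<longrightarrow>
      (\<forall>l>1. topological_G_operad (pi1_orbit_operad Q D actD \<eta>)
        (pi_orbit_operad l Q D actD \<eta>) (pi_orbit_act l Q D actD \<eta>)))"
proof -
  interpret based_operad Q D actD \<eta>
    by (rule based_operad.intro) (use assms in simp_all)
  have grp: "\<And>n. group (Grp G n)" and H: "\<And>n. H n \<lhd> Grp G n"
    using assms(1,2) by (simp_all add: group_operad_def normal_sub_grp_operad_def)
  have Q: "non_crossed Q" if "non_crossed G"
    unfolding assms(5) by (rule non_crossed_quotient[OF _ grp that]) (simp add: H normal_imp_subgroup)
  show ?thesis
    using group_operad_DO non_crossed_DO group_operad_PO ses topological_G_operad_LO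
      homeomorphic_quotient_operad[OF assms(4) H] topological_G_operad_conj[OF group_operad_PO non_crossed_PO[OF Q]]
    by (simp add: assms(5-7)[symmetric])
qed

end
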